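(* For every $d\ge 2$, \[ \lim_{p\to\infty}\frac{\|R\|_{L^p(\mathbb{R}^d)}}{\|H\|_p}=1 . \]
   Context: For $j=1,\dots,d$, $R_j$ is the $j$-th Riesz transform on $\mathbb{R}^d$, with Fourier multiplier $\widehat{R_jf}(\xi)=\frac{i\xi_j}{|\xi|}\widehat f(\xi)$. For $1<p<\infty$, $\|R\|_{L^p(\mathbb{R}^d)}=\sup\big\{\big\|(\sum_{k=1}^d|R_kf|^2)^{1/2}\big\|_{L^p(\mathbb{R}^d)}:\ f \text{ real-valued},\ \|f\|_{L^p(\mathbb{R}^d)}\le1\big\}$. $\|H\|_p$ denotes the operator norm on $L^p(\mathbb{R})$ of the Hilbert transform $Hf(x)=\frac1\pi\,\mathrm{p.v.}\int_{\mathbb{R}}\frac{f(x-y)}{y}dy$ (which equals $\cot(\pi/(2p^* ))$, $p^*=\max\{p,p/(p-1)\}$). *)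

theory Defs
  imports "HOL-Analysis.Analysis"
begin

definition lp_norm :: "'a measure \<Rightarrow> real \<Rightarrow> ('a \<Rightarrow> 'b::real_normed_vector) \<Rightarrow> ennreal" where
  "lp_norm M p g =
     (let I = (\<integral>\<^sup>+ x. ennreal (norm (g x) powr p) \<partial>M)
      in if I = \<infinity> then \<infinity> else ennreal (enn2real I powr (1 / p)))"

definition hilbert :: "(real \<Rightarrow> complex) \<Rightarrow> real \<Rightarrow> complex" where
  "hilbert f x = Lim (at_right (0::real))
     (\<lambda>\<epsilon>. complex_of_real (1 / pi) *
          (LINT y : {y. \<epsilon> < \<bar>y\<bar>} | lborel. f (x - y) / complex_of_real y))"

definition hilbert_norm :: "real \<Rightarrow> ennreal" where
  "hilbert_norm p = Sup {lp_norm lborel p (hilbert f) | f.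
      f \<in> borel_measurable lborel \<and> lp_norm lborel p f \<le> 1}"

definition riesz_const :: "nat \<Rightarrow> real" where
  "riesz_const d = Gamma ((real d + 1) / 2) / pi powr ((real d + 1) / 2)"

text \<open>j-th Riesz transform on R^d (d = CARD('n)) as a principal value singular integral
  with kernel -c_d y_j/|y|^(d+1); this has Fourier multiplier i xi_j/|xi| with the
  convention hat f(xi) = integral of f(x) exp(-2 pi i x.xi).\<close>
definition riesz :: "'n::finite \<Rightarrow> (real^'n \<Rightarrow> real) \<Rightarrow> real^'n \<Rightarrow> real" where
  "riesz j f x = Lim (at_right (0::real))
     (\<lambda>\<epsilon>. - riesz_const CARD('n) *
          (LINT y : {y. \<epsilon> < norm y} | lborel. (y $ j / norm y ^ (CARD('n) + 1)) * f (x - y)))"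

definition riesz_norm :: "'n::finite itself \<Rightarrow> real \<Rightarrow> ennreal" where
  "riesz_norm _ p = Sup {lp_norm lborel p (\<lambda>x. sqrt (\<Sum>k\<in>UNIV. (riesz k f x)\<^sup>2)) | f :: real^'n \<Rightarrow> real.
      f \<in> borel_measurable lborel \<and> lp_norm lborel p f \<le> 1}"

end

theory Submission
  imports Defs "HOL-Complex_Analysis.Complex_Analysis"
begin

text \<open>
  A finite net \<open>S\<close> of unit vectors with \<open>(1 - \<delta>) |v| \<le> max {|v \<bullet> a| | a. a \<in> S}\<close> gives
  \<open>|v|^p \<le> (1 - \<delta>)^(- p) * (\<Sum>a\<in>S. |v \<bullet> a|^p)\<close>. For fixed \<open>\<delta>\<close> the factor \<open>(card S)^(1/p)\<close> tends to 1 as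
  \<open>p\<close> tends to infinity, so the norm of a vector-valued transform may be replaced by the largest norm
  of its components.

  A component \<open>a \<bullet> R\<close> of the Riesz vector is an average of one-dimensional Hilbert transforms along
  lines, with total mass one (method of rotations), so its norm is at most the norm of the Hilbert
  transform. Conversely, the Riesz transform of a function \<open>\<phi> x\<^sub>j\<close> times wide cut-offs in the other
  variables converges, after rescaling, to minus the Hilbert transform of \<open>\<phi>\<close> times the cut-offs, so Fatou's lemma
  bounds the norm of the Hilbert transform on real functions by the norm of the Riesz vector.

  Because both transforms are principal values of arbitrary \<open>L\<^sup>p\<close> functions, the truncations have to
  converge almost everywhere. This follows from the boundedness of the maximal truncated Hilbert
  transform, which is controlled by the conjugate Poisson integral and the Hardy-Littlewood maximal
  function.
\<close>

section \<open>Powers and integrals of powers\<close>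

text \<open>The exact norm of the Hilbert transform is never computed; only its finiteness and
  positivity enter. Auxiliary constants may therefore be crude, but the comparison of the real
  scalar transforms must lose nothing. Sharpness comes from Jensen's inequality for probability
  densities in one direction and from a rescaling limit in the other; the only loss is the net
  factor, and the net does not depend on \<open>p\<close>.

  All main estimates are for \<open>p\<close> at least 6, which is harmless for a limit at infinity.
  The bound originates in the conjugate function inequality: the auxiliary function there needs two
  classical derivatives, and its decay in the half plane must survive multiplication by the height.

  Estimates are stated for \<open>lp_int\<close>, the p-th power of the norm in
  \<open>ennreal\<close>, because Tonelli, Fatou and Jensen apply to it without roots; roots are
  taken only when the norms of the statement are compared. Minkowski's inequality is replaced by one
  with a free parameter \<theta>, whose leading factor tends to 1. Since \<open>Lim\<close> is
  unspecified where no limit exists, no operator bound can precede almost everywhere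
  convergence.\<close>

definition lp_int :: "real \<Rightarrow> ('a::euclidean_space \<Rightarrow> 'b::real_normed_vector) \<Rightarrow> ennreal" where
  "lp_int p f = (\<integral>\<^sup>+x. ennreal (norm (f x) powr p) \<partial>lborel)"

text \<open>The dense class of test functions. Against an odd kernel of size \<open>1 / t\<close> a
  Lipschitz difference is absolutely integrable near 0, and compact support takes care of infinity,
  so principal values exist at every point.\<close>

definition lipc :: "('a::euclidean_space \<Rightarrow> real) \<Rightarrow> bool" where
  "lipc f \<longleftrightarrow> (\<exists>C A. (\<forall>x y. \<bar>f x - f y\<bar> \<le> C * norm (x - y)) \<and> (\<forall>x. norm x > A \<longrightarrow> f x = 0))"

text \<open>The split is at \<open>b \<le> \<theta> * a\<close>: on either side one summand controls
  the whole sum. A small \<theta> keeps the factor of \<open>a\<close> near 1 at the expense of that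
  of \<open>b\<close>.\<close>

lemma add_powr_le:
  fixes a b :: real
  assumes "0 \<le> a" "0 \<le> b" "0 < \<theta>" "0 \<le> p"
  shows "(a + b) powr p \<le> (1 + \<theta>) powr p * a powr p + (1 + 1/\<theta>) powr p * b powr p"
proof (cases "b \<le> \<theta> * a")
  case True
  have "(a + b) powr p \<le> ((1 + \<theta>) * a) powr p"
    using assms True by (intro powr_mono2) (auto simp: algebra_simps)
  also have "\<dots> = (1 + \<theta>) powr p * a powr p" using assms by (simp add: powr_mult)
  finally show ?thesis by (smt (verit) mult_nonneg_nonneg powr_ge_zero)
next
  case False
  have "(a + b) powr p \<le> ((1 + 1/\<theta>) * b) powr p"
    using assms False by (intro powr_mono2) (auto simp: field_simps)
  also have "\<dots> = (1 + 1/\<theta>) powr p * b powr p" using assms by (simp add: powr_mult)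
  finally show ?thesis by (smt (verit) mult_nonneg_nonneg powr_ge_zero)
qed

lemma lp_int_mono:
  assumes "\<And>x. norm (f x) \<le> norm (g x)" "0 \<le> p"
  shows "lp_int p f \<le> lp_int p g"
  unfolding lp_int_def using assms by (intro nn_integral_mono ennreal_leI powr_mono2) auto

lemma lp_int_cong_AE:
  "AE x in lborel. norm (f x) = norm (g x) \<Longrightarrow> lp_int p f = lp_int p g"
  unfolding lp_int_def by (intro nn_integral_cong_AE) auto

text \<open>Stands in for Minkowski's inequality. \<theta> = 1 suffices for finiteness and density;
  \<theta> tending to 0 is used in \<open>hilR_le_riesz_norm\<close>, where the constant must not
  grow.\<close>

lemma lp_int_add:
  fixes f g :: "'a::euclidean_space \<Rightarrow> 'b::{real_normed_vector,second_countable_topology}"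
  assumes [measurable]: "f \<in> borel_measurable borel" "g \<in> borel_measurable borel" and "0 < \<theta>" "0 \<le> p"
  shows "lp_int p (\<lambda>x. f x + g x) \<le> ennreal ((1 + \<theta>) powr p) * lp_int p f + ennreal ((1 + 1/\<theta>) powr p) * lp_int p g"
proof -
  have "lp_int p (\<lambda>x. f x + g x) \<le> (\<integral>\<^sup>+x. ennreal ((1 + \<theta>) powr p) * ennreal (norm (f x) powr p) +
      ennreal ((1 + 1/\<theta>) powr p) * ennreal (norm (g x) powr p) \<partial>lborel)"
    unfolding lp_int_def
  proof (intro nn_integral_mono)
    fix x
    have "norm (f x + g x) powr p \<le> (norm (f x) + norm (g x)) powr p"
      using assms by (intro powr_mono2 norm_triangle_ineq) auto
    also have "\<dots> \<le> (1 + \<theta>) powr p * norm (f x) powr p + (1 + 1/\<theta>) powr p * norm (g x) powr p"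
      using assms by (intro add_powr_le) auto
    finally show "ennreal (norm (f x + g x) powr p) \<le> ennreal ((1 + \<theta>) powr p) * ennreal (norm (f x) powr p) +
      ennreal ((1 + 1/\<theta>) powr p) * ennreal (norm (g x) powr p)"
      by (subst ennreal_mult[symmetric], simp, simp)+ (simp add: ennreal_plus[symmetric] del: ennreal_plus)
  qed
  also have "\<dots> = ennreal ((1 + \<theta>) powr p) * lp_int p f + ennreal ((1 + 1/\<theta>) powr p) * lp_int p g"
    unfolding lp_int_def by (simp add: nn_integral_add nn_integral_cmult)
  finally show ?thesis .
qed

lemma lp_int_scale:
  fixes f :: "'a::euclidean_space \<Rightarrow> 'b::{real_normed_vector,second_countable_topology}"
  assumes [measurable]: "f \<in> borel_measurable borel"
  shows "lp_int p (\<lambda>x. c *\<^sub>R f x) = ennreal (\<bar>c\<bar> powr p) * lp_int p f"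
  unfolding lp_int_def by (simp add: powr_mult ennreal_mult nn_integral_cmult)

lemma lp_int_add_finite:
  fixes f g :: "'a::euclidean_space \<Rightarrow> 'b::{real_normed_vector,second_countable_topology}"
  assumes "f \<in> borel_measurable borel" "g \<in> borel_measurable borel" "0 \<le> p"
    and "lp_int p f < \<infinity>" "lp_int p g < \<infinity>"
  shows "lp_int p (\<lambda>x. f x + g x) < \<infinity>"
  using lp_int_add[OF assms(1,2), of 1 p] assms
  by (auto simp: ennreal_mult_less_top intro: le_less_trans)

lemma lp_int_diff_finite:
  fixes f g :: "'a::euclidean_space \<Rightarrow> 'b::{real_normed_vector,second_countable_topology}"
  assumes "f \<in> borel_measurable borel" "g \<in> borel_measurable borel" "0 \<le> p"
    and "lp_int p f < \<infinity>" "lp_int p g < \<infinity>"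
  shows "lp_int p (\<lambda>x. f x - g x) < \<infinity>"
  using lp_int_add_finite[of f "\<lambda>x. - g x" p] assms by (auto simp: lp_int_def)

section \<open>Compactly supported Lipschitz functions\<close>

lemma lipc_continuous:
  fixes f :: "'a::euclidean_space \<Rightarrow> real"
  assumes "lipc f" shows "continuous_on UNIV f"
proof -
  from assms obtain C where C: "\<And>x y. \<bar>f x - f y\<bar> \<le> C * norm (x - y)" unfolding lipc_def by blast
  have "\<bar>C\<bar>-lipschitz_on UNIV f"
  proof (rule lipschitz_onI)
    fix x y :: 'a
    have "C * norm (x - y) \<le> \<bar>C\<bar> * norm (x - y)" by (intro mult_right_mono) auto
    then show "dist (f x) (f y) \<le> \<bar>C\<bar> * dist x y" using C[of x y] by (simp add: dist_norm)
  qed auto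
  then show ?thesis using lipschitz_on_continuous_on by blast
qed

lemma lipc_measurable [measurable_dest]: "lipc f \<Longrightarrow> f \<in> borel_measurable borel"
  by (intro borel_measurable_continuous_onI lipc_continuous)

lemma lipc_bounds:
  fixes f :: "'a::euclidean_space \<Rightarrow> real"
  assumes "lipc f"
  shows "\<exists>C A B. 0 < C \<and> 0 < A \<and> 0 < B \<and> (\<forall>x y. \<bar>f x - f y\<bar> \<le> C * norm (x - y)) \<and>
    (\<forall>x. norm x > A \<longrightarrow> f x = 0) \<and> (\<forall>x. \<bar>f x\<bar> \<le> B)"
proof -
  obtain C A where C: "\<And>x y. \<bar>f x - f y\<bar> \<le> C * norm (x - y)" and A: "\<And>x. norm x > A \<Longrightarrow> f x = 0"
    using assms unfolding lipc_def by blast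
  define C' A' where "C' = \<bar>C\<bar> + 1" and "A' = \<bar>A\<bar> + 1"
  have C': "\<bar>f x - f y\<bar> \<le> C' * norm (x - y)" for x y
    using C[of x y] mult_right_mono[of C C' "norm (x - y)"] unfolding C'_def by (smt (verit) norm_ge_zero)
  have A': "norm x > A' \<Longrightarrow> f x = 0" for x using A[of x] by (auto simp: A'_def)
  have "\<bar>f x\<bar> \<le> C' * (2 * A' + 1)" for x
  proof (cases "norm x > A'")
    case True
    then show ?thesis using A'[of x] by (simp add: C'_def A'_def)
  next
    case False
    \<comment> \<open>\<open>y\<close> below has norm \<open>A' + 1\<close>, so it lies outside the
      support, and its distance from \<open>x\<close> is at most \<open>2 * A' + 1\<close>.\<close>
    obtain b :: 'a where b: "b \<in> Basis" using nonempty_Basis by blast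
    define y where "y = (A' + 1) *\<^sub>R b"
    have ny: "norm y = A' + 1" using b by (simp add: y_def A'_def)
    then have "f y = 0" using A' by simp
    moreover have "norm (x - y) \<le> 2 * A' + 1" using norm_triangle_ineq4[of x y] ny False by simp
    moreover have "C' > 0" by (simp add: C'_def)
    ultimately show ?thesis using C'[of x y]
      by (smt (verit) mult_left_mono)
  qed
  then show ?thesis using C' A'
    by (intro exI[of _ C'] exI[of _ A'] exI[of _ "C' * (2 * A' + 1)"]) (auto simp: C'_def A'_def add_pos_pos)
qed

lemma lipc_lp_finite:
  fixes f :: "'a::euclidean_space \<Rightarrow> real"
  assumes "lipc f" "0 < p"
  shows "lp_int p f < \<infinity>"
proof -
  obtain C A B where *: "0 < C" "0 < A" "0 < B" "\<And>x y. \<bar>f x - f y\<bar> \<le> C * norm (x - y)"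
      "\<And>x. norm x > A \<Longrightarrow> f x = 0" "\<And>x. \<bar>f x\<bar> \<le> B"
    using lipc_bounds[OF assms(1)] by blast
  have "lp_int p f \<le> (\<integral>\<^sup>+(x::'a). ennreal (B powr p) * indicator (cball 0 A) x \<partial>lborel)"
    unfolding lp_int_def
  proof (intro nn_integral_mono)
    fix x :: 'a
    show "ennreal (norm (f x) powr p) \<le> ennreal (B powr p) * indicator (cball 0 A) x"
      using *(2,3,5,6) assms by (cases "norm x > A") (auto simp: indicator_def intro!: powr_mono2)
  qed
  also have "\<dots> < \<infinity>"
    using emeasure_lborel_cball_finite[of "0::'a" A] by (simp add: nn_integral_cmult_indicator ennreal_mult_less_top)
  finally show ?thesis .
qed

lemma lipc_zero: "lipc (\<lambda>x. 0)" unfolding lipc_def by (rule exI[of _ 0]) auto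

lemma lipc_add:
  assumes "lipc f" "lipc g" shows "lipc (\<lambda>x. f x + g x)"
proof -
  obtain C A where 1: "\<And>x y. \<bar>f x - f y\<bar> \<le> C * norm (x - y)" "\<And>x. norm x > A \<Longrightarrow> f x = 0"
    using assms(1) unfolding lipc_def by blast
  obtain D B where 2: "\<And>x y. \<bar>g x - g y\<bar> \<le> D * norm (x - y)" "\<And>x. norm x > B \<Longrightarrow> g x = 0"
    using assms(2) unfolding lipc_def by blast
  have "\<bar>f x + g x - (f y + g y)\<bar> \<le> (C + D) * norm (x - y)" for x y
    using 1(1)[of x y] 2(1)[of x y] unfolding distrib_right by linarith
  then show ?thesis unfolding lipc_def using 1(2) 2(2)
    by (intro exI[of _ "C + D"] exI[of _ "max A B"]) auto
qed

lemma lipc_cmult: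
  assumes "lipc f" shows "lipc (\<lambda>x. c * f x)"
proof -
  obtain C A where 1: "\<And>x y. \<bar>f x - f y\<bar> \<le> C * norm (x - y)" "\<And>x. norm x > A \<Longrightarrow> f x = 0"
    using assms(1) unfolding lipc_def by blast
  have "\<bar>c * f x - c * f y\<bar> \<le> (\<bar>c\<bar> * C) * norm (x - y)" for x y
  proof -
    have "\<bar>c * f x - c * f y\<bar> = \<bar>c\<bar> * \<bar>f x - f y\<bar>" by (simp add: abs_mult[symmetric] algebra_simps)
    also have "\<dots> \<le> \<bar>c\<bar> * (C * norm (x - y))" using 1(1) by (intro mult_left_mono) auto
    finally show ?thesis by (simp add: mult.assoc)
  qed
  then show ?thesis unfolding lipc_def using 1(2) by (intro exI[of _ "\<bar>c\<bar> * C"] exI[of _ A]) auto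
qed

section \<open>Density of Lipschitz functions in the p-th power norm\<close>

definition lp_approx :: "real \<Rightarrow> ('a::euclidean_space \<Rightarrow> real) \<Rightarrow> bool" where
  "lp_approx p g \<longleftrightarrow> g \<in> borel_measurable borel \<and> (\<forall>r>0. \<exists>\<phi>. lipc \<phi> \<and> lp_int p (\<lambda>x. g x - \<phi> x) < r)"

lemma ennreal_small_mult:
  assumes "0 < (r::ennreal)" shows "\<exists>s>0. ennreal c * s \<le> r"
proof (cases "c \<le> 0")
  case True
  then show ?thesis using assms by (intro exI[of _ 1]) (auto simp: ennreal_neg)
next
  case False
  show ?thesis
  proof (cases r)
    case (real t)
    then show ?thesis using False assms
      by (intro exI[of _ "ennreal (t / c)"]) (auto simp: ennreal_mult[symmetric])
  next
    case top
    then show ?thesis by (intro exI[of _ 1]) auto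
  qed
qed

lemma lp_approx_closed:
  fixes g :: "'a::euclidean_space \<Rightarrow> real"
  assumes [measurable]: "g \<in> borel_measurable borel" and p: "0 \<le> p"
    and ap: "\<And>r. 0 < r \<Longrightarrow> \<exists>h. lp_approx p h \<and> lp_int p (\<lambda>x. g x - h x) < r"
  shows "lp_approx p g"
  unfolding lp_approx_def
proof (intro conjI allI impI)
  fix r :: ennreal assume "0 < r"
  then obtain r' where r': "0 < r'" "r' < r" using dense by blast
  then have "0 < r' / 2" by (simp add: ennreal_zero_less_divide)
  then obtain s where s: "s > 0" "ennreal (2 powr p) * s \<le> r' / 2" using ennreal_small_mult by blast
  obtain h where h: "lp_approx p h" "lp_int p (\<lambda>x. g x - h x) < s" using ap s by blast
  then obtain \<phi> where f: "lipc \<phi>" "lp_int p (\<lambda>x. h x - \<phi> x) < s"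
    using s unfolding lp_approx_def by blast
  have [measurable]: "h \<in> borel_measurable borel" "\<phi> \<in> borel_measurable borel"
    using h f unfolding lp_approx_def by (auto dest: lipc_measurable)
  have "lp_int p (\<lambda>x. (g x - h x) + (h x - \<phi> x)) \<le> ennreal ((1 + 1) powr p) * lp_int p (\<lambda>x. g x - h x)
     + ennreal ((1 + 1/1) powr p) * lp_int p (\<lambda>x. h x - \<phi> x)"
    using p by (intro lp_int_add) auto
  also have "\<dots> \<le> ennreal (2 powr p) * s + ennreal (2 powr p) * s"
    using h(2) f(2) by (simp only: one_add_one div_by_1) (intro add_mono mult_left_mono less_imp_le, auto)
  also have "\<dots> \<le> r' / 2 + r' / 2" using s by (intro add_mono)
  also have "r' / 2 + r' / 2 = r'"
    by (simp add: mult_2_right[symmetric] ennreal_divide_times)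
  also have "\<dots> < r" by (rule r')
  finally show "\<exists>\<phi>. lipc \<phi> \<and> lp_int p (\<lambda>x. g x - \<phi> x) < r" using f by auto
qed simp


lemma lp_approx_add:
  fixes g h :: "'a::euclidean_space \<Rightarrow> real"
  assumes "lp_approx p g" "lp_approx p h" "0 \<le> p"
  shows "lp_approx p (\<lambda>x. g x + h x)"
  unfolding lp_approx_def
proof (intro conjI allI impI)
  have [measurable]: "g \<in> borel_measurable borel" "h \<in> borel_measurable borel"
    using assms unfolding lp_approx_def by auto
  show "(\<lambda>x. g x + h x) \<in> borel_measurable borel" by measurable
  fix r :: ennreal assume "0 < r"
  then obtain r' where r': "0 < r'" "r' < r" using dense by blast
  then have "0 < r' / 2" by (simp add: ennreal_zero_less_divide)
  then obtain s where s: "s > 0" "ennreal (2 powr p) * s \<le> r' / 2" using ennreal_small_mult by blast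
  obtain \<phi> \<psi> where f: "lipc \<phi>" "lp_int p (\<lambda>x. g x - \<phi> x) < s" "lipc \<psi>" "lp_int p (\<lambda>x. h x - \<psi> x) < s"
    using s assms unfolding lp_approx_def by blast
  have [measurable]: "\<phi> \<in> borel_measurable borel" "\<psi> \<in> borel_measurable borel"
    using f by (auto dest: lipc_measurable)
  have "lp_int p (\<lambda>x. (g x - \<phi> x) + (h x - \<psi> x)) \<le> ennreal ((1 + 1) powr p) * lp_int p (\<lambda>x. g x - \<phi> x)
     + ennreal ((1 + 1/1) powr p) * lp_int p (\<lambda>x. h x - \<psi> x)"
    using assms by (intro lp_int_add) auto
  also have "\<dots> \<le> ennreal (2 powr p) * s + ennreal (2 powr p) * s"
    using f by (simp only: one_add_one div_by_1) (intro add_mono mult_left_mono less_imp_le, auto)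
  also have "\<dots> \<le> r' / 2 + r' / 2" using s by (intro add_mono)
  also have "r' / 2 + r' / 2 = r'"
    by (simp add: mult_2_right[symmetric] ennreal_divide_times)
  also have "\<dots> < r" by (rule r')
  finally have "lp_int p (\<lambda>x. g x + h x - (\<phi> x + \<psi> x)) < r" by (simp add: algebra_simps)
  then show "\<exists>\<phi>. lipc \<phi> \<and> lp_int p (\<lambda>x. g x + h x - \<phi> x) < r" using lipc_add[OF f(1,3)] by blast
qed

lemma lp_approx_cmult:
  fixes g :: "'a::euclidean_space \<Rightarrow> real"
  assumes "lp_approx p g"
  shows "lp_approx p (\<lambda>x. c * g x)"
  unfolding lp_approx_def
proof (intro conjI allI impI)
  have [measurable]: "g \<in> borel_measurable borel"
    using assms unfolding lp_approx_def by auto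
  show "(\<lambda>x. c * g x) \<in> borel_measurable borel" by measurable
  fix r :: ennreal assume "0 < r"
  then obtain r' where r': "0 < r'" "r' < r" using dense by blast
  then obtain s where s: "s > 0" "ennreal (\<bar>c\<bar> powr p) * s \<le> r'" using ennreal_small_mult by blast
  obtain \<phi> where f: "lipc \<phi>" "lp_int p (\<lambda>x. g x - \<phi> x) < s"
    using s assms unfolding lp_approx_def by blast
  have [measurable]: "\<phi> \<in> borel_measurable borel" using f by (auto dest: lipc_measurable)
  have "lp_int p (\<lambda>x. c *\<^sub>R (g x - \<phi> x)) = ennreal (\<bar>c\<bar> powr p) * lp_int p (\<lambda>x. g x - \<phi> x)"
    by (rule lp_int_scale) measurable
  also have "\<dots> \<le> ennreal (\<bar>c\<bar> powr p) * s" using f by (intro mult_left_mono) auto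
  also have "\<dots> < r" using s r' by simp
  finally have "lp_int p (\<lambda>x. c * g x - c * \<phi> x) < r" by (simp add: algebra_simps)
  then show "\<exists>\<phi>. lipc \<phi> \<and> lp_int p (\<lambda>x. c * g x - \<phi> x) < r" using lipc_cmult[OF f(1)] by blast
qed

text \<open>Dominated convergence with the p-th power of \<open>g\<close> as majorant: since
  \<open>0 \<le> U i x \<le> g x\<close>, the error never exceeds \<open>g\<close>.\<close>

lemma lp_approx_seq:
  fixes g :: "'a::euclidean_space \<Rightarrow> real"
  assumes [measurable]: "g \<in> borel_measurable borel" and p: "0 < p" and fin: "lp_int p g < \<infinity>"
    and U: "\<And>i. lp_approx p (U i)" "\<And>i x. 0 \<le> U i x" "\<And>i x. U i x \<le> g x" "\<And>x. (\<lambda>i. U i x) \<longlonglongrightarrow> g x"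
  shows "lp_approx p g"
proof (rule lp_approx_closed)
  fix r :: ennreal assume "0 < r"
  have [measurable]: "U i \<in> borel_measurable borel" for i using U(1) unfolding lp_approx_def by auto
  have "(\<lambda>i. \<integral>\<^sup>+x. ennreal (norm (g x - U i x) powr p) \<partial>lborel) \<longlonglongrightarrow> (\<integral>\<^sup>+(x::'a). 0 \<partial>lborel)"
  proof (rule nn_integral_dominated_convergence[where w="\<lambda>x. ennreal (norm (g x) powr p)"])
    show "(\<integral>\<^sup>+ x. ennreal (norm (g x) powr p) \<partial>lborel) < \<infinity>" using fin by (simp add: lp_int_def)
    show "AE x in lborel. ennreal (norm (g x - U j x) powr p) \<le> ennreal (norm (g x) powr p)" for j
      using U(2,3)[of j] p by (auto intro!: AE_I2 ennreal_leI powr_mono2 simp: abs_if) (metis order_trans not_less)+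
    show "AE x in lborel. (\<lambda>i. ennreal (norm (g x - U i x) powr p)) \<longlonglongrightarrow> 0"
    proof (rule AE_I2)
      fix x
      have "(\<lambda>i. norm (g x - U i x) powr p) \<longlonglongrightarrow> norm (g x - g x) powr p"
        using p U(4)[of x] by (intro tendsto_powr2 tendsto_intros) auto
      then show "(\<lambda>i. ennreal (norm (g x - U i x) powr p)) \<longlonglongrightarrow> 0"
        by (auto dest: tendsto_ennrealI)
    qed
  qed auto
  then have "(\<lambda>i. lp_int p (\<lambda>x. g x - U i x)) \<longlonglongrightarrow> 0" by (simp add: lp_int_def)
  then have "eventually (\<lambda>i. lp_int p (\<lambda>x. g x - U i x) < r) sequentially"
    using \<open>0 < r\<close> by (simp add: order_tendsto_iff)
  then obtain i where "lp_int p (\<lambda>x. g x - U i x) < r" by (auto dest: eventually_happens)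
  then show "\<exists>h. lp_approx p h \<and> lp_int p (\<lambda>x. g x - h x) < r" using U(1) by blast
qed (use p in auto)

text \<open>Regularity of Lebesgue measure squeezes \<open>A\<close> between a compact
  \<open>K\<close> and an open \<open>U\<close> whose difference has measure at most
  \<open>2 * e\<close>. A Lipschitz bump equal to 1 on \<open>K\<close> and 0 off \<open>U\<close>
  differs from the indicator by at most 1, and only on \<open>U - K\<close>.\<close>

lemma lp_approx_indicator_bounded:
  fixes A :: "'a::euclidean_space set"
  assumes A: "A \<in> sets borel" "bounded A" and p: "0 < p"
  shows "lp_approx p (indicator A)"
  unfolding lp_approx_def
proof (intro conjI allI impI)
  show "indicator A \<in> borel_measurable borel" using A by simp
  fix r :: ennreal assume "0 < r"
  then obtain e where e: "0 < e" "ennreal (2 * e) < r"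
  proof -
    obtain r' where r': "0 < r'" "r' < r" using dense[OF \<open>0 < r\<close>] by blast
    then obtain t where t: "r' = ennreal t" "0 \<le> t" by (cases r') auto
    then show thesis using that[of "t/2"] r' by auto
  qed
  have AL: "A \<in> sets lebesgue" using A by simp
  obtain K where K: "closed K" "K \<subseteq> A" "A - K \<in> lmeasurable" "emeasure lebesgue (A - K) < ennreal e"
    using sets_lebesgue_inner_closed[OF AL e(1)] by metis
  obtain U where U: "open U" "A \<subseteq> U" "U - A \<in> lmeasurable" "emeasure lebesgue (U - A) < ennreal e"
    using sets_lebesgue_outer_open[OF AL e(1)] by metis
  have cK: "compact K" using K A by (meson bounded_subset compact_eq_bounded_closed)
  have m: "emeasure lborel (U - K) \<le> ennreal (2 * e)"
  proof -
    have "emeasure lborel (U - K) = emeasure lborel ((U - A) \<union> (A - K))"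
      using K U by (intro arg_cong[where f="emeasure lborel"]) auto
    also have "\<dots> \<le> emeasure lborel (U - A) + emeasure lborel (A - K)"
      using K U A by (intro emeasure_subadditive) auto
    also have "\<dots> \<le> ennreal e + ennreal e"
      using K U A by (intro add_mono) auto
    finally show ?thesis using e by (simp add: ennreal_plus[symmetric] del: ennreal_plus)
  qed
  show "\<exists>\<phi>. lipc \<phi> \<and> lp_int p (\<lambda>x. indicator A x - \<phi> x) < r"
  proof -
    have "\<exists>\<phi>::'a\<Rightarrow>real. lipc \<phi> \<and> (\<forall>x. 0 \<le> \<phi> x \<and> \<phi> x \<le> 1) \<and> (\<forall>x\<in>K. \<phi> x = 1) \<and> (\<forall>x. x \<notin> U \<longrightarrow> \<phi> x = 0)"
    proof (cases "K = {}")
      case True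
      then show ?thesis by (intro exI[of _ "\<lambda>x. 0"]) (auto simp: lipc_zero)
    next
      case False
      have "\<exists>\<delta>>0. \<forall>x\<in>K. \<forall>y\<in>-U. \<delta> \<le> dist x y"
        using K U by (intro separate_compact_closed cK) auto
      then obtain d where d: "d > 0" "\<And>x y. x \<in> K \<Longrightarrow> y \<notin> U \<Longrightarrow> d \<le> dist x y" by auto
      obtain B where B: "\<And>x. x \<in> K \<Longrightarrow> norm x \<le> B" using cK compact_imp_bounded bounded_iff by metis
      \<comment> \<open>The slope \<open>1 / d\<close> is dictated by the gap \<open>d\<close>
        between \<open>K\<close> and the complement of \<open>U\<close>; boundedness of
        \<open>K\<close> makes the support bounded.\<close>
      define \<phi> :: "'a \<Rightarrow> real" where "\<phi> x = max 0 (1 - infdist x K / d)" for x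
      have "lipc \<phi>" unfolding lipc_def
      proof (intro exI conjI allI impI)
        fix x y :: 'a
        have "\<bar>infdist x K - infdist y K\<bar> \<le> dist x y"
          using infdist_triangle[of x K y] infdist_triangle[of y K x] by (auto simp: dist_commute)
        then have "\<bar>infdist x K / d - infdist y K / d\<bar> \<le> 1/d * norm (x - y)"
          using d by (simp add: dist_norm diff_divide_distrib[symmetric] divide_right_mono)
        then show "\<bar>\<phi> x - \<phi> y\<bar> \<le> 1/d * norm (x - y)" unfolding \<phi>_def by (auto simp: max_def abs_if split: if_splits)
      next
        fix x :: 'a assume x: "norm x > B + d"
        have "d \<le> infdist x K"
          unfolding infdist_notempty[OF False]
        proof (rule cINF_greatest[OF False])
          fix y assume "y \<in> K"
          then show "d \<le> dist x y" using x B[of y] norm_triangle_ineq2[of x y] by (simp add: dist_norm)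
        qed
        then show "\<phi> x = 0" using d by (simp add: \<phi>_def)
      qed
      moreover have "0 \<le> \<phi> x \<and> \<phi> x \<le> 1" for x using d infdist_nonneg[of x K] by (auto simp: \<phi>_def)
      moreover have "x \<in> K \<Longrightarrow> \<phi> x = 1" for x by (simp add: \<phi>_def)
      moreover have "\<phi> x = 0" if "x \<notin> U" for x
      proof -
        have "d \<le> infdist x K"
          unfolding infdist_notempty[OF False]
          using d(2) that by (intro cINF_greatest[OF False]) (auto simp: dist_commute)
        then show "\<phi> x = 0" using d by (simp add: \<phi>_def)
      qed
      ultimately show ?thesis by blast
    qed
    then obtain \<phi> :: "'a\<Rightarrow>real" where \<phi>: "lipc \<phi>" "\<And>x. 0 \<le> \<phi> x" "\<And>x. \<phi> x \<le> 1" "\<And>x. x \<in> K \<Longrightarrow> \<phi> x = 1" "\<And>x. x \<notin> U \<Longrightarrow> \<phi> x = 0"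
      by blast
    have "lp_int p (\<lambda>x. indicator A x - \<phi> x) \<le> (\<integral>\<^sup>+x. indicator (U - K) x \<partial>lborel)"
      unfolding lp_int_def
    proof (intro nn_integral_mono)
      fix x
      show "ennreal (norm (indicator A x - \<phi> x) powr p) \<le> indicator (U - K) x"
      proof (cases "x \<in> U - K")
        case True
        have "norm (indicator A x - \<phi> x) \<le> 1" using \<phi>(2,3)[of x] by (auto simp: indicator_def)
        then have "norm (indicator A x - \<phi> x) powr p \<le> 1 powr p" using p by (intro powr_mono2) auto
        then show ?thesis using True by simp
      next
        case False
        then have "indicator A x - \<phi> x = 0" using K U \<phi>(4,5)[of x] by (auto simp: indicator_def)
        then show ?thesis using p by simp
      qed
    qed
    also have "\<dots> = emeasure lborel (U - K)" using K U by (intro nn_integral_indicator) auto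
    also have "\<dots> < r" using m e by simp
    finally show ?thesis using \<phi>(1) by blast
  qed
qed

text \<open>Induction over nonnegative measurable functions; \<open>lp_approx\<close> was made a
  predicate stable under sums, multiples and limits from below for this purpose. Finiteness of the
  integral is inherited by summands and approximants because they lie below the whole.\<close>

lemma lp_approx_nonneg:
  fixes g :: "'a::euclidean_space \<Rightarrow> real"
  assumes "g \<in> borel_measurable borel" "\<And>x. 0 \<le> g x" and p: "0 < p" and fin: "lp_int p g < \<infinity>"
  shows "lp_approx p g"
  using assms(1,2) fin
proof (induction g rule: borel_measurable_induct_real)
  case (set A)
  note [measurable] = set(1)
  show ?case
  proof (rule lp_approx_seq[where U="\<lambda>n. indicator (A \<inter> cball 0 (real n))"])
    fix x :: 'a
    obtain N where N: "norm x \<le> real N" using real_arch_simple by blast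
    have "eventually (\<lambda>i. indicator (A \<inter> cball 0 (real i)) x = (indicator A x :: real)) sequentially"
      using eventually_ge_at_top[of N] by eventually_elim (use N in \<open>auto simp: indicator_def\<close>)
    then show "(\<lambda>i. indicator (A \<inter> cball 0 (real i)) x) \<longlonglongrightarrow> (indicator A x :: real)"
      by (rule tendsto_eventually)
  next
    show "lp_approx p (indicator (A \<inter> cball 0 (real i)))" for i
      using set p by (intro lp_approx_indicator_bounded) auto
  qed (use set p in \<open>auto simp: indicator_def\<close>)
next
  case (mult u c)
  show ?case
  proof (cases "c = 0")
    case True
    have "lp_approx p (\<lambda>x. 0 :: real)" unfolding lp_approx_def
      by (auto intro!: exI[of _ "\<lambda>x. 0"] lipc_zero simp: lp_int_def)
    then show ?thesis using True by simp
  next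
    case False
    have "lp_int p (\<lambda>x. c *\<^sub>R u x) = ennreal (\<bar>c\<bar> powr p) * lp_int p u"
      using mult by (intro lp_int_scale) auto
    moreover have "0 < \<bar>c\<bar> powr p" using False by simp
    ultimately have "lp_int p u < \<infinity>" using mult.prems by (auto simp: ennreal_mult_less_top)
    then show ?thesis using mult by (intro lp_approx_cmult) auto
  qed
next
  case (add u v)
  have "lp_int p u \<le> lp_int p (\<lambda>x. v x + u x)" "lp_int p v \<le> lp_int p (\<lambda>x. v x + u x)"
    using add p by (auto intro!: lp_int_mono)
  then have "lp_int p u < \<infinity>" "lp_int p v < \<infinity>" using add.prems by auto
  then show ?case using add p by (intro lp_approx_add) auto
next
  case (seq U)
  have le: "U i x \<le> g x" for i x
    using seq(3,4) by (intro incseq_le[of "\<lambda>i. U i x"]) (auto simp: incseq_def le_fun_def)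
  have nn: "0 \<le> g x" for x using le[of 0 x] seq(2)[of 0 x] by simp
  have m: "g \<in> borel_measurable borel"
    using seq(1,4) by (intro borel_measurable_LIMSEQ_real[of borel U g]) auto
  have "lp_int p (U i) < \<infinity>" for i
  proof -
    have "lp_int p (U i) \<le> lp_int p g" using le seq(2) nn p by (intro lp_int_mono) auto
    then show ?thesis using seq.prems by auto
  qed
  then show ?case using seq le m p by (intro lp_approx_seq[of g p U]) auto
qed

lemma lp_density:
  fixes g :: "'a::euclidean_space \<Rightarrow> real"
  assumes [measurable]: "g \<in> borel_measurable borel" and p: "0 < p" and fin: "lp_int p g < \<infinity>" and "0 < r"
  shows "\<exists>\<phi>. lipc \<phi> \<and> lp_int p (\<lambda>x. g x - \<phi> x) < r"
proof -
  have "lp_int p (\<lambda>x. max 0 (g x)) \<le> lp_int p g" "lp_int p (\<lambda>x. max 0 (- g x)) \<le> lp_int p g"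
    using p by (auto intro!: lp_int_mono)
  then have *: "lp_int p (\<lambda>x. max 0 (g x)) < \<infinity>" "lp_int p (\<lambda>x. max 0 (- g x)) < \<infinity>"
    using fin by auto
  have "lp_approx p (\<lambda>x. max 0 (g x) + (-1) * max 0 (- g x))"
    using * p by (intro lp_approx_add lp_approx_cmult lp_approx_nonneg) auto
  also have "(\<lambda>x. max 0 (g x) + (-1) * max 0 (- g x)) = g" by (auto simp: max_def)
  finally show ?thesis using \<open>0 < r\<close> unfolding lp_approx_def by blast
qed

section \<open>Jensen, integrability against decaying kernels, Fubini along lines\<close>

text \<open>Convexity of the power function, in the form of a tangent line. It is Young's inequality
  for \<open>a / t\<close> and 1 with exponents \<open>p\<close> and \<open>p / (p - 1)\<close>,
  multiplied by \<open>p\<close> and by \<open>t powr p\<close>.\<close>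

lemma powr_above_tangent:
  fixes a t :: real
  assumes "0 \<le> a" "0 \<le> t" "1 < p"
  shows "t powr p + p * t powr (p - 1) * (a - t) \<le> a powr p"
proof (cases "t = 0")
  case False
  then have t: "0 < t" using assms by simp
  define q where "q = p / (p - 1)"
  have "(a / t) * 1 \<le> (a / t) powr p / p + 1 powr q / q"
    using assms t by (intro Youngs_inequality) (auto simp: q_def field_simps)
  then have "(a / t) * p \<le> ((a / t) powr p / p + (p - 1) / p) * p"
    using assms by (intro mult_right_mono) (auto simp: q_def)
  also have "\<dots> = (a / t) powr p + (p - 1)" using assms by (simp add: distrib_right)
  finally have "(a / t) * p \<le> (a / t) powr p + (p - 1)" .
  then have "t powr p * ((a / t) * p) \<le> t powr p * ((a / t) powr p + (p - 1))"
    by (intro mult_left_mono) auto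
  also have "\<dots> = a powr p + t powr p * (p - 1)"
    using assms t by (simp add: powr_divide algebra_simps)
  finally have "t powr p * ((a / t) * p) \<le> a powr p + t powr p * (p - 1)" .
  moreover have "t powr p * (a / t) = t powr (p - 1) * a" using t by (simp add: powr_diff)
  moreover have "t powr p = t powr (p - 1) * t" using t by (simp add: powr_diff)
  ultimately show ?thesis using t by (simp add: algebra_simps)
qed (use assms in auto)

text \<open>Integrate the tangent line of the power function at the mean \<open>t\<close>; its
  linear term integrates to zero because \<rho> has mass one. A finite right side makes all
  integrals involved finite, an infinite one leaves nothing to show.\<close>

lemma jensen_powr:
  fixes \<rho> h :: "'a \<Rightarrow> real"
  assumes [measurable]: "\<rho> \<in> borel_measurable M" "h \<in> borel_measurable M"
    and nn: "\<And>x. 0 \<le> \<rho> x" "\<And>x. 0 \<le> h x" and \<rho>: "integrable M \<rho>" "(LINT x|M. \<rho> x) = 1"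
    and \<rho>h: "integrable M (\<lambda>x. \<rho> x * h x)" and p: "1 < p"
  shows "ennreal ((LINT x|M. \<rho> x * h x) powr p) \<le> (\<integral>\<^sup>+x. ennreal (\<rho> x * h x powr p) \<partial>M)"
proof (cases "(\<integral>\<^sup>+x. ennreal (\<rho> x * h x powr p) \<partial>M) = \<infinity>")
  case False
  have ip: "integrable M (\<lambda>x. \<rho> x * h x powr p)"
    using False nn by (intro integrableI_nonneg) (auto simp: top.not_eq_extremum)
  define t where "t = (LINT x|M. \<rho> x * h x)"
  have t0: "0 \<le> t" unfolding t_def using nn by (intro integral_nonneg_AE) auto
  have ig: "integrable M (\<lambda>x. \<rho> x * (t powr p) + (p * t powr (p - 1)) * (\<rho> x * h x - \<rho> x * t))"
    using \<rho> \<rho>h by (intro Bochner_Integration.integrable_add integrable_mult_right integrable_mult_left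
        Bochner_Integration.integrable_diff) auto
  have "(LINT x|M. \<rho> x * (t powr p) + (p * t powr (p - 1)) * (\<rho> x * h x - \<rho> x * t)) = t powr p"
    using \<rho> \<rho>h by (simp add: t_def)
  moreover have "(LINT x|M. \<rho> x * (t powr p) + (p * t powr (p - 1)) * (\<rho> x * h x - \<rho> x * t))
     \<le> (LINT x|M. \<rho> x * h x powr p)"
  proof (rule integral_mono[OF ig ip])
    fix x
    have "\<rho> x * (t powr p + p * t powr (p - 1) * (h x - t)) \<le> \<rho> x * h x powr p"
      using nn t0 p by (intro mult_left_mono powr_above_tangent) auto
    then show "\<rho> x * (t powr p) + (p * t powr (p - 1)) * (\<rho> x * h x - \<rho> x * t) \<le> \<rho> x * h x powr p"
      by (simp add: algebra_simps)
  qed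
  ultimately have "t powr p \<le> (LINT x|M. \<rho> x * h x powr p)" by simp
  then have "ennreal (t powr p) \<le> ennreal (LINT x|M. \<rho> x * h x powr p)" by (rule ennreal_leI)
  also have "\<dots> = (\<integral>\<^sup>+x. ennreal (\<rho> x * h x powr p) \<partial>M)"
    using ip nn by (intro nn_integral_eq_integral[symmetric]) auto
  finally show ?thesis by (simp add: t_def)
qed simp

section \<open>Affine substitutions and integration along lines\<close>

lemma nn_integral_lborel_affine:
  fixes f :: "'a::euclidean_space \<Rightarrow> ennreal"
  assumes [measurable]: "f \<in> borel_measurable borel" and c: "c \<noteq> 0"
  shows "(\<integral>\<^sup>+x. f x \<partial>lborel) = ennreal (\<bar>c\<bar> ^ DIM('a)) * (\<integral>\<^sup>+x. f (t + c *\<^sub>R x) \<partial>lborel)"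
  by (subst lborel_affine[OF c, of t])
     (simp add: nn_integral_density nn_integral_distr nn_integral_cmult ennreal_power)

lemma nn_integral_lborel_reflect:
  fixes f :: "'a::euclidean_space \<Rightarrow> ennreal"
  assumes [measurable]: "f \<in> borel_measurable borel"
  shows "(\<integral>\<^sup>+x. f (t - x) \<partial>lborel) = (\<integral>\<^sup>+x. f x \<partial>lborel)"
  using nn_integral_lborel_affine[of f "-1" t] by simp

lemma nn_integral_lborel_translate:
  fixes f :: "'a::euclidean_space \<Rightarrow> ennreal"
  assumes [measurable]: "f \<in> borel_measurable borel"
  shows "(\<integral>\<^sup>+x. f (t + x) \<partial>lborel) = (\<integral>\<^sup>+x. f x \<partial>lborel)"
  using nn_integral_lborel_affine[of f "1" t] by simp

text \<open>Slicing by lines parallel to \<open>z\<close> without an orthogonal decomposition.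
  Insert the mass one of \<psi>, exchange the integrals and translate \<open>x\<close> by
  \<open>s\<close> times \<open>z\<close>; this moves the coordinate
  \<open>x \<bullet> z / (z \<bullet> z)\<close> by exactly \<open>s\<close> and makes the weight
  independent of \<open>s\<close>. A one-dimensional p-th power bound thus integrates to the same
  bound in space, with the same constant.\<close>

lemma line_fubini:
  fixes G :: "'a::euclidean_space \<Rightarrow> ennreal"
  assumes [measurable]: "G \<in> borel_measurable borel" "\<psi> \<in> borel_measurable borel"
    and \<psi>: "(\<integral>\<^sup>+s. \<psi> s \<partial>lborel) = 1" and z: "z \<noteq> 0"
  shows "(\<integral>\<^sup>+x. G x \<partial>lborel) = (\<integral>\<^sup>+x. \<psi> (x \<bullet> z / (z \<bullet> z)) * (\<integral>\<^sup>+s. G (x + s *\<^sub>R z) \<partial>lborel) \<partial>lborel)"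
proof -
  have "(\<integral>\<^sup>+x. G x \<partial>lborel) = (\<integral>\<^sup>+x. G x * (\<integral>\<^sup>+s. \<psi> (x \<bullet> z / (z \<bullet> z) - s) \<partial>lborel) \<partial>lborel)"
    by (simp add: nn_integral_lborel_reflect \<psi>)
  also have "\<dots> = (\<integral>\<^sup>+x. (\<integral>\<^sup>+s. G x * \<psi> (x \<bullet> z / (z \<bullet> z) - s) \<partial>lborel) \<partial>lborel)"
    by (simp add: nn_integral_cmult)
  also have "\<dots> = (\<integral>\<^sup>+s. (\<integral>\<^sup>+x. G x * \<psi> (x \<bullet> z / (z \<bullet> z) - s) \<partial>lborel) \<partial>lborel)"
    by (rule lborel_pair.Fubini') measurable
  also have "\<dots> = (\<integral>\<^sup>+s. (\<integral>\<^sup>+x. G (s *\<^sub>R z + x) * \<psi> ((s *\<^sub>R z + x) \<bullet> z / (z \<bullet> z) - s) \<partial>lborel) \<partial>lborel)"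
    by (intro nn_integral_cong nn_integral_lborel_translate[symmetric]) measurable
  also have "\<dots> = (\<integral>\<^sup>+s. (\<integral>\<^sup>+x. G (x + s *\<^sub>R z) * \<psi> (x \<bullet> z / (z \<bullet> z)) \<partial>lborel) \<partial>lborel)"
    using z by (intro nn_integral_cong) (simp add: inner_add_left add_divide_distrib add.commute)
  also have "\<dots> = (\<integral>\<^sup>+x. (\<integral>\<^sup>+s. G (x + s *\<^sub>R z) * \<psi> (x \<bullet> z / (z \<bullet> z)) \<partial>lborel) \<partial>lborel)"
    by (rule lborel_pair.Fubini') measurable
  also have "\<dots> = (\<integral>\<^sup>+x. \<psi> (x \<bullet> z / (z \<bullet> z)) * (\<integral>\<^sup>+s. G (x + s *\<^sub>R z) \<partial>lborel) \<partial>lborel)"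
    by (simp add: nn_integral_multc mult.commute)
  finally show ?thesis .
qed

lemma nn_integral_even_le:
  fixes f :: "real \<Rightarrow> ennreal"
  assumes [measurable]: "f \<in> borel_measurable borel"
  shows "(\<integral>\<^sup>+x. f \<bar>x\<bar> \<partial>lborel) \<le> 2 * (\<integral>\<^sup>+x. f x * indicator {0..} x \<partial>lborel)"
proof -
  have "(\<integral>\<^sup>+x. f \<bar>x\<bar> \<partial>lborel) \<le> (\<integral>\<^sup>+x. f x * indicator {0..} x + f (0 - x) * indicator {0..} (0 - x) \<partial>lborel)"
    by (intro nn_integral_mono) (auto simp: indicator_def)
  also have "\<dots> = (\<integral>\<^sup>+x. f x * indicator {0..} x \<partial>lborel) + (\<integral>\<^sup>+x. f (0 - x) * indicator {0..} (0 - x) \<partial>lborel)"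
    by (intro nn_integral_add) measurable
  also have "(\<integral>\<^sup>+x. f (0 - x) * indicator {0..} (0 - x) \<partial>lborel) = (\<integral>\<^sup>+x. f x * indicator {0..} x \<partial>lborel)"
    by (rule nn_integral_lborel_reflect[where f="\<lambda>x. f x * indicator {0..} x"]) measurable
  finally show ?thesis by (simp add: mult_2)
qed

text \<open>A majorant that factors over the coordinates, so that integrals of its powers reduce to
  dimension one. It still dominates \<open>(1 / (1 + norm y)) ^ DIM('a)\<close>, the decay of the
  truncated Riesz kernels, and all its powers above 1 are integrable.\<close>

definition box_decay :: "'a::euclidean_space \<Rightarrow> real" where
  "box_decay y = (\<Prod>b\<in>Basis. 1 / (1 + \<bar>y \<bullet> b\<bar>))"

lemma box_decay_measurable [measurable]: "box_decay \<in> borel_measurable borel"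
  unfolding box_decay_def[abs_def] by measurable

lemma box_decay_pos: "0 < box_decay y" unfolding box_decay_def by (intro prod_pos) (auto intro: add_pos_nonneg)

lemma box_decay_real: "box_decay (y::real) = 1 / (1 + \<bar>y\<bar>)" by (simp add: box_decay_def)

lemma box_decay_ge: "(1 / (1 + norm y)) ^ DIM('a) \<le> box_decay (y::'a::euclidean_space)"
proof -
  have "(\<Prod>b\<in>(Basis::'a set). 1 / (1 + norm y)) \<le> box_decay y"
    unfolding box_decay_def
    by (intro prod_mono) (auto intro!: divide_left_mono mult_pos_pos add_pos_nonneg simp: Basis_le_norm)
  then show ?thesis by simp
qed

lemma decay_powr_finite:
  assumes q: "1 < q"
  shows "(\<integral>\<^sup>+s. ennreal ((1 / (1 + \<bar>s\<bar>)) powr q) \<partial>lborel) < \<infinity>"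
proof -
  have "(\<integral>\<^sup>+s. ennreal ((1 / (1 + \<bar>s\<bar>)) powr q) \<partial>lborel) \<le>
     2 * (\<integral>\<^sup>+s. ennreal ((1 / (1 + \<bar>s\<bar>)) powr q) * indicator {0..} s \<partial>lborel)"
    using nn_integral_even_le[of "\<lambda>s. ennreal ((1 / (1 + \<bar>s\<bar>)) powr q)"] by simp
  also have "(\<integral>\<^sup>+s. ennreal ((1 / (1 + \<bar>s\<bar>)) powr q) * indicator {0..} s \<partial>lborel) =
       (\<integral>\<^sup>+s. ennreal ((1 + s) powr (-q)) * indicator {0..} s \<partial>lborel)"
    by (intro nn_integral_cong) (auto simp: indicator_def powr_divide powr_minus_divide)
  also have "\<dots> = ennreal (0 - (1 + 0) powr (1 - q) / (1 - q))"
  proof (rule nn_integral_FTC_atLeast)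
    fix x :: real assume "0 \<le> x"
    then have "((\<lambda>s. (1 + s) powr (1 - q)) has_real_derivative (1 - q) * (1 + x) powr (1 - q - 1) * 1) (at x)"
      by (intro DERIV_chain'[where g="\<lambda>u. u powr (1 - q)"] has_real_derivative_powr) (auto intro!: derivative_eq_intros)
    from DERIV_cdivide[OF this, of "1 - q"]
    show "((\<lambda>s. (1 + s) powr (1 - q) / (1 - q)) has_real_derivative (1 + x) powr - q) (at x)"
      using q by simp
  next
    show "((\<lambda>s. (1 + s) powr (1 - q) / (1 - q)) \<longlongrightarrow> 0) at_top"
      using q by real_asymp
  qed (use q in auto)
  finally show ?thesis by (auto simp: ennreal_mult_less_top intro: le_less_trans)
qed

lemma box_decay_powr_finite:
  assumes q: "1 < q"
  shows "(\<integral>\<^sup>+y. ennreal (box_decay (y::'a::euclidean_space) powr q) \<partial>lborel) < \<infinity>"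
proof -
  have "(\<integral>\<^sup>+y. ennreal (box_decay (y::'a) powr q) \<partial>lborel) = (\<integral>\<^sup>+(y::'a). (\<Prod>b\<in>Basis. ennreal ((1 / (1 + \<bar>y \<bullet> b\<bar>)) powr q)) \<partial>lborel)"
    unfolding box_decay_def by (intro nn_integral_cong) (simp add: prod_powr_distrib[symmetric] prod_ennreal)
  also have "\<dots> = (\<Prod>b\<in>(Basis::'a set). (\<integral>\<^sup>+s. ennreal ((1 / (1 + \<bar>s\<bar>)) powr q) \<partial>lborel))"
    by (rule nn_integral_lborel_prod) auto
  also have "\<dots> < \<infinity>" using decay_powr_finite[OF q] by (simp add: power_less_top_ennreal)
  finally show ?thesis .
qed

text \<open>Young's inequality bounds the product pointwise by the p-th power of \<open>f\<close>
  plus the q-th power of the majorant of \<open>k\<close>, with \<open>q\<close> the conjugate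
  exponent; both are integrable.\<close>

lemma lp_kernel_integrable:
  fixes f k :: "'a::euclidean_space \<Rightarrow> real"
  assumes [measurable]: "f \<in> borel_measurable borel" "k \<in> borel_measurable borel"
    and p: "1 < p" and fin: "lp_int p f < \<infinity>" and k: "\<And>y. \<bar>k y\<bar> \<le> C * box_decay y"
  shows "integrable lborel (\<lambda>y. k y * f (x - y))"
proof (rule integrableI_bounded)
  define q where "q = p / (p - 1)"
  have q: "1 < q" "1/p + 1/q = 1" using p by (auto simp: q_def field_simps)
  have C: "0 \<le> C"
  proof -
    have "0 \<le> C * box_decay (0::'a)" using k[of 0] by (smt (verit))
    then show ?thesis using box_decay_pos[of "0::'a"] by (simp add: zero_le_mult_iff)
  qed
  have "(\<integral>\<^sup>+y. norm (k y * f (x - y)) \<partial>lborel) \<le>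
    (\<integral>\<^sup>+y. ennreal (norm (f (x - y)) powr p) + ennreal (C powr q) * ennreal (box_decay y powr q) \<partial>lborel)"
  proof (intro nn_integral_mono)
    fix y
    have "norm (k y * f (x - y)) \<le> norm (f (x - y)) * (C * box_decay y)"
      using mult_right_mono[OF k[of y] abs_ge_zero[of "f (x - y)"]] by (simp add: abs_mult mult.commute)
    also have "\<dots> \<le> norm (f (x - y)) powr p / p + (C * box_decay y) powr q / q"
      using p q C box_decay_pos[of y] by (intro Youngs_inequality) (auto intro: less_imp_le)
    also have "\<dots> \<le> norm (f (x - y)) powr p + (C * box_decay y) powr q"
      using p q by (intro add_mono) (auto simp: divide_le_eq mult_le_cancel_left1)
    also have "(C * box_decay y) powr q = C powr q * box_decay y powr q"
      using C box_decay_pos[of y] by (simp add: powr_mult less_imp_le)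
    finally show "ennreal (norm (k y * f (x - y))) \<le> ennreal (norm (f (x - y)) powr p) + ennreal (C powr q) * ennreal (box_decay y powr q)"
      by (simp add: ennreal_mult[symmetric] ennreal_plus[symmetric] del: ennreal_plus)
  qed
  also have "\<dots> = (\<integral>\<^sup>+y. ennreal (norm (f (x - y)) powr p) \<partial>lborel) + ennreal (C powr q) * (\<integral>\<^sup>+y. ennreal (box_decay (y::'a) powr q) \<partial>lborel)"
    by (simp add: nn_integral_add nn_integral_cmult)
  also have "(\<integral>\<^sup>+y. ennreal (norm (f (x - y)) powr p) \<partial>lborel) = lp_int p f"
    unfolding lp_int_def by (rule nn_integral_lborel_reflect) measurable
  also have "\<dots> + ennreal (C powr q) * (\<integral>\<^sup>+y. ennreal (box_decay (y::'a) powr q) \<partial>lborel) < \<infinity>"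
    using fin box_decay_powr_finite[OF q(1), where 'a='a] by (simp add: ennreal_mult_less_top)
  finally show "(\<integral>\<^sup>+y. norm (k y * f (x - y)) \<partial>lborel) < \<infinity>" .
qed measurable

section \<open>The Hardy--Littlewood maximal inequality on the line\<close>

text \<open>Vitali covering: disjoint balls \<open>cball i (r i)\<close> whose fivefold enlargements
  cover \<open>S\<close>. An enlargement has length \<open>10 * r i\<close>, which is
  \<open>5 / l\<close> times \<open>2 * r i * l\<close> and hence at most \<open>5 / l\<close> times
  the mass of \<open>h\<close> on the ball. Finiteness of the integral bounds all radii, as the
  covering lemma requires.\<close>

lemma maximal_weak_type:
  fixes h :: "real \<Rightarrow> ennreal"
  assumes [measurable]: "h \<in> borel_measurable borel" "S \<in> sets borel" and l: "0 < l"
    and S: "\<And>x. x \<in> S \<Longrightarrow> \<exists>r>0. ennreal (2 * r * l) < (\<integral>\<^sup>+y. h y * indicator (cball x r) y \<partial>lborel)"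
  shows "emeasure lborel S \<le> ennreal (5 / l) * (\<integral>\<^sup>+y. h y \<partial>lborel)"
proof (cases "(\<integral>\<^sup>+y. h y \<partial>lborel) = \<infinity>")
  case True
  then show ?thesis using l by (simp add: ennreal_mult_top)
next
  case False
  then obtain I where I: "(\<integral>\<^sup>+y. h y \<partial>lborel) = ennreal I" "0 \<le> I"
    by (metis ennreal_cases infinity_ennreal_def)
  obtain r where r: "\<And>x. x \<in> S \<Longrightarrow> 0 < r x"
    "\<And>x. x \<in> S \<Longrightarrow> ennreal (2 * r x * l) < (\<integral>\<^sup>+y. h y * indicator (cball x (r x)) y \<partial>lborel)"
    using S by metis
  have rB: "0 < r x \<and> r x \<le> I / (2 * l)" if "x \<in> S" for x
  proof -
    have "(\<integral>\<^sup>+y. h y * indicator (cball x (r x)) y \<partial>lborel) \<le> ennreal I"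
      unfolding I(1)[symmetric] by (intro nn_integral_mono) (auto simp: indicator_def)
    then have "ennreal (2 * r x * l) < ennreal I" using r(2)[OF that] by (rule less_le_trans[rotated])
    then have "2 * r x * l < I" using r(1)[OF that] l I by (subst (asm) ennreal_less_iff) auto
    then show ?thesis using r(1)[OF that] l by (auto simp: field_simps)
  qed
  have "S \<subseteq> (\<Union>i\<in>S. cball i (r i))" using r(1) by (force intro: less_imp_le)
  then obtain C where C: "countable C" "C \<subseteq> S" "pairwise (\<lambda>i j. disjnt (cball i (r i)) (cball j (r j))) C"
     "S \<subseteq> (\<Union>i\<in>C. cball i (5 * r i))"
    using rB by (rule Vitali_covering_lemma_cballs[where a="\<lambda>x. x"])
  have "emeasure lborel S = (\<integral>\<^sup>+x. indicator S x \<partial>lborel)" by simp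
  also have "\<dots> \<le> (\<integral>\<^sup>+x. (\<integral>\<^sup>+i. indicator (cball i (5 * r i)) x \<partial>count_space C) \<partial>lborel)"
  proof (intro nn_integral_mono)
    fix x
    show "indicator S x \<le> (\<integral>\<^sup>+i. indicator (cball i (5 * r i)) x \<partial>count_space C)"
    proof (cases "x \<in> S")
      case True
      then obtain i where i: "i \<in> C" "x \<in> cball i (5 * r i)" using C(4) by auto
      have "1 = (\<integral>\<^sup>+j. indicator {i} j \<partial>count_space C)"
        using i by simp
      also have "\<dots> \<le> (\<integral>\<^sup>+i. indicator (cball i (5 * r i)) x \<partial>count_space C)"
        using i by (intro nn_integral_mono) (auto simp: indicator_def)
      finally show ?thesis using True by simp
    qed simp
  qed
  also have "\<dots> = (\<integral>\<^sup>+i. (\<integral>\<^sup>+x. indicator (cball i (5 * r i)) x \<partial>lborel) \<partial>count_space C)"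
    using C(1) by (intro nn_integral_count_space_nn_integral) (auto intro!: borel_measurable_indicator)
  also have "\<dots> \<le> (\<integral>\<^sup>+i. ennreal (5 / l) * emeasure (density lborel h) (cball i (r i)) \<partial>count_space C)"
  proof (intro nn_integral_mono)
    fix i assume "i \<in> space (count_space C)"
    then have i: "i \<in> S" using C by auto
    have "(\<integral>\<^sup>+x. indicator (cball i (5 * r i)) x \<partial>lborel) = ennreal (10 * r i)"
      using r(1)[OF i] by (simp add: cball_eq_atLeastAtMost)
    also have "\<dots> = ennreal (5 / l) * ennreal (2 * r i * l)"
      using l r(1)[OF i] by (subst ennreal_mult[symmetric]) auto
    also have "\<dots> \<le> ennreal (5 / l) * emeasure (density lborel h) (cball i (r i))"
      using r(2)[OF i] by (intro mult_left_mono) (auto simp: emeasure_density)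
    finally show "(\<integral>\<^sup>+x. indicator (cball i (5 * r i)) x \<partial>lborel) \<le> ennreal (5 / l) * emeasure (density lborel h) (cball i (r i))" .
  qed
  also have "\<dots> = ennreal (5 / l) * (\<integral>\<^sup>+i. emeasure (density lborel h) (cball i (r i)) \<partial>count_space C)"
    by (intro nn_integral_cmult) auto
  also have "(\<integral>\<^sup>+i. emeasure (density lborel h) (cball i (r i)) \<partial>count_space C) = emeasure (density lborel h) (\<Union>i\<in>C. cball i (r i))"
    using C by (intro emeasure_UN_countable[symmetric]) (auto simp: disjoint_family_on_def pairwise_def disjnt_def)
  also have "\<dots> \<le> emeasure (density lborel h) (space (density lborel h))" by (rule emeasure_space)
  also have "\<dots> = (\<integral>\<^sup>+y. h y \<partial>lborel)" by (simp add: emeasure_density)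
  finally show ?thesis by (simp add: mult_left_mono)
qed

lemma layer_cake_powr:
  assumes "0 \<le> t" "-1 < (a::real)"
  shows "(\<integral>\<^sup>+l. ennreal (l powr a) * indicator {0..t} l \<partial>lborel) = ennreal (t powr (a + 1) / (a + 1))"
proof -
  have "(\<integral>\<^sup>+l. ennreal (if l \<in> {0..t} then l powr a else 0) \<partial>lborel) = ennreal (t powr (a + 1) / (a + 1))"
  proof (rule nn_integral_has_integral_lborel)
    show "((\<lambda>l. if l \<in> {0..t} then l powr a else 0) has_integral (t powr (a + 1) / (a + 1))) UNIV"
      unfolding has_integral_restrict_UNIV using assms by (intro has_integral_powr_from_0) auto
  qed auto
  also have "(\<integral>\<^sup>+l. ennreal (if l \<in> {0..t} then l powr a else 0) \<partial>lborel) = (\<integral>\<^sup>+l. ennreal (l powr a) * indicator {0..t} l \<partial>lborel)"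
    by (intro nn_integral_cong) (auto simp: indicator_def)
  finally show ?thesis .
qed

text \<open>The Marcinkiewicz argument. The last hypothesis says, through levels, that
  \<open>T\<close> is at most the centred maximal function of \<open>h\<close>. At level
  \<open>l\<close> the part of \<open>h\<close> below \<open>l\<close> adds at most \<open>l\<close>
  to any average, so the rest must exceed \<open>l\<close>; integrating the weak bound over
  \<open>l\<close> produces the factor \<open>5 * p / (p - 1)\<close>.\<close>

lemma maximal_strong_type:
  fixes h T :: "real \<Rightarrow> real"
  assumes [measurable]: "h \<in> borel_measurable borel" "T \<in> borel_measurable borel"
    and nn: "\<And>x. 0 \<le> h x" "\<And>x. 0 \<le> T x" and p: "1 < p"
    and T: "\<And>x l. 0 < l \<Longrightarrow> l < T x \<Longrightarrow>
        \<exists>r>0. ennreal (2 * r * l) < (\<integral>\<^sup>+y. ennreal (h y) * indicator (cball x r) y \<partial>lborel)"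
  shows "lp_int p T \<le> ennreal (3 powr p * (5 * p / (p - 1))) * lp_int p h"
proof -
  have level: "emeasure lborel {x. 3 * l \<le> T x} \<le> ennreal (5 / l) * (\<integral>\<^sup>+y. ennreal (h y) * indicator {y. l < h y} y \<partial>lborel)"
    if l: "0 < l" for l
  proof (rule maximal_weak_type)
    fix x assume "x \<in> {x. 3 * l \<le> T x}"
    \<comment> \<open>The level \<open>3 * l\<close> rather than \<open>2 * l\<close> yields the
      strict inequality that the hypothesis on \<open>T\<close> demands.\<close>
    then have "2 * l < T x" "0 < 2 * l" using l by auto
    then obtain r where r: "r > 0" "ennreal (2 * r * (2 * l)) < (\<integral>\<^sup>+y. ennreal (h y) * indicator (cball x r) y \<partial>lborel)"
      using T by blast
    have "(\<integral>\<^sup>+y. ennreal (h y) * indicator (cball x r) y \<partial>lborel)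
      \<le> (\<integral>\<^sup>+y. (ennreal (h y) * indicator {y. l < h y} y) * indicator (cball x r) y + ennreal l * indicator (cball x r) y \<partial>lborel)"
      by (intro nn_integral_mono) (auto simp: indicator_def intro!: ennreal_leI)
    also have "\<dots> = (\<integral>\<^sup>+y. (ennreal (h y) * indicator {y. l < h y} y) * indicator (cball x r) y \<partial>lborel) + ennreal (2 * r * l)"
      using r l by (subst nn_integral_add) (auto simp: nn_integral_cmult_indicator cball_eq_atLeastAtMost ennreal_mult[symmetric] mult_ac)
    finally have "ennreal (2 * r * (2 * l)) < (\<integral>\<^sup>+y. (ennreal (h y) * indicator {y. l < h y} y) * indicator (cball x r) y \<partial>lborel) + ennreal (2 * r * l)"
      using r(2) by (rule less_le_trans[rotated])
    moreover have "ennreal (2 * r * (2 * l)) = ennreal (2 * r * l) + ennreal (2 * r * l)"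
      using r l by (subst ennreal_plus[symmetric]) (auto simp: algebra_simps)
    ultimately have "ennreal (2 * r * l) < (\<integral>\<^sup>+y. (ennreal (h y) * indicator {y. l < h y} y) * indicator (cball x r) y \<partial>lborel)"
      by (metis add_right_mono not_less)
    then show "\<exists>r>0. ennreal (2 * r * l) < (\<integral>\<^sup>+y. (ennreal (h y) * indicator {y. l < h y} y) * indicator (cball x r) y \<partial>lborel)"
      using r by blast
  qed (use l in \<open>measurable; simp\<close>)+
  have p1: "-1 < p - 1" "-1 < p - 2" using p by auto
  have "lp_int p (\<lambda>x. T x / 3) = (\<integral>\<^sup>+x. (\<integral>\<^sup>+l. ennreal p * (ennreal (l powr (p - 1)) * indicator {0..T x / 3} l) \<partial>lborel) \<partial>lborel)"
    unfolding lp_int_def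
  proof (intro nn_integral_cong)
    fix x
    show "ennreal (norm (T x / 3) powr p) = (\<integral>\<^sup>+l. ennreal p * (ennreal (l powr (p - 1)) * indicator {0..T x / 3} l) \<partial>lborel)"
      using nn[of x] p p1 by (subst nn_integral_cmult, simp, subst layer_cake_powr) (auto simp: ennreal_mult[symmetric])
  qed
  also have "\<dots> = (\<integral>\<^sup>+l. (\<integral>\<^sup>+x. ennreal p * (ennreal (l powr (p - 1)) * indicator {0..T x / 3} l) \<partial>lborel) \<partial>lborel)"
    by (rule lborel_pair.Fubini') (simp add: indicator_def[abs_def] split_beta' cong: if_cong)
  also have "\<dots> \<le> (\<integral>\<^sup>+l. (\<integral>\<^sup>+x. ennreal (5 * p) * (ennreal (h x) * (ennreal (l powr (p - 2)) * indicator {0..h x} l)) \<partial>lborel) \<partial>lborel)"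
  proof (rule nn_integral_mono)
    fix l :: real
    show "(\<integral>\<^sup>+x. ennreal p * (ennreal (l powr (p - 1)) * indicator {0..T x / 3} l) \<partial>lborel) \<le>
      (\<integral>\<^sup>+x. ennreal (5 * p) * (ennreal (h x) * (ennreal (l powr (p - 2)) * indicator {0..h x} l)) \<partial>lborel)"
    proof (cases "0 < l")
      case True
      have "(\<integral>\<^sup>+x. ennreal p * (ennreal (l powr (p - 1)) * indicator {0..T x / 3} l) \<partial>lborel) =
         (\<integral>\<^sup>+x. ennreal (p * l powr (p - 1)) * indicator {x. 3 * l \<le> T x} x \<partial>lborel)"
        using True p by (intro nn_integral_cong) (auto simp: indicator_def ennreal_mult)
      also have "\<dots> = ennreal (p * l powr (p - 1)) * emeasure lborel {x. 3 * l \<le> T x}"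
        by (intro nn_integral_cmult_indicator) measurable
      also have "\<dots> \<le> ennreal (p * l powr (p - 1)) * (ennreal (5 / l) * (\<integral>\<^sup>+y. ennreal (h y) * indicator {y. l < h y} y \<partial>lborel))"
        by (intro mult_left_mono level True) auto
      also have "\<dots> = ennreal (5 * p * l powr (p - 2)) * (\<integral>\<^sup>+y. ennreal (h y) * indicator {y. l < h y} y \<partial>lborel)"
        using True p by (subst mult.assoc[symmetric], subst ennreal_mult[symmetric]) (auto simp: powr_diff power2_eq_square field_simps)
      also have "\<dots> = (\<integral>\<^sup>+y. ennreal (5 * p * l powr (p - 2)) * (ennreal (h y) * indicator {y. l < h y} y) \<partial>lborel)"
        by (intro nn_integral_cmult[symmetric]) measurable
      also have "\<dots> \<le> (\<integral>\<^sup>+x. ennreal (5 * p) * (ennreal (h x) * (ennreal (l powr (p - 2)) * indicator {0..h x} l)) \<partial>lborel)"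
        using True p nn by (intro nn_integral_mono) (auto simp: indicator_def ennreal_mult[symmetric] mult_ac)
      finally show ?thesis .
    next
      case False
      then have "ennreal p * (ennreal (l powr (p - 1)) * indicator {0..T x / 3} l) = 0" for x
        by (cases "l = 0") (auto simp: indicator_def)
      then have "(\<integral>\<^sup>+x. ennreal p * (ennreal (l powr (p - 1)) * indicator {0..T x / 3} l) \<partial>lborel) = (\<integral>\<^sup>+(x::real). 0 \<partial>lborel)"
        by (intro nn_integral_cong)
      then show ?thesis by simp
    qed
  qed
  also have "\<dots> = (\<integral>\<^sup>+x. (\<integral>\<^sup>+l. ennreal (5 * p) * (ennreal (h x) * (ennreal (l powr (p - 2)) * indicator {0..h x} l)) \<partial>lborel) \<partial>lborel)"
    by (rule lborel_pair.Fubini') (simp add: indicator_def[abs_def] split_beta' cong: if_cong)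
  also have "\<dots> = (\<integral>\<^sup>+x. ennreal (5 * p / (p - 1)) * ennreal (norm (h x) powr p) \<partial>lborel)"
  proof (intro nn_integral_cong)
    fix x
    have "h x * (h x powr (p - 1)) = h x powr p" using nn[of x] p by (cases "h x = 0") (auto simp: powr_diff)
    moreover have "(\<integral>\<^sup>+l. ennreal (5 * p) * (ennreal (h x) * (ennreal (l powr (p - 2)) * indicator {0..h x} l)) \<partial>lborel)
       = ennreal (5 * p) * (ennreal (h x) * ennreal (h x powr (p - 1) / (p - 1)))"
      using nn[of x] layer_cake_powr[OF nn(1)[of x] p1(2)] by (simp add: nn_integral_cmult)
    ultimately show "(\<integral>\<^sup>+l. ennreal (5 * p) * (ennreal (h x) * (ennreal (l powr (p - 2)) * indicator {0..h x} l)) \<partial>lborel) =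
        ennreal (5 * p / (p - 1)) * ennreal (norm (h x) powr p)"
      using nn[of x] p by (simp add: ennreal_mult[symmetric])
  qed
  also have "\<dots> = ennreal (5 * p / (p - 1)) * lp_int p h"
    unfolding lp_int_def by (intro nn_integral_cmult) measurable
  finally have *: "lp_int p (\<lambda>x. T x / 3) \<le> ennreal (5 * p / (p - 1)) * lp_int p h" .
  have "lp_int p T = lp_int p (\<lambda>x. 3 *\<^sub>R (T x / 3))" by simp
  also have "\<dots> = ennreal (\<bar>3\<bar> powr p) * lp_int p (\<lambda>x. T x / 3)"
    by (rule lp_int_scale) measurable
  also have "\<dots> \<le> ennreal (3 powr p) * (ennreal (5 * p / (p - 1)) * lp_int p h)"
    using * by (intro mult_mono) auto
  finally show ?thesis using p by (subst ennreal_mult) (auto simp: mult.assoc)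
qed

section \<open>Poisson and conjugate Poisson kernels\<close>

text \<open>Poisson kernel, conjugate Poisson kernel and truncated Hilbert kernel, with the
  convolutions \<open>pc\<close>, \<open>qc\<close> and \<open>trH\<close>. The full Hilbert kernel
  is \<open>hk 0\<close>, which is 0 at the origin.\<close>

definition pk :: "real \<Rightarrow> real \<Rightarrow> real" where "pk d t = d / (pi * (t\<^sup>2 + d\<^sup>2))"
definition qk :: "real \<Rightarrow> real \<Rightarrow> real" where "qk d t = t / (pi * (t\<^sup>2 + d\<^sup>2))"
definition hk :: "real \<Rightarrow> real \<Rightarrow> real" where "hk e t = (if e < \<bar>t\<bar> then 1 / (pi * t) else 0)"

definition pc :: "real \<Rightarrow> (real \<Rightarrow> real) \<Rightarrow> real \<Rightarrow> real" where "pc d g x = (LINT t|lborel. pk d t * g (x - t))"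
definition qc :: "real \<Rightarrow> (real \<Rightarrow> real) \<Rightarrow> real \<Rightarrow> real" where "qc d g x = (LINT t|lborel. qk d t * g (x - t))"
definition trH :: "real \<Rightarrow> (real \<Rightarrow> real) \<Rightarrow> real \<Rightarrow> real" where "trH e g x = (LINT t|lborel. hk e t * g (x - t))"

lemma kernel_measurable [measurable]:
  "pk d \<in> borel_measurable borel" "qk d \<in> borel_measurable borel" "hk d \<in> borel_measurable borel"
  unfolding pk_def[abs_def] qk_def[abs_def] hk_def[abs_def] by measurable

lemma conv_measurable [measurable]:
  assumes [measurable]: "g \<in> borel_measurable borel"
  shows "pc d g \<in> borel_measurable borel" "qc d g \<in> borel_measurable borel" "trH d g \<in> borel_measurable borel"
  unfolding pc_def[abs_def] qc_def[abs_def] trH_def[abs_def] by measurable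

lemma pk_pos: "0 < d \<Longrightarrow> 0 < pk d t"
  unfolding pk_def by (intro divide_pos_pos mult_pos_pos add_nonneg_pos) auto

lemma pk_decay: assumes "0 < d" shows "\<bar>pk d t\<bar> \<le> ((1/d + 1/2) / pi) * box_decay t"
proof -
  have pos: "0 < t\<^sup>2 + d\<^sup>2" using assms by (intro add_nonneg_pos) auto
  have "d * d \<le> t\<^sup>2 + d\<^sup>2" by (simp add: power2_eq_square)
  then have 1: "d \<le> (t\<^sup>2 + d\<^sup>2) / d" using assms by (simp add: field_simps)
  have "0 \<le> (d - \<bar>t\<bar>)\<^sup>2" by simp
  then have 2: "d * \<bar>t\<bar> \<le> (t\<^sup>2 + d\<^sup>2) / 2" by (simp add: power2_eq_square algebra_simps)
  have "(1/d + 1/2) * (t\<^sup>2 + d\<^sup>2) = (t\<^sup>2 + d\<^sup>2) / d + (t\<^sup>2 + d\<^sup>2) / 2" by (simp only: distrib_right) simp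
  moreover have "d * (1 + \<bar>t\<bar>) = d + d * \<bar>t\<bar>" by (simp add: distrib_left)
  ultimately have "d * (1 + \<bar>t\<bar>) \<le> (1/d + 1/2) * (t\<^sup>2 + d\<^sup>2)" using 1 2 by linarith
  then have "d / (t\<^sup>2 + d\<^sup>2) \<le> (1/d + 1/2) / (1 + \<bar>t\<bar>)"
    using pos by (simp add: pos_divide_le_eq pos_le_divide_eq add_pos_nonneg mult.commute)
  then have "d / (t\<^sup>2 + d\<^sup>2) / pi \<le> (1/d + 1/2) / (1 + \<bar>t\<bar>) / pi" by (intro divide_right_mono) auto
  then show ?thesis using pk_pos[OF assms, of t] by (simp add: pk_def box_decay_real mult.commute)
qed

lemma qk_decay: assumes "0 < d" shows "\<bar>qk d t\<bar> \<le> ((1/(2*d) + 1) / pi) * box_decay t"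
proof -
  have pos: "0 < t\<^sup>2 + d\<^sup>2" using assms by (intro add_nonneg_pos) auto
  have "0 \<le> (d - \<bar>t\<bar>)\<^sup>2" by simp
  then have "d * \<bar>t\<bar> \<le> (t\<^sup>2 + d\<^sup>2) / 2" by (simp add: power2_eq_square algebra_simps)
  then have 1: "\<bar>t\<bar> \<le> (t\<^sup>2 + d\<^sup>2) / (2 * d)" using assms by (simp add: field_simps)
  have 2: "\<bar>t\<bar> * \<bar>t\<bar> \<le> t\<^sup>2 + d\<^sup>2" by (simp add: power2_eq_square)
  have "(1/(2*d) + 1) * (t\<^sup>2 + d\<^sup>2) = (t\<^sup>2 + d\<^sup>2) / (2*d) + (t\<^sup>2 + d\<^sup>2)" by (simp only: distrib_right) simp
  moreover have "\<bar>t\<bar> * (1 + \<bar>t\<bar>) = \<bar>t\<bar> + \<bar>t\<bar> * \<bar>t\<bar>" by (simp add: distrib_left)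
  ultimately have "\<bar>t\<bar> * (1 + \<bar>t\<bar>) \<le> (1/(2*d) + 1) * (t\<^sup>2 + d\<^sup>2)" using 1 2 by linarith
  then have "\<bar>t\<bar> / (t\<^sup>2 + d\<^sup>2) \<le> (1/(2*d) + 1) / (1 + \<bar>t\<bar>)"
    using pos by (simp add: pos_divide_le_eq pos_le_divide_eq add_pos_nonneg mult.commute)
  then have "\<bar>t\<bar> / (t\<^sup>2 + d\<^sup>2) / pi \<le> (1/(2*d) + 1) / (1 + \<bar>t\<bar>) / pi" by (intro divide_right_mono) auto
  then show ?thesis using pos by (simp add: qk_def box_decay_real abs_mult mult.commute)
qed

lemma hk_decay: assumes "0 < e" shows "\<bar>hk e t\<bar> \<le> ((1/e + 1) / pi) * box_decay t"
proof (cases "e < \<bar>t\<bar>")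
  case True
  have "1 + \<bar>t\<bar> \<le> (1/e + 1) * \<bar>t\<bar>" using True assms by (simp add: field_simps)
  then have "1 / \<bar>t\<bar> \<le> (1/e + 1) / (1 + \<bar>t\<bar>)"
    using True assms by (simp add: pos_divide_le_eq pos_le_divide_eq add_pos_nonneg mult.commute)
  then have "1 / \<bar>t\<bar> / pi \<le> (1/e + 1) / (1 + \<bar>t\<bar>) / pi" by (intro divide_right_mono) auto
  then show ?thesis using True by (simp add: hk_def box_decay_real abs_mult mult.commute)
next
  case False
  then show ?thesis using assms box_decay_pos[of t] by (simp add: hk_def)
qed

text \<open>Height and truncation level agree. Beyond \<open>e\<close> the difference is
  \<open>e / t\<close> times \<open>pk e t\<close>; within \<open>e\<close> only
  \<open>qk e t\<close> is left, and there \<open>\<bar>t\<bar> \<le> e\<close>.\<close>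

lemma kernel_diff_le: assumes "0 < e" shows "\<bar>hk e t - qk e t\<bar> \<le> pk e t"
proof -
  have pos: "0 < t\<^sup>2 + e\<^sup>2" using assms by (intro add_nonneg_pos) auto
  show ?thesis
  proof (cases "e < \<bar>t\<bar>")
    case True
    then have t: "t \<noteq> 0" using assms by auto
    define s where "s = t\<^sup>2 + e\<^sup>2"
    have s: "s \<noteq> 0" using pos unfolding s_def by linarith
    have "1 / (pi * t) - t / (pi * s) = (s - t\<^sup>2) / (pi * t * s)"
      using t s by (simp add: field_simps power2_eq_square)
    also have "\<dots> = (e / t) * (e / (pi * s))" by (simp add: s_def power2_eq_square)
    finally have "hk e t - qk e t = (e / t) * pk e t"
      using True by (simp add: hk_def qk_def pk_def s_def)
    moreover have "\<bar>e / t\<bar> \<le> 1" using True assms by simp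
    moreover have "\<bar>(e / t) * pk e t\<bar> = \<bar>e / t\<bar> * pk e t"
      using pk_pos[OF assms, of t] by (simp only: abs_mult[of "e/t" "pk e t"])
    moreover have "\<bar>e / t\<bar> * pk e t \<le> 1 * pk e t"
      using pk_pos[OF assms, of t] \<open>\<bar>e / t\<bar> \<le> 1\<close> by (intro mult_right_mono) auto
    ultimately show ?thesis by (simp only: mult_1_left)
  next
    case False
    then have "\<bar>t\<bar> / (pi * (t\<^sup>2 + e\<^sup>2)) \<le> e / (pi * (t\<^sup>2 + e\<^sup>2))" using pos by (intro divide_right_mono) auto
    then show ?thesis using False pos by (simp add: hk_def qk_def pk_def abs_mult)
  qed
qed

lemma kernel_integrable:
  assumes "g \<in> borel_measurable borel" "1 < p" "lp_int p g < \<infinity>" "0 < d"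
  shows "integrable lborel (\<lambda>t. pk d t * g (x - t))" "integrable lborel (\<lambda>t. qk d t * g (x - t))"
    "integrable lborel (\<lambda>t. hk d t * g (x - t))"
proof -
  note k = lp_kernel_integrable[OF assms(1) _ assms(2,3)]
  show "integrable lborel (\<lambda>t. pk d t * g (x - t))"
    by (rule k[OF _ pk_decay[OF assms(4)]]) simp
  show "integrable lborel (\<lambda>t. qk d t * g (x - t))"
    by (rule k[OF _ qk_decay[OF assms(4)]]) simp
  show "integrable lborel (\<lambda>t. hk d t * g (x - t))"
    by (rule k[OF _ hk_decay[OF assms(4)]]) simp
qed

lemma FTC_line:
  fixes F f :: "real \<Rightarrow> 'a::euclidean_space"
  assumes "\<And>x. (F has_vector_derivative f x) (at x)" "\<And>x. isCont f x" "integrable lborel f"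
    "(F \<longlongrightarrow> A) at_bot" "(F \<longlongrightarrow> B) at_top"
  shows "(LINT x|lborel. f x) = B - A"
proof -
  have "(LBINT x=-\<infinity>..\<infinity>. f x) = B - A"
    using assms by (intro interval_integral_FTC_integrable[where F=F])
      (auto simp: set_integrable_def ereal_tendsto_simps)
  then show ?thesis by (simp add: interval_lebesgue_integral_def set_lebesgue_integral_def)
qed

lemma pk_integral:
  assumes d: "0 < d"
  shows "integrable lborel (pk d)" "(LINT t|lborel. pk d t) = 1"
proof -
  have pos: "0 < t\<^sup>2 + d\<^sup>2" for t using d by (intro add_nonneg_pos) auto
  have D: "((\<lambda>t. arctan (t / d) / pi) has_real_derivative pk d x) (at x)" for x
  proof -
    have "((\<lambda>t. arctan (t / d) / pi) has_real_derivative inverse (1 + (x / d)\<^sup>2) * (1 / d) / pi) (at x)"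
      by (intro DERIV_cdivide DERIV_chain'[OF _ DERIV_arctan] DERIV_ident)
    also have "inverse (1 + (x / d)\<^sup>2) * (1 / d) / pi = pk d x"
      using d pos[of x] by (simp add: pk_def field_simps power2_eq_square)
    finally show ?thesis .
  qed
  have C: "isCont (pk d) x" for x
    unfolding pk_def[abs_def] using pos[of x] by (intro continuous_intros) auto
  have L: "((\<lambda>t. arctan (t / d) / pi) \<longlongrightarrow> - (1/2)) at_bot" "((\<lambda>t. arctan (t / d) / pi) \<longlongrightarrow> 1/2) at_top"
    using d by (real_asymp simp: )+
  have *: "(LBINT x=-\<infinity>..\<infinity>. pk d x) = 1/2 - (-(1/2))" "set_integrable lborel (einterval (-\<infinity>) \<infinity>) (pk d)"
    using interval_integral_FTC_nonneg[of "-\<infinity>" \<infinity> "\<lambda>t. arctan (t / d) / pi" "pk d" "-(1/2)" "1/2"] D C L less_imp_le[OF pk_pos[OF d]]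
    by (auto simp: ereal_tendsto_simps)
  show "integrable lborel (pk d)" using *(2) by (simp add: set_integrable_def)
  show "(LINT t|lborel. pk d t) = 1" using *(1) by (simp add: interval_lebesgue_integral_def set_lebesgue_integral_def)
qed

text \<open>Jensen for the probability density \<open>pk d\<close>, then Tonelli and translation
  invariance.\<close>

lemma pc_contraction:
  assumes [measurable]: "g \<in> borel_measurable borel" and p: "1 < p" and fin: "lp_int p g < \<infinity>" and d: "0 < d"
  shows "lp_int p (pc d g) \<le> lp_int p g"
proof -
  have [measurable]: "(\<lambda>x. \<bar>g x\<bar>) \<in> borel_measurable borel" by measurable
  have fin': "lp_int p (\<lambda>x. \<bar>g x\<bar>) < \<infinity>" using fin by (simp add: lp_int_def)
  have "lp_int p (pc d g) \<le> (\<integral>\<^sup>+x. (\<integral>\<^sup>+t. ennreal (pk d t * \<bar>g (x - t)\<bar> powr p) \<partial>lborel) \<partial>lborel)"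
    unfolding lp_int_def
  proof (rule nn_integral_mono)
    fix x
    have "norm (pc d g x) \<le> (LINT t|lborel. \<bar>pk d t * g (x - t)\<bar>)"
      unfolding pc_def using integral_norm_bound[of lborel "\<lambda>t. pk d t * g (x - t)"] by simp
    also have "\<dots> = (LINT t|lborel. pk d t * \<bar>g (x - t)\<bar>)"
      using pk_pos[OF d] by (simp add: abs_mult less_imp_le)
    finally have "norm (pc d g x) powr p \<le> (LINT t|lborel. pk d t * \<bar>g (x - t)\<bar>) powr p"
      using p by (intro powr_mono2) auto
    then have "ennreal (norm (pc d g x) powr p) \<le> ennreal ((LINT t|lborel. pk d t * \<bar>g (x - t)\<bar>) powr p)" by (rule ennreal_leI)
    also have "\<dots> \<le> (\<integral>\<^sup>+t. ennreal (pk d t * \<bar>g (x - t)\<bar> powr p) \<partial>lborel)"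
      using pk_integral[OF d] p pk_pos[OF d] kernel_integrable(1)[OF _ p fin' d]
      by (intro jensen_powr) (auto intro: less_imp_le)
    finally show "ennreal (norm (pc d g x) powr p) \<le> (\<integral>\<^sup>+t. ennreal (pk d t * \<bar>g (x - t)\<bar> powr p) \<partial>lborel)" .
  qed
  also have "\<dots> = (\<integral>\<^sup>+t. (\<integral>\<^sup>+x. ennreal (pk d t * \<bar>g (x - t)\<bar> powr p) \<partial>lborel) \<partial>lborel)"
    by (rule lborel_pair.Fubini') measurable
  also have "\<dots> = (\<integral>\<^sup>+t. ennreal (pk d t) * lp_int p g \<partial>lborel)"
  proof (rule nn_integral_cong)
    fix t
    have "(\<integral>\<^sup>+x. ennreal (pk d t * \<bar>g (x - t)\<bar> powr p) \<partial>lborel) = ennreal (pk d t) * (\<integral>\<^sup>+x. ennreal (\<bar>g (x - t)\<bar> powr p) \<partial>lborel)"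
      using pk_pos[OF d, of t] by (simp add: ennreal_mult nn_integral_cmult)
    also have "(\<integral>\<^sup>+x. ennreal (\<bar>g (x - t)\<bar> powr p) \<partial>lborel) = lp_int p g"
      unfolding lp_int_def using nn_integral_lborel_translate[of "\<lambda>x. ennreal (\<bar>g x\<bar> powr p)" "-t"] by simp
    finally show "(\<integral>\<^sup>+x. ennreal (pk d t * \<bar>g (x - t)\<bar> powr p) \<partial>lborel) = ennreal (pk d t) * lp_int p g" .
  qed
  also have "\<dots> = ennreal (LINT t|lborel. pk d t) * lp_int p g"
    using pk_integral[OF d] pk_pos[OF d] by (simp add: nn_integral_multc nn_integral_eq_integral less_imp_le)
  finally show ?thesis using pk_integral[OF d] by simp
qed

text \<open>Let \<open>k\<close> be least with \<open>\<bar>s\<bar> \<le> 2^k * d\<close>. For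
  positive \<open>k\<close>, minimality gives \<open>2^(k-1) * d < \<bar>s\<bar>\<close>, so the
  kernel is at most \<open>4 / (pi * d) * (1/4)^k\<close>; this single term of the series is
  enough.\<close>

lemma pk_le_dyadic:
  assumes d: "0 < d"
  shows "ennreal (pk d s) \<le> (\<Sum>k. ennreal (4 / (pi * d) * (1/4)^k) * indicator {s. \<bar>s\<bar> \<le> 2^k * d} s)"
proof -
  have ex: "\<exists>k. \<bar>s\<bar> \<le> 2^k * d"
  proof -
    obtain k where "\<bar>s\<bar> / d < 2 ^ k" using real_arch_pow[of 2 "\<bar>s\<bar> / d"] by auto
    then show ?thesis using d by (intro exI[of _ k]) (simp add: field_simps)
  qed
  define k where "k = (LEAST k. \<bar>s\<bar> \<le> 2^k * d)"
  have k: "\<bar>s\<bar> \<le> 2^k * d" unfolding k_def using ex by (rule LeastI_ex)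
  have pos: "0 < s\<^sup>2 + d\<^sup>2" using d by (intro add_nonneg_pos) auto
  have "pk d s \<le> 4 / (pi * d) * (1/4)^k"
  proof (cases k)
    case 0
    have "pk d s \<le> d / (pi * d\<^sup>2)" unfolding pk_def using d pos by (intro divide_left_mono mult_left_mono mult_pos_pos) auto
    also have "\<dots> \<le> 4 / (pi * d)" using d by (simp add: power2_eq_square divide_right_mono)
    finally show ?thesis using 0 by simp
  next
    case (Suc m)
    have "\<not> \<bar>s\<bar> \<le> 2^m * d" using not_less_Least[of m "\<lambda>k. \<bar>s\<bar> \<le> 2^k * d"] Suc by (simp add: k_def)
    then have "(2^m * d)\<^sup>2 \<le> \<bar>s\<bar>\<^sup>2" using d by (intro power_mono) auto
    then have "4^m * d\<^sup>2 \<le> s\<^sup>2"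
      by (simp add: power_mult_distrib power_mult[symmetric] mult.commute[of m] power_mult)
    then have "4^m * d\<^sup>2 \<le> s\<^sup>2 + d\<^sup>2" by (smt (verit) zero_le_power2)
    then have "pk d s \<le> d / (pi * (4^m * d\<^sup>2))" unfolding pk_def using d pos by (intro divide_left_mono mult_left_mono mult_pos_pos) auto
    also have "\<dots> = 4 / (pi * d) * (1/4)^k" using d Suc by (simp add: power2_eq_square power_divide field_simps)
    finally show ?thesis .
  qed
  define f where "f j = ennreal (4 / (pi * d) * (1/4)^j) * indicator {s. \<bar>s\<bar> \<le> 2^j * d} s" for j
  have "ennreal (pk d s) \<le> f k"
    using k \<open>pk d s \<le> _\<close> by (simp add: f_def ennreal_leI)
  also have "\<dots> = (\<Sum>j\<in>{k}. f j)" by simp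
  also have "\<dots> \<le> (\<Sum>j. f j)" by (intro sum_le_suminf) auto
  finally show ?thesis by (simp only: f_def)
qed

text \<open>The interval of radius \<open>2^k * d\<close> enters with weight
  \<open>4 / (pi * d) * (1/4)^k\<close> and mass at most \<open>2 * 2^k * d * m\<close>. The
  products form a geometric series of ratio 1/2 with sum \<open>16 * m / pi\<close>.\<close>

lemma poisson_le_average:
  fixes h :: "real \<Rightarrow> ennreal"
  assumes [measurable]: "h \<in> borel_measurable borel" and d: "0 < d" and m: "0 \<le> m"
    and av: "\<And>r. 0 < r \<Longrightarrow> (\<integral>\<^sup>+y. h y * indicator (cball x r) y \<partial>lborel) \<le> ennreal (2 * r * m)"
  shows "(\<integral>\<^sup>+t. ennreal (pk d t) * h (x - t) \<partial>lborel) \<le> ennreal (6 * m)"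
proof -
  have "(\<integral>\<^sup>+t. ennreal (pk d t) * h (x - t) \<partial>lborel) \<le>
    (\<integral>\<^sup>+t. (\<Sum>k. ennreal (4 / (pi * d) * (1/4)^k) * (h (x - t) * indicator {s. \<bar>s\<bar> \<le> 2^k * d} t)) \<partial>lborel)"
  proof (rule nn_integral_mono)
    fix t
    have "ennreal (pk d t) * h (x - t) \<le> (\<Sum>k. ennreal (4 / (pi * d) * (1/4)^k) * indicator {s. \<bar>s\<bar> \<le> 2^k * d} t) * h (x - t)"
      by (intro mult_right_mono pk_le_dyadic d) auto
    also have "\<dots> = (\<Sum>k. ennreal (4 / (pi * d) * (1/4)^k) * indicator {s. \<bar>s\<bar> \<le> 2^k * d} t * h (x - t))"
      by (rule ennreal_suminf_multc[symmetric])
    finally show "ennreal (pk d t) * h (x - t) \<le> (\<Sum>k. ennreal (4 / (pi * d) * (1/4)^k) * (h (x - t) * indicator {s. \<bar>s\<bar> \<le> 2^k * d} t))"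
      by (simp add: mult_ac)
  qed
  also have "\<dots> = (\<Sum>k. (\<integral>\<^sup>+t. ennreal (4 / (pi * d) * (1/4)^k) * (h (x - t) * indicator {s. \<bar>s\<bar> \<le> 2^k * d} t) \<partial>lborel))"
    by (rule nn_integral_suminf) measurable
  also have "\<dots> \<le> (\<Sum>k. ennreal (8 * m / pi * (1/2)^k))"
  proof (rule suminf_le)
    fix k :: nat
    have [measurable]: "cball x (2^k * d) \<in> sets borel" by (intro borel_closed closed_cball)
    have "(\<integral>\<^sup>+t. h (x - t) * indicator {s. \<bar>s\<bar> \<le> 2^k * d} t \<partial>lborel) =
      (\<integral>\<^sup>+t. (\<lambda>y. h y * indicator (cball x (2^k * d)) y) (x - t) \<partial>lborel)"
      by (intro nn_integral_cong) (auto simp: indicator_def dist_real_def)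
    also have "\<dots> = (\<integral>\<^sup>+y. h y * indicator (cball x (2^k * d)) y \<partial>lborel)"
      by (rule nn_integral_lborel_reflect) measurable
    also have "\<dots> \<le> ennreal (2 * (2^k * d) * m)" using d by (intro av) auto
    finally have *: "(\<integral>\<^sup>+t. h (x - t) * indicator {s. \<bar>s\<bar> \<le> 2^k * d} t \<partial>lborel) \<le> ennreal (2 * (2^k * d) * m)" .
    have "(\<integral>\<^sup>+t. ennreal (4 / (pi * d) * (1/4)^k) * (h (x - t) * indicator {s. \<bar>s\<bar> \<le> 2^k * d} t) \<partial>lborel)
      = ennreal (4 / (pi * d) * (1/4)^k) * (\<integral>\<^sup>+t. h (x - t) * indicator {s. \<bar>s\<bar> \<le> 2^k * d} t \<partial>lborel)"
      by (rule nn_integral_cmult) measurable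
    also have "\<dots> \<le> ennreal (4 / (pi * d) * (1/4)^k) * ennreal (2 * (2^k * d) * m)"
      by (intro mult_left_mono *) auto
    also have "\<dots> = ennreal (4 / (pi * d) * (1/4)^k * (2 * (2^k * d) * m))"
      using d m by (intro ennreal_mult[symmetric]) auto
    also have "4 / (pi * d) * (1/4)^k * (2 * (2^k * d) * m) = 8 * m / pi * ((1/4)^k * 2^k)"
      using d by (simp add: field_simps)
    also have "(1/4::real)^k * 2^k = (1/2)^k" by (simp add: power_mult_distrib[symmetric])
    finally show "(\<integral>\<^sup>+t. ennreal (4 / (pi * d) * (1/4)^k) * (h (x - t) * indicator {s. \<bar>s\<bar> \<le> 2^k * d} t) \<partial>lborel)
      \<le> ennreal (8 * m / pi * (1/2)^k)" .
  qed auto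
  also have "\<dots> = ennreal (\<Sum>k. 8 * m / pi * (1/2)^k)"
    using m by (intro suminf_ennreal2) (auto intro!: summable_mult summable_geometric)
  also have "(\<Sum>k. 8 * m / pi * (1/2)^k) = 8 * m / pi * 2"
    by (subst suminf_mult) (auto intro!: summable_geometric simp: suminf_geometric)
  \<comment> \<open>Only \<open>3 < pi\<close> is used: 16/3 is below 6.\<close>
  also have "8 * m / pi * 2 \<le> 6 * m"
  proof -
    have "3 * m \<le> pi * m" using m pi_gt3 by (intro mult_right_mono) auto
    then have "16 * m \<le> 6 * (pi * m)" using m by linarith
    then show ?thesis by (simp add: field_simps)
  qed
  finally show ?thesis by (simp add: ennreal_leI order_trans)
qed

text \<open>If no average of \<open>h1 + h2\<close> around \<open>x\<close> exceeded
  \<open>l\<close>, each Poisson integral would be at most \<open>6 * l\<close> and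
  \<open>T x\<close> at most \<open>12 * l\<close>. The heights may depend on \<open>x\<close>,
  which is what makes this a maximal inequality.\<close>

lemma poisson_maximal:
  fixes h1 h2 T :: "real \<Rightarrow> real"
  assumes [measurable]: "h1 \<in> borel_measurable borel" "h2 \<in> borel_measurable borel" "T \<in> borel_measurable borel"
    and nn: "\<And>x. 0 \<le> h1 x" "\<And>x. 0 \<le> h2 x" "\<And>x. 0 \<le> T x" and p: "1 < p"
    and fin: "lp_int p h1 < \<infinity>" "lp_int p h2 < \<infinity>"
    and T: "\<And>x. \<exists>d>0. \<exists>e>0. T x \<le> pc d h1 x + pc e h2 x"
  shows "lp_int p T \<le> ennreal (12 powr p * (3 powr p * (5 * p / (p - 1)))) * lp_int p (\<lambda>x. h1 x + h2 x)"
proof -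
  have pcn: "ennreal (pc d h x) = (\<integral>\<^sup>+t. ennreal (pk d t) * ennreal (h (x - t)) \<partial>lborel)"
    if [measurable]: "h \<in> borel_measurable borel" and "\<And>x. 0 \<le> h x" "lp_int p h < \<infinity>" "0 < d" for h d x
    unfolding pc_def using that pk_pos[OF \<open>0 < d\<close>] kernel_integrable(1)[of h p d x] p
    by (subst nn_integral_eq_integral[symmetric]) (auto simp: ennreal_mult less_imp_le)
  have "lp_int p (\<lambda>x. T x / 12) \<le> ennreal (3 powr p * (5 * p / (p - 1))) * lp_int p (\<lambda>x. h1 x + h2 x)"
  proof (rule maximal_strong_type)
    fix x l :: real assume l: "0 < l" "l < T x / 12"
    obtain d e where de: "0 < d" "0 < e" "T x \<le> pc d h1 x + pc e h2 x" using T by blast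
    show "\<exists>r>0. ennreal (2 * r * l) < (\<integral>\<^sup>+y. ennreal (h1 y + h2 y) * indicator (cball x r) y \<partial>lborel)"
    proof (rule ccontr)
      assume "\<not> ?thesis"
      then have *: "(\<integral>\<^sup>+y. ennreal (h1 y + h2 y) * indicator (cball x r) y \<partial>lborel) \<le> ennreal (2 * r * l)" if "0 < r" for r
        using that by (metis not_less)
      have av: "(\<integral>\<^sup>+y. ennreal (h y) * indicator (cball x r) y \<partial>lborel) \<le> ennreal (2 * r * l)"
        if "0 < r" and h: "\<And>y. h y \<le> h1 y + h2 y" for r and h :: "real \<Rightarrow> real"
      proof (rule order_trans[OF nn_integral_mono *[OF \<open>0 < r\<close>]])
        show "ennreal (h y) * indicator (cball x r) y \<le> ennreal (h1 y + h2 y) * indicator (cball x r) y" for y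
          using h[of y] by (intro mult_right_mono ennreal_leI) auto
      qed
      have "ennreal (pc d h1 x) \<le> ennreal (6 * l)"
        unfolding pcn[OF assms(1) nn(1) fin(1) de(1)]
        by (rule poisson_le_average[OF _ de(1)]) (use l nn in \<open>auto intro!: av\<close>)
      moreover have "ennreal (pc e h2 x) \<le> ennreal (6 * l)"
        unfolding pcn[OF assms(2) nn(2) fin(2) de(2)]
        by (rule poisson_le_average[OF _ de(2)]) (use l nn in \<open>auto intro!: av\<close>)
      ultimately have "pc d h1 x \<le> 6 * l" "pc e h2 x \<le> 6 * l" using l ennreal_le_iff[of "6 * l"] by auto
      then show False using l de by simp
    qed
  qed (use nn p in auto)
  then have "ennreal (\<bar>12\<bar> powr p) * lp_int p (\<lambda>x. T x / 12) \<le> ennreal (12 powr p) * (ennreal (3 powr p * (5 * p / (p - 1))) * lp_int p (\<lambda>x. h1 x + h2 x))"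
    by (intro mult_mono) auto
  also have "ennreal (\<bar>12\<bar> powr p) * lp_int p (\<lambda>x. T x / 12) = lp_int p (\<lambda>x. 12 *\<^sub>R (T x / 12))"
    by (rule lp_int_scale[symmetric]) measurable
  finally show ?thesis using p by (subst ennreal_mult) (auto simp: mult.assoc)
qed

section \<open>The semigroup identity for the conjugate Poisson kernel\<close>

lemma tendsto_Ln_one:
  assumes "filterlim f at_infinity F"
  shows "((\<lambda>t. Ln (1 + a / f t)) \<longlongrightarrow> 0) F"
proof -
  have "((\<lambda>t. 1 + a / f t) \<longlongrightarrow> 1 + 0) F"
    by (intro tendsto_add tendsto_const tendsto_divide_0[OF tendsto_const] assms)
  then have "((\<lambda>t. Ln (1 + a / f t)) \<longlongrightarrow> Ln (1 + 0)) F"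
    by (intro tendsto_Ln) auto
  then show ?thesis by simp
qed

text \<open>Subtracting \<open>ln \<bar>t\<bar>\<close> removes the growth and leaves the argument.
  As \<open>t\<close> tends to minus infinity, \<open>of_real t - a\<close> approaches the branch
  cut from the side opposite to that of \<open>a\<close>, which fixes the sign of the limit.\<close>

lemma Ln_shift_limits:
  assumes a: "Im a \<noteq> 0"
  shows "((\<lambda>t. Ln (of_real t - a) - of_real (ln \<bar>t\<bar>)) \<longlongrightarrow> 0) at_top"
    and "((\<lambda>t. Ln (of_real t - a) - of_real (ln \<bar>t\<bar>)) \<longlongrightarrow> - of_real (sgn (Im a) * pi) * \<i>) at_bot"
proof -
  have inf: "filterlim (of_real :: real \<Rightarrow> complex) at_infinity at_top" "filterlim (of_real :: real \<Rightarrow> complex) at_infinity at_bot"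
  proof -
    have "filterlim (\<lambda>t::real. \<bar>t\<bar>) at_top at_bot" by real_asymp
    then show "filterlim (of_real :: real \<Rightarrow> complex) at_infinity at_bot"
      by (intro filterlim_norm_at_top_imp_at_infinity) simp
  qed (rule filterlim_of_real_at_infinity)
  have ne: "1 + (-a) / of_real t \<noteq> 0" if "t \<noteq> 0" for t
  proof
    assume "1 + (-a) / of_real t = 0"
    then have "of_real t = a" using that by (simp add: field_simps)
    then show False using a by auto
  qed
  show "((\<lambda>t. Ln (of_real t - a) - of_real (ln \<bar>t\<bar>)) \<longlongrightarrow> 0) at_top"
  proof (rule Lim_transform_eventually[OF tendsto_Ln_one[OF inf(1), of "-a"]])
    show "eventually (\<lambda>t. Ln (1 + - a / of_real t) = Ln (of_real t - a) - of_real (ln \<bar>t\<bar>)) at_top"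
      using eventually_gt_at_top[of 0]
    proof eventually_elim
      case (elim t)
      have "of_real t - a = of_real t * (1 + (-a) / of_real t)" using elim by (simp add: field_simps)
      then show ?case using elim ne[of t] Ln_times_of_real[of t "1 + (-a) / of_real t"] by (simp add: Ln_of_real)
    qed
  qed
  show "((\<lambda>t. Ln (of_real t - a) - of_real (ln \<bar>t\<bar>)) \<longlongrightarrow> - of_real (sgn (Im a) * pi) * \<i>) at_bot"
  proof (rule Lim_transform_eventually)
    show "((\<lambda>t. Ln (1 + - a / of_real t) - of_real (sgn (Im a) * pi) * \<i>) \<longlongrightarrow> - of_real (sgn (Im a) * pi) * \<i>) at_bot"
      using tendsto_diff[OF tendsto_Ln_one[OF inf(2), of "-a"] tendsto_const[of "of_real (sgn (Im a) * pi) * \<i>"]] by simp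
    show "eventually (\<lambda>t. Ln (1 + - a / of_real t) - of_real (sgn (Im a) * pi) * \<i> = Ln (of_real t - a) - of_real (ln \<bar>t\<bar>)) at_bot"
      using eventually_gt_at_bot[of 0]
    proof eventually_elim
      case (elim t)
      define w where "w = 1 + (-a) / of_real t"
      have w: "w \<noteq> 0" using ne[of t] elim by (simp add: w_def)
      have Imw: "Im w = Im a / \<bar>t\<bar>" using elim by (simp add: w_def Im_divide_of_real)
      have *: "of_real t - a = of_real \<bar>t\<bar> * (- w)" using elim by (simp add: w_def field_simps)
      have h0: "0 < \<bar>t\<bar>" "- w \<noteq> 0" using elim w by auto
      have "Ln (of_real t - a) = of_real (ln \<bar>t\<bar>) + Ln (- w)"
        unfolding * using Ln_times_of_real[OF h0] Ln_of_real[OF h0(1)] by metis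
      moreover have "Ln (- w) = Ln w - of_real (sgn (Im a) * pi) * \<i>"
      proof (cases "0 < Im a")
        case True
        then have "0 < Im w" unfolding Imw using h0 by (intro divide_pos_pos)
        then show ?thesis using Ln_minus[OF w] True by (simp add: mult.commute)
      next
        case False
        then have "Im w < 0" unfolding Imw using h0 a by (intro divide_neg_pos) auto
        then show ?thesis using Ln_minus[OF w] False a by (simp add: sgn_if mult.commute)
      qed
      ultimately show ?case by (simp add: w_def)
    qed
  qed
qed

text \<open>Partial fractions take the place of residues: \<open>pk d\<close> has its poles at
  \<open>a\<close> and \<open>a'\<close>, plus and minus \<open>\<i> * d\<close>, and logarithms
  give a primitive on the whole line. The hypothesis \<open>Re b \<noteq> 0\<close> keeps
  \<open>b\<close> away from \<open>a\<close>.\<close>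

lemma pk_cauchy_integral:
  assumes d: "0 < d" and b: "0 < Im b" "Re b \<noteq> 0"
  shows "(LINT t|lborel. of_real (pk d t) * (1 / (of_real t - b))) = - 1 / (b + \<i> * of_real d)"
    and "integrable lborel (\<lambda>t. of_real (pk d t) * (1 / (of_real t - b)))"
proof -
  define a a' where "a = \<i> * of_real d" and "a' = - \<i> * of_real d"
  have Ima: "Im a = d" "Im a' = - d" by (auto simp: a_def a'_def)
  have nz: "of_real t - a \<noteq> 0" "of_real t - a' \<noteq> 0" "of_real t - b \<noteq> 0" for t :: real
    using d b Ima by (auto simp: complex_eq_iff)
  have ab: "a - b \<noteq> 0" "a' - b \<noteq> 0" using b by (auto simp: complex_eq_iff a_def a'_def)
  define L where "L c t = Ln (complex_of_real t - c)" for c t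
  define F where "F t = (1 / (2 * pi * \<i>)) * ((L a t - L b t) / (a - b) - (L a' t - L b t) / (a' - b))" for t
  have LD: "(L c has_vector_derivative 1 / (of_real t - c)) (at t)" if "Im c \<noteq> 0" for c t
  proof -
    have "of_real t - c \<notin> \<real>\<^sub>\<le>\<^sub>0" using that by (auto simp: complex_nonpos_Reals_iff)
    then have "((\<lambda>z. Ln (z - c)) has_field_derivative 1 / (of_real t - c)) (at (of_real t))"
      by (auto intro!: derivative_eq_intros simp: inverse_eq_divide)
    then have "((\<lambda>z. Ln (z - c)) \<circ> of_real has_vector_derivative 1 * (1 / (of_real t - c))) (at t)"
      by (intro field_vector_diff_chain_at) (auto intro!: derivative_eq_intros has_vector_derivative_real_field simp: of_real_def)
    then show ?thesis by (simp add: L_def[abs_def] o_def)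
  qed
  have pf: "of_real (pk d t) * (1 / (of_real t - b)) = (1 / (2 * pi * \<i>)) *
     ((1 / (of_real t - a) - 1 / (of_real t - b)) / (a - b) - (1 / (of_real t - a') - 1 / (of_real t - b)) / (a' - b))" for t
  proof -
    have 1: "(1 / (of_real t - c) - 1 / (of_real t - b)) / (c - b) = 1 / ((of_real t - c) * (of_real t - b))"
      if "of_real t - c \<noteq> 0" "c - b \<noteq> 0" for c
      using that nz(3)[of t] by (simp add: divide_simps) 
    have "of_real (pk d t) = of_real d / (of_real pi * ((of_real t - a) * (of_real t - a')))"
      by (simp add: pk_def a_def a'_def power2_eq_square algebra_simps)
    also have "\<dots> = (1 / (2 * pi * \<i>)) * (1 / (of_real t - a) - 1 / (of_real t - a'))"
      using nz[of t] by (simp add: divide_simps) (simp add: a_def a'_def algebra_simps)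
    finally have 2: "of_real (pk d t) = (1 / (2 * pi * \<i>)) * (1 / (of_real t - a) - 1 / (of_real t - a'))" .
    show ?thesis unfolding 1[OF nz(1) ab(1)] 1[OF nz(2) ab(2)] 2
      by (simp only: mult.assoc left_diff_distrib times_divide_times_eq mult_1_left)
  qed
  have FD: "(F has_vector_derivative of_real (pk d t) * (1 / (of_real t - b))) (at t)" for t
    unfolding pf F_def[abs_def] using d b Ima
    by (intro has_vector_derivative_mult_right has_vector_derivative_diff has_vector_derivative_divide LD) auto
  have cont: "isCont (\<lambda>t. of_real (pk d t) * (1 / (of_real t - b))) t" for t
  proof -
    have "t\<^sup>2 + d\<^sup>2 \<noteq> 0" using d by (simp add: sum_power2_eq_zero_iff)
    then show ?thesis unfolding pk_def using nz(3)[of t] by (intro continuous_intros) auto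
  qed
  show int: "integrable lborel (\<lambda>t. of_real (pk d t) * (1 / (of_real t - b)))"
  proof (rule Bochner_Integration.integrable_bound[where f="\<lambda>t. pk d t * (1 / Im b)"])
    show "integrable lborel (\<lambda>t. pk d t * (1 / Im b))" using pk_integral[OF d] by simp
    show "AE t in lborel. norm (of_real (pk d t) * (1 / (of_real t - b))) \<le> norm (pk d t * (1 / Im b))"
    proof (rule AE_I2)
      fix t
      have "Im b \<le> norm (of_real t - b)" using abs_Im_le_cmod[of "of_real t - b"] b by simp
      then have "1 / norm (of_real t - b) \<le> 1 / Im b" using b nz(3)[of t] by (intro divide_left_mono mult_pos_pos) auto
      then have "\<bar>pk d t\<bar> * (1 / norm (of_real t - b)) \<le> \<bar>pk d t\<bar> * (1 / Im b)" by (intro mult_left_mono) auto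
      then show "norm (of_real (pk d t) * (1 / (of_real t - b))) \<le> norm (pk d t * (1 / Im b))"
        using b by (simp add: norm_mult norm_divide abs_mult)
    qed
  qed (use cont in \<open>auto intro!: borel_measurable_continuous_onI continuous_at_imp_continuous_on\<close>)
  \<comment> \<open>The terms \<open>ln \<bar>t\<bar>\<close> cancel in each difference, so every
    logarithm may be replaced by one with a finite limit.\<close>
  have Leq: "F t = (1 / (2 * pi * \<i>)) * (((L a t - of_real (ln \<bar>t\<bar>)) - (L b t - of_real (ln \<bar>t\<bar>))) / (a - b)
       - ((L a' t - of_real (ln \<bar>t\<bar>)) - (L b t - of_real (ln \<bar>t\<bar>))) / (a' - b))" for t
    by (simp add: F_def)
  have top: "(F \<longlongrightarrow> (1 / (2 * pi * \<i>)) * ((0 - 0) / (a - b) - (0 - 0) / (a' - b))) at_top"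
    unfolding Leq L_def using d b Ima ab by (intro tendsto_intros Ln_shift_limits) auto
  \<comment> \<open>The logarithms belonging to \<open>a\<close> and \<open>b\<close> have the same
    limit here, both points being in the upper half plane; only the pole \<open>a'\<close>
    contributes.\<close>
  have bot: "(F \<longlongrightarrow> (1 / (2 * pi * \<i>)) * (((- of_real (sgn (Im a) * pi) * \<i>) - (- of_real (sgn (Im b) * pi) * \<i>)) / (a - b)
      - ((- of_real (sgn (Im a') * pi) * \<i>) - (- of_real (sgn (Im b) * pi) * \<i>)) / (a' - b))) at_bot"
    unfolding Leq L_def using d b Ima ab by (intro tendsto_intros Ln_shift_limits) auto
  have "(LINT t|lborel. of_real (pk d t) * (1 / (of_real t - b))) = 0 - (1 / (2 * pi * \<i>)) * (- (2 * pi * \<i> / (a' - b)))"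
    using FTC_line[OF FD cont int bot top] d b Ima by simp
  also have "\<dots> = 1 / (a' - b)" by simp
  also have "a' - b = - (b + \<i> * of_real d)" by (simp add: a'_def)
  finally show "(LINT t|lborel. of_real (pk d t) * (1 / (of_real t - b))) = - 1 / (b + \<i> * of_real d)"
    by (simp add: minus_divide_right)
qed

lemma lborel_integral_reflect:
  fixes f :: "real \<Rightarrow> 'a :: {banach, second_countable_topology}"
  shows "(LINT t|lborel. f (x - t)) = (LINT t|lborel. f t)"
  using lborel_integral_real_affine[of "-1" f x] by simp

text \<open>With \<open>b = Complex y e\<close>, the function \<open>qk e (y - t)\<close> is
  \<open>- 1 / pi\<close> times the real part of \<open>1 / (t - b)\<close>, so the Cauchy integral
  applies. For \<open>y = 0\<close>, where \<open>b\<close> could meet the pole of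
  \<open>pk d\<close>, both sides vanish by oddness.\<close>

lemma pk_qk_convolution:
  assumes d: "0 < d" and e: "0 < e"
  shows "(LINT t|lborel. pk d t * qk e (y - t)) = qk (d + e) y"
proof (cases "y = 0")
  case True
  have "(LINT t|lborel. pk d t * qk e (y - t)) = (LINT t|lborel. pk d (0 - t) * qk e (y - (0 - t)))"
    by (rule lborel_integral_reflect[symmetric, of "\<lambda>t. pk d t * qk e (y - t)" 0])
  also have "\<dots> = (LINT t|lborel. - (pk d t * qk e (y - t)))"
    using True by (intro Bochner_Integration.integral_cong) (auto simp: pk_def qk_def)
  also have "\<dots> = - (LINT t|lborel. pk d t * qk e (y - t))" by (rule Bochner_Integration.integral_minus)
  finally show ?thesis using True by (simp add: qk_def)
next
  case False
  have Re_mult_2: "Re (of_real u * (of_real v * w)) = u * (v * Re w)" for u v w by simp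
  define b where "b = Complex y e"
  have b: "0 < Im b" "Re b \<noteq> 0" using e False by (auto simp: b_def)
  have eq: "pk d t * qk e (y - t) = Re (of_real (- 1 / pi) * (of_real (pk d t) * (1 / (of_real t - b))))" for t
  proof -
    have "Re (1 / (of_real t - b)) = (t - y) / ((t - y)\<^sup>2 + e\<^sup>2)" by (simp add: b_def Re_divide)
    then have "Re (of_real (- 1 / pi) * (of_real (pk d t) * (1 / (of_real t - b)))) = (- 1 / pi) * (pk d t * ((t - y) / ((t - y)\<^sup>2 + e\<^sup>2)))"
      by (simp only: Re_mult_2)
    also have "(t - y)\<^sup>2 = (y - t)\<^sup>2" by (rule power2_commute)
    also have "(- 1 / pi) * (pk d t * ((t - y) / ((y - t)\<^sup>2 + e\<^sup>2))) = pk d t * qk e (y - t)"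
    proof -
      have "(- 1 / pi) * (P * ((t - y) / D)) = P * ((y - t) / (pi * D))" for P D :: real
        by (cases "D = 0") (auto simp: field_simps)
      then show ?thesis unfolding qk_def .
    qed
    finally show ?thesis ..
  qed
  have "(LINT t|lborel. pk d t * qk e (y - t)) = Re (of_real (- 1 / pi) * (LINT t|lborel. of_real (pk d t) * (1 / (of_real t - b))))"
  proof -
    have "(LINT t|lborel. pk d t * qk e (y - t)) = (LINT t|lborel. Re (of_real (- 1 / pi) * (of_real (pk d t) * (1 / (of_real t - b)))))"
      by (intro Bochner_Integration.integral_cong refl eq)
    also have "\<dots> = Re (LINT t|lborel. of_real (- 1 / pi) * (of_real (pk d t) * (1 / (of_real t - b))))"
      by (rule integral_Re) (intro integrable_mult_right pk_cauchy_integral(2)[OF d b])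
    also have "(LINT t|lborel. of_real (- 1 / pi) * (of_real (pk d t) * (1 / (of_real t - b)))) =
      of_real (- 1 / pi) * (LINT t|lborel. of_real (pk d t) * (1 / (of_real t - b)))"
      by (rule integral_mult_right_zero)
    finally show ?thesis .
  qed
  also have "\<dots> = qk (d + e) y"
  proof -
    have "Re (- 1 / (b + \<i> * of_real d)) = - y / (y\<^sup>2 + (d + e)\<^sup>2)" by (simp add: b_def Re_divide add.commute)
    moreover have "Re (of_real (- 1 / pi) * w) = (- 1 / pi) * Re w" for w by simp
    ultimately have "Re (of_real (- 1 / pi) * (- 1 / (b + \<i> * of_real d))) = (- 1 / pi) * (- y / (y\<^sup>2 + (d + e)\<^sup>2))" by (simp only:)
    then show ?thesis unfolding pk_cauchy_integral(1)[OF d b] by (simp add: qk_def)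
  qed
  finally show ?thesis .
qed

lemma lborel_integrable_prod_mult:
  fixes f :: "'a::euclidean_space \<Rightarrow> real" and g :: "'b::euclidean_space \<Rightarrow> real"
  assumes f: "integrable lborel f" and g: "integrable lborel g"
  shows "integrable (lborel \<Otimes>\<^sub>M lborel) (\<lambda>(x, y). f x * g y)"
proof (rule lborel_pair.Fubini_integrable)
  have [measurable]: "f \<in> borel_measurable borel" "g \<in> borel_measurable borel" using f g by auto
  show "(\<lambda>(x, y). f x * g y) \<in> borel_measurable (lborel \<Otimes>\<^sub>M lborel)" by measurable
  show "integrable lborel (\<lambda>x. LINT y|lborel. norm (case (x, y) of (x, y) \<Rightarrow> f x * g y))"
    using f by (simp add: abs_mult)
  show "AE x in lborel. integrable lborel (\<lambda>y. case (x, y) of (x, y) \<Rightarrow> f x * g y)"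
    using g by simp
qed

lemma qk_bounded: assumes "0 < d" shows "\<bar>qk d t\<bar> \<le> (1/(2*d) + 1) / pi"
proof -
  have "box_decay t \<le> 1" by (simp add: box_decay_real)
  then have "((1/(2*d) + 1) / pi) * box_decay t \<le> ((1/(2*d) + 1) / pi) * 1"
    using assms by (intro mult_left_mono) auto
  then show ?thesis using qk_decay[OF assms, of t] by simp
qed

text \<open>Averaging with the Poisson kernel raises the height of the conjugate function. Thus all
  heights above a fixed one are Poisson averages of a single function, to which the maximal
  inequality applies. Boundedness of \<open>qk e\<close> and integrability of \<open>pk d\<close>
  and \<open>g\<close> justify Fubini.\<close>

lemma pc_qc_semigroup:
  assumes g: "integrable lborel g" and d: "0 < d" and e: "0 < e"
  shows "pc d (qc e g) x = qc (d + e) g x"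
proof -
  have [measurable]: "g \<in> borel_measurable borel" using g by auto
  have int2: "integrable (lborel \<Otimes>\<^sub>M lborel) (\<lambda>(t, s). pk d t * (qk e (s - t) * g (x - s)))"
  proof -
    have ig: "integrable lborel (\<lambda>s. g (x - s))"
      using lborel_integrable_real_affine[OF g, of "-1" x] by simp
    have "integrable (lborel \<Otimes>\<^sub>M lborel) (\<lambda>(t, s). ((1/(2*e) + 1) / pi * pk d t) * g (x - s))"
      using pk_integral(1)[OF d] ig by (intro lborel_integrable_prod_mult) auto
    then show ?thesis
    proof (rule Bochner_Integration.integrable_bound)
      show "AE ts in lborel \<Otimes>\<^sub>M lborel. norm (case ts of (t, s) \<Rightarrow> pk d t * (qk e (s - t) * g (x - s)))
        \<le> norm (case ts of (t, s) \<Rightarrow> ((1/(2*e) + 1) / pi * pk d t) * g (x - s))"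
      proof (rule AE_I2, clarsimp simp: abs_mult split: prod.split)
        fix t s
        have "\<bar>qk e (s - t)\<bar> * (\<bar>pk d t\<bar> * \<bar>g (x - s)\<bar>) \<le> ((1/(2*e) + 1) / pi) * (\<bar>pk d t\<bar> * \<bar>g (x - s)\<bar>)"
          using qk_bounded[OF e] by (intro mult_right_mono) auto
        then show "\<bar>pk d t\<bar> * (\<bar>qk e (s - t)\<bar> * \<bar>g (x - s)\<bar>) \<le> \<bar>1 / (2 * e) + 1\<bar> * \<bar>pk d t\<bar> * \<bar>g (x - s)\<bar> / pi"
          using e by (simp add: mult_ac)
      qed
    qed measurable
  qed
  have "pc d (qc e g) x = (LINT t|lborel. (LINT s|lborel. pk d t * (qk e (s - t) * g (x - s))))"
    unfolding pc_def
  proof (rule Bochner_Integration.integral_cong)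
    fix t
    have "qc e g (x - t) = (LINT s|lborel. qk e (s - t) * g (x - s))"
      unfolding qc_def using lborel_integral_real_affine[of 1 "\<lambda>s. qk e (s - t) * g (x - s)" t] by (simp add: algebra_simps)
    then show "pk d t * qc e g (x - t) = (LINT s|lborel. pk d t * (qk e (s - t) * g (x - s)))" by simp
  qed simp
  also have "\<dots> = (LINT s|lborel. (LINT t|lborel. pk d t * (qk e (s - t) * g (x - s))))"
    by (rule lborel_pair.Fubini_integral[symmetric, OF int2])
  also have "\<dots> = (LINT s|lborel. (LINT t|lborel. pk d t * qk e (s - t)) * g (x - s))"
    by (simp add: mult.assoc[symmetric])
  also have "\<dots> = qc (d + e) g x" by (simp add: pk_qk_convolution[OF d e] qc_def)
  finally show ?thesis .
qed

section \<open>The conjugate function inequality\<close>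

lemma abs_has_derivative_sgn:
  assumes "(v::real) \<noteq> 0" shows "(abs has_real_derivative sgn v) (at v)"
proof (cases "0 < v")
  case True
  have "((\<lambda>x. x) has_real_derivative 1) (at v)" by (rule DERIV_ident)
  then have "(abs has_real_derivative 1) (at v)"
    by (rule has_field_derivative_transform_within_open[where S="{0<..}"]) (use True in auto)
  then show ?thesis using True by simp
next
  case False
  have "((\<lambda>x. - x) has_real_derivative - 1) (at v)" by (intro DERIV_minus DERIV_ident)
  then have "(abs has_real_derivative - 1) (at v)"
    by (rule has_field_derivative_transform_within_open[where S="{..<0}"]) (use False assms in auto)
  then show ?thesis using False assms by (simp add: sgn_if)
qed

lemma abs_powr_has_derivative:
  fixes v :: real
  assumes "1 < q"
  shows "((\<lambda>v. \<bar>v\<bar> powr q) has_real_derivative q * (v * \<bar>v\<bar> powr (q - 2))) (at v)"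
proof (cases "v = 0")
  case True
  have "(\<lambda>h::real. \<bar>h\<bar> powr q / h) \<midarrow>0\<rightarrow> 0"
  proof (rule Lim_null_comparison)
    show "eventually (\<lambda>h::real. norm (\<bar>h\<bar> powr q / h) \<le> \<bar>h\<bar> powr (q - 1)) (at 0)"
      by (auto simp: eventually_at_filter powr_diff intro!: always_eventually)
    have "((\<lambda>h::real. \<bar>h\<bar> powr (q - 1)) \<longlongrightarrow> \<bar>0\<bar> powr (q - 1)) (at 0)"
      using assms by (intro tendsto_powr2 tendsto_intros) auto
    then show "((\<lambda>h::real. \<bar>h\<bar> powr (q - 1)) \<longlongrightarrow> 0) (at 0)" by simp
  qed
  then show ?thesis using True by (simp add: DERIV_def)
next
  case False
  have "((\<lambda>v. \<bar>v\<bar> powr q) has_real_derivative (q * \<bar>v\<bar> powr (q - 1)) * sgn v) (at v)"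
    using False by (intro DERIV_chain'[where g="\<lambda>u. u powr q"] has_real_derivative_powr abs_has_derivative_sgn) auto
  moreover have "q * \<bar>v\<bar> powr (q - 1) * sgn v = q * (v * \<bar>v\<bar> powr (q - 2))"
  proof -
    have "\<bar>v\<bar> powr (q - 1) = \<bar>v\<bar> powr (q - 2) * \<bar>v\<bar>"
      using False powr_add[of "\<bar>v\<bar>" "q - 2" 1] by simp
    then show ?thesis by (simp add: sgn_if)
  qed
  ultimately show ?thesis by simp
qed

lemma mult_abs_powr_has_derivative:
  fixes v :: real
  assumes "2 < q"
  shows "((\<lambda>v. v * \<bar>v\<bar> powr (q - 2)) has_real_derivative (q - 1) * \<bar>v\<bar> powr (q - 2)) (at v)"
proof (cases "v = 0")
  case True
  have "((\<lambda>h::real. \<bar>h\<bar> powr (q - 2)) \<longlongrightarrow> \<bar>0\<bar> powr (q - 2)) (at 0)"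
    using assms by (intro tendsto_powr2 tendsto_intros) auto
  then have "((\<lambda>h::real. \<bar>h\<bar> powr (q - 2)) \<longlongrightarrow> 0) (at 0)" by simp
  then have "((\<lambda>h::real. (h * \<bar>h\<bar> powr (q - 2)) / h) \<longlongrightarrow> 0) (at 0)"
    by (rule Lim_transform_eventually) (auto simp: eventually_at_filter)
  then show ?thesis using True by (simp add: DERIV_def)
next
  case False
  have "((\<lambda>v. \<bar>v\<bar> powr (q - 2)) has_real_derivative ((q - 2) * \<bar>v\<bar> powr (q - 2 - 1)) * sgn v) (at v)"
    using False by (intro DERIV_chain'[where g="\<lambda>u. u powr (q - 2)"] has_real_derivative_powr abs_has_derivative_sgn) auto
  then have *: "((\<lambda>v. v * \<bar>v\<bar> powr (q - 2)) has_real_derivative (v * (((q - 2) * \<bar>v\<bar> powr (q - 2 - 1)) * sgn v) + 1 * \<bar>v\<bar> powr (q - 2))) (at v)"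
    by (intro DERIV_mult' DERIV_ident)
  have "v * (((q - 2) * \<bar>v\<bar> powr (q - 2 - 1)) * sgn v) = (q - 2) * \<bar>v\<bar> powr (q - 2)"
  proof -
    have "\<bar>v\<bar> powr (q - 2) = \<bar>v\<bar> powr (q - 2 - 1) * \<bar>v\<bar>"
      using False powr_add[of "\<bar>v\<bar>" "q - 2 - 1" 1] by simp
    then show ?thesis by (simp add: sgn_if)
  qed
  then show ?thesis by (intro DERIV_cong[OF *]) (simp add: left_diff_distrib)
qed

text \<open>Differentiation exchanges the even and odd power functions and lowers the degree by one.
  Two derivatives of \<open>Wf\<close> can therefore be computed without distinguishing the sign of
  \<open>v\<close> or the case \<open>v = 0\<close>.\<close>

definition mq :: "real \<Rightarrow> real \<Rightarrow> real" where "mq q v = \<bar>v\<bar> powr q"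
definition nq :: "real \<Rightarrow> real \<Rightarrow> real" where "nq q v = v * \<bar>v\<bar> powr (q - 2)"

lemma mq_deriv: "1 < q \<Longrightarrow> (mq q has_real_derivative q * nq q v) (at v)"
  unfolding mq_def[abs_def] nq_def by (rule abs_powr_has_derivative)

lemma nq_deriv: "2 < q \<Longrightarrow> (nq q has_real_derivative (q - 1) * mq (q - 2) v) (at v)"
  unfolding mq_def nq_def[abs_def] by (rule mult_abs_powr_has_derivative)

text \<open>
  Along a holomorphic \<open>u + i v\<close> this function is superharmonic, and it is at least
  \<open>|v|^p / 2 - C |u|^p\<close>. Integrating its Laplacian over the half plane against the height thus bounds
  the conjugate function.
\<close>

definition Wf :: "real \<Rightarrow> real \<Rightarrow> real \<Rightarrow> real" where
  "Wf p u v = mq p v - (p * (p - 1) / 2) * (u\<^sup>2 * mq (p - 2) v)"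

text \<open>\<open>Wf1\<close> and \<open>Wf2\<close> are the first and second derivatives of
  \<open>Wf p\<close> along a curve through \<open>(u, v)\<close> with velocity
  \<open>(u1, v1)\<close> and acceleration \<open>(u2, v2)\<close>, written out by the chain
  rule.\<close>

definition Wf1 :: "real \<Rightarrow> real \<Rightarrow> real \<Rightarrow> real \<Rightarrow> real \<Rightarrow> real" where
  "Wf1 p u v u1 v1 = p * (nq p v * v1) - (p * (p - 1) / 2) *
     (2 * (u * mq (p - 2) v * u1) + (p - 2) * (u\<^sup>2 * nq (p - 2) v * v1))"

definition Wf2 :: "real \<Rightarrow> real \<Rightarrow> real \<Rightarrow> real \<Rightarrow> real \<Rightarrow> real \<Rightarrow> real \<Rightarrow> real" where
  "Wf2 p u v u1 v1 u2 v2 = p * ((p - 1) * (mq (p - 2) v * v1\<^sup>2) + nq p v * v2) - (p * (p - 1) / 2) *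
     (2 * (u1\<^sup>2 * mq (p - 2) v + (p - 2) * (u * nq (p - 2) v * v1 * u1) + u * mq (p - 2) v * u2)
      + (p - 2) * (2 * (u * u1 * nq (p - 2) v * v1) + (p - 3) * (u\<^sup>2 * mq (p - 4) v * v1\<^sup>2) + u\<^sup>2 * nq (p - 2) v * v2))"

lemma Wf_deriv:
  assumes p: "6 \<le> p" and u: "(u has_real_derivative u1) (at s)" and v: "(v has_real_derivative v1) (at s)"
  shows "((\<lambda>s. Wf p (u s) (v s)) has_real_derivative Wf1 p (u s) (v s) u1 v1) (at s)"
proof -
  have 1: "((\<lambda>s. mq p (v s)) has_real_derivative (p * nq p (v s)) * v1) (at s)"
    using p by (intro DERIV_chain'[OF v mq_deriv]) auto
  have 2: "((\<lambda>s. mq (p - 2) (v s)) has_real_derivative ((p - 2) * nq (p - 2) (v s)) * v1) (at s)"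
    using p by (intro DERIV_chain'[OF v mq_deriv]) auto
  have 3: "((\<lambda>s. (u s)\<^sup>2) has_real_derivative 2 * u s * u1) (at s)"
    using u by (auto intro!: derivative_eq_intros)
  show ?thesis unfolding Wf_def Wf1_def
    by (rule DERIV_cong[OF DERIV_diff[OF 1 DERIV_cmult[OF DERIV_mult'[OF 3 2]]]]) (simp add: algebra_simps)
qed

lemma Wf1_deriv:
  assumes p: "6 \<le> p" and u: "(u has_real_derivative u1 s) (at s)" and v: "(v has_real_derivative v1 s) (at s)"
    and u1: "(u1 has_real_derivative u2) (at s)" and v1: "(v1 has_real_derivative v2) (at s)"
  shows "((\<lambda>s. Wf1 p (u s) (v s) (u1 s) (v1 s)) has_real_derivative Wf2 p (u s) (v s) (u1 s) (v1 s) u2 v2) (at s)"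
proof -
  have 1: "((\<lambda>s. nq p (v s)) has_real_derivative ((p - 1) * mq (p - 2) (v s)) * v1 s) (at s)"
    using p by (intro DERIV_chain'[OF v nq_deriv]) auto
  have 2: "((\<lambda>s. mq (p - 2) (v s)) has_real_derivative ((p - 2) * nq (p - 2) (v s)) * v1 s) (at s)"
    using p by (intro DERIV_chain'[OF v mq_deriv]) auto
  have "(nq (p - 2) has_real_derivative (p - 3) * mq (p - 4) (v s)) (at (v s))"
    using nq_deriv[of "p - 2" "v s"] p by simp
  then have 4: "((\<lambda>s. nq (p - 2) (v s)) has_real_derivative ((p - 3) * mq (p - 4) (v s)) * v1 s) (at s)"
    by (intro DERIV_chain'[OF v])
  have 3: "((\<lambda>s. (u s)\<^sup>2) has_real_derivative 2 * u s * u1 s) (at s)"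
    using u by (auto intro!: derivative_eq_intros)
  note d = DERIV_diff[OF DERIV_cmult[OF DERIV_mult'[OF 1 v1]] DERIV_cmult[OF DERIV_add[OF DERIV_cmult[OF DERIV_mult'[OF DERIV_mult'[OF u 2] u1]]
     DERIV_cmult[OF DERIV_mult'[OF DERIV_mult'[OF 3 4] v1]]]]]
  show ?thesis unfolding Wf1_def Wf2_def
    by (rule DERIV_cong[OF d]) (simp add: algebra_simps power2_eq_square)
qed

text \<open>By the Cauchy-Riemann equations the vertical direction has velocity
  \<open>(- v1, u1)\<close> and acceleration \<open>(- u2, - v2)\<close>. Accelerations and mixed
  terms cancel in the sum. The coefficient \<open>p * (p - 1) / 2\<close> in \<open>Wf\<close> is
  chosen so that the terms with \<open>mq (p - 2) v\<close> cancel too; what remains is minus a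
  square times \<open>mq (p - 4) v\<close>.\<close>

lemma Wf2_laplacian:
  assumes p: "6 \<le> p"
  shows "Wf2 p u v u1 v1 u2 v2 + Wf2 p u v (- v1) u1 (- u2) (- v2) \<le> 0"
proof -
  have "Wf2 p u v u1 v1 u2 v2 + Wf2 p u v (- v1) u1 (- u2) (- v2) =
     - ((u1\<^sup>2 + v1\<^sup>2) * ((p * (p - 1) / 2) * (p - 2) * (p - 3) * u\<^sup>2 * mq (p - 4) v))"
    unfolding Wf2_def by (simp add: algebra_simps power2_eq_square add_divide_distrib diff_divide_distrib)
  moreover have "0 \<le> (u1\<^sup>2 + v1\<^sup>2) * ((p * (p - 1) / 2) * (p - 2) * (p - 3) * u\<^sup>2 * mq (p - 4) v)"
    using p by (intro mult_nonneg_nonneg) (auto simp: mq_def)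
  ultimately show ?thesis by linarith
qed

lemma mq_bound: "\<bar>v\<bar> \<le> M \<Longrightarrow> 0 \<le> q \<Longrightarrow> \<bar>mq q v\<bar> \<le> M powr q"
  unfolding mq_def by (auto intro: powr_mono2)

lemma nq_bound: assumes "\<bar>v\<bar> \<le> M" "2 \<le> q" "0 < M" shows "\<bar>nq q v\<bar> \<le> M powr (q - 1)"
proof -
  have "\<bar>nq q v\<bar> = \<bar>v\<bar> * \<bar>v\<bar> powr (q - 2)" by (simp add: nq_def abs_mult)
  also have "\<dots> \<le> M * M powr (q - 2)" using assms by (intro mult_mono powr_mono2) auto
  also have "\<dots> = M powr (q - 1)" using assms powr_add[of M "q - 2" 1] by simp
  finally show ?thesis .
qed

lemma abs_mult_le: "\<bar>x::real\<bar> \<le> a \<Longrightarrow> \<bar>y\<bar> \<le> b \<Longrightarrow> \<bar>x * y\<bar> \<le> a * b"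
  by (auto simp: abs_mult intro!: mult_mono)

lemma abs_add_le: "\<bar>x::real\<bar> \<le> a \<Longrightarrow> \<bar>y\<bar> \<le> b \<Longrightarrow> \<bar>x + y\<bar> \<le> a + b" by linarith
lemma abs_diff_le: "\<bar>x::real\<bar> \<le> a \<Longrightarrow> \<bar>y\<bar> \<le> b \<Longrightarrow> \<bar>x - y\<bar> \<le> a + b" by linarith

text \<open>Every monomial is homogeneous of degree \<open>p\<close> in the function and its
  derivatives together, with coefficients depending on \<open>p\<close> only. One bound
  \<open>M\<close> for all of them therefore gives a multiple of \<open>M powr p\<close>;
  \<open>c\<close> adds up the three resulting constants.\<close>

lemma Wf_bounds:
  assumes p: "6 \<le> p"
  obtains c where "0 \<le> c"
   "\<And>M u v u1 v1 u2 v2. \<lbrakk>0 < M; \<bar>u\<bar> \<le> M; \<bar>v\<bar> \<le> M; \<bar>u1\<bar> \<le> M; \<bar>v1\<bar> \<le> M; \<bar>u2\<bar> \<le> M; \<bar>v2\<bar> \<le> M\<rbrakk> \<Longrightarrow>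
     \<bar>Wf p u v\<bar> \<le> c * M powr p \<and> \<bar>Wf1 p u v u1 v1\<bar> \<le> c * M powr p \<and> \<bar>Wf2 p u v u1 v1 u2 v2\<bar> \<le> c * M powr p"
proof -
  define a where "a = p * (p - 1) / 2"
  define c where "c = p * ((p - 1) * 1 + 1) + a * (2 * (1 + (p - 2) * 1 + 1) + (p - 2) * (2 * 1 + (p - 3) * 1 + 1)) + (1 + a) + (p + a * (2 + (p - 2)))"
  have a0: "0 \<le> a" using p by (simp add: a_def)
  have nonneg: "0 \<le> p * ((p - 1) * 1 + 1) + a * (2 * (1 + (p - 2) * 1 + 1) + (p - 2) * (2 * 1 + (p - 3) * 1 + 1))" "0 \<le> 1 + a" "0 \<le> p + a * (2 + (p - 2))"
    using p a0 by (auto intro!: add_nonneg_nonneg mult_nonneg_nonneg)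
  show ?thesis
  proof (rule that[of c])
    show "0 \<le> c" using nonneg by (simp add: c_def)
    fix M u v u1 v1 u2 v2 :: real
    assume M: "0 < M" and h: "\<bar>u\<bar> \<le> M" "\<bar>v\<bar> \<le> M" "\<bar>u1\<bar> \<le> M" "\<bar>v1\<bar> \<le> M" "\<bar>u2\<bar> \<le> M" "\<bar>v2\<bar> \<le> M"
    define P where "P = M powr p"
    have P0: "0 \<le> P" by (simp add: P_def)
    have sq: "\<bar>x\<^sup>2\<bar> \<le> M * M" if "\<bar>x\<bar> \<le> M" for x
      using abs_mult_le[OF that that] by (simp add: power2_eq_square)
    have m0: "\<bar>mq p v\<bar> \<le> P" using mq_bound[OF h(2), of p] p by (simp add: P_def)
    have m2: "\<bar>mq (p - 2) v\<bar> \<le> M powr (p - 2)" using mq_bound[OF h(2), of "p - 2"] p by simp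
    have m4: "\<bar>mq (p - 4) v\<bar> \<le> M powr (p - 4)" using mq_bound[OF h(2), of "p - 4"] p by simp
    have n0: "\<bar>nq p v\<bar> \<le> M powr (p - 1)" using nq_bound[OF h(2), of p] p M by simp
    have n2: "\<bar>nq (p - 2) v\<bar> \<le> M powr (p - 3)" using nq_bound[OF h(2), of "p - 2"] p M by simp
    have e: "M powr (p - 1) * M = P" "M powr (p - 2) * (M * M) = P" "M powr (p - 3) * (M * (M * M)) = P" "M powr (p - 4) * (M * (M * (M * M))) = P"
      using M powr_add[of M "p - 1" 1] powr_add[of M "p - 2" 2] powr_add[of M "p - 3" 3] powr_add[of M "p - 4" 4]
      by (auto simp: P_def powr_numeral power2_eq_square power3_eq_cube power4_eq_xxxx)
    have t1: "\<bar>nq p v * x\<bar> \<le> P" if "\<bar>x\<bar> \<le> M" for x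
      using abs_mult_le[OF n0 that] e(1) by simp
    have t2: "\<bar>mq (p - 2) v * (x * y)\<bar> \<le> P" if "\<bar>x\<bar> \<le> M" "\<bar>y\<bar> \<le> M" for x y
      using abs_mult_le[OF m2 abs_mult_le[OF that]] e(2) by simp
    have t3: "\<bar>nq (p - 2) v * (x * (y * w))\<bar> \<le> P" if "\<bar>x\<bar> \<le> M" "\<bar>y\<bar> \<le> M" "\<bar>w\<bar> \<le> M" for x y w
      using abs_mult_le[OF n2 abs_mult_le[OF that(1) abs_mult_le[OF that(2,3)]]] e(3) by simp
    have t4: "\<bar>mq (p - 4) v * (x * (y * (w * k)))\<bar> \<le> P" if "\<bar>x\<bar> \<le> M" "\<bar>y\<bar> \<le> M" "\<bar>w\<bar> \<le> M" "\<bar>k\<bar> \<le> M" for x y w k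
      using abs_mult_le[OF m4 abs_mult_le[OF that(1) abs_mult_le[OF that(2) abs_mult_le[OF that(3,4)]]]] e(4) by simp
    have ca: "\<bar>a\<bar> \<le> a" "\<bar>p\<bar> \<le> p" "\<bar>p - 1\<bar> \<le> p - 1" "\<bar>p - 2\<bar> \<le> p - 2" "\<bar>p - 3\<bar> \<le> p - 3" "\<bar>2::real\<bar> \<le> 2" using p a0 by auto
    have w0: "\<bar>Wf p u v\<bar> \<le> P + a * P"
    proof -
      have "Wf p u v = mq p v - a * (mq (p - 2) v * (u * u))" by (simp add: Wf_def a_def power2_eq_square mult_ac)
      then show ?thesis using abs_diff_le[OF m0 abs_mult_le[OF ca(1) t2[OF h(1,1)]]] by (simp only:)
    qed
    have w1: "\<bar>Wf1 p u v u1 v1\<bar> \<le> p * P + a * (2 * P + (p - 2) * P)"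
    proof -
      have "Wf1 p u v u1 v1 = p * (nq p v * v1) - a * (2 * (mq (p - 2) v * (u * u1)) + (p - 2) * (nq (p - 2) v * (u * (u * v1))))"
        by (simp add: Wf1_def a_def power2_eq_square mult_ac)
      then show ?thesis
        using abs_diff_le[OF abs_mult_le[OF ca(2) t1[OF h(4)]] abs_mult_le[OF ca(1) abs_add_le[OF abs_mult_le[OF ca(6) t2[OF h(1,3)]] abs_mult_le[OF ca(4) t3[OF h(1,1,4)]]]]]
        by (simp only:)
    qed
    have w2: "\<bar>Wf2 p u v u1 v1 u2 v2\<bar> \<le> p * ((p - 1) * P + P) + a * (2 * (P + (p - 2) * P + P) + (p - 2) * (2 * P + (p - 3) * P + P))"
    proof -
      have "Wf2 p u v u1 v1 u2 v2 = p * ((p - 1) * (mq (p - 2) v * (v1 * v1)) + nq p v * v2) - a *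
       (2 * (mq (p - 2) v * (u1 * u1) + (p - 2) * (nq (p - 2) v * (u * (v1 * u1))) + mq (p - 2) v * (u * u2))
       + (p - 2) * (2 * (nq (p - 2) v * (u * (u1 * v1))) + (p - 3) * (mq (p - 4) v * (u * (u * (v1 * v1)))) + nq (p - 2) v * (u * (u * v2))))"
        by (simp add: Wf2_def a_def power2_eq_square mult_ac)
      then show ?thesis
        using abs_diff_le[OF abs_mult_le[OF ca(2) abs_add_le[OF abs_mult_le[OF ca(3) t2[OF h(4,4)]] t1[OF h(6)]]]
          abs_mult_le[OF ca(1) abs_add_le[OF
            abs_mult_le[OF ca(6) abs_add_le[OF abs_add_le[OF t2[OF h(3,3)] abs_mult_le[OF ca(4) t3[OF h(1,4,3)]]] t2[OF h(1,5)]]]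
            abs_mult_le[OF ca(4) abs_add_le[OF abs_add_le[OF abs_mult_le[OF ca(6) t3[OF h(1,3,4)]] abs_mult_le[OF ca(5) t4[OF h(1,1,4,4)]]] t3[OF h(1,1,6)]]]]]]
        by (simp only:)
    qed
    have c0: "P + a * P = (1 + a) * P" "p * P + a * (2 * P + (p - 2) * P) = (p + a * (2 + (p - 2))) * P"
      "p * ((p - 1) * P + P) + a * (2 * (P + (p - 2) * P + P) + (p - 2) * (2 * P + (p - 3) * P + P)) =
       (p * ((p - 1) * 1 + 1) + a * (2 * (1 + (p - 2) * 1 + 1) + (p - 2) * (2 * 1 + (p - 3) * 1 + 1))) * P"
      by (simp_all add: algebra_simps)
    have "k * P \<le> c * P" if "k \<le> c" for k using that P0 by (intro mult_right_mono)
    moreover have "1 + a \<le> c" "p + a * (2 + (p - 2)) \<le> c"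
       "p * ((p - 1) * 1 + 1) + a * (2 * (1 + (p - 2) * 1 + 1) + (p - 2) * (2 * 1 + (p - 3) * 1 + 1)) \<le> c"
      using nonneg unfolding c_def by linarith+
    ultimately show "\<bar>Wf p u v\<bar> \<le> c * M powr p \<and> \<bar>Wf1 p u v u1 v1\<bar> \<le> c * M powr p \<and> \<bar>Wf2 p u v u1 v1 u2 v2\<bar> \<le> c * M powr p"
      using w0 w1 w2 unfolding c0 P_def[symmetric] by (meson order_trans)
  qed
qed

text \<open>Differentiation under the integral by an explicit remainder: the difference to the
  linear part is \<open>h^2\<close> times an integral whose integrand is at most
  \<open>2 / y^3 * \<bar>g t\<bar>\<close> once \<open>norm h < y / 2\<close>, with \<open>y\<close>
  the height of \<open>z\<close>.\<close>

lemma cauchy_transform_holomorphic: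
  fixes g :: "real \<Rightarrow> real"
  assumes g: "integrable lborel g"
  shows "(\<lambda>z. LINT t|lborel. of_real (g t) / (z - of_real t)) holomorphic_on {z. 0 < Im z}"
proof (rule holomorphic_onI)
  fix z :: complex assume "z \<in> {z. 0 < Im z}"
  then have z: "0 < Im z" by simp
  have [measurable]: "g \<in> borel_measurable borel" using g by auto
  define y where "y = Im z"
  define f :: "complex \<Rightarrow> complex" where "f = (\<lambda>z. LINT t|lborel. of_real (g t) / (z - of_real t))"
  define D where "D = (LINT t|lborel. - of_real (g t) / (z - of_real t)\<^sup>2)"
  define K where "K = (LINT t|lborel. \<bar>g t\<bar>) * (2 / y^3)"
  have y: "0 < y" using z by (simp add: y_def)
  have low: "Im w \<le> norm (w - of_real t)" for w t using abs_Im_le_cmod[of "w - of_real t"] by simp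
  have int: "integrable lborel (\<lambda>t. of_real (g t) * k t)" if [measurable]: "k \<in> borel_measurable borel" and "\<And>t. norm (k t) \<le> C" for k :: "real \<Rightarrow> complex" and C
  proof (rule Bochner_Integration.integrable_bound[where f="\<lambda>t. g t * C"])
    show "AE t in lborel. norm (of_real (g t) * k t) \<le> norm (g t * C)"
    proof (rule AE_I2)
      fix t
      have "norm (k t) \<le> \<bar>C\<bar>" using that(2)[of t] by linarith
      then show "norm (of_real (g t) * k t) \<le> norm (g t * C)" by (simp add: norm_mult abs_mult mult_left_mono)
    qed
  qed (use g in auto)
  have i1: "integrable lborel (\<lambda>t. of_real (g t) / (w - of_real t))" if "0 < Im w" for w
  proof -
    have "norm (1 / (w - of_real t)) \<le> 1 / Im w" for t using low[of w t] that by (simp add: norm_divide frac_le)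
    from int[OF _ this] show ?thesis by simp
  qed
  have i2: "integrable lborel (\<lambda>t. - of_real (g t) / (z - of_real t)\<^sup>2)"
  proof -
    have "norm (- 1 / (z - of_real t)\<^sup>2) \<le> 1 / y^2" for t
      using power_mono[OF low[of z t], of 2] y by (simp add: norm_divide norm_power frac_le y_def)
    from int[OF _ this] show ?thesis by simp
  qed
  have "(\<lambda>h. (f (z + h) - f z) / h - D) \<midarrow>0\<rightarrow> 0"
  proof (rule Lim_null_comparison)
    show "eventually (\<lambda>h. norm ((f (z + h) - f z) / h - D) \<le> K * norm h) (at 0)"
      unfolding eventually_at
    proof (intro exI conjI ballI impI)
      show "0 < y / 2" using y by simp
      fix h :: complex assume "h \<noteq> 0 \<and> dist h 0 < y / 2"
      then have h: "h \<noteq> 0" "norm h < y / 2" by auto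
      have zh: "y / 2 < Im (z + h)" using h abs_Im_le_cmod[of h] by (simp add: y_def)
      then have zh0: "0 < Im (z + h)" using y by simp
      have "f (z + h) - f z - h * D = (LINT t|lborel. of_real (g t) / (z + h - of_real t) - of_real (g t) / (z - of_real t) - h * (- of_real (g t) / (z - of_real t)\<^sup>2))"
      proof -
        have "integral\<^sup>L lborel a - integral\<^sup>L lborel b - h * integral\<^sup>L lborel c = (LINT t|lborel. a t - b t - h * c t)"
          if "integrable lborel a" "integrable lborel b" "integrable lborel c" for a b c :: "real \<Rightarrow> complex"
          using that by simp
        from this[OF i1[OF zh0] i1[OF z] i2] show ?thesis unfolding f_def D_def .
      qed
      also have "\<dots> = (LINT t|lborel. h\<^sup>2 * of_real (g t) / ((z + h - of_real t) * (z - of_real t)\<^sup>2))"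
      proof (rule Bochner_Integration.integral_cong)
        fix t
        define a b where "a = z - of_real t" and "b = z + h - of_real t"
        have nz: "a \<noteq> 0" "b \<noteq> 0" using low[of z t] low[of "z + h" t] z zh0 by (auto simp: a_def b_def)
        have hb: "h = b - a" by (simp add: a_def b_def)
        have "of_real (g t) / b - of_real (g t) / a - h * (- of_real (g t) / a\<^sup>2) = h\<^sup>2 * of_real (g t) / (b * a\<^sup>2)"
          unfolding hb using nz by (simp add: divide_simps power2_eq_square) (simp add: algebra_simps)
        then show "of_real (g t) / (z + h - of_real t) - of_real (g t) / (z - of_real t) - h * (- of_real (g t) / (z - of_real t)\<^sup>2) = h\<^sup>2 * of_real (g t) / ((z + h - of_real t) * (z - of_real t)\<^sup>2)"
          by (simp add: a_def b_def)
      qed simp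
      finally have eq: "f (z + h) - f z - h * D = (LINT t|lborel. h\<^sup>2 * of_real (g t) / ((z + h - of_real t) * (z - of_real t)\<^sup>2))" .
      have "norm (f (z + h) - f z - h * D) \<le> (LINT t|lborel. (norm h)\<^sup>2 * (2 / y^3) * \<bar>g t\<bar>)"
        unfolding eq
      proof (rule Bochner_Integration.integral_norm_bound_integral)
        fix t
        have "(y / 2) * y\<^sup>2 \<le> norm (z + h - of_real t) * (norm (z - of_real t))\<^sup>2"
          using low[of z t] low[of "z + h" t] zh y by (intro mult_mono power_mono) (auto simp: y_def)
        then have "1 / (norm (z + h - of_real t) * (norm (z - of_real t))\<^sup>2) \<le> 1 / ((y / 2) * y\<^sup>2)"
          using y by (intro frac_le) auto
        also have "\<dots> = 2 / y^3" by (simp add: power2_eq_square power3_eq_cube)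
        finally have "(norm h)\<^sup>2 * \<bar>g t\<bar> * (1 / (norm (z + h - of_real t) * (norm (z - of_real t))\<^sup>2)) \<le> (norm h)\<^sup>2 * \<bar>g t\<bar> * (2 / y^3)"
          by (intro mult_left_mono) auto
        then show "norm (h\<^sup>2 * of_real (g t) / ((z + h - of_real t) * (z - of_real t)\<^sup>2)) \<le> (norm h)\<^sup>2 * (2 / y^3) * \<bar>g t\<bar>"
          by (simp add: norm_mult norm_divide norm_power mult_ac)
      next
        have "norm (h\<^sup>2 / ((z + h - of_real t) * (z - of_real t)\<^sup>2)) \<le> (norm h)\<^sup>2 / ((y/2) * y\<^sup>2)" for t
        proof -
          have "(y / 2) * y\<^sup>2 \<le> norm (z + h - of_real t) * (norm (z - of_real t))\<^sup>2"
            using low[of z t] low[of "z + h" t] zh y by (intro mult_mono power_mono) (auto simp: y_def)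
          then show ?thesis unfolding norm_divide norm_mult norm_power using y by (intro frac_le) auto
        qed
        from int[OF _ this] show "integrable lborel (\<lambda>t. h\<^sup>2 * of_real (g t) / ((z + h - of_real t) * (z - of_real t)\<^sup>2))"
          by (simp add: mult.commute)
      qed (use g in auto)
      also have "\<dots> = K * (norm h)\<^sup>2" by (simp add: K_def)
      finally have *: "norm (f (z + h) - f z - h * D) \<le> K * (norm h)\<^sup>2" .
      have "(f (z + h) - f z) / h - D = (f (z + h) - f z - h * D) / h" using h by (simp add: diff_divide_distrib)
      then have "norm ((f (z + h) - f z) / h - D) = norm (f (z + h) - f z - h * D) / norm h" by (simp add: norm_divide)
      also have "\<dots> \<le> K * (norm h)\<^sup>2 / norm h" using * by (intro divide_right_mono) auto
      also have "\<dots> = K * norm h" using h by (simp add: power2_eq_square)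
      finally show "norm ((f (z + h) - f z) / h - D) \<le> K * norm h" .
    qed
    have "((\<lambda>h::complex. K * norm h) \<longlongrightarrow> K * norm (0::complex)) (at 0)" by (intro tendsto_intros)
    then show "((\<lambda>h::complex. K * norm h) \<longlongrightarrow> 0) (at 0)" by simp
  qed
  then have "(\<lambda>h. (f (z + h) - f z) / h) \<midarrow>0\<rightarrow> D" by (simp add: LIM_zero_iff)
  then have "(f has_field_derivative D) (at z)" by (simp add: DERIV_def)
  then show "(\<lambda>z. LINT t|lborel. of_real (g t) / (z - of_real t)) field_differentiable at z within {z. 0 < Im z}"
    unfolding f_def by (meson field_differentiable_at_within field_differentiable_def)
qed

text \<open>The holomorphic extension is studied on the lines \<open>Im z = d + s\<close> with
  \<open>0 \<le> s\<close>. Starting at height \<open>d\<close> keeps the boundary line inside the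
  half plane of holomorphy, and the bounded support gives decay in every direction. The constant
  finally obtained depends on \<open>p\<close> alone, not on \<open>A\<close>, \<open>B\<close> or
  \<open>d\<close>.\<close>

locale conj_ext =
  fixes g :: "real \<Rightarrow> real" and A B d p :: real
  assumes g_meas [measurable]: "g \<in> borel_measurable borel"
    and g_bound: "\<And>t. \<bar>g t\<bar> \<le> B" and g_supp: "\<And>t. A < \<bar>t\<bar> \<Longrightarrow> g t = 0"
    and A: "0 < A" and d: "0 < d" and p: "6 \<le> p"
begin

definition F :: "complex \<Rightarrow> complex" where
  "F z = (\<i> / of_real pi) * (LINT t|lborel. of_real (g t) / (z - of_real t))"
definition F1 :: "complex \<Rightarrow> complex" where "F1 = deriv F"
definition F2 :: "complex \<Rightarrow> complex" where "F2 = deriv F1"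
definition zz :: "real \<Rightarrow> real \<Rightarrow> complex" where "zz x s = of_real x + \<i> * of_real (d + s)"
text \<open>Weaker than the true decay, the reciprocal of the distance, but a product of a function
  of \<open>x\<close> and one of \<open>s\<close>: integrability over the half plane can then be
  checked one variable at a time.\<close>

definition ew :: "real \<Rightarrow> real \<Rightarrow> real" where "ew x s = ((1 + x\<^sup>2) * (1 + s\<^sup>2)) powr (- 1 / 4)"
definition rr :: "real \<Rightarrow> real" where "rr x = 1 / (1 + x\<^sup>2)"

lemma g_int: "integrable lborel g"
proof (rule Bochner_Integration.integrable_bound[where f="\<lambda>t. B * indicator {-A..A} t"])
  show "integrable lborel (\<lambda>t. B * indicator {-A..A} t)"
    using A by (intro integrable_mult_right integrable_real_indicator) auto
  show "AE t in lborel. norm (g t) \<le> norm (B * indicator {-A..A} t)"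
  proof (rule AE_I2)
    fix t
    show "norm (g t) \<le> norm (B * indicator {-A..A} t)"
      using g_bound[of t] g_supp[of t] by (cases "A < \<bar>t\<bar>") (auto simp: indicator_def)
  qed
qed measurable

lemma open_H: "open {z. 0 < Im z}" by (rule open_halfspace_Im_gt)

lemma F_hol: "F holomorphic_on {z. 0 < Im z}"
  unfolding F_def[abs_def] by (intro holomorphic_intros cauchy_transform_holomorphic g_int)
lemma F1_hol: "F1 holomorphic_on {z. 0 < Im z}"
  unfolding F1_def by (intro holomorphic_deriv F_hol open_H)
lemma F2_hol: "F2 holomorphic_on {z. 0 < Im z}"
  unfolding F2_def by (intro holomorphic_deriv F1_hol open_H)

lemma F_D: "0 < Im z \<Longrightarrow> (F has_field_derivative F1 z) (at z)"
  unfolding F1_def by (rule holomorphic_derivI[OF F_hol open_H]) simp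
lemma F1_D: "0 < Im z \<Longrightarrow> (F1 has_field_derivative F2 z) (at z)"
  unfolding F2_def by (rule holomorphic_derivI[OF F1_hol open_H]) simp

lemma zz_Im: "0 \<le> s \<Longrightarrow> 0 < Im (zz x s)" "Im (zz x s) = d + s" "Re (zz x s) = x" using d by (auto simp: zz_def)

lemma dist_bound: "\<exists>K>0. \<forall>x s t. 0 \<le> s \<longrightarrow> \<bar>t\<bar> \<le> A \<longrightarrow> 1 / norm (zz x s - of_real t) \<le> K * ew x s"
proof -
  \<comment> \<open>For the distance \<open>N\<close> below, \<open>1 + x^2 \<le> k1 * N^2\<close>
    and \<open>1 + s^2 \<le> k2 * N^2\<close>; multiplying the two and taking fourth roots gives the
    product weight.\<close>
  define k1 k2 where "k1 = 2 + (1 + 2 * A\<^sup>2) / d\<^sup>2" and "k2 = 1 + 1 / d\<^sup>2"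
  have k: "0 < k1" "0 < k2" using d by (auto simp: k1_def k2_def add_pos_nonneg)
  have main: "1 / norm (zz x s - of_real t) \<le> (k1 * k2) powr (1/4) * ew x s" if s: "0 \<le> s" and t: "\<bar>t\<bar> \<le> A" for x s t
  proof -
    define N where "N = norm (zz x s - of_real t)"
    have N2: "N\<^sup>2 = (x - t)\<^sup>2 + (d + s)\<^sup>2" unfolding N_def cmod_power2 by (simp add: zz_def)
    have N0: "0 < N" using zz_Im(1)[OF s, of x] by (auto simp: N_def complex_eq_iff)
    have "x\<^sup>2 \<le> 2 * (x - t)\<^sup>2 + 2 * t\<^sup>2"
    proof -
      have "0 \<le> (x - 2 * t)\<^sup>2" by simp
      then show ?thesis by (simp add: power2_eq_square algebra_simps)
    qed
    also have "t\<^sup>2 \<le> A\<^sup>2" using t by (metis abs_ge_zero power2_abs power_mono)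
    finally have x2: "1 + x\<^sup>2 \<le> 2 * (x - t)\<^sup>2 + (1 + 2 * A\<^sup>2)" by simp
    also have "\<dots> = 2 * (x - t)\<^sup>2 + ((1 + 2 * A\<^sup>2) / d\<^sup>2) * d\<^sup>2" using d by simp
    also have "\<dots> \<le> k1 * (x - t)\<^sup>2 + k1 * d\<^sup>2"
      using d by (intro add_mono mult_right_mono) (auto simp: k1_def)
    also have "\<dots> = k1 * ((x - t)\<^sup>2 + d\<^sup>2)" by (simp add: distrib_left)
    also have "d\<^sup>2 \<le> (d + s)\<^sup>2" using s d by (intro power_mono) auto
    finally have b1: "1 + x\<^sup>2 \<le> k1 * N\<^sup>2" using k N2 by (simp add: mult_left_mono)
    have "1 + s\<^sup>2 \<le> (1 / d\<^sup>2) * (d + s)\<^sup>2 + (d + s)\<^sup>2"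
    proof (intro add_mono)
      have "d\<^sup>2 \<le> (d + s)\<^sup>2" using s d by (intro power_mono) auto
      then show "1 \<le> (1 / d\<^sup>2) * (d + s)\<^sup>2" using d by simp
      show "s\<^sup>2 \<le> (d + s)\<^sup>2" using s d by (intro power_mono) auto
    qed
    also have "\<dots> = k2 * (d + s)\<^sup>2" by (simp add: k2_def distrib_right)
    also have "\<dots> \<le> k2 * N\<^sup>2" unfolding N2 using k by (intro mult_left_mono) auto
    finally have b2: "1 + s\<^sup>2 \<le> k2 * N\<^sup>2" .
    define Q where "Q = (1 + x\<^sup>2) * (1 + s\<^sup>2)"
    have Q0: "0 < Q" unfolding Q_def by (intro mult_pos_pos) (auto simp: add_pos_nonneg)
    have "Q \<le> (k1 * N\<^sup>2) * (k2 * N\<^sup>2)" unfolding Q_def using b1 b2 k by (intro mult_mono) auto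
    also have "\<dots> = (k1 * k2) * N ^ 4" by (simp add: power4_eq_xxxx power2_eq_square)
    finally have "Q powr (1/4) \<le> ((k1 * k2) * N ^ 4) powr (1/4)" using Q0 by (intro powr_mono2) auto
    also have "\<dots> = (k1 * k2) powr (1/4) * N"
      using k N0 powr_powr[of N 4 "1/4"] by (simp add: powr_mult powr_numeral)
    finally have "1 / N \<le> (k1 * k2) powr (1/4) / Q powr (1/4)" using N0 Q0 by (simp add: field_simps)
    then show ?thesis by (simp add: N_def ew_def Q_def powr_minus_divide)
  qed
  then show ?thesis using k by (intro exI[of _ "(k1 * k2) powr (1/4)"]) auto
qed

lemma ew_pos: "0 < ew x s"
proof -
  have "(1 + x\<^sup>2) * (1 + s\<^sup>2) \<noteq> 0" by (simp add: add_nonneg_eq_0_iff)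
  then show ?thesis unfolding ew_def by simp
qed

text \<open>Stated on a whole disc of radius \<open>d / 2\<close>, so that Cauchy's estimate hands
  the same decay to the derivatives. On the disc the distance to a real point drops by at most a
  factor 2, since the centre is at distance at least \<open>d\<close> from the axis.\<close>

lemma F_bound_near: "\<exists>K>0. \<forall>x s w. 0 \<le> s \<longrightarrow> norm (w - zz x s) \<le> d / 2 \<longrightarrow> norm (F w) \<le> K * ew x s"
proof -
  obtain K0 where K0: "0 < K0" "\<And>x s t. 0 \<le> s \<Longrightarrow> \<bar>t\<bar> \<le> A \<Longrightarrow> 1 / norm (zz x s - of_real t) \<le> K0 * ew x s"
    using dist_bound by blast
  define I where "I = (LINT t|lborel. \<bar>g t\<bar>)"
  have I: "0 \<le> I" unfolding I_def by simp
  have "norm (F w) \<le> ((1 / pi) * (2 * K0 * I) + 1) * ew x s" if s: "0 \<le> s" and w: "norm (w - zz x s) \<le> d / 2" for x s w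
  proof -
    have "norm (LINT t|lborel. of_real (g t) / (w - of_real t)) \<le> (LINT t|lborel. (2 * (K0 * ew x s)) * \<bar>g t\<bar>)"
    proof (rule Bochner_Integration.integral_norm_bound_integral)
      have Imw: "d / 2 \<le> Im w" using abs_Im_le_cmod[of "w - zz x s"] w s by (simp add: zz_Im(2))
      have low: "Im w \<le> norm (w - of_real t)" for t using abs_Im_le_cmod[of "w - of_real t"] by simp
      show "integrable lborel (\<lambda>t. of_real (g t) / (w - of_real t))"
      proof (rule Bochner_Integration.integrable_bound[where f="\<lambda>t. g t * (2 / d)"])
        show "AE t in lborel. norm (of_real (g t) / (w - of_real t)) \<le> norm (g t * (2 / d))"
        proof (rule AE_I2)
          fix t
          have "1 / norm (w - of_real t) \<le> 1 / (d / 2)" using low[of t] Imw d by (intro frac_le) auto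
          then have "\<bar>g t\<bar> * (1 / norm (w - of_real t)) \<le> \<bar>g t\<bar> * (2 / d)" by (intro mult_left_mono) auto
          then show "norm (of_real (g t) / (w - of_real t)) \<le> norm (g t * (2 / d))"
            using d by (simp add: norm_divide abs_mult)
        qed
      qed (use g_int in auto)
      show "integrable lborel (\<lambda>t. (2 * (K0 * ew x s)) * \<bar>g t\<bar>)" using g_int by auto
      fix t
      show "norm (of_real (g t) / (w - of_real t)) \<le> (2 * (K0 * ew x s)) * \<bar>g t\<bar>"
      proof (cases "\<bar>t\<bar> \<le> A")
        case True
        define N where "N = norm (zz x s - of_real t)"
        have "d + s \<le> N" using abs_Im_le_cmod[of "zz x s - of_real t"] by (simp add: N_def zz_Im(2))
        moreover have "N \<le> norm (w - of_real t) + norm (w - zz x s)"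
          unfolding N_def using norm_triangle_ineq4[of "w - of_real t" "w - zz x s"] by simp
        ultimately have "N / 2 \<le> norm (w - of_real t)" "0 < N" using w s d by auto
        then have "1 / norm (w - of_real t) \<le> 1 / (N / 2)" by (intro frac_le) auto
        also have "\<dots> = 2 * (1 / N)" by simp
        also have "\<dots> \<le> 2 * (K0 * ew x s)" using K0(2)[OF s True, of x] by (simp add: N_def)
        finally have "1 / norm (w - of_real t) \<le> 2 * (K0 * ew x s)" .
        then have "1 / norm (w - of_real t) * \<bar>g t\<bar> \<le> 2 * (K0 * ew x s) * \<bar>g t\<bar>" by (rule mult_right_mono) auto
        then show ?thesis by (simp add: norm_divide)
      next
        case False
        then show ?thesis using g_supp[of t] by simp
      qed
    qed
    also have "\<dots> = 2 * K0 * I * ew x s" by (simp add: I_def)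
    finally have "norm (F w) \<le> (1 / pi) * (2 * K0 * I * ew x s)"
      unfolding F_def by (simp add: norm_mult norm_divide divide_right_mono)
    also have "\<dots> \<le> ((1 / pi) * (2 * K0 * I) + 1) * ew x s" using ew_pos[of x s] by (simp add: distrib_right mult.assoc)
    finally show ?thesis .
  qed
  moreover have "0 < (1 / pi) * (2 * K0 * I) + 1" using K0 I by (intro add_nonneg_pos) auto
  ultimately show ?thesis by blast
qed

lemma F_bounds: "\<exists>K>0. \<forall>x s. 0 \<le> s \<longrightarrow> norm (F (zz x s)) \<le> K * ew x s \<and> norm (F1 (zz x s)) \<le> K * ew x s \<and> norm (F2 (zz x s)) \<le> K * ew x s"
proof -
  obtain K where K: "0 < K" "\<And>x s w. 0 \<le> s \<Longrightarrow> norm (w - zz x s) \<le> d / 2 \<Longrightarrow> norm (F w) \<le> K * ew x s"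
    using F_bound_near by blast
  define L where "L = K + K / (d / 2) + 2 * K / (d / 2)^2"
  have L: "K \<le> L" "K / (d / 2) \<le> L" "2 * K / (d / 2)^2 \<le> L" "0 < L" using K d by (auto simp: L_def add_nonneg_nonneg add_pos_pos)
  have "norm (F (zz x s)) \<le> L * ew x s \<and> norm (F1 (zz x s)) \<le> L * ew x s \<and> norm (F2 (zz x s)) \<le> L * ew x s" if s: "0 \<le> s" for x s
  proof -
    have sub: "cball (zz x s) (d / 2) \<subseteq> {z. 0 < Im z}"
    proof
      fix w assume "w \<in> cball (zz x s) (d / 2)"
      then have "norm (w - zz x s) \<le> d / 2" by (simp add: dist_norm norm_minus_commute)
      then have "d / 2 \<le> Im w" using abs_Im_le_cmod[of "w - zz x s"] s by (simp add: zz_Im(2))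
      then show "w \<in> {z. 0 < Im z}" using d by simp
    qed
    have hol: "F holomorphic_on ball (zz x s) (d / 2)"
      by (rule holomorphic_on_subset[OF F_hol]) (use sub ball_subset_cball in blast)
    have cont: "continuous_on (cball (zz x s) (d / 2)) F"
      by (rule continuous_on_subset[OF holomorphic_on_imp_continuous_on[OF F_hol] sub])
    have CI: "norm ((deriv ^^ n) F (zz x s)) \<le> fact n * (K * ew x s) / (d / 2) ^ n" for n
      using d K(2)[OF s] by (intro Cauchy_inequality[OF hol cont]) (auto simp: norm_minus_commute)
    have 0: "norm (F (zz x s)) \<le> K * ew x s" using K(2)[OF s, of "zz x s"] d by simp
    have 1: "norm (F1 (zz x s)) \<le> K / (d / 2) * ew x s" using CI[of 1] by (simp add: F1_def mult_ac)
    have 2: "norm (F2 (zz x s)) \<le> 2 * K / (d / 2)^2 * ew x s" using CI[of 2] by (simp add: F1_def F2_def numeral_2_eq_2 mult_ac)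
    have "k * ew x s \<le> L * ew x s" if "k \<le> L" for k using that ew_pos[of x s] by (intro mult_right_mono) auto
    then show ?thesis using 0 1 2 L by (meson order_trans)
  qed
  then show ?thesis using L(4) by blast
qed

definition W :: "real \<Rightarrow> real \<Rightarrow> real" where "W x s = Wf p (Re (F (zz x s))) (Im (F (zz x s)))"
definition Wx :: "real \<Rightarrow> real \<Rightarrow> real" where
  "Wx x s = Wf1 p (Re (F (zz x s))) (Im (F (zz x s))) (Re (F1 (zz x s))) (Im (F1 (zz x s)))"
definition Wxx :: "real \<Rightarrow> real \<Rightarrow> real" where
  "Wxx x s = Wf2 p (Re (F (zz x s))) (Im (F (zz x s))) (Re (F1 (zz x s))) (Im (F1 (zz x s))) (Re (F2 (zz x s))) (Im (F2 (zz x s)))"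
text \<open>Moving \<open>s\<close> multiplies the complex derivative by \<open>\<i>\<close>: the
  velocity is \<open>\<i> * F1\<close>, with parts \<open>- Im F1\<close> and \<open>Re F1\<close>,
  and the acceleration in \<open>Wss\<close> is \<open>- F2\<close>.\<close>

definition Ws :: "real \<Rightarrow> real \<Rightarrow> real" where
  "Ws x s = Wf1 p (Re (F (zz x s))) (Im (F (zz x s))) (- Im (F1 (zz x s))) (Re (F1 (zz x s)))"
definition Wss :: "real \<Rightarrow> real \<Rightarrow> real" where
  "Wss x s = Wf2 p (Re (F (zz x s))) (Im (F (zz x s))) (- Im (F1 (zz x s))) (Re (F1 (zz x s))) (- Re (F2 (zz x s))) (- Im (F2 (zz x s)))"

lemma line_deriv:
  assumes f: "(f has_field_derivative D) (at (z0 + of_real s * c))"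
  shows "((\<lambda>s. Re (f (z0 + of_real s * c))) has_real_derivative Re (c * D)) (at s)"
    "((\<lambda>s. Im (f (z0 + of_real s * c))) has_real_derivative Im (c * D)) (at s)"
proof -
  have "((\<lambda>s. z0 + of_real s * c) has_vector_derivative c) (at s)"
    by (auto intro!: derivative_eq_intros simp: has_vector_derivative_def scaleR_conv_of_real)
  then have "(f \<circ> (\<lambda>s. z0 + of_real s * c) has_vector_derivative c * D) (at s)"
    using f by (intro field_vector_diff_chain_at) auto
  then have *: "((\<lambda>s. f (z0 + of_real s * c)) has_vector_derivative c * D) (at s)" by (simp add: o_def)
  show "((\<lambda>s. Re (f (z0 + of_real s * c))) has_real_derivative Re (c * D)) (at s)"
    using bounded_linear.has_vector_derivative[OF bounded_linear_Re *]
    by (simp add: has_real_derivative_iff_has_vector_derivative)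
  show "((\<lambda>s. Im (f (z0 + of_real s * c))) has_real_derivative Im (c * D)) (at s)"
    using bounded_linear.has_vector_derivative[OF bounded_linear_Im *]
    by (simp add: has_real_derivative_iff_has_vector_derivative)
qed

lemma zz_x: "zz x s = (\<i> * of_real (d + s)) + of_real x * 1" by (simp add: zz_def)
lemma zz_s: "zz x s = (of_real x + \<i> * of_real d) + of_real s * \<i>" by (simp add: zz_def algebra_simps)

lemma W_x_deriv: assumes "0 \<le> s" shows "((\<lambda>x. W x s) has_real_derivative Wx x s) (at x)" "((\<lambda>x. Wx x s) has_real_derivative Wxx x s) (at x)"
proof -
  note 1 = line_deriv[OF F_D[OF zz_Im(1)[OF assms, of x], unfolded zz_x], unfolded zz_x[symmetric] mult_1_left]
  note 2 = line_deriv[OF F1_D[OF zz_Im(1)[OF assms, of x], unfolded zz_x], unfolded zz_x[symmetric] mult_1_left]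
  show "((\<lambda>x. W x s) has_real_derivative Wx x s) (at x)"
    unfolding W_def Wx_def by (rule Wf_deriv[OF p 1])
  show "((\<lambda>x. Wx x s) has_real_derivative Wxx x s) (at x)"
    unfolding Wx_def Wxx_def by (rule Wf1_deriv[OF p 1 2])
qed

lemma W_s_deriv: assumes "0 \<le> s" shows "((\<lambda>s. W x s) has_real_derivative Ws x s) (at s)" "((\<lambda>s. Ws x s) has_real_derivative Wss x s) (at s)"
proof -
  note 1 = line_deriv[OF F_D[OF zz_Im(1)[OF assms, of x], unfolded zz_s], unfolded zz_s[symmetric]]
  note 2 = line_deriv[OF F1_D[OF zz_Im(1)[OF assms, of x], unfolded zz_s], unfolded zz_s[symmetric]]
  have 1: "((\<lambda>s. Re (F (zz x s))) has_real_derivative - Im (F1 (zz x s))) (at s)" "((\<lambda>s. Im (F (zz x s))) has_real_derivative Re (F1 (zz x s))) (at s)"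
    using 1 by auto
  have 2: "((\<lambda>s. - Im (F1 (zz x s))) has_real_derivative - Re (F2 (zz x s))) (at s)" "((\<lambda>s. Re (F1 (zz x s))) has_real_derivative - Im (F2 (zz x s))) (at s)"
    using 2 by (auto intro!: DERIV_minus)
  show "((\<lambda>s. W x s) has_real_derivative Ws x s) (at s)"
    unfolding W_def Ws_def by (rule Wf_deriv[OF p 1])
  show "((\<lambda>s. Ws x s) has_real_derivative Wss x s) (at s)"
    unfolding Ws_def Wss_def by (rule Wf1_deriv[OF p 1 2])
qed

lemma laplacian_le: "Wss x s + Wxx x s \<le> 0"
  unfolding Wss_def Wxx_def using Wf2_laplacian[OF p] by (simp add: add.commute)

lemma rr_pos: "0 < rr x" "rr x \<le> 1" by (auto simp: rr_def add_pos_nonneg)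


text \<open>The place where \<open>6 \<le> p\<close> is exhausted: the exponent \<open>p / 4\<close>
  is at least 3/2, so after the factor \<open>s\<close> has consumed half a power of
  \<open>1 + s^2\<close>, a full power is left in each variable.\<close>

lemma ew_powr: assumes s: "0 \<le> s" shows "ew x s powr p \<le> rr x * rr s" "s * ew x s powr p \<le> rr x * rr s"
proof -
  define a b where "a = 1 + x\<^sup>2" and "b = 1 + s\<^sup>2"
  have ab: "1 \<le> a" "1 \<le> b" by (auto simp: a_def b_def)
  have ab1: "1 \<le> a * b" using ab mult_mono[of 1 a 1 b] by simp
  have "ew x s powr p = (a * b) powr (- (p / 4))" by (simp add: ew_def powr_powr a_def b_def)
  also have "\<dots> \<le> (a * b) powr (- 3/2)" using ab1 p by (intro powr_mono) auto
  also have "\<dots> = a powr (- 3/2) * b powr (- 3/2)" using ab by (simp add: powr_mult)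
  finally have e: "ew x s powr p \<le> a powr (- 3/2) * b powr (- 3/2)" .
  have inv: "y powr (- 3/2) \<le> 1 / y" if "1 \<le> y" for y :: real
    using powr_mono[of "-3/2" "-1" y] that by (simp add: powr_minus_divide)
  have "a powr (- 3/2) * b powr (- 3/2) \<le> (1 / a) * (1 / b)" using inv ab by (intro mult_mono) auto
  then show "ew x s powr p \<le> rr x * rr s" using e by (simp add: rr_def a_def b_def)
  have "s \<le> b powr (1/2)"
    using s ab real_le_rsqrt[of s b] by (simp add: powr_half_sqrt b_def)
  then have "s * b powr (- 3/2) \<le> b powr (1/2) * b powr (- 3/2)" by (intro mult_right_mono) auto
  also have "\<dots> = 1 / b" using ab powr_add[of b "1/2" "-3/2"] by (simp add: powr_minus_divide)
  finally have sb: "s * b powr (- 3/2) \<le> 1 / b" .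
  have "s * ew x s powr p \<le> s * (a powr (- 3/2) * b powr (- 3/2))" using e s by (intro mult_left_mono)
  also have "\<dots> = a powr (- 3/2) * (s * b powr (- 3/2))" by simp
  also have "\<dots> \<le> (1 / a) * (1 / b)" using inv[OF ab(1)] sb s ab by (intro mult_mono) auto
  finally show "s * ew x s powr p \<le> rr x * rr s" by (simp add: rr_def a_def b_def)
qed

lemma uv_bounds: "\<exists>K>0. \<forall>x s. 0 \<le> s \<longrightarrow> \<bar>Re (F (zz x s))\<bar> \<le> K * ew x s \<and> \<bar>Im (F (zz x s))\<bar> \<le> K * ew x s
   \<and> \<bar>Re (F1 (zz x s))\<bar> \<le> K * ew x s \<and> \<bar>Im (F1 (zz x s))\<bar> \<le> K * ew x s
   \<and> \<bar>Re (F2 (zz x s))\<bar> \<le> K * ew x s \<and> \<bar>Im (F2 (zz x s))\<bar> \<le> K * ew x s"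
  using F_bounds by (meson abs_Re_le_cmod abs_Im_le_cmod order_trans)

lemma W_bounds: "\<exists>C\<ge>0. \<forall>x s. 0 \<le> s \<longrightarrow>
  \<bar>W x s\<bar> \<le> C * (rr x * rr s) \<and> \<bar>Wx x s\<bar> \<le> C * (rr x * rr s) \<and> \<bar>Wxx x s\<bar> \<le> C * (rr x * rr s) \<and>
  s * \<bar>Ws x s\<bar> \<le> C * (rr x * rr s) \<and> s * \<bar>Wss x s\<bar> \<le> C * (rr x * rr s) \<and> s * \<bar>Wxx x s\<bar> \<le> C * (rr x * rr s)"
proof -
  obtain K where K: "K > 0" "\<And>x s. 0 \<le> s \<Longrightarrow> \<bar>Re (F (zz x s))\<bar> \<le> K * ew x s \<and> \<bar>Im (F (zz x s))\<bar> \<le> K * ew x s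
   \<and> \<bar>Re (F1 (zz x s))\<bar> \<le> K * ew x s \<and> \<bar>Im (F1 (zz x s))\<bar> \<le> K * ew x s
   \<and> \<bar>Re (F2 (zz x s))\<bar> \<le> K * ew x s \<and> \<bar>Im (F2 (zz x s))\<bar> \<le> K * ew x s"
    using uv_bounds by blast
  obtain c where c: "0 \<le> c"
   "\<And>M u v u1 v1 u2 v2. \<lbrakk>0 < M; \<bar>u\<bar> \<le> M; \<bar>v\<bar> \<le> M; \<bar>u1\<bar> \<le> M; \<bar>v1\<bar> \<le> M; \<bar>u2\<bar> \<le> M; \<bar>v2\<bar> \<le> M\<rbrakk> \<Longrightarrow>
     \<bar>Wf p u v\<bar> \<le> c * M powr p \<and> \<bar>Wf1 p u v u1 v1\<bar> \<le> c * M powr p \<and> \<bar>Wf2 p u v u1 v1 u2 v2\<bar> \<le> c * M powr p"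
    using Wf_bounds[OF p] by blast
  define C where "C = c * K powr p"
  have C: "0 \<le> C" using c by (simp add: C_def)
  have "\<bar>W x s\<bar> \<le> C * (rr x * rr s) \<and> \<bar>Wx x s\<bar> \<le> C * (rr x * rr s) \<and> \<bar>Wxx x s\<bar> \<le> C * (rr x * rr s) \<and>
    s * \<bar>Ws x s\<bar> \<le> C * (rr x * rr s) \<and> s * \<bar>Wss x s\<bar> \<le> C * (rr x * rr s) \<and> s * \<bar>Wxx x s\<bar> \<le> C * (rr x * rr s)" if s: "0 \<le> s" for x s
  proof -
    have M: "0 < K * ew x s" using K ew_pos by simp
    have eq: "c * (K * ew x s) powr p = C * ew x s powr p" using K ew_pos[of x s] by (simp add: C_def powr_mult)
    have "\<bar>W x s\<bar> \<le> C * ew x s powr p" "\<bar>Wx x s\<bar> \<le> C * ew x s powr p" "\<bar>Wxx x s\<bar> \<le> C * ew x s powr p"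
      "\<bar>Ws x s\<bar> \<le> C * ew x s powr p" "\<bar>Wss x s\<bar> \<le> C * ew x s powr p"
      using c(2)[OF M, of "Re (F (zz x s))" "Im (F (zz x s))" "Re (F1 (zz x s))" "Im (F1 (zz x s))" "Re (F2 (zz x s))" "Im (F2 (zz x s))"]
        c(2)[OF M, of "Re (F (zz x s))" "Im (F (zz x s))" "- Im (F1 (zz x s))" "Re (F1 (zz x s))" "- Re (F2 (zz x s))" "- Im (F2 (zz x s))"]
        K(2)[OF s, of x] unfolding eq W_def Wx_def Wxx_def Ws_def Wss_def by auto
    moreover have "C * ew x s powr p \<le> C * (rr x * rr s)" using ew_powr(1)[OF s] C by (intro mult_left_mono)
    moreover have "s * w \<le> C * (rr x * rr s)" if "w \<le> C * ew x s powr p" for w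
    proof -
      have "s * w \<le> s * (C * ew x s powr p)" using that s by (intro mult_left_mono)
      also have "\<dots> = C * (s * ew x s powr p)" by simp
      also have "\<dots> \<le> C * (rr x * rr s)" using ew_powr(2)[OF s] C by (intro mult_left_mono)
      finally show ?thesis .
    qed
    ultimately show ?thesis by (meson order_trans)
  qed
  then show ?thesis using C by blast
qed

section \<open>Green's identity in the half plane, weighted by the height\<close>

lemma rr_integrable: "integrable lborel rr"
proof -
  have *: "rr = (\<lambda>x. pi * pk 1 x)" by (auto simp: rr_def pk_def add.commute)
  show ?thesis unfolding * by (intro integrable_mult_right pk_integral) simp
qed

lemma rr_limits: "(rr \<longlongrightarrow> 0) at_top" "(rr \<longlongrightarrow> 0) at_bot"
  unfolding rr_def[abs_def] by real_asymp+

text \<open>Holomorphy, hence measurability, is known only in the upper half plane. The cut-off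
  versions are Borel on the whole plane and agree with the originals at every \<open>zz x s\<close>
  with \<open>0 \<le> s\<close>.\<close>

definition Fm :: "(complex \<Rightarrow> complex) \<Rightarrow> complex \<Rightarrow> complex" where "Fm f z = indicator {z. 0 < Im z} z *\<^sub>R f z"

lemma Fm_measurable [measurable]: "Fm F \<in> borel_measurable borel" "Fm F1 \<in> borel_measurable borel" "Fm F2 \<in> borel_measurable borel"
  unfolding Fm_def[abs_def]
  by (intro borel_measurable_continuous_on_indicator holomorphic_on_imp_continuous_on F_hol F1_hol F2_hol borel_open open_H)+

lemma Fm_eq: "0 \<le> s \<Longrightarrow> f (zz x s) = Fm f (zz x s)" using zz_Im(1)[of s x] by (simp add: Fm_def)

lemma zz_measurable [measurable]: "(\<lambda>(x, s). zz x s) \<in> borel_measurable (borel \<Otimes>\<^sub>M borel)"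
  "(\<lambda>s. zz x s) \<in> borel_measurable borel" "(\<lambda>x. zz x s) \<in> borel_measurable borel"
  unfolding zz_def by measurable

lemma mnq_measurable [measurable]: "mq q \<in> borel_measurable borel" "nq q \<in> borel_measurable borel"
  unfolding mq_def[abs_def] nq_def[abs_def] by measurable

text \<open>The weight \<open>s\<close> is harmonic and vanishes on the boundary line, so that two
  integrations by parts in \<open>s\<close> leave exactly the boundary value of
  \<open>W\<close>.\<close>

definition h1 :: "real \<Rightarrow> real \<Rightarrow> real" where "h1 x s = (if 0 < s then s * Wss x s else 0)"
definition h2 :: "real \<Rightarrow> real \<Rightarrow> real" where "h2 x s = (if 0 < s then s * Wxx x s else 0)"

lemma h_measurable [measurable]: "(\<lambda>(x, s). h1 x s) \<in> borel_measurable (borel \<Otimes>\<^sub>M borel)" "(\<lambda>(x, s). h2 x s) \<in> borel_measurable (borel \<Otimes>\<^sub>M borel)"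
proof -
  have "h1 x s = (if 0 < s then s * Wf2 p (Re (Fm F (zz x s))) (Im (Fm F (zz x s))) (- Im (Fm F1 (zz x s))) (Re (Fm F1 (zz x s))) (- Re (Fm F2 (zz x s))) (- Im (Fm F2 (zz x s))) else 0)" for x s
    unfolding h1_def Wss_def by (auto simp: Fm_eq[symmetric])
  then have 1: "(\<lambda>(x, s). h1 x s) = (\<lambda>(x, s). if 0 < s then s * Wf2 p (Re (Fm F (zz x s))) (Im (Fm F (zz x s))) (- Im (Fm F1 (zz x s))) (Re (Fm F1 (zz x s))) (- Re (Fm F2 (zz x s))) (- Im (Fm F2 (zz x s))) else 0)"
    by auto
  have "h2 x s = (if 0 < s then s * Wf2 p (Re (Fm F (zz x s))) (Im (Fm F (zz x s))) (Re (Fm F1 (zz x s))) (Im (Fm F1 (zz x s))) (Re (Fm F2 (zz x s))) (Im (Fm F2 (zz x s))) else 0)" for x s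
    unfolding h2_def Wxx_def by (auto simp: Fm_eq[symmetric])
  then have 2: "(\<lambda>(x, s). h2 x s) = (\<lambda>(x, s). if 0 < s then s * Wf2 p (Re (Fm F (zz x s))) (Im (Fm F (zz x s))) (Re (Fm F1 (zz x s))) (Im (Fm F1 (zz x s))) (Re (Fm F2 (zz x s))) (Im (Fm F2 (zz x s))) else 0)"
    by auto
  show "(\<lambda>(x, s). h1 x s) \<in> borel_measurable (borel \<Otimes>\<^sub>M borel)" unfolding 1 Wf2_def by measurable
  show "(\<lambda>(x, s). h2 x s) \<in> borel_measurable (borel \<Otimes>\<^sub>M borel)" unfolding 2 Wf2_def by measurable
qed

lemma h_integrable: "integrable (lborel \<Otimes>\<^sub>M lborel) (\<lambda>(x, s). h1 x s)" "integrable (lborel \<Otimes>\<^sub>M lborel) (\<lambda>(x, s). h2 x s)"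
proof -
  obtain C where C: "0 \<le> C" "\<And>x s. 0 \<le> s \<Longrightarrow> s * \<bar>Wss x s\<bar> \<le> C * (rr x * rr s)" "\<And>x s. 0 \<le> s \<Longrightarrow> s * \<bar>Wxx x s\<bar> \<le> C * (rr x * rr s)"
    using W_bounds by blast
  have i: "integrable (lborel \<Otimes>\<^sub>M lborel) (\<lambda>(x, s). (C * rr x) * rr s)"
    by (intro lborel_integrable_prod_mult integrable_mult_right rr_integrable)
  have b: "\<bar>h1 x s\<bar> \<le> C * rr x * rr s" "\<bar>h2 x s\<bar> \<le> C * rr x * rr s" for x s
    using C(2,3)[of s x] C(1) rr_pos(1)[of x] rr_pos(1)[of s] by (auto simp: h1_def h2_def abs_mult mult.assoc)
  show "integrable (lborel \<Otimes>\<^sub>M lborel) (\<lambda>(x, s). h1 x s)" "integrable (lborel \<Otimes>\<^sub>M lborel) (\<lambda>(x, s). h2 x s)"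
    using b C(1) rr_pos(1)
    by (auto intro!: Bochner_Integration.integrable_bound[OF i] AE_I2 order_trans[OF b(1)] order_trans[OF b(2)] simp: measurable_lborel1 split: prod.split)
qed

lemma isCont_Wf2:
  assumes "isCont a s" "isCont b s" "isCont a1 s" "isCont b1 s" "isCont a2 s" "isCont b2 s"
  shows "isCont (\<lambda>s. Wf2 p (a s) (b s) (a1 s) (b1 s) (a2 s) (b2 s)) (s::real)"
proof -
  have m2: "isCont (\<lambda>s. mq (p - 2) (b s)) s" using p by (intro isCont_o2[OF assms(2)] DERIV_isCont[OF mq_deriv]) auto
  have m4: "isCont (\<lambda>s. mq (p - 4) (b s)) s" using p by (intro isCont_o2[OF assms(2)] DERIV_isCont[OF mq_deriv]) auto
  have n0: "isCont (\<lambda>s. nq p (b s)) s" using p by (intro isCont_o2[OF assms(2)] DERIV_isCont[OF nq_deriv]) auto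
  have n2: "isCont (\<lambda>s. nq (p - 2) (b s)) s" using p by (intro isCont_o2[OF assms(2)] DERIV_isCont[OF nq_deriv]) auto
  show ?thesis unfolding Wf2_def by (intro continuous_intros m2 m4 n0 n2 assms)
qed

lemma F2_cont: assumes "0 < Im z" shows "isCont F z" "isCont F1 z" "isCont F2 z"
  using assms F_hol F1_hol F2_hol holomorphic_on_imp_continuous_on[of _ "{z. 0 < Im z}"]
    continuous_on_eq_continuous_at[OF open_H] by blast+

lemma zz_cont: "isCont (zz x) s" "isCont (\<lambda>x. zz x s) x" unfolding zz_def[abs_def] by (intro continuous_intros)+

lemma Wxx_integral: assumes s: "0 \<le> s" shows "(LINT x|lborel. Wxx x s) = 0"
proof -
  obtain C where C: "0 \<le> C" "\<And>x. \<bar>Wx x s\<bar> \<le> C * (rr x * rr s)" "\<And>x. \<bar>Wxx x s\<bar> \<le> C * (rr x * rr s)"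
    using W_bounds s by blast
  have cont: "isCont (\<lambda>x. Wxx x s) x" for x
    unfolding Wxx_def using zz_Im(1)[OF s, of x]
    by (intro isCont_Wf2 isCont_Re isCont_Im isCont_o2[OF zz_cont(2)] F2_cont)
  have lim: "((\<lambda>x. Wx x s) \<longlongrightarrow> 0) G" if "(rr \<longlongrightarrow> 0) G" for G
  proof (rule Lim_null_comparison)
    show "eventually (\<lambda>x. norm (Wx x s) \<le> C * (rr x * rr s)) G" using C(2) by simp
    have "((\<lambda>x. C * (rr x * rr s)) \<longlongrightarrow> C * (0 * rr s)) G" by (intro tendsto_intros that)
    then show "((\<lambda>x. C * (rr x * rr s)) \<longlongrightarrow> 0) G" by simp
  qed
  have "integrable lborel (\<lambda>x. Wxx x s)"
  proof (rule Bochner_Integration.integrable_bound[where f="\<lambda>x. C * (rr x * rr s)"])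
    show "AE x in lborel. norm (Wxx x s) \<le> norm (C * (rr x * rr s))"
      using C(3) by (intro AE_I2) (metis abs_ge_self order_trans real_norm_def)
    show "(\<lambda>x. Wxx x s) \<in> borel_measurable lborel"
      using cont by (auto intro!: borel_measurable_continuous_onI continuous_at_imp_continuous_on)
  qed (use rr_integrable in auto)
  then have "(LINT x|lborel. Wxx x s) = 0 - 0"
    using W_x_deriv(2)[OF s] cont lim rr_limits
    by (intro FTC_line[where F="\<lambda>x. Wx x s"]) (auto simp: has_real_derivative_iff_has_vector_derivative)
  then show ?thesis by simp
qed

lemma h1_integral: "(LINT s|lborel. h1 x s) = W x 0"
proof -
  obtain C where C: "0 \<le> C" "\<And>s. 0 \<le> s \<Longrightarrow> \<bar>W x s\<bar> \<le> C * (rr x * rr s)" "\<And>s. 0 \<le> s \<Longrightarrow> s * \<bar>Ws x s\<bar> \<le> C * (rr x * rr s)" "\<And>s. 0 \<le> s \<Longrightarrow> s * \<bar>Wss x s\<bar> \<le> C * (rr x * rr s)"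
    using W_bounds by blast
  \<comment> \<open>The primitive of \<open>s * Wss x s\<close> found by parts. It tends to 0 at
    infinity and equals \<open>- W x 0\<close> at the boundary.\<close>
  define G where "G s = s * Ws x s - W x s" for s
  have GD: "(G has_real_derivative s * Wss x s) (at s)" if "0 \<le> s" for s
    unfolding G_def[abs_def]
    by (rule DERIV_cong[OF DERIV_diff[OF DERIV_mult'[OF DERIV_ident W_s_deriv(2)[OF that]] W_s_deriv(1)[OF that]]]) simp
  have cont: "isCont (\<lambda>s. s * Wss x s) s" if "0 \<le> s" for s
    unfolding Wss_def using zz_Im(1)[OF that, of x]
    by (intro continuous_intros isCont_Wf2 isCont_Re isCont_Im isCont_o2[OF zz_cont(1)] F2_cont isCont_minus)
  have Gtop: "(G \<longlongrightarrow> 0) at_top"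
  proof (rule Lim_null_comparison)
    show "eventually (\<lambda>s. norm (G s) \<le> 2 * C * (rr x * rr s)) at_top"
      using eventually_ge_at_top[of 0]
    proof eventually_elim
      case (elim s)
      have "\<bar>s * Ws x s\<bar> \<le> C * (rr x * rr s)" using C(3)[OF elim] elim by (simp add: abs_mult)
      then show ?case using C(2)[OF elim] by (simp add: G_def)
    qed
    have "((\<lambda>s. 2 * C * (rr x * rr s)) \<longlongrightarrow> 2 * C * (rr x * 0)) at_top" by (intro tendsto_intros rr_limits)
    then show "((\<lambda>s. 2 * C * (rr x * rr s)) \<longlongrightarrow> 0) at_top" by simp
  qed
  have G0: "(G \<longlongrightarrow> - W x 0) (at_right 0)"
  proof -
    have "isCont G 0" using GD[of 0] by (simp add: DERIV_isCont)
    then have "(G \<longlongrightarrow> G 0) (at_right 0)" by (simp add: isCont_def filterlim_at_split)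
    then show ?thesis by (simp add: G_def)
  qed
  have int: "set_integrable lborel {0<..} (\<lambda>s. s * Wss x s)"
    unfolding set_integrable_def
  proof (rule Bochner_Integration.integrable_bound[where f="\<lambda>s. C * (rr x * rr s)"])
    show "AE s in lborel. norm (indicator {0<..} s *\<^sub>R (s * Wss x s)) \<le> norm (C * (rr x * rr s))"
      using C(1,4) rr_pos(1)[of x] rr_pos(1) by (intro AE_I2) (auto simp: indicator_def abs_mult less_imp_le)
    have "(\<lambda>s. indicator {0<..} s *\<^sub>R (s * Wss x s)) \<in> borel_measurable borel"
      by (rule borel_measurable_continuous_on_indicator) (use cont in \<open>auto intro!: continuous_at_imp_continuous_on\<close>)
    then show "(\<lambda>s. indicator {0<..} s *\<^sub>R (s * Wss x s)) \<in> borel_measurable lborel" by simp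
  qed (use rr_integrable in auto)
  have ein: "einterval (ereal 0) \<infinity> = {0<..}" by (auto simp: einterval_def)
  have "(LBINT s=ereal 0..\<infinity>. s * Wss x s) = 0 - (- W x 0)"
    using GD cont int G0 Gtop
    by (intro interval_integral_FTC_integrable[where F=G])
       (auto simp: has_real_derivative_iff_has_vector_derivative[symmetric] ereal_tendsto_simps less_imp_le ein)
  then have "(LINT s:{0<..}|lborel. s * Wss x s) = W x 0"
    by (simp add: interval_integral_to_infinity_eq)
  moreover have "(LINT s:{0<..}|lborel. s * Wss x s) = (LINT s|lborel. h1 x s)"
    unfolding set_lebesgue_integral_def h1_def by (intro Bochner_Integration.integral_cong) (auto simp: indicator_def)
  ultimately show ?thesis by simp
qed

lemma h2_integral: "(LINT x|lborel. h2 x s) = 0"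
  using Wxx_integral[of s] by (cases "0 < s") (auto simp: h2_def)

text \<open>The nonpositive function \<open>s * (Wss x s + Wxx x s)\<close> is integrated over the
  half plane. The first summand, integrated in \<open>s\<close> first, gives the integral of
  \<open>W x 0\<close>; the second, integrated in \<open>x\<close> first, gives 0.\<close>

lemma W_integral_le: "(LINT x|lborel. W x 0) \<le> 0"
proof -
  have "(LINT x|lborel. W x 0) = (LINT x|lborel. (LINT s|lborel. h1 x s))" by (simp add: h1_integral)
  also have "\<dots> = (LINT z|(lborel \<Otimes>\<^sub>M lborel). (case z of (x, s) \<Rightarrow> h1 x s))"
    by (rule lborel_pair.integral_fst[OF h_integrable(1)])
  finally have 1: "(LINT x|lborel. W x 0) = (LINT z|(lborel \<Otimes>\<^sub>M lborel). (case z of (x, s) \<Rightarrow> h1 x s))" .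
  have "(LINT z|(lborel \<Otimes>\<^sub>M lborel). (case z of (x, s) \<Rightarrow> h2 x s)) = (LINT s|lborel. (LINT x|lborel. h2 x s))"
    by (rule lborel_pair.integral_snd[symmetric, OF h_integrable(2)])
  then have 2: "(LINT z|(lborel \<Otimes>\<^sub>M lborel). (case z of (x, s) \<Rightarrow> h2 x s)) = 0" by (simp add: h2_integral)
  have "(LINT z|(lborel \<Otimes>\<^sub>M lborel). (case z of (x, s) \<Rightarrow> h1 x s) + (case z of (x, s) \<Rightarrow> h2 x s))
    \<le> (LINT z|((lborel :: real measure) \<Otimes>\<^sub>M (lborel :: real measure)). (0::real))"
  proof (rule integral_mono)
    fix z :: "real \<times> real"
    obtain x s where z: "z = (x, s)" by (cases z)
    show "(case z of (x, s) \<Rightarrow> h1 x s) + (case z of (x, s) \<Rightarrow> h2 x s) \<le> 0"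
      using laplacian_le[of x s] mult_left_mono[of "Wss x s + Wxx x s" 0 s]
      by (auto simp: z h1_def h2_def distrib_left)
  qed (use h_integrable in auto)
  then show ?thesis using 1 2 h_integrable by simp
qed

text \<open>At height \<open>d\<close> the kernel \<open>\<i> / (pi * (y + \<i> * d))\<close> has
  real part \<open>pk d y\<close> and imaginary part \<open>qk d y\<close>.\<close>

lemma F_eq: "Re (F (zz x 0)) = pc d g x" "Im (F (zz x 0)) = qc d g x"
proof -
  have fin: "integrable lborel (\<lambda>t. pk d (x - t) * g t)" "integrable lborel (\<lambda>t. qk d (x - t) * g t)"
  proof -
    have b: "\<bar>pk d s\<bar> \<le> (1/d + 1/2) / pi" for s
    proof -
      have "box_decay s \<le> 1" by (simp add: box_decay_real)
      then have "((1/d + 1/2) / pi) * box_decay s \<le> ((1/d + 1/2) / pi) * 1" using d by (intro mult_left_mono) auto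
      then show ?thesis using pk_decay[OF d, of s] by simp
    qed
    have gen: "integrable lborel (\<lambda>t. k (x - t) * g t)"
      if [measurable]: "k \<in> borel_measurable borel" and k: "\<And>s. \<bar>k s\<bar> \<le> c" for k :: "real \<Rightarrow> real" and c
    proof (rule Bochner_Integration.integrable_bound[where f="\<lambda>t. c * g t"])
      show "AE t in lborel. norm (k (x - t) * g t) \<le> norm (c * g t)"
      proof (rule AE_I2)
        fix t
        have "\<bar>k (x - t)\<bar> * \<bar>g t\<bar> \<le> \<bar>c\<bar> * \<bar>g t\<bar>" using k[of "x - t"] by (intro mult_right_mono) auto
        then show "norm (k (x - t) * g t) \<le> norm (c * g t)" by (simp add: abs_mult)
      qed
    qed (use g_int in auto)
    show "integrable lborel (\<lambda>t. pk d (x - t) * g t)"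
      by (rule gen[where k="pk d", OF _ b]) simp
    show "integrable lborel (\<lambda>t. qk d (x - t) * g t)"
      by (rule gen[where k="qk d", OF _ qk_bounded[OF d]]) simp
  qed
  have ptw: "(\<i> / of_real pi) * (of_real (g t) / (zz x 0 - of_real t)) = of_real (pk d (x - t) * g t) + \<i> * of_real (qk d (x - t) * g t)" for t
  proof -
    define y where "y = x - t"
    have yd: "y\<^sup>2 + d\<^sup>2 \<noteq> 0" using d by (simp add: sum_power2_eq_zero_iff)
    have z: "zz x 0 - of_real t = Complex y d" by (simp add: zz_def y_def complex_eq_iff)
    define N where "N = y\<^sup>2 + d\<^sup>2"
    have N: "N \<noteq> 0" using yd by (simp add: N_def)
    have inv: "1 / Complex y d = Complex (y / N) (- d / N)"
      by (simp add: complex_eq_iff Re_divide Im_divide N_def)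
    have "(\<i> / of_real pi) * (of_real (g t) / Complex y d) = (\<i> / of_real pi) * (of_real (g t) * (1 / Complex y d))" by simp
    also have "\<dots> = of_real (d / (pi * N) * g t) + \<i> * of_real (y / (pi * N) * g t)"
      unfolding inv using N by (simp add: complex_eq_iff field_simps)
    finally show ?thesis unfolding z y_def[symmetric] pk_def qk_def N_def[symmetric] .
  qed
  have "F (zz x 0) = (LINT t|lborel. (\<i> / of_real pi) * (of_real (g t) / (zz x 0 - of_real t)))"
    unfolding F_def by (rule integral_mult_right_zero[symmetric])
  also have "\<dots> = (LINT t|lborel. of_real (pk d (x - t) * g t) + \<i> * of_real (qk d (x - t) * g t))"
    unfolding ptw ..
  also have "\<dots> = (LINT t|lborel. complex_of_real (pk d (x - t) * g t)) + (LINT t|lborel. \<i> * complex_of_real (qk d (x - t) * g t))"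
    using fin by (intro Bochner_Integration.integral_add integrable_mult_right integrable_of_real)
  also have "\<dots> = of_real (LINT t|lborel. pk d (x - t) * g t) + \<i> * of_real (LINT t|lborel. qk d (x - t) * g t)"
    by (simp only: integral_mult_right_zero integral_complex_of_real)
  finally have *: "F (zz x 0) = of_real (LINT t|lborel. pk d (x - t) * g t) + \<i> * of_real (LINT t|lborel. qk d (x - t) * g t)" .
  have "pc d g x = (LINT t|lborel. pk d (x - t) * g t)" "qc d g x = (LINT t|lborel. qk d (x - t) * g t)"
    using lborel_integral_reflect[of "\<lambda>t. pk d t * g (x - t)" x] lborel_integral_reflect[of "\<lambda>t. qk d t * g (x - t)" x]
    by (simp_all add: pc_def qc_def)
  then show "Re (F (zz x 0)) = pc d g x" "Im (F (zz x 0)) = qc d g x" unfolding * by simp_all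
qed

text \<open>With \<open>a = p * (p - 1) / 2\<close>, either \<open>a * u^2 \<le> v^2 / 2\<close>,
  and the subtracted term is at most half of \<open>mq p v\<close>; or \<open>\<bar>v\<bar>\<close>
  is at most \<open>sqrt (2 * a)\<close> times \<open>\<bar>u\<bar>\<close>, and the subtracted term
  is bounded by a power of \<open>u\<close> alone.\<close>

lemma Wf_lower: "mq p v / 2 - (p * (p - 1)) powr (p / 2) / 2 * mq p u \<le> Wf p u v"
proof -
  define a where "a = p * (p - 1) / 2"
  have a: "0 < a" using p by (simp add: a_def)
  have mp: "mq (p - 2) v * v\<^sup>2 = mq p v"
  proof (cases "v = 0")
    case False
    have "mq p v = mq (p - 2) v * \<bar>v\<bar>\<^sup>2" unfolding mq_def using False powr_add[of "\<bar>v\<bar>" "p - 2" 2] by (simp add: powr_numeral)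
    then show ?thesis by simp
  qed (use p in \<open>simp add: mq_def\<close>)
  show ?thesis
  proof (cases "a * u\<^sup>2 \<le> v\<^sup>2 / 2")
    case True
    then have "a * u\<^sup>2 * mq (p - 2) v \<le> v\<^sup>2 / 2 * mq (p - 2) v" by (intro mult_right_mono) (auto simp: mq_def)
    also have "\<dots> = mq p v / 2" using mp by (simp add: mult.commute)
    finally have "a * (u\<^sup>2 * mq (p - 2) v) \<le> mq p v / 2" by (simp add: mult.assoc)
    moreover have "0 \<le> (p * (p - 1)) powr (p / 2) / 2 * mq p u" by (simp add: mq_def)
    ultimately show ?thesis unfolding Wf_def a_def[symmetric] by linarith
  next
    case False
    then have "v\<^sup>2 \<le> (2 * a) * u\<^sup>2" by simp
    then have "sqrt (v\<^sup>2) \<le> sqrt ((2 * a) * u\<^sup>2)" by (rule real_sqrt_le_mono)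
    then have v: "\<bar>v\<bar> \<le> (2 * a) powr (1/2) * \<bar>u\<bar>" using a by (simp add: real_sqrt_mult powr_half_sqrt)
    have u0: "u \<noteq> 0" using False by auto
    have "mq (p - 2) v \<le> ((2 * a) powr (1/2) * \<bar>u\<bar>) powr (p - 2)" unfolding mq_def using v p by (intro powr_mono2) auto
    also have "\<dots> = (2 * a) powr ((p - 2) / 2) * \<bar>u\<bar> powr (p - 2)" using a by (simp add: powr_mult powr_powr)
    finally have "a * u\<^sup>2 * mq (p - 2) v \<le> a * u\<^sup>2 * ((2 * a) powr ((p - 2) / 2) * \<bar>u\<bar> powr (p - 2))"
      using a by (intro mult_left_mono) auto
    also have "\<dots> = ((2 * a) * (2 * a) powr ((p - 2) / 2)) / 2 * (\<bar>u\<bar>\<^sup>2 * \<bar>u\<bar> powr (p - 2))" by simp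
    also have "(2 * a) * (2 * a) powr ((p - 2) / 2) = (2 * a) powr (p / 2)"
      using a powr_add[of "2 * a" 1 "(p - 2) / 2"] by (simp add: add_divide_distrib[symmetric] diff_divide_distrib)
    also have "\<bar>u\<bar>\<^sup>2 * \<bar>u\<bar> powr (p - 2) = mq p u"
      using u0 powr_add[of "\<bar>u\<bar>" 2 "p - 2"] by (simp add: mq_def powr_numeral)
    finally have "a * (u\<^sup>2 * mq (p - 2) v) \<le> (p * (p - 1)) powr (p / 2) / 2 * mq p u" by (simp add: a_def mult.assoc)
    moreover have "0 \<le> mq p v" by (simp add: mq_def)
    ultimately show ?thesis unfolding Wf_def a_def[symmetric] by linarith
  qed
qed

text \<open>M. Riesz's inequality at a fixed height: integrate \<open>Wf_lower\<close> and use
  \<open>W_integral_le\<close>. The powers of both functions must first be known to be integrable,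
  for otherwise the difference could not be split.\<close>

lemma conj_bound: "lp_int p (qc d g) \<le> ennreal ((p * (p - 1)) powr (p / 2)) * lp_int p (pc d g)"
proof -
  define K where "K = (p * (p - 1)) powr (p / 2)"
  obtain L where L: "0 < L" "\<And>x. \<bar>Re (F (zz x 0))\<bar> \<le> L * ew x 0" "\<And>x. \<bar>Im (F (zz x 0))\<bar> \<le> L * ew x 0"
    using uv_bounds by (metis order_refl)
  have int: "integrable lborel (\<lambda>x. mq p (w x))" if [measurable]: "w \<in> borel_measurable borel" and w: "\<And>x. \<bar>w x\<bar> \<le> L * ew x 0" for w
  proof (rule Bochner_Integration.integrable_bound[where f="\<lambda>x. L powr p * rr x"])
    show "AE x in lborel. norm (mq p (w x)) \<le> norm (L powr p * rr x)"
    proof (rule AE_I2)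
      fix x
      have "mq p (w x) \<le> (L * ew x 0) powr p" unfolding mq_def using w[of x] p by (intro powr_mono2) auto
      also have "\<dots> = L powr p * ew x 0 powr p" using L ew_pos[of x 0] by (simp add: powr_mult)
      also have "\<dots> \<le> L powr p * (rr x * rr 0)" using ew_powr(1)[of 0 x] by (intro mult_left_mono) auto
      finally show "norm (mq p (w x)) \<le> norm (L powr p * rr x)" using rr_pos(1)[of x] by (simp add: mq_def rr_def)
    qed
  qed (use rr_integrable in auto)
  have iu: "integrable lborel (\<lambda>x. mq p (pc d g x))" by (rule int) (use L(2) in \<open>auto simp: F_eq\<close>)
  have iv: "integrable lborel (\<lambda>x. mq p (qc d g x))" by (rule int) (use L(3) in \<open>auto simp: F_eq\<close>)
  have iW: "integrable lborel (\<lambda>x. W x 0)"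
  proof -
    obtain C where C: "0 \<le> C" "\<And>x. \<bar>W x 0\<bar> \<le> C * (rr x * rr 0)" using W_bounds by (metis order_refl)
    show ?thesis
    proof (rule Bochner_Integration.integrable_bound[where f="\<lambda>x. C * (rr x * rr 0)"])
      show "(\<lambda>x. W x 0) \<in> borel_measurable lborel" unfolding W_def F_eq Wf_def by measurable
      show "AE x in lborel. norm (W x 0) \<le> norm (C * (rr x * rr 0))"
        using C(2) by (intro AE_I2) (metis abs_ge_self order_trans real_norm_def)
    qed (use rr_integrable in auto)
  qed
  have "(LINT x|lborel. mq p (qc d g x) / 2 - K / 2 * mq p (pc d g x)) \<le> (LINT x|lborel. W x 0)"
  proof (rule integral_mono)
    show "mq p (qc d g x) / 2 - K / 2 * mq p (pc d g x) \<le> W x 0" for x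
      unfolding W_def F_eq K_def by (rule Wf_lower)
  qed (use iu iv iW in auto)
  also have "\<dots> \<le> 0" by (rule W_integral_le)
  finally have "(LINT x|lborel. mq p (qc d g x)) \<le> K * (LINT x|lborel. mq p (pc d g x))"
    using iu iv by simp
  then have "ennreal (LINT x|lborel. mq p (qc d g x)) \<le> ennreal (K * (LINT x|lborel. mq p (pc d g x)))" by (rule ennreal_leI)
  also have "\<dots> = ennreal K * ennreal (LINT x|lborel. mq p (pc d g x))"
    by (intro ennreal_mult) (auto simp: K_def mq_def)
  finally show ?thesis
    using iu iv by (simp add: lp_int_def K_def[symmetric] mq_def nn_integral_eq_integral)
qed

end

section \<open>The maximal truncated Hilbert transform\<close>

lemma lp_int_fatou:
  fixes f :: "'a::euclidean_space \<Rightarrow> real"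
  assumes [measurable]: "\<And>k::nat. F k \<in> borel_measurable borel" and p: "0 < p"
    and lim: "AE x in lborel. (\<lambda>k. F k x) \<longlonglongrightarrow> f x" and C: "\<And>k. lp_int p (F k) \<le> C"
  shows "lp_int p f \<le> C"
proof -
  have "lp_int p f = (\<integral>\<^sup>+x. liminf (\<lambda>k. ennreal (norm (F k x) powr p)) \<partial>lborel)"
    unfolding lp_int_def
  proof (rule nn_integral_cong_AE, use lim in eventually_elim)
    fix x assume "(\<lambda>k. F k x) \<longlonglongrightarrow> f x"
    then have "(\<lambda>k. ennreal (norm (F k x) powr p)) \<longlonglongrightarrow> ennreal (norm (f x) powr p)"
      using p by (intro tendsto_ennrealI tendsto_powr2 tendsto_intros) auto
    then show "ennreal (norm (f x) powr p) = liminf (\<lambda>k. ennreal (norm (F k x) powr p))"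
      by (rule lim_imp_Liminf[OF sequentially_bot, symmetric])
  qed
  also have "\<dots> \<le> liminf (\<lambda>k. \<integral>\<^sup>+x. ennreal (norm (F k x) powr p) \<partial>lborel)"
    by (rule nn_integral_liminf) measurable
  also have "\<dots> = liminf (\<lambda>k. lp_int p (F k))" by (simp add: lp_int_def)
  also have "\<dots> \<le> liminf (\<lambda>k::nat. C)" using C by (intro Liminf_mono) auto
  also have "\<dots> = C" by (simp add: Liminf_const)
  finally show ?thesis .
qed

lemma bounded_support_lp_finite:
  fixes g :: "real \<Rightarrow> real"
  assumes "\<And>t. \<bar>g t\<bar> \<le> B" "\<And>t. A < \<bar>t\<bar> \<Longrightarrow> g t = 0" "0 < A" "0 < p"
  shows "lp_int p g < \<infinity>"
proof -
  have "lp_int p g \<le> (\<integral>\<^sup>+t. ennreal (B powr p) * indicator {-A..A} t \<partial>lborel)"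
    unfolding lp_int_def
  proof (rule nn_integral_mono)
    fix t
    show "ennreal (norm (g t) powr p) \<le> ennreal (B powr p) * indicator {-A..A} t"
      using assms(1)[of t] assms(2)[of t] assms(4)
      by (cases "A < \<bar>t\<bar>") (auto simp: indicator_def intro!: ennreal_leI powr_mono2)
  qed
  also have "\<dots> < \<infinity>" using assms(3) by (simp add: nn_integral_cmult_indicator ennreal_mult_less_top)
  finally show ?thesis .
qed

lemma qc_bound:
  assumes "g \<in> borel_measurable borel" "\<And>t. \<bar>g t\<bar> \<le> B" "\<And>t. A < \<bar>t\<bar> \<Longrightarrow> g t = 0" "0 < A" "0 < d" "6 \<le> p"
  shows "lp_int p (qc d g) \<le> ennreal ((p * (p - 1)) powr (p / 2)) * lp_int p g"
proof -
  interpret conj_ext g A B d p by standard (use assms in auto)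
  have "lp_int p (qc d g) \<le> ennreal ((p * (p - 1)) powr (p / 2)) * lp_int p (pc d g)" by (rule conj_bound)
  also have "\<dots> \<le> ennreal ((p * (p - 1)) powr (p / 2)) * lp_int p g"
    using assms bounded_support_lp_finite[OF assms(2,3,4), where p=p]
    by (intro mult_left_mono pc_contraction) auto
  finally show ?thesis .
qed

lemma trH_qc_diff:
  assumes "g \<in> borel_measurable borel" "1 < p" "lp_int p g < \<infinity>" "0 < e"
  shows "\<bar>trH e g x\<bar> \<le> \<bar>qc e g x\<bar> + pc e (\<lambda>x. \<bar>g x\<bar>) x"
proof -
  note i = kernel_integrable[OF assms]
  have fin': "lp_int p (\<lambda>x. \<bar>g x\<bar>) < \<infinity>" using assms by (simp add: lp_int_def)
  have m: "(\<lambda>x. \<bar>g x\<bar>) \<in> borel_measurable borel" using assms by measurable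
  have "trH e g x - qc e g x = (LINT t|lborel. hk e t * g (x - t) - qk e t * g (x - t))"
    unfolding trH_def qc_def using i(2,3) by simp
  also have "norm \<dots> \<le> (LINT t|lborel. pk e t * \<bar>g (x - t)\<bar>)"
  proof (rule Bochner_Integration.integral_norm_bound_integral)
    fix t
    have "\<bar>hk e t - qk e t\<bar> * \<bar>g (x - t)\<bar> \<le> pk e t * \<bar>g (x - t)\<bar>"
      using kernel_diff_le[OF assms(4)] by (intro mult_right_mono) auto
    then show "norm (hk e t * g (x - t) - qk e t * g (x - t)) \<le> pk e t * \<bar>g (x - t)\<bar>"
      by (simp add: left_diff_distrib[symmetric] abs_mult)
  qed (use i kernel_integrable(1)[OF m assms(2) fin' assms(4)] in auto)
  finally show ?thesis unfolding pc_def real_norm_def by linarith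
qed

text \<open>Finitely many levels come first because then some height lies below all of them, as the
  semigroup argument requires. The supremum over all levels follows by monotone convergence, the
  bound being independent of \<open>n\<close>.\<close>

primrec tmax :: "(nat \<Rightarrow> real) \<Rightarrow> (real \<Rightarrow> real) \<Rightarrow> nat \<Rightarrow> real \<Rightarrow> real" where
  "tmax e g 0 x = \<bar>trH (e 0) g x\<bar>"
| "tmax e g (Suc n) x = max (tmax e g n x) \<bar>trH (e (Suc n)) g x\<bar>"

lemma tmax_measurable [measurable]: "g \<in> borel_measurable borel \<Longrightarrow> tmax e g n \<in> borel_measurable borel"
proof (induction n)
  case 0
  have "tmax e g 0 = (\<lambda>x. \<bar>trH (e 0) g x\<bar>)" by (rule ext) simp
  then show ?case using 0 by simp
next
  case (Suc n)
  have "tmax e g (Suc n) = (\<lambda>x. max (tmax e g n x) \<bar>trH (e (Suc n)) g x\<bar>)" by (rule ext) simp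
  then show ?case using Suc by simp
qed

lemma tmax_attained: "\<exists>i\<le>n. tmax e g n x = \<bar>trH (e i) g x\<bar>"
  by (induction n) (auto simp: max_def intro: le_SucI)

lemma tmax_ge: "i \<le> n \<Longrightarrow> \<bar>trH (e i) g x\<bar> \<le> tmax e g n x"
  by (induction n) (auto simp: le_Suc_eq)

lemma tmax_mono: "m \<le> n \<Longrightarrow> tmax e g m x \<le> tmax e g n x"
  by (induction n) (auto simp: le_Suc_eq)

lemma tmax_nonneg: "0 \<le> tmax e g n x" using tmax_ge[of 0 n e g x] by simp

lemma tmax_tendsto:
  assumes "\<And>i. (\<lambda>k. trH (e i) (G k) x) \<longlonglongrightarrow> trH (e i) g x"
  shows "(\<lambda>k. tmax e (G k) n x) \<longlonglongrightarrow> tmax e g n x"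
  by (induction n) (auto intro!: tendsto_max tendsto_rabs assms)

text \<open>The first factor is the constant of \<open>poisson_maximal\<close>; the second comes
  from adding the conjugate function and \<open>\<bar>g\<bar>\<close> with \<theta> = 1. Its size is
  irrelevant, only that it depends on \<open>p\<close> alone.\<close>

definition hmax_const :: "real \<Rightarrow> real" where
  "hmax_const p = (12 powr p * (3 powr p * (5 * p / (p - 1)))) * (2 powr p * (p * (p - 1)) powr (p / 2) + 2 powr p)"

lemma hmax_const_pos: "6 \<le> p \<Longrightarrow> 0 < hmax_const p"
  unfolding hmax_const_def by (intro mult_pos_pos add_nonneg_pos divide_pos_pos) auto

text \<open>Fix a height \<open>y\<close> below all levels. A truncation at level \<open>e i\<close>
  is at most the conjugate function at height \<open>e i\<close> plus a Poisson average of
  \<open>\<bar>g\<bar>\<close>, and by the semigroup identity the former is a Poisson average of the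
  conjugate function at height \<open>y\<close>. Only two fixed functions are averaged, whatever the
  level.\<close>

lemma tmax_bound_bounded:
  assumes [measurable]: "g \<in> borel_measurable borel" and b: "\<And>t. \<bar>g t\<bar> \<le> B" "\<And>t. A < \<bar>t\<bar> \<Longrightarrow> g t = 0" "0 < A" and p: "6 \<le> p"
    and e: "\<And>i. 0 < e i"
  shows "lp_int p (tmax e g n) \<le> ennreal (hmax_const p) * lp_int p g"
proof -
  have fin: "lp_int p g < \<infinity>" using b p by (intro bounded_support_lp_finite) auto
  define y where "y = Min (e ` {..n}) / 2"
  have y: "0 < y" unfolding y_def using e by (auto simp: Min_gr_iff)
  have ye: "y < e i" if "i \<le> n" for i
  proof -
    have "Min (e ` {..n}) \<le> e i" using that by (intro Min_le) auto
    then show ?thesis using e[of i] y by (simp add: y_def)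
  qed
  define v where "v = (\<lambda>x. \<bar>qc y g x\<bar>)"
  define h where "h = (\<lambda>x. \<bar>g x\<bar>)"
  have [measurable]: "v \<in> borel_measurable borel" "h \<in> borel_measurable borel" unfolding v_def h_def by measurable
  have gi: "integrable lborel g"
  proof -
    interpret conj_ext g A B y p by standard (use assms y in auto)
    show ?thesis by (rule g_int)
  qed
  have qb: "lp_int p v \<le> ennreal ((p * (p - 1)) powr (p / 2)) * lp_int p g"
    using qc_bound[OF assms(1) b y p] by (simp add: lp_int_def v_def)
  have fq: "lp_int p (qc y g) < \<infinity>" using qb fin by (auto simp: lp_int_def v_def ennreal_mult_less_top intro: le_less_trans)
  have "lp_int p (tmax e g n) \<le> ennreal (12 powr p * (3 powr p * (5 * p / (p - 1)))) * lp_int p (\<lambda>x. v x + h x)"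
  proof (rule poisson_maximal)
    fix x
    obtain i where i: "i \<le> n" "tmax e g n x = \<bar>trH (e i) g x\<bar>" using tmax_attained by blast
    have "\<bar>trH (e i) g x\<bar> \<le> \<bar>qc (e i) g x\<bar> + pc (e i) h x"
      unfolding h_def using p fin e by (intro trH_qc_diff) auto
    also have "qc (e i) g x = pc (e i - y) (qc y g) x"
      using pc_qc_semigroup[OF gi, of "e i - y" y x] ye[OF i(1)] y by simp
    also have "\<bar>pc (e i - y) (qc y g) x\<bar> \<le> pc (e i - y) v x"
    proof -
      have "\<bar>pc (e i - y) (qc y g) x\<bar> \<le> (LINT t|lborel. \<bar>pk (e i - y) t * qc y g (x - t)\<bar>)"
        unfolding pc_def by (rule integral_abs_bound)
      also have "\<dots> = pc (e i - y) v x"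
        unfolding pc_def v_def using pk_pos[of "e i - y"] ye[OF i(1)] by (simp add: abs_mult less_imp_le)
      finally show ?thesis .
    qed
    finally have "tmax e g n x \<le> pc (e i - y) v x + pc (e i) h x" unfolding i(2) by simp
    moreover have "0 < e i - y" "0 < e i" using ye[OF i(1)] e[of i] by auto
    ultimately show "\<exists>d>0. \<exists>d'>0. tmax e g n x \<le> pc d v x + pc d' h x" by blast
  qed (use p fin fq tmax_nonneg in \<open>auto simp: v_def h_def lp_int_def\<close>)
  also have "lp_int p (\<lambda>x. v x + h x) \<le> ennreal ((1 + 1) powr p) * lp_int p v + ennreal ((1 + 1/1) powr p) * lp_int p h"
    using p by (intro lp_int_add) auto
  also have "\<dots> \<le> ennreal (2 powr p) * (ennreal ((p * (p - 1)) powr (p / 2)) * lp_int p g) + ennreal (2 powr p) * lp_int p g"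
    using qb by (auto simp: lp_int_def h_def intro!: add_mono mult_left_mono)
  also have "\<dots> = ennreal (2 powr p * (p * (p - 1)) powr (p / 2) + 2 powr p) * lp_int p g"
    by (simp add: ennreal_mult distrib_right mult.assoc)
  finally have "lp_int p (tmax e g n) \<le> ennreal (12 powr p * (3 powr p * (5 * p / (p - 1)))) *
     (ennreal (2 powr p * (p * (p - 1)) powr (p / 2) + 2 powr p) * lp_int p g)"
    by (simp add: mult_left_mono)
  also have "\<dots> = ennreal (hmax_const p) * lp_int p g"
    unfolding hmax_const_def using p by (subst ennreal_mult) (auto simp: mult.assoc)
  finally show ?thesis .
qed

text \<open>Cut \<open>g\<close> off in size and position and let the cut-off grow. The constant
  does not see the cut-off, so Fatou's lemma transfers the bound.\<close>

lemma tmax_bound: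
  assumes [measurable]: "g \<in> borel_measurable borel" and p: "6 \<le> p" and e: "\<And>i. 0 < e i"
  shows "lp_int p (tmax e g n) \<le> ennreal (hmax_const p) * lp_int p g"
proof (cases "lp_int p g = \<infinity>")
  case True
  then show ?thesis using hmax_const_pos[OF p] by (simp add: ennreal_mult_top)
next
  case False
  then have fin: "lp_int p g < \<infinity>" by (simp add: top.not_eq_extremum)
  define G where "G k x = (if \<bar>g x\<bar> \<le> real k \<and> \<bar>x\<bar> \<le> real k then g x else 0)" for k :: nat and x
  have Gm[measurable]: "G k \<in> borel_measurable borel" for k unfolding G_def[abs_def] by measurable
  have Gle: "\<bar>G k x\<bar> \<le> \<bar>g x\<bar>" for k x by (simp add: G_def)
  have Glim: "(\<lambda>k. G k x) \<longlonglongrightarrow> g x" for x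
  proof (rule tendsto_eventually)
    obtain N where N: "max \<bar>g x\<bar> \<bar>x\<bar> \<le> real N" using real_arch_simple by blast
    show "eventually (\<lambda>k. G k x = g x) sequentially"
      using eventually_ge_at_top[of N] by eventually_elim (use N in \<open>auto simp: G_def\<close>)
  qed
  show ?thesis
  proof (rule lp_int_fatou)
    show "AE x in lborel. (\<lambda>k. tmax e (G k) n x) \<longlonglongrightarrow> tmax e g n x"
    proof (rule AE_I2, rule tmax_tendsto)
      fix x i
      show "(\<lambda>k. trH (e i) (G k) x) \<longlonglongrightarrow> trH (e i) g x"
        unfolding trH_def
      proof (rule integral_dominated_convergence[where w="\<lambda>t. \<bar>hk (e i) t * g (x - t)\<bar>"])
        show "integrable lborel (\<lambda>t. \<bar>hk (e i) t * g (x - t)\<bar>)"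
          using kernel_integrable(3)[OF assms(1) _ fin e[of i], of x] p by auto
        show "AE t in lborel. (\<lambda>k. hk (e i) t * G k (x - t)) \<longlonglongrightarrow> hk (e i) t * g (x - t)"
          using Glim by (intro AE_I2 tendsto_intros)
        show "AE t in lborel. norm (hk (e i) t * G k (x - t)) \<le> \<bar>hk (e i) t * g (x - t)\<bar>" for k
          using Gle by (intro AE_I2) (auto simp: abs_mult mult_left_mono)
      qed measurable
    qed
    fix k
    have "lp_int p (tmax e (G k) n) \<le> ennreal (hmax_const p) * lp_int p (G k)"
      using p e by (intro tmax_bound_bounded[where B="real k" and A="real k + 1"]) (auto simp: G_def)
    also have "\<dots> \<le> ennreal (hmax_const p) * lp_int p g"
      using Gle p by (intro mult_left_mono lp_int_mono) auto
    finally show "lp_int p (tmax e (G k) n) \<le> ennreal (hmax_const p) * lp_int p g" .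
  qed (use p in auto)
qed

text \<open>Truncations depend right-continuously on the level, so the supremum over all positive
  levels equals one over countably many and stays measurable.\<close>

definition prats :: "real set" where "prats = {q \<in> \<rat>. 0 < q}"
definition rs :: "nat \<Rightarrow> real" where "rs = from_nat_into prats"

lemma prats_countable: "countable prats" "prats \<noteq> {}"
proof -
  show "countable prats" unfolding prats_def by (rule countable_subset[OF _ countable_rat]) auto
  have "1 \<in> prats" by (simp add: prats_def)
  then show "prats \<noteq> {}" by auto
qed

lemma rs_pos: "0 < rs n" and range_rs: "range rs = prats"
proof -
  show *: "range rs = prats" unfolding rs_def using prats_countable by (intro range_from_nat_into) auto
  have "rs n \<in> prats" using * by auto
  then show "0 < rs n" by (simp add: prats_def)
qed

definition Hmax :: "real \<Rightarrow> (real \<Rightarrow> real) \<Rightarrow> real \<Rightarrow> ennreal" where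
  "Hmax p g x = (SUP n. ennreal (\<bar>trH (rs n) g x\<bar> powr p))"

lemma Hmax_measurable [measurable]: "g \<in> borel_measurable borel \<Longrightarrow> Hmax p g \<in> borel_measurable borel"
  unfolding Hmax_def[abs_def] by measurable

lemma Hmax_bound:
  assumes [measurable]: "g \<in> borel_measurable borel" and p: "6 \<le> p"
  shows "(\<integral>\<^sup>+x. Hmax p g x \<partial>lborel) \<le> ennreal (hmax_const p) * lp_int p g"
proof -
  have "(\<integral>\<^sup>+x. Hmax p g x \<partial>lborel) \<le> (\<integral>\<^sup>+x. (SUP n. ennreal (norm (tmax rs g n x) powr p)) \<partial>lborel)"
    unfolding Hmax_def
  proof (intro nn_integral_mono SUP_mono)
    fix x n
    show "\<exists>m\<in>UNIV. ennreal (\<bar>trH (rs n) g x\<bar> powr p) \<le> ennreal (norm (tmax rs g m x) powr p)"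
      using tmax_ge[of n n rs g x] tmax_nonneg[of rs g n x] p
      by (intro bexI[of _ n] ennreal_leI powr_mono2) auto
  qed
  also have "\<dots> = (SUP n. lp_int p (tmax rs g n))"
    unfolding lp_int_def
  proof (rule nn_integral_monotone_convergence_SUP)
    show "incseq (\<lambda>n x. ennreal (norm (tmax rs g n x) powr p))"
      using tmax_mono[of _ _ rs g] tmax_nonneg[of rs g] p
      by (auto simp: incseq_def le_fun_def intro!: ennreal_leI powr_mono2)
  qed measurable
  also have "\<dots> \<le> ennreal (hmax_const p) * lp_int p g"
    using p rs_pos by (intro SUP_least tmax_bound) auto
  finally show ?thesis .
qed

text \<open>Levels approach \<open>e\<close> from above, so the kernel at \<open>e\<close> is a
  common majorant. The strict cut-off \<open>e < \<bar>t\<bar>\<close> gives pointwise convergence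
  at every \<open>t\<close>: beyond \<open>e\<close> the kernels agree eventually, within
  \<open>e\<close> all of them vanish.\<close>

lemma trH_right_continuous:
  assumes [measurable]: "g \<in> borel_measurable borel" and p: "1 < p" and fin: "lp_int p g < \<infinity>"
    and e: "0 < e" and X: "\<And>k. e \<le> X k" "X \<longlonglongrightarrow> e"
  shows "(\<lambda>k. trH (X k) g x) \<longlonglongrightarrow> trH e g x"
  unfolding trH_def
proof (rule integral_dominated_convergence[where w="\<lambda>t. \<bar>hk e t * g (x - t)\<bar>"])
  show "integrable lborel (\<lambda>t. \<bar>hk e t * g (x - t)\<bar>)"
    using kernel_integrable(3)[OF assms(1) p fin e, of x] by auto
  show "AE t in lborel. (\<lambda>k. hk (X k) t * g (x - t)) \<longlonglongrightarrow> hk e t * g (x - t)"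
  proof (rule AE_I2, rule tendsto_mult[OF _ tendsto_const], rule tendsto_eventually)
    fix t
    show "eventually (\<lambda>k. hk (X k) t = hk e t) sequentially"
    proof (cases "e < \<bar>t\<bar>")
      case True
      then have "eventually (\<lambda>k. X k < \<bar>t\<bar>) sequentially" using X(2) by (rule order_tendstoD(2)[rotated])
      then show ?thesis by eventually_elim (use True in \<open>auto simp: hk_def\<close>)
    next
      case False
      then have "hk (X k) t = hk e t" for k using X(1)[of k] by (auto simp: hk_def)
      then show ?thesis by simp
    qed
  qed
  show "AE t in lborel. norm (hk (X k) t * g (x - t)) \<le> \<bar>hk e t * g (x - t)\<bar>" for k
    using X(1)[of k] by (intro AE_I2) (auto simp: hk_def abs_mult)
qed measurable

lemma rational_approx_above:
  assumes "0 < (e::real)"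
  shows "\<exists>X. (\<forall>k. X k \<in> prats \<and> e \<le> X k) \<and> X \<longlonglongrightarrow> e"
proof -
  have "\<exists>q\<in>\<rat>. e < q \<and> q < e + 1 / real (Suc k)" for k by (rule Rats_dense_in_real) simp
  then obtain X where X: "\<And>k. X k \<in> \<rat>" "\<And>k. e < X k" "\<And>k. X k < e + 1 / real (Suc k)" by metis
  have "X \<longlonglongrightarrow> e"
  proof (rule tendsto_sandwich)
    show "(\<lambda>k. e) \<longlonglongrightarrow> e" by simp
    have "(\<lambda>k. e + 1 / real (Suc k)) \<longlonglongrightarrow> e + 0" by (intro tendsto_add tendsto_const lim_1_over_n[THEN LIMSEQ_Suc])
    then show "(\<lambda>k. e + 1 / real (Suc k)) \<longlonglongrightarrow> e" by simp
  qed (use X in \<open>auto intro!: always_eventually less_imp_le\<close>)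
  moreover have "X k \<in> prats \<and> e \<le> X k" for k using X(1,2)[of k] assms by (auto simp: prats_def)
  ultimately show ?thesis by blast
qed

lemma trH_le_Hmax:
  assumes [measurable]: "g \<in> borel_measurable borel" and p: "1 < p" and fin: "lp_int p g < \<infinity>" and e: "0 < e"
  shows "ennreal (\<bar>trH e g x\<bar> powr p) \<le> Hmax p g x"
proof -
  obtain X where X: "\<And>k. X k \<in> prats" "\<And>k. e \<le> X k" "X \<longlonglongrightarrow> e" using rational_approx_above[OF e] by blast
  have lim: "(\<lambda>k. ennreal (\<bar>trH (X k) g x\<bar> powr p)) \<longlonglongrightarrow> ennreal (\<bar>trH e g x\<bar> powr p)"
    using p by (intro tendsto_ennrealI tendsto_powr2 tendsto_rabs tendsto_const trH_right_continuous[OF assms(1) p fin e X(2,3)]) auto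
  have "ennreal (\<bar>trH (X k) g x\<bar> powr p) \<le> Hmax p g x" for k
  proof -
    obtain n where "X k = rs n" using X(1)[of k] range_rs by auto
    then show ?thesis unfolding Hmax_def by (auto intro: SUP_upper2)
  qed
  then show ?thesis by (intro LIMSEQ_le_const2[OF lim]) blast
qed

section \<open>Principal values: symmetrisation, Lipschitz functions, almost everywhere
  limits\<close>

lemma trH_symmetric:
  assumes "g \<in> borel_measurable borel" "1 < p" "lp_int p g < \<infinity>" "0 < e"
  shows "trH e g x = (LINT t|lborel. hk e t * (g (x - t) - g (x + t))) / 2"
    and "integrable lborel (\<lambda>t. hk e t * (g (x - t) - g (x + t)))"
proof -
  note i = kernel_integrable(3)[OF assms, of x]
  have odd: "hk e (- t) = - hk e t" for t by (simp add: hk_def)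
  have r: "(LINT t|lborel. hk e t * g (x + t)) = - trH e g x"
  proof -
    have "(LINT t|lborel. hk e t * g (x + t)) = (LINT t|lborel. hk e (0 - t) * g (x + (0 - t)))"
      by (rule lborel_integral_reflect[symmetric, of "\<lambda>t. hk e t * g (x + t)" 0])
    then show ?thesis by (simp add: odd trH_def)
  qed
  have i2: "integrable lborel (\<lambda>t. hk e t * g (x + t))"
    using lborel_integrable_real_affine[OF i, of "-1" 0] by (simp add: odd)
  show "integrable lborel (\<lambda>t. hk e t * (g (x - t) - g (x + t)))"
    using i i2 by (simp add: right_diff_distrib)
  show "trH e g x = (LINT t|lborel. hk e t * (g (x - t) - g (x + t))) / 2"
    using i i2 r by (simp add: right_diff_distrib trH_def)
qed

definition hilR :: "(real \<Rightarrow> real) \<Rightarrow> real \<Rightarrow> real" where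
  "hilR g x = Lim (at_right 0) (\<lambda>e. trH e g x)"

lemma hilR_eqI: "((\<lambda>e. trH e g x) \<longlongrightarrow> l) (at_right 0) \<Longrightarrow> hilR g x = l"
  unfolding hilR_def by (intro tendsto_Lim) auto

text \<open>Oddness of the kernel turns the integrand into a symmetric difference of size
  \<open>L * \<bar>t\<bar>\<close>, which cancels the singularity: \<open>L / pi\<close> on the
  interval of radius \<open>R\<close> is a majorant for every level. The second claim is its
  integral, uniform in \<open>e\<close>.\<close>

lemma trH_symmetric_limit:
  assumes m[measurable]: "g \<in> borel_measurable borel" and p: "1 < p" and fin: "lp_int p g < \<infinity>"
    and L: "\<And>t. \<bar>g (x - t) - g (x + t)\<bar> \<le> L * \<bar>t\<bar>" and R: "\<And>t. R < \<bar>t\<bar> \<Longrightarrow> g (x - t) - g (x + t) = 0" "0 \<le> R" "0 \<le> L"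
  shows "((\<lambda>e. trH e g x) \<longlongrightarrow> (LINT t|lborel. hk 0 t * (g (x - t) - g (x + t))) / 2) (at_right 0)"
    and "\<And>e. 0 < e \<Longrightarrow> \<bar>trH e g x\<bar> \<le> L * R / pi"
proof -
  define w where "w t = L / pi * indicator {-R..R} t" for t :: real
  have wi: "integrable lborel w" "(LINT t|lborel. w t) = L / pi * (2 * R)"
    unfolding w_def[abs_def] using R by (auto intro!: integrable_mult_right integrable_real_indicator)
  have bnd: "norm (hk e t * (g (x - t) - g (x + t))) \<le> w t" if "0 \<le> e" for e t
  proof (cases "R < \<bar>t\<bar>")
    case False
    have "\<bar>hk e t\<bar> * \<bar>t\<bar> \<le> 1 / pi" using that by (cases "t = 0") (auto simp: hk_def abs_mult)
    then have "L * (\<bar>hk e t\<bar> * \<bar>t\<bar>) \<le> L * (1 / pi)" using R by (intro mult_left_mono) auto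
    moreover have "\<bar>hk e t\<bar> * \<bar>g (x - t) - g (x + t)\<bar> \<le> \<bar>hk e t\<bar> * (L * \<bar>t\<bar>)" using L by (intro mult_left_mono) auto
    moreover have "indicator {-R..R} t = (1::real)" using False by (auto simp: indicator_def)
    ultimately show ?thesis by (simp add: w_def abs_mult mult_ac)
  qed (use R in \<open>auto simp: w_def\<close>)
  show "((\<lambda>e. trH e g x) \<longlongrightarrow> (LINT t|lborel. hk 0 t * (g (x - t) - g (x + t))) / 2) (at_right 0)"
    unfolding tendsto_at_iff_sequentially comp_def
  proof (intro allI impI)
    fix X :: "nat \<Rightarrow> real" assume X: "\<forall>i. X i \<in> {0<..} - {0}" "X \<longlonglongrightarrow> 0"
    then have Xp: "0 < X i" for i by auto
    have "(\<lambda>i. (LINT t|lborel. hk (X i) t * (g (x - t) - g (x + t)))) \<longlonglongrightarrow> (LINT t|lborel. hk 0 t * (g (x - t) - g (x + t)))"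
    proof (rule integral_dominated_convergence[OF _ _ wi(1)])
      show "AE t in lborel. norm (hk (X i) t * (g (x - t) - g (x + t))) \<le> w t" for i
        using bnd Xp by (intro AE_I2) (auto intro: less_imp_le)
      show "AE t in lborel. (\<lambda>i. hk (X i) t * (g (x - t) - g (x + t))) \<longlonglongrightarrow> hk 0 t * (g (x - t) - g (x + t))"
      proof (rule AE_I2, rule tendsto_mult[OF _ tendsto_const], rule tendsto_eventually)
        fix t
        show "eventually (\<lambda>i. hk (X i) t = hk 0 t) sequentially"
        proof (cases "t = 0")
          case True
          then show ?thesis using Xp by (auto simp: hk_def)
        next
          case False
          then have "eventually (\<lambda>i. X i < \<bar>t\<bar>) sequentially" by (intro order_tendstoD(2)[OF X(2)]) simp
          then show ?thesis by eventually_elim (use False in \<open>auto simp: hk_def\<close>)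
        qed
      qed
    qed measurable
    then have "(\<lambda>i. (LINT t|lborel. hk (X i) t * (g (x - t) - g (x + t))) / 2) \<longlonglongrightarrow> (LINT t|lborel. hk 0 t * (g (x - t) - g (x + t))) / 2"
      by (intro tendsto_divide tendsto_const) auto
    then show "(\<lambda>i. trH (X i) g x) \<longlonglongrightarrow> (LINT t|lborel. hk 0 t * (g (x - t) - g (x + t))) / 2"
      by (simp only: trH_symmetric(1)[OF m p fin Xp])
  qed
  fix e :: real assume e: "0 < e"
  have "\<bar>LINT t|lborel. hk e t * (g (x - t) - g (x + t))\<bar> \<le> (LINT t|lborel. w t)"
    using Bochner_Integration.integral_norm_bound_integral[OF trH_symmetric(2)[OF m p fin e, of x] wi(1)] bnd e
    by (auto intro: less_imp_le)
  then show "\<bar>trH e g x\<bar> \<le> L * R / pi" unfolding trH_symmetric(1)[OF m p fin e, of x] wi(2) by (simp add: mult_ac)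
qed

lemma lipc_trH_limit:
  assumes "lipc (g::real \<Rightarrow> real)"
  shows "((\<lambda>e. trH e g x) \<longlongrightarrow> hilR g x) (at_right 0)"
    and "hilR g x = (LINT t|lborel. hk 0 t * (g (x - t) - g (x + t))) / 2"
proof -
  obtain C A B where c: "0 < C" "0 < A" "0 < B" "\<And>x y. \<bar>g x - g y\<bar> \<le> C * norm (x - y)"
      "\<And>x. norm x > A \<Longrightarrow> g x = 0" "\<And>x. \<bar>g x\<bar> \<le> B"
    using lipc_bounds[OF assms] by blast
  have *: "((\<lambda>e. trH e g x) \<longlongrightarrow> (LINT t|lborel. hk 0 t * (g (x - t) - g (x + t))) / 2) (at_right 0)"
  proof (rule trH_symmetric_limit(1)[where p=2 and L="2 * C" and R="A + \<bar>x\<bar>"])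
    show "\<bar>g (x - t) - g (x + t)\<bar> \<le> 2 * C * \<bar>t\<bar>" for t using c(4)[of "x - t" "x + t"] by (simp add: mult_ac)
    show "A + \<bar>x\<bar> < \<bar>t\<bar> \<Longrightarrow> g (x - t) - g (x + t) = 0" for t using c(5)[of "x - t"] c(5)[of "x + t"] by auto
  qed (use c lipc_measurable[OF assms] lipc_lp_finite[OF assms, of 2] in auto)
  then show **: "hilR g x = (LINT t|lborel. hk 0 t * (g (x - t) - g (x + t))) / 2" by (rule hilR_eqI)
  show "((\<lambda>e. trH e g x) \<longlongrightarrow> hilR g x) (at_right 0)" unfolding ** by (rule *)
qed

lemma trH_diff:
  assumes "f \<in> borel_measurable borel" "g \<in> borel_measurable borel" "1 < p" "lp_int p f < \<infinity>" "lp_int p g < \<infinity>" "0 < e"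
  shows "trH e (\<lambda>x. f x - g x) x = trH e f x - trH e g x"
  unfolding trH_def using kernel_integrable(3)[OF assms(1,3,4,6), of x] kernel_integrable(3)[OF assms(2,3,5,6), of x]
  by (simp add: right_diff_distrib)

text \<open>Exchange of two limits: the approximations are uniform in \<open>e\<close>, so their
  limits form a Cauchy sequence and \<open>f\<close> inherits its limit.\<close>

lemma lim_uniform_approx:
  fixes f :: "real \<Rightarrow> real"
  assumes a: "\<And>n. (F n \<longlongrightarrow> l n) (at_right 0)" and r: "r \<longlonglongrightarrow> 0"
    and b: "\<And>n e. 0 < e \<Longrightarrow> \<bar>f e - F n e\<bar> \<le> r n"
  shows "\<exists>L. (f \<longlongrightarrow> L) (at_right 0) \<and> l \<longlonglongrightarrow> L"
proof -
  have lr: "\<bar>l n - l m\<bar> \<le> r n + r m" for n m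
  proof (rule tendsto_upperbound)
    show "((\<lambda>e. \<bar>F n e - F m e\<bar>) \<longlongrightarrow> \<bar>l n - l m\<bar>) (at_right 0)" by (intro tendsto_intros a)
    show "eventually (\<lambda>e. \<bar>F n e - F m e\<bar> \<le> r n + r m) (at_right 0)"
    proof (rule eventually_at_rightI[of 0 1])
      fix e :: real assume "e \<in> {0<..<1}"
      then show "\<bar>F n e - F m e\<bar> \<le> r n + r m" using b[of e n] b[of e m] by simp
    qed simp
  qed simp
  have "Cauchy l"
  proof (rule metric_CauchyI)
    fix eps :: real assume "0 < eps"
    then have "eventually (\<lambda>n. r n < eps / 2) sequentially" by (intro order_tendstoD(2)[OF r]) simp
    then obtain N where N: "\<And>n. N \<le> n \<Longrightarrow> r n < eps / 2" by (auto simp: eventually_sequentially)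
    have "dist (l m) (l n) < eps" if "N \<le> m" "N \<le> n" for m n
      using lr[of m n] N[OF that(1)] N[OF that(2)] by (simp add: dist_real_def)
    then show "\<exists>M. \<forall>m\<ge>M. \<forall>n\<ge>M. dist (l m) (l n) < eps" by blast
  qed
  then obtain L where L: "l \<longlonglongrightarrow> L" using Cauchy_convergent_iff convergent_def by blast
  have "(f \<longlongrightarrow> L) (at_right 0)"
  proof (rule swap_uniform_limit[where f=F and g=l and F=sequentially])
    show "uniform_limit {0<..} F f sequentially"
    proof (rule uniform_limitI)
      fix eps :: real assume "0 < eps"
      then have "eventually (\<lambda>n. r n < eps) sequentially" by (intro order_tendstoD(2)[OF r])
      then show "eventually (\<lambda>n. \<forall>x\<in>{0<..}. dist (F n x) (f x) < eps) sequentially"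
      proof eventually_elim
        case (elim n)
        then show ?case using b[of _ n] by (metis abs_minus_commute dist_real_def greaterThan_iff le_less_trans)
      qed
    qed
  qed (use a L in auto)
  then show ?thesis using L by blast
qed

lemma ennreal_powr_root_le:
  assumes "ennreal (\<bar>a\<bar> powr p) \<le> ennreal r" "0 < p" "0 \<le> r"
  shows "\<bar>a\<bar> \<le> r powr (1 / p)"
proof -
  have "\<bar>a\<bar> powr p \<le> r" using assms by (simp add: ennreal_le_iff)
  then have "(\<bar>a\<bar> powr p) powr (1 / p) \<le> r powr (1 / p)" using assms by (intro powr_mono2) auto
  then show ?thesis using assms by (simp add: powr_powr)
qed

text \<open>Choose the approximants with errors below \<open>(1/2)^n\<close>. By the maximal
  inequality the sum over \<open>n\<close> of the maximal functions of \<open>g - \<phi> n\<close>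
  has finite integral, so it is finite almost everywhere. At such a point the truncations of
  \<open>g - \<phi> n\<close> tend to 0 uniformly in the level, which gives both limits at
  once.\<close>

lemma hilR_approx:
  assumes m[measurable]: "g \<in> borel_measurable borel" and p: "6 \<le> p" and fin: "lp_int p g < \<infinity>"
  shows "\<exists>\<phi>. (\<forall>n. lipc (\<phi> n)) \<and> (\<lambda>n. lp_int p (\<lambda>x. g x - \<phi> n x)) \<longlonglongrightarrow> 0 \<and>
     (AE x in lborel. ((\<lambda>e. trH e g x) \<longlongrightarrow> hilR g x) (at_right 0) \<and> (\<lambda>n. hilR (\<phi> n) x) \<longlonglongrightarrow> hilR g x)"
proof -
  have "\<exists>\<phi>. lipc \<phi> \<and> lp_int p (\<lambda>x. g x - \<phi> x) < ennreal ((1/2)^n)" for n :: nat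
    using p by (intro lp_density m fin) auto
  then obtain \<phi> where \<phi>: "\<And>n. lipc (\<phi> n)" "\<And>n. lp_int p (\<lambda>x. g x - \<phi> n x) < ennreal ((1/2)^n)" by metis
  note [measurable] = lipc_measurable[OF \<phi>(1)]
  have lim0: "(\<lambda>n. lp_int p (\<lambda>x. g x - \<phi> n x)) \<longlonglongrightarrow> 0"
  proof (rule tendsto_sandwich)
    show "(\<lambda>n::nat. 0::ennreal) \<longlonglongrightarrow> 0" by simp
    have "(\<lambda>n. (1/2::real)^n) \<longlonglongrightarrow> 0" by (intro LIMSEQ_power_zero) simp
    then show "(\<lambda>n. ennreal ((1/2)^n)) \<longlonglongrightarrow> 0" by (auto dest: tendsto_ennrealI)
  qed (use \<phi>(2) in \<open>auto intro!: always_eventually less_imp_le\<close>)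
  have "(\<integral>\<^sup>+x. (\<Sum>n. Hmax p (\<lambda>x. g x - \<phi> n x) x) \<partial>lborel) = (\<Sum>n. \<integral>\<^sup>+x. Hmax p (\<lambda>x. g x - \<phi> n x) x \<partial>lborel)"
    by (rule nn_integral_suminf) measurable
  also have "\<dots> \<le> (\<Sum>n. ennreal (hmax_const p * (1/2)^n))"
  proof (rule suminf_le)
    fix n
    have "(\<integral>\<^sup>+x. Hmax p (\<lambda>x. g x - \<phi> n x) x \<partial>lborel) \<le> ennreal (hmax_const p) * lp_int p (\<lambda>x. g x - \<phi> n x)"
      using p by (intro Hmax_bound) auto
    also have "\<dots> \<le> ennreal (hmax_const p) * ennreal ((1/2)^n)" using \<phi>(2)[of n] by (intro mult_left_mono) auto
    also have "\<dots> = ennreal (hmax_const p * (1/2)^n)" using hmax_const_pos[OF p] by (subst ennreal_mult) auto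
    finally show "(\<integral>\<^sup>+x. Hmax p (\<lambda>x. g x - \<phi> n x) x \<partial>lborel) \<le> ennreal (hmax_const p * (1/2)^n)" .
  qed auto
  also have "\<dots> = ennreal (\<Sum>n. hmax_const p * (1/2)^n)"
    using hmax_const_pos[OF p] by (intro suminf_ennreal2) (auto intro!: summable_mult summable_geometric)
  also have "\<dots> < \<infinity>" by simp
  finally have "(\<integral>\<^sup>+x. (\<Sum>n. Hmax p (\<lambda>x. g x - \<phi> n x) x) \<partial>lborel) \<noteq> \<infinity>" by simp
  then have "AE x in lborel. (\<Sum>n. Hmax p (\<lambda>x. g x - \<phi> n x) x) \<noteq> \<infinity>"
    by (intro nn_integral_PInf_AE) auto
  then have "AE x in lborel. ((\<lambda>e. trH e g x) \<longlongrightarrow> hilR g x) (at_right 0) \<and> (\<lambda>n. hilR (\<phi> n) x) \<longlonglongrightarrow> hilR g x"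
  proof eventually_elim
    case (elim x)
    have ne: "Hmax p (\<lambda>x. g x - \<phi> n x) x \<noteq> \<infinity>" for n
    proof
      assume "Hmax p (\<lambda>x. g x - \<phi> n x) x = \<infinity>"
      moreover have "Hmax p (\<lambda>x. g x - \<phi> n x) x \<le> (\<Sum>n. Hmax p (\<lambda>x. g x - \<phi> n x) x)"
        using sum_le_suminf[of "\<lambda>n. Hmax p (\<lambda>x. g x - \<phi> n x) x" "{n}"] by simp
      ultimately show False using elim by (simp add: top_unique)
    qed
    define r where "r n = enn2real (Hmax p (\<lambda>x. g x - \<phi> n x) x)" for n
    have rH: "Hmax p (\<lambda>x. g x - \<phi> n x) x = ennreal (r n)" for n unfolding r_def using ne[of n] by (simp add: top.not_eq_extremum)
    have r0: "0 \<le> r n" for n by (simp add: r_def)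
    have "summable r" using elim unfolding rH by (intro summable_suminf_not_top r0) auto
    then have "r \<longlonglongrightarrow> 0" by (rule summable_LIMSEQ_zero)
    then have "(\<lambda>n. r n powr (1 / p)) \<longlonglongrightarrow> 0 powr (1 / p)" using p r0 by (intro tendsto_powr2 tendsto_const) auto
    then have rp: "(\<lambda>n. r n powr (1 / p)) \<longlonglongrightarrow> 0" by simp
    have "\<exists>L. ((\<lambda>e. trH e g x) \<longlongrightarrow> L) (at_right 0) \<and> (\<lambda>n. hilR (\<phi> n) x) \<longlonglongrightarrow> L"
    proof (rule lim_uniform_approx[OF _ rp])
      show "((\<lambda>e. trH e (\<phi> n) x) \<longlongrightarrow> hilR (\<phi> n) x) (at_right 0)" for n by (rule lipc_trH_limit(1)[OF \<phi>(1)])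
      fix n and e :: real assume e: "0 < e"
      have f: "lp_int p (\<phi> n) < \<infinity>" using \<phi>(1)[of n] p by (intro lipc_lp_finite) auto
      have "ennreal (\<bar>trH e (\<lambda>x. g x - \<phi> n x) x\<bar> powr p) \<le> ennreal (r n)"
        unfolding rH[symmetric] using p e fin f by (intro trH_le_Hmax lp_int_diff_finite) auto
      then have "\<bar>trH e (\<lambda>x. g x - \<phi> n x) x\<bar> \<le> r n powr (1 / p)" using p r0 by (intro ennreal_powr_root_le) auto
      then show "\<bar>trH e g x - trH e (\<phi> n) x\<bar> \<le> r n powr (1 / p)"
        using trH_diff[of g "\<phi> n" p e x] p fin f e by simp
    qed
    then show ?case using hilR_eqI by metis
  qed
  then show ?thesis using \<phi>(1) lim0 by blast
qed

lemma hilR_converges: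
  assumes "g \<in> borel_measurable borel" "6 \<le> p" "lp_int p g < \<infinity>"
  shows "AE x in lborel. ((\<lambda>e. trH e g x) \<longlongrightarrow> hilR g x) (at_right 0)"
  using hilR_approx[OF assms] by auto

lemma hilR_bound:
  assumes m: "g \<in> borel_measurable borel" and p: "6 \<le> p" and fin: "lp_int p g < \<infinity>"
  shows "lp_int p (hilR g) \<le> ennreal (hmax_const p) * lp_int p g"
proof -
  have "lp_int p (hilR g) \<le> (\<integral>\<^sup>+x. Hmax p g x \<partial>lborel)"
    unfolding lp_int_def
  proof (rule nn_integral_mono_AE, use hilR_converges[OF assms] in eventually_elim)
    case (elim x)
    have "((\<lambda>e. ennreal (\<bar>trH e g x\<bar> powr p)) \<longlongrightarrow> ennreal (\<bar>hilR g x\<bar> powr p)) (at_right 0)"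
      using p elim by (intro tendsto_ennrealI tendsto_powr2 tendsto_rabs tendsto_const) auto
    then have "ennreal (\<bar>hilR g x\<bar> powr p) \<le> Hmax p g x"
    proof (rule tendsto_upperbound)
      show "eventually (\<lambda>e. ennreal (\<bar>trH e g x\<bar> powr p) \<le> Hmax p g x) (at_right 0)"
        using p fin by (intro eventually_at_rightI[of 0 1] trH_le_Hmax m) auto
    qed simp
    then show ?case by simp
  qed
  also have "\<dots> \<le> ennreal (hmax_const p) * lp_int p g" by (rule Hmax_bound[OF m p])
  finally show ?thesis .
qed

section \<open>Directional Hilbert transforms\<close>

text \<open>The Hilbert transform along the line through \<open>x\<close> with direction
  \<open>z\<close>, evaluated at \<open>x\<close>. The direction is not normalised and
  \<open>e\<close> counts multiples of \<open>z\<close>, so the truncation distance in space is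
  \<open>e * norm z\<close>.\<close>

definition dirH :: "real \<Rightarrow> ('a::euclidean_space \<Rightarrow> real) \<Rightarrow> 'a \<Rightarrow> 'a \<Rightarrow> real" where
  "dirH e f x z = trH e (\<lambda>s. f (x + s *\<^sub>R z)) 0"

lemma dirH_line: "trH e (\<lambda>s. f (x + s *\<^sub>R z)) s = dirH e f (x + s *\<^sub>R z) z"
  unfolding dirH_def trH_def by (simp add: algebra_simps)

lemma dirH_measurable [measurable]:
  fixes f :: "'a::euclidean_space \<Rightarrow> real"
  assumes [measurable]: "f \<in> borel_measurable borel"
  shows "(\<lambda>(x, z). dirH e f x z) \<in> borel_measurable (borel \<Otimes>\<^sub>M borel)"
  unfolding dirH_def trH_def split_beta' by measurable

text \<open>The density used in \<open>line_fubini\<close>. It is positive everywhere, which is what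
  lets finiteness be read off on almost every line.\<close>

definition pk1 :: "real \<Rightarrow> ennreal" where "pk1 s = ennreal (pk 1 s)"

lemma pk1_measurable [measurable]: "pk1 \<in> borel_measurable borel" unfolding pk1_def[abs_def] by measurable

lemma pk1_integral: "(\<integral>\<^sup>+s. pk1 s \<partial>lborel) = 1"
  unfolding pk1_def using pk_integral[of 1] pk_pos[of 1] by (simp add: nn_integral_eq_integral less_imp_le)

lemma pk1_pos: "0 < pk1 s" unfolding pk1_def using pk_pos[of 1 s] by simp

lemma line_lp:
  fixes f :: "'a::euclidean_space \<Rightarrow> real"
  assumes [measurable]: "f \<in> borel_measurable borel" and z: "z \<noteq> 0"
  shows "lp_int p f = (\<integral>\<^sup>+x. pk1 (x \<bullet> z / (z \<bullet> z)) * lp_int p (\<lambda>s. f (x + s *\<^sub>R z)) \<partial>lborel)"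
  unfolding lp_int_def by (rule line_fubini[OF _ _ pk1_integral z]) measurable

lemma line_lp_measurable [measurable]:
  fixes f :: "'a::euclidean_space \<Rightarrow> real"
  assumes [measurable]: "f \<in> borel_measurable borel"
  shows "(\<lambda>(x, z). lp_int p (\<lambda>s. f (x + s *\<^sub>R z))) \<in> borel_measurable (borel \<Otimes>\<^sub>M borel)"
    "(\<lambda>x. lp_int p (\<lambda>s. f (x + s *\<^sub>R z))) \<in> borel_measurable borel"
  unfolding lp_int_def split_beta' by measurable

lemma line_lp_finite:
  fixes f :: "'a::euclidean_space \<Rightarrow> real"
  assumes [measurable]: "f \<in> borel_measurable borel" and z: "z \<noteq> 0" and fin: "lp_int p f < \<infinity>"
  shows "AE x in lborel. lp_int p (\<lambda>s. f (x + s *\<^sub>R z)) < \<infinity>"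
proof -
  have "(\<integral>\<^sup>+x. pk1 (x \<bullet> z / (z \<bullet> z)) * lp_int p (\<lambda>s. f (x + s *\<^sub>R z)) \<partial>lborel) \<noteq> \<infinity>"
    using line_lp[OF assms(1) z, of p] fin by simp
  then have "AE x in lborel. pk1 (x \<bullet> z / (z \<bullet> z)) * lp_int p (\<lambda>s. f (x + s *\<^sub>R z)) \<noteq> \<infinity>"
    by (intro nn_integral_PInf_AE) auto
  then show ?thesis
  proof eventually_elim
    case (elim x)
    then show ?case using pk1_pos[of "x \<bullet> z / (z \<bullet> z)"] by (auto simp: ennreal_mult_eq_top_iff top.not_eq_extremum)
  qed
qed

text \<open>\<open>line_fubini\<close> applied to the indicator of the exceptional set: a set that
  is null on almost every line parallel to \<open>z\<close> is null.\<close>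

lemma line_AE:
  fixes P :: "'a::euclidean_space \<Rightarrow> bool"
  assumes [measurable]: "Measurable.pred borel P" and z: "z \<noteq> 0"
    and P: "AE x in lborel. AE s in lborel. P (x + s *\<^sub>R z)"
  shows "AE x in lborel. P x"
proof -
  have "(\<integral>\<^sup>+x. indicator {x. \<not> P x} x \<partial>lborel) = (\<integral>\<^sup>+x. pk1 (x \<bullet> z / (z \<bullet> z)) * (\<integral>\<^sup>+s. indicator {x. \<not> P x} (x + s *\<^sub>R z) \<partial>lborel) \<partial>lborel)"
    by (rule line_fubini[OF _ _ pk1_integral z]) measurable
  also have "\<dots> = (\<integral>\<^sup>+(x::'a). 0 \<partial>lborel)"
  proof (rule nn_integral_cong_AE, use P in eventually_elim)
    case (elim x)
    then have "(\<integral>\<^sup>+s. indicator {x. \<not> P x} (x + s *\<^sub>R z) \<partial>lborel) = (\<integral>\<^sup>+(s::real). 0 \<partial>lborel)"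
      by (intro nn_integral_cong_AE) (auto elim!: eventually_mono)
    then show ?case by simp
  qed
  finally have "emeasure lborel {x. \<not> P x} = 0" by simp
  moreover have "{x. \<not> P x} \<in> sets lborel" by measurable
  ultimately show ?thesis by (intro AE_I[of _ _ "{x. \<not> P x}"]) auto
qed

definition dirM :: "real \<Rightarrow> ('a::euclidean_space \<Rightarrow> real) \<Rightarrow> 'a \<Rightarrow> 'a \<Rightarrow> ennreal" where
  "dirM p f x z = (SUP n. ennreal (\<bar>dirH (rs n) f x z\<bar> powr p))"

lemma dirM_measurable [measurable]:
  fixes f :: "'a::euclidean_space \<Rightarrow> real"
  assumes [measurable]: "f \<in> borel_measurable borel"
  shows "(\<lambda>(x, z). dirM p f x z) \<in> borel_measurable (borel \<Otimes>\<^sub>M borel)"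
    "(\<lambda>x. dirM p f x z) \<in> borel_measurable borel" "(\<lambda>z. dirM p f x z) \<in> borel_measurable borel"
  unfolding dirM_def split_beta' by measurable

lemma dirM_line: "Hmax p (\<lambda>s. f (x + s *\<^sub>R z)) s = dirM p f (x + s *\<^sub>R z) z"
  unfolding Hmax_def dirM_def dirH_line ..

lemma dirM_bound:
  fixes f :: "'a::euclidean_space \<Rightarrow> real"
  assumes [measurable]: "f \<in> borel_measurable borel" and z: "z \<noteq> 0" and p: "6 \<le> p"
  shows "(\<integral>\<^sup>+x. dirM p f x z \<partial>lborel) \<le> ennreal (hmax_const p) * lp_int p f"
proof -
  have "(\<integral>\<^sup>+x. dirM p f x z \<partial>lborel) = (\<integral>\<^sup>+x. pk1 (x \<bullet> z / (z \<bullet> z)) * (\<integral>\<^sup>+s. dirM p f (x + s *\<^sub>R z) z \<partial>lborel) \<partial>lborel)"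
    by (rule line_fubini[OF _ _ pk1_integral z]) measurable
  also have "\<dots> \<le> (\<integral>\<^sup>+x. ennreal (hmax_const p) * (pk1 (x \<bullet> z / (z \<bullet> z)) * lp_int p (\<lambda>s. f (x + s *\<^sub>R z))) \<partial>lborel)"
  proof (rule nn_integral_mono)
    fix x
    have "(\<integral>\<^sup>+s. dirM p f (x + s *\<^sub>R z) z \<partial>lborel) \<le> ennreal (hmax_const p) * lp_int p (\<lambda>s. f (x + s *\<^sub>R z))"
      unfolding dirM_line[symmetric] by (rule Hmax_bound[OF _ p]) measurable
    then have "pk1 (x \<bullet> z / (z \<bullet> z)) * (\<integral>\<^sup>+s. dirM p f (x + s *\<^sub>R z) z \<partial>lborel)
      \<le> pk1 (x \<bullet> z / (z \<bullet> z)) * (ennreal (hmax_const p) * lp_int p (\<lambda>s. f (x + s *\<^sub>R z)))"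
      by (intro mult_left_mono) auto
    then show "pk1 (x \<bullet> z / (z \<bullet> z)) * (\<integral>\<^sup>+s. dirM p f (x + s *\<^sub>R z) z \<partial>lborel)
      \<le> ennreal (hmax_const p) * (pk1 (x \<bullet> z / (z \<bullet> z)) * lp_int p (\<lambda>s. f (x + s *\<^sub>R z)))"
      by (simp add: mult_ac)
  qed
  also have "\<dots> = ennreal (hmax_const p) * lp_int p f"
    unfolding line_lp[OF assms(1) z] by (rule nn_integral_cmult) measurable
  finally show ?thesis .
qed

text \<open>Convergence of the truncations is phrased through rational truncation levels, which makes it
  a jointly measurable condition on point and direction.\<close>

definition rat_cauchy :: "(real \<Rightarrow> real) \<Rightarrow> bool" where
  "rat_cauchy F \<longleftrightarrow> (\<forall>m::nat. \<exists>n::nat. \<forall>i j. rs i < 1 / real (Suc n) \<longrightarrow> rs j < 1 / real (Suc n) \<longrightarrow> \<bar>F (rs i) - F (rs j)\<bar> \<le> 1 / real (Suc m))"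

lemma rat_cauchy_if_tendsto:
  assumes "(F \<longlongrightarrow> l) (at_right 0)"
  shows "rat_cauchy F"
  unfolding rat_cauchy_def
proof
  fix m :: nat
  have "eventually (\<lambda>e. dist (F e) l < 1 / real (Suc m) / 2) (at_right 0)"
    by (rule tendstoD[OF assms]) simp
  then obtain b where b: "0 < b" "\<And>e. 0 < e \<Longrightarrow> e < b \<Longrightarrow> dist (F e) l < 1 / real (Suc m) / 2"
    unfolding eventually_at_right_field by auto
  obtain n where n: "1 / real (Suc n) < b" using b(1) nat_approx_posE by (metis)
  show "\<exists>n. \<forall>i j. rs i < 1 / real (Suc n) \<longrightarrow> rs j < 1 / real (Suc n) \<longrightarrow> \<bar>F (rs i) - F (rs j)\<bar> \<le> 1 / real (Suc m)"
  proof (intro exI[of _ n] allI impI)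
    fix i j assume "rs i < 1 / real (Suc n)" "rs j < 1 / real (Suc n)"
    then have "dist (F (rs i)) l < 1 / real (Suc m) / 2" "dist (F (rs j)) l < 1 / real (Suc m) / 2"
      using b(2)[OF rs_pos] n by (meson less_trans)+
    moreover have "\<bar>a - b\<bar> \<le> q" if "dist a l < q / 2" "dist b l < q / 2" for a b q :: real
      using that unfolding dist_real_def by linarith
    ultimately show "\<bar>F (rs i) - F (rs j)\<bar> \<le> 1 / real (Suc m)" by blast
  qed
qed

text \<open>Right-continuity \<open>c\<close> carries the oscillation bound from rational levels to
  all levels, by approximating both levels from above.\<close>

lemma tendsto_if_rat_cauchy:
  assumes F: "rat_cauchy F" and c: "\<And>e X. 0 < e \<Longrightarrow> (\<And>k::nat. e \<le> X k) \<Longrightarrow> X \<longlonglongrightarrow> e \<Longrightarrow> (\<lambda>k. F (X k)) \<longlonglongrightarrow> F e"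
  shows "\<exists>l. (F \<longlongrightarrow> l) (at_right 0)"
proof -
  have osc: "\<exists>n. \<forall>e e'. 0 < e \<longrightarrow> e < 1 / real (Suc n) \<longrightarrow> 0 < e' \<longrightarrow> e' < 1 / real (Suc n) \<longrightarrow> \<bar>F e - F e'\<bar> \<le> 1 / real (Suc m)" for m
  proof -
    obtain n where n: "\<And>i j. rs i < 1 / real (Suc n) \<Longrightarrow> rs j < 1 / real (Suc n) \<Longrightarrow> \<bar>F (rs i) - F (rs j)\<bar> \<le> 1 / real (Suc m)"
      using F unfolding rat_cauchy_def by blast
    show ?thesis
    proof (intro exI[of _ n] allI impI)
      fix e e' :: real assume e: "0 < e" "e < 1 / real (Suc n)" "0 < e'" "e' < 1 / real (Suc n)"
      obtain X where X: "\<And>k. X k \<in> prats" "\<And>k. e \<le> X k" "X \<longlonglongrightarrow> e" using rational_approx_above[OF e(1)] by blast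
      obtain Y where Y: "\<And>k. Y k \<in> prats" "\<And>k. e' \<le> Y k" "Y \<longlonglongrightarrow> e'" using rational_approx_above[OF e(3)] by blast
      have lim: "(\<lambda>k. \<bar>F (X k) - F (Y k)\<bar>) \<longlonglongrightarrow> \<bar>F e - F e'\<bar>"
        by (intro tendsto_intros c e X Y)
      have "eventually (\<lambda>k. \<bar>F (X k) - F (Y k)\<bar> \<le> 1 / real (Suc m)) sequentially"
        using order_tendstoD(2)[OF X(3) e(2)] order_tendstoD(2)[OF Y(3) e(4)]
      proof eventually_elim
        case (elim k)
        obtain i j where "X k = rs i" "Y k = rs j" using X(1)[of k] Y(1)[of k] range_rs by (metis imageE)
        then show ?case using n elim by simp
      qed
      then show "\<bar>F e - F e'\<bar> \<le> 1 / real (Suc m)" by (intro tendsto_upperbound[OF lim]) auto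
    qed
  qed
  \<comment> \<open>The doubled \<open>Suc\<close> puts the k-th level strictly below
    \<open>1 / real (Suc n)\<close> already for \<open>k = n\<close>.\<close>
  have "Cauchy (\<lambda>k. F (1 / real (Suc (Suc k))))"
  proof (rule metric_CauchyI)
    fix eps :: real assume "0 < eps"
    then obtain m where m: "1 / real (Suc m) < eps" using nat_approx_posE by metis
    obtain n where n: "\<And>e e'. 0 < e \<Longrightarrow> e < 1 / real (Suc n) \<Longrightarrow> 0 < e' \<Longrightarrow> e' < 1 / real (Suc n) \<Longrightarrow> \<bar>F e - F e'\<bar> \<le> 1 / real (Suc m)"
      using osc[of m] by blast
    show "\<exists>M. \<forall>i\<ge>M. \<forall>j\<ge>M. dist (F (1 / real (Suc (Suc i)))) (F (1 / real (Suc (Suc j)))) < eps"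
    proof (intro exI[of _ n] allI impI)
      fix i j assume ij: "n \<le> i" "n \<le> j"
      have "1 / real (Suc (Suc k)) < 1 / real (Suc n)" if "n \<le> k" for k using that by (intro divide_strict_left_mono) auto
      then have "\<bar>F (1 / real (Suc (Suc i))) - F (1 / real (Suc (Suc j)))\<bar> \<le> 1 / real (Suc m)" using ij by (intro n) auto
      then show "dist (F (1 / real (Suc (Suc i)))) (F (1 / real (Suc (Suc j)))) < eps" using m by (simp add: dist_real_def)
    qed
  qed
  then obtain L where L: "(\<lambda>k. F (1 / real (Suc (Suc k)))) \<longlonglongrightarrow> L" using Cauchy_convergent_iff convergent_def by blast
  have "(F \<longlongrightarrow> L) (at_right 0)"
  proof (rule tendstoI)
    fix eps :: real assume "0 < eps"
    then obtain m where m: "1 / real (Suc m) < eps" using nat_approx_posE by metis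
    obtain n where n: "\<And>e e'. 0 < e \<Longrightarrow> e < 1 / real (Suc n) \<Longrightarrow> 0 < e' \<Longrightarrow> e' < 1 / real (Suc n) \<Longrightarrow> \<bar>F e - F e'\<bar> \<le> 1 / real (Suc m)"
      using osc[of m] by blast
    show "eventually (\<lambda>e. dist (F e) L < eps) (at_right 0)"
    proof (rule eventually_at_rightI[of 0 "1 / real (Suc n)"])
      fix e assume e: "e \<in> {0<..<1 / real (Suc n)}"
      have lim: "(\<lambda>k. \<bar>F e - F (1 / real (Suc (Suc k)))\<bar>) \<longlonglongrightarrow> \<bar>F e - L\<bar>" by (intro tendsto_intros L)
      have "eventually (\<lambda>k. \<bar>F e - F (1 / real (Suc (Suc k)))\<bar> \<le> 1 / real (Suc m)) sequentially"
        using eventually_ge_at_top[of n]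
      proof eventually_elim
        case (elim k)
        have "1 / real (Suc (Suc k)) < 1 / real (Suc n)" using elim by (intro divide_strict_left_mono) auto
        then show ?case using e by (intro n) auto
      qed
      then have "\<bar>F e - L\<bar> \<le> 1 / real (Suc m)" by (intro tendsto_upperbound[OF lim]) auto
      then show "dist (F e) L < eps" using m by (simp add: dist_real_def)
    qed simp
  qed
  then show ?thesis by blast
qed

lemma rat_cauchy_measurable [measurable]:
  fixes f :: "'a::euclidean_space \<Rightarrow> real"
  assumes [measurable]: "f \<in> borel_measurable borel"
  shows "Measurable.pred (borel \<Otimes>\<^sub>M borel) (\<lambda>(x, z). rat_cauchy (\<lambda>e. dirH e f x z))"
    "Measurable.pred borel (\<lambda>x. rat_cauchy (\<lambda>e. dirH e f x z))"
  unfolding rat_cauchy_def split_beta' by measurable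

text \<open>A limit along one fixed sequence of levels is jointly measurable in point and direction
  for every measurable \<open>f\<close>; it equals the full limit wherever that exists.\<close>

definition dirL :: "('a::euclidean_space \<Rightarrow> real) \<Rightarrow> 'a \<Rightarrow> 'a \<Rightarrow> real" where
  "dirL f x z = lim (\<lambda>k. dirH (1 / real (Suc k)) f x z)"

lemma dirL_measurable [measurable]:
  fixes f :: "'a::euclidean_space \<Rightarrow> real"
  assumes [measurable]: "f \<in> borel_measurable borel"
  shows "(\<lambda>(x, z). dirL f x z) \<in> borel_measurable (borel \<Otimes>\<^sub>M borel)"
    "(\<lambda>x. dirL f x z) \<in> borel_measurable borel" "(\<lambda>z. dirL f x z) \<in> borel_measurable borel"
  unfolding dirL_def split_beta' by (measurable)

lemma dirL_eqI:
  assumes "((\<lambda>e. dirH e f x z) \<longlongrightarrow> l) (at_right 0)"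
  shows "dirL f x z = l"
proof -
  have "filterlim (\<lambda>k. 1 / real (Suc k)) (at_right 0) sequentially"
    unfolding filterlim_at using LIMSEQ_Suc[OF lim_1_over_n] by (auto simp: always_eventually)
  then have "(\<lambda>k. dirH (1 / real (Suc k)) f x z) \<longlonglongrightarrow> l" by (rule filterlim_compose[OF assms])
  then show ?thesis unfolding dirL_def by (rule limI)
qed

lemma dirH_converges:
  fixes f :: "'a::euclidean_space \<Rightarrow> real"
  assumes [measurable]: "f \<in> borel_measurable borel" and p: "1 < p"
    and fin: "lp_int p (\<lambda>s. f (x + s *\<^sub>R z)) < \<infinity>" and c: "rat_cauchy (\<lambda>e. dirH e f x z)"
  shows "((\<lambda>e. dirH e f x z) \<longlongrightarrow> dirL f x z) (at_right 0)"
proof -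
  have "\<exists>l. ((\<lambda>e. dirH e f x z) \<longlongrightarrow> l) (at_right 0)"
  proof (rule tendsto_if_rat_cauchy[OF c])
    fix e and X :: "nat \<Rightarrow> real" assume "0 < e" "\<And>k. e \<le> X k" "X \<longlonglongrightarrow> e"
    then show "(\<lambda>k. dirH (X k) f x z) \<longlonglongrightarrow> dirH e f x z"
      unfolding dirH_def using fin p by (intro trH_right_continuous[where p=p]) auto
  qed
  then show ?thesis using dirL_eqI by metis
qed

lemma dirH_le_dirM:
  fixes f :: "'a::euclidean_space \<Rightarrow> real"
  assumes [measurable]: "f \<in> borel_measurable borel" and p: "1 < p"
    and fin: "lp_int p (\<lambda>s. f (x + s *\<^sub>R z)) < \<infinity>" and e: "0 < e"
  shows "ennreal (\<bar>dirH e f x z\<bar> powr p) \<le> dirM p f x z"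
  using trH_le_Hmax[of "\<lambda>s. f (x + s *\<^sub>R z)" p e 0] assms unfolding dirM_line by (simp add: dirH_def)

lemma line_converges:
  fixes f :: "'a::euclidean_space \<Rightarrow> real"
  assumes [measurable]: "f \<in> borel_measurable borel" and z: "z \<noteq> 0" and p: "6 \<le> p" and fin: "lp_int p f < \<infinity>"
  shows "AE x in lborel. AE s in lborel. ((\<lambda>e. dirH e f (x + s *\<^sub>R z) z) \<longlongrightarrow> hilR (\<lambda>s. f (x + s *\<^sub>R z)) s) (at_right 0)"
  using line_lp_finite[OF assms(1) z fin]
proof eventually_elim
  case (elim x)
  have "AE s in lborel. ((\<lambda>e. trH e (\<lambda>s. f (x + s *\<^sub>R z)) s) \<longlongrightarrow> hilR (\<lambda>s. f (x + s *\<^sub>R z)) s) (at_right 0)"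
    by (rule hilR_converges[OF _ p elim]) measurable
  then show ?case unfolding dirH_line .
qed

lemma AE_lborel_swap:
  fixes P :: "'a::euclidean_space \<Rightarrow> 'b::euclidean_space \<Rightarrow> bool"
  assumes P: "Measurable.pred (borel \<Otimes>\<^sub>M borel) (\<lambda>(x, z). P x z)"
    and AE: "AE z in lborel. AE x in lborel. P x z"
  shows "AE x in lborel. AE z in lborel. P x z"
proof -
  have "sets (lborel \<Otimes>\<^sub>M lborel) = sets (borel \<Otimes>\<^sub>M (borel :: 'b measure) :: ('a \<times> 'b) measure)"
    by (intro sets_pair_measure_cong) auto
  then have "{x \<in> space (lborel \<Otimes>\<^sub>M lborel). P (fst x) (snd x)} \<in> sets (lborel \<Otimes>\<^sub>M lborel)"
    using P by (simp add: pred_def split_beta' space_pair_measure)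
  from lborel_pair.AE_commute[OF this] AE show ?thesis by simp
qed

text \<open>For a fixed direction, almost every point is good, by the one-dimensional theorem on
  lines. The average over directions needs the reverse order, almost every direction for almost
  every point; the exchange requires joint measurability of the condition.\<close>

lemma dir_good:
  fixes f :: "'a::euclidean_space \<Rightarrow> real"
  assumes m[measurable]: "f \<in> borel_measurable borel" and p: "6 \<le> p" and fin: "lp_int p f < \<infinity>"
  shows "AE x in lborel. AE z in lborel. ((\<lambda>e. dirH e f x z) \<longlongrightarrow> dirL f x z) (at_right 0) \<and>
    (\<forall>e>0. ennreal (\<bar>dirH e f x z\<bar> powr p) \<le> dirM p f x z)"
proof -
  have nz: "AE z in (lborel :: 'a measure). z \<noteq> 0" by (rule AE_lborel_singleton)
  have "AE z in lborel. AE x in lborel. rat_cauchy (\<lambda>e. dirH e f x z)"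
    using nz
  proof eventually_elim
    case (elim z)
    have "AE x in lborel. AE s in lborel. rat_cauchy (\<lambda>e. dirH e f (x + s *\<^sub>R z) z)"
      using line_converges[OF m elim p fin]
    proof eventually_elim
      case (elim x)
      then show ?case by eventually_elim (rule rat_cauchy_if_tendsto)
    qed
    then show ?case by (rule line_AE[OF rat_cauchy_measurable(2)[OF m] elim])
  qed
  then have 1: "AE x in lborel. AE z in lborel. rat_cauchy (\<lambda>e. dirH e f x z)"
    by (rule AE_lborel_swap[OF rat_cauchy_measurable(1)[OF m]])
  have "AE z in lborel. AE x in lborel. lp_int p (\<lambda>s. f (x + s *\<^sub>R z)) < \<infinity>"
    using nz by eventually_elim (rule line_lp_finite[OF m _ fin])
  then have 2: "AE x in lborel. AE z in lborel. lp_int p (\<lambda>s. f (x + s *\<^sub>R z)) < \<infinity>"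
    by (rule AE_lborel_swap[rotated]) measurable
  show ?thesis using 1 2
  proof eventually_elim
    case (elim x)
    from elim show ?case
    proof eventually_elim
      case (elim z)
      then show ?case using dirH_converges[OF m _ elim(2,1)] dirH_le_dirM[OF m _ elim(2)] p by auto
    qed
  qed
qed

text \<open>Tonelli in point and direction. At almost every point it supplies the majorant for
  dominated convergence under the integral over directions.\<close>

lemma dirM_weighted:
  fixes f :: "'a::euclidean_space \<Rightarrow> real"
  assumes m[measurable]: "f \<in> borel_measurable borel" and p: "6 \<le> p" and fin: "lp_int p f < \<infinity>"
    and w[measurable]: "w \<in> borel_measurable borel" and wf: "(\<integral>\<^sup>+z. w z \<partial>lborel) < \<infinity>"
  shows "AE x in lborel. (\<integral>\<^sup>+z. w z * dirM p f x z \<partial>lborel) < \<infinity>"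
proof -
  have nz: "AE z in (lborel :: 'a measure). z \<noteq> 0" by (rule AE_lborel_singleton)
  have "(\<integral>\<^sup>+x. (\<integral>\<^sup>+z. w z * dirM p f x z \<partial>lborel) \<partial>lborel) = (\<integral>\<^sup>+z. (\<integral>\<^sup>+x. w z * dirM p f x z \<partial>lborel) \<partial>lborel)"
    by (rule lborel_pair.Fubini') measurable
  also have "\<dots> = (\<integral>\<^sup>+z. w z * (\<integral>\<^sup>+x. dirM p f x z \<partial>lborel) \<partial>lborel)" by (simp add: nn_integral_cmult)
  also have "\<dots> \<le> (\<integral>\<^sup>+z. w z * (ennreal (hmax_const p) * lp_int p f) \<partial>lborel)"
    by (rule nn_integral_mono_AE, use nz in eventually_elim) (intro mult_left_mono dirM_bound[OF m _ p], auto)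
  also have "\<dots> = (\<integral>\<^sup>+z. w z \<partial>lborel) * (ennreal (hmax_const p) * lp_int p f)" by (rule nn_integral_multc) measurable
  also have "\<dots> < \<infinity>" using wf fin by (simp add: ennreal_mult_less_top)
  finally have "AE x in lborel. (\<integral>\<^sup>+z. w z * dirM p f x z \<partial>lborel) \<noteq> \<infinity>"
    by (intro nn_integral_PInf_AE) auto
  then show ?thesis by eventually_elim (simp add: top.not_eq_extremum)
qed

text \<open>\<open>line_lp\<close> represents both sides with the same weight, so the
  one-dimensional constant \<open>N\<close> is transferred without loss.\<close>

lemma dirL_bound:
  fixes f :: "'a::euclidean_space \<Rightarrow> real"
  assumes m[measurable]: "f \<in> borel_measurable borel" and z: "z \<noteq> 0" and p: "6 \<le> p" and fin: "lp_int p f < \<infinity>"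
    and N: "\<And>h. h \<in> borel_measurable borel \<Longrightarrow> lp_int p h < \<infinity> \<Longrightarrow> lp_int p (hilR h) \<le> N * lp_int p h"
  shows "lp_int p (\<lambda>x. dirL f x z) \<le> N * lp_int p f"
proof -
  have "lp_int p (\<lambda>x. dirL f x z) = (\<integral>\<^sup>+x. pk1 (x \<bullet> z / (z \<bullet> z)) * lp_int p (\<lambda>s. dirL f (x + s *\<^sub>R z) z) \<partial>lborel)"
    by (rule line_lp[OF _ z]) measurable
  also have "\<dots> \<le> (\<integral>\<^sup>+x. N * (pk1 (x \<bullet> z / (z \<bullet> z)) * lp_int p (\<lambda>s. f (x + s *\<^sub>R z))) \<partial>lborel)"
  proof (rule nn_integral_mono_AE, use line_converges[OF m z p fin] line_lp_finite[OF m z fin] in eventually_elim)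
    case (elim x)
    have "lp_int p (\<lambda>s. dirL f (x + s *\<^sub>R z) z) = lp_int p (hilR (\<lambda>s. f (x + s *\<^sub>R z)))"
      using elim(1) by (intro lp_int_cong_AE) (auto elim!: eventually_mono simp: dirL_eqI)
    also have "\<dots> \<le> N * lp_int p (\<lambda>s. f (x + s *\<^sub>R z))" using elim(2) by (intro N) auto
    finally have "pk1 (x \<bullet> z / (z \<bullet> z)) * lp_int p (\<lambda>s. dirL f (x + s *\<^sub>R z) z) \<le> pk1 (x \<bullet> z / (z \<bullet> z)) * (N * lp_int p (\<lambda>s. f (x + s *\<^sub>R z)))"
      by (intro mult_left_mono) auto
    then show ?case by (simp add: mult_ac)
  qed
  also have "\<dots> = N * lp_int p f"
    unfolding line_lp[OF m z] by (rule nn_integral_cmult) measurable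
  finally show ?thesis .
qed

section \<open>Gaussian and Gamma integrals\<close>

lemma nn_integral_even:
  fixes f :: "real \<Rightarrow> ennreal"
  assumes [measurable]: "f \<in> borel_measurable borel"
  shows "(\<integral>\<^sup>+x. f \<bar>x\<bar> \<partial>lborel) = 2 * (\<integral>\<^sup>+x. f x * indicator {0<..} x \<partial>lborel)"
proof -
  have "(\<integral>\<^sup>+x. f \<bar>x\<bar> \<partial>lborel) = (\<integral>\<^sup>+x. f x * indicator {0<..} x + f (0 - x) * indicator {0<..} (0 - x) \<partial>lborel)"
    by (rule nn_integral_cong_AE, use AE_lborel_singleton[of 0] in eventually_elim) (auto simp: indicator_def)
  also have "\<dots> = (\<integral>\<^sup>+x. f x * indicator {0<..} x \<partial>lborel) + (\<integral>\<^sup>+x. f (0 - x) * indicator {0<..} (0 - x) \<partial>lborel)"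
    by (intro nn_integral_add) measurable
  also have "(\<integral>\<^sup>+x. f (0 - x) * indicator {0<..} (0 - x) \<partial>lborel) = (\<integral>\<^sup>+x. f x * indicator {0<..} x \<partial>lborel)"
    by (rule nn_integral_lborel_reflect[where f="\<lambda>x. f x * indicator {0<..} x"]) measurable
  finally show ?thesis by (simp add: mult_2)
qed

lemma exp_tail_integral: "(\<integral>\<^sup>+u. ennreal (exp (- u)) * indicator {c..} u \<partial>lborel) = ennreal (exp (- c))"
proof -
  have "(\<integral>\<^sup>+u. ennreal (exp (- u)) * indicator {c..} u \<partial>lborel) = ennreal (0 - (- exp (- c)))"
  proof (rule nn_integral_FTC_atLeast)
    show "((\<lambda>u. - exp (- u)) has_real_derivative exp (- x)) (at x)" for x :: real
      by (auto intro!: derivative_eq_intros)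
    show "((\<lambda>u::real. - exp (- u)) \<longlongrightarrow> 0) at_top" by real_asymp
  qed auto
  then show ?thesis by simp
qed

lemma gamma_integral:
  assumes "0 < s"
  shows "(\<integral>\<^sup>+u. ennreal (u powr (s - 1) * exp (- u)) * indicator {0<..} u \<partial>lborel) = ennreal (Gamma s)"
  unfolding Gamma_conv_nn_integral_real[OF assms]
proof (rule nn_integral_cong)
  fix u :: real
  show "ennreal (u powr (s - 1) * exp (- u)) * indicator {0<..} u = ennreal (indicat_real {0..} u * u powr (s - 1) / exp u)"
    by (cases "u = 0") (auto simp: indicator_def exp_minus divide_inverse)
qed

text \<open>Write the Gaussian as a tail integral of the exponential and exchange: the set where
  \<open>s^2 \<le> u\<close> has length \<open>2 * sqrt u\<close>, which leaves twice the Gamma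
  function at 3/2.\<close>

lemma gauss_integral: "(\<integral>\<^sup>+s. ennreal (exp (- s\<^sup>2)) \<partial>lborel) = ennreal (sqrt pi)"
proof -
  have "(\<integral>\<^sup>+s. ennreal (exp (- s\<^sup>2)) \<partial>lborel) = (\<integral>\<^sup>+s. (\<integral>\<^sup>+u. ennreal (exp (- u)) * indicator {s\<^sup>2..} u \<partial>lborel) \<partial>lborel)"
    by (simp add: exp_tail_integral)
  also have "\<dots> = (\<integral>\<^sup>+u. (\<integral>\<^sup>+s. ennreal (exp (- u)) * indicator {s\<^sup>2..} u \<partial>lborel) \<partial>lborel)"
    by (rule lborel_pair.Fubini') (simp add: indicator_def[abs_def] split_beta' cong: if_cong)
  also have "\<dots> = (\<integral>\<^sup>+u. 2 * (ennreal (u powr (3/2 - 1) * exp (- u)) * indicator {0<..} u) \<partial>lborel)"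
  proof (rule nn_integral_cong_AE, use AE_lborel_singleton[of 0] in eventually_elim)
    case (elim u)
    show ?case
    proof (cases "0 < u")
      case True
      have "(\<integral>\<^sup>+s. ennreal (exp (- u)) * indicator {s\<^sup>2..} u \<partial>lborel) = (\<integral>\<^sup>+s. ennreal (exp (- u)) * indicator {- sqrt u..sqrt u} s \<partial>lborel)"
      proof (rule nn_integral_cong)
        fix s :: real
        have "s\<^sup>2 \<le> u \<longleftrightarrow> - sqrt u \<le> s \<and> s \<le> sqrt u"
          using True real_sqrt_le_iff[of "s\<^sup>2" u] by auto
        then show "ennreal (exp (- u)) * indicator {s\<^sup>2..} u = ennreal (exp (- u)) * indicator {- sqrt u..sqrt u} s"
          by (auto simp: indicator_def)
      qed
      also have "\<dots> = ennreal (exp (- u)) * ennreal (2 * sqrt u)" using True by (simp add: nn_integral_cmult_indicator)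
      also have "\<dots> = 2 * (ennreal (u powr (3/2 - 1) * exp (- u)) * indicator {0<..} u)"
        using True by (simp add: powr_half_sqrt ennreal_mult mult_ac)
      finally show ?thesis .
    next
      case False
      then have "(\<integral>\<^sup>+s. ennreal (exp (- u)) * indicator {s\<^sup>2..} u \<partial>lborel) = (\<integral>\<^sup>+(s::real). 0 \<partial>lborel)"
        using elim by (intro nn_integral_cong) (auto simp: indicator_def not_less dest: order_trans[OF zero_le_power2])
      then show ?thesis using False by simp
    qed
  qed
  also have "\<dots> = 2 * ennreal (Gamma (3/2))"
    using gamma_integral[of "3/2"] by (subst nn_integral_cmult) auto
  also have "Gamma (3/2 :: real) = 1/2 * sqrt pi"
  proof -
    have "(1/2 :: real) \<notin> \<int>\<^sub>\<le>\<^sub>0" using nonpos_Ints_nonpos[of "1/2 :: real"] by auto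
    from Gamma_plus1[OF this] show ?thesis by (simp add: Gamma_one_half_real)
  qed
  also have "2 * ennreal (1/2 * sqrt pi) = ennreal (2 * (1/2 * sqrt pi))"
    by (subst ennreal_mult) auto
  finally show ?thesis by simp
qed

lemma gauss_abs_integral: "(\<integral>\<^sup>+s. ennreal (\<bar>s\<bar> * exp (- s\<^sup>2)) \<partial>lborel) = 1"
proof -
  have "(\<integral>\<^sup>+s. ennreal (\<bar>s\<bar> * exp (- s\<^sup>2)) \<partial>lborel) = 2 * (\<integral>\<^sup>+s. ennreal (s * exp (- s\<^sup>2)) * indicator {0<..} s \<partial>lborel)"
    using nn_integral_even[of "\<lambda>s. ennreal (s * exp (- s\<^sup>2))"] by simp
  also have "(\<integral>\<^sup>+s. ennreal (s * exp (- s\<^sup>2)) * indicator {0<..} s \<partial>lborel) = (\<integral>\<^sup>+s. ennreal (s * exp (- s\<^sup>2)) * indicator {0..} s \<partial>lborel)"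
    by (intro nn_integral_cong) (auto simp: indicator_def)
  also have "\<dots> = ennreal (0 - (- exp (- 0\<^sup>2) / 2))"
  proof (rule nn_integral_FTC_atLeast)
    show "((\<lambda>u. - exp (- u\<^sup>2) / 2) has_real_derivative x * exp (- x\<^sup>2)) (at x)" for x :: real
      by (auto intro!: derivative_eq_intros)
    show "((\<lambda>u::real. - exp (- u\<^sup>2) / 2) \<longlongrightarrow> 0) at_top" by real_asymp
  qed auto
  also have "2 * ennreal (0 - (- exp (- 0\<^sup>2) / 2)) = ennreal (2 * (0 - (- exp (- 0\<^sup>2) / 2)))"
    by (subst ennreal_mult) auto
  finally show ?thesis by simp
qed

lemma gauss_euclidean: "(\<integral>\<^sup>+z. ennreal (exp (- (norm (z::'a::euclidean_space))\<^sup>2)) \<partial>lborel) = ennreal (sqrt pi ^ DIM('a))"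
proof -
  have "(\<integral>\<^sup>+z. ennreal (exp (- (norm (z::'a))\<^sup>2)) \<partial>lborel) = (\<integral>\<^sup>+(z::'a). (\<Prod>b\<in>Basis. ennreal (exp (- (z \<bullet> b)\<^sup>2))) \<partial>lborel)"
  proof (rule nn_integral_cong)
    fix z :: 'a
    have "(norm z)\<^sup>2 = (\<Sum>b\<in>Basis. (z \<bullet> b)\<^sup>2)"
      unfolding power2_norm_eq_inner by (subst euclidean_inner) (simp add: power2_eq_square)
    then show "ennreal (exp (- (norm z)\<^sup>2)) = (\<Prod>b\<in>Basis. ennreal (exp (- (z \<bullet> b)\<^sup>2)))"
      by (simp add: prod_ennreal exp_sum[symmetric] sum_negf)
  qed
  also have "\<dots> = (\<Prod>b\<in>(Basis::'a set). (\<integral>\<^sup>+s. ennreal (exp (- s\<^sup>2)) \<partial>lborel))"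
    by (rule nn_integral_lborel_prod) auto
  also have "\<dots> = ennreal (sqrt pi ^ DIM('a))" by (simp add: gauss_integral ennreal_power)
  finally show ?thesis .
qed

text \<open>Integrate along the lines parallel to \<open>a\<close> with a Gaussian density \<psi>.
  Completing the square splits off the factor \<open>exp (c^2)\<close>, with
  \<open>c = x \<bullet> a\<close>, and \<psi> cancels it; the rest is the full Gaussian, and one
  factor \<open>sqrt pi\<close> is lost to the normalisation of \<psi>.\<close>

lemma gauss_direction:
  fixes a :: "'a::euclidean_space"
  assumes a: "norm a = 1"
  shows "(\<integral>\<^sup>+z. ennreal (\<bar>z \<bullet> a\<bar> * exp (- (norm z)\<^sup>2)) \<partial>lborel) = ennreal (sqrt pi ^ (DIM('a) - 1))"
proof -
  have aa: "a \<bullet> a = 1" "a \<noteq> 0" using a by (auto simp: norm_eq_1)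
  define \<psi> where "\<psi> s = ennreal (exp (- s\<^sup>2) / sqrt pi)" for s
  have [measurable]: "\<psi> \<in> borel_measurable borel" unfolding \<psi>_def[abs_def] by measurable
  have \<psi>1: "(\<integral>\<^sup>+s. \<psi> s \<partial>lborel) = 1"
  proof -
    have "(\<integral>\<^sup>+s. \<psi> s \<partial>lborel) = (\<integral>\<^sup>+s. ennreal (1 / sqrt pi) * ennreal (exp (- s\<^sup>2)) \<partial>lborel)"
      by (intro nn_integral_cong) (simp add: \<psi>_def ennreal_mult[symmetric])
    also have "\<dots> = ennreal (1 / sqrt pi) * ennreal (sqrt pi)" by (simp add: nn_integral_cmult gauss_integral)
    also have "\<dots> = 1" by (simp add: ennreal_mult[symmetric])
    finally show ?thesis .
  qed
  have "(\<integral>\<^sup>+z. ennreal (\<bar>z \<bullet> a\<bar> * exp (- (norm z)\<^sup>2)) \<partial>lborel) =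
    (\<integral>\<^sup>+x. \<psi> (x \<bullet> a / (a \<bullet> a)) * (\<integral>\<^sup>+s. ennreal (\<bar>(x + s *\<^sub>R a) \<bullet> a\<bar> * exp (- (norm (x + s *\<^sub>R a))\<^sup>2)) \<partial>lborel) \<partial>lborel)"
    by (rule line_fubini[OF _ _ \<psi>1 aa(2)]) measurable
  also have "\<dots> = (\<integral>\<^sup>+x. ennreal (1 / sqrt pi) * ennreal (exp (- (norm (x::'a))\<^sup>2)) \<partial>lborel)"
  proof (rule nn_integral_cong)
    fix x :: 'a
    define c where "c = x \<bullet> a"
    have n: "(norm (x + s *\<^sub>R a))\<^sup>2 = ((norm x)\<^sup>2 - c\<^sup>2) + (c + s)\<^sup>2" for s
      unfolding power2_norm_eq_inner c_def using aa
      by (simp add: inner_add_left inner_add_right power2_eq_square algebra_simps inner_commute)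
    have "(\<integral>\<^sup>+s. ennreal (\<bar>(x + s *\<^sub>R a) \<bullet> a\<bar> * exp (- (norm (x + s *\<^sub>R a))\<^sup>2)) \<partial>lborel)
      = (\<integral>\<^sup>+s. ennreal (exp (- ((norm x)\<^sup>2 - c\<^sup>2))) * ennreal (\<bar>c + s\<bar> * exp (- (c + s)\<^sup>2)) \<partial>lborel)"
    proof (rule nn_integral_cong)
      fix s :: real
      have "exp (- (norm (x + s *\<^sub>R a))\<^sup>2) = exp (- ((norm x)\<^sup>2 - c\<^sup>2)) * exp (- (c + s)\<^sup>2)"
        unfolding n by (simp add: exp_add[symmetric])
      moreover have "(x + s *\<^sub>R a) \<bullet> a = c + s" using aa by (simp add: c_def inner_add_left)
      ultimately show "ennreal (\<bar>(x + s *\<^sub>R a) \<bullet> a\<bar> * exp (- (norm (x + s *\<^sub>R a))\<^sup>2)) =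
         ennreal (exp (- ((norm x)\<^sup>2 - c\<^sup>2))) * ennreal (\<bar>c + s\<bar> * exp (- (c + s)\<^sup>2))"
        by (subst ennreal_mult[symmetric]) (auto simp: mult_ac)
    qed
    also have "\<dots> = ennreal (exp (- ((norm x)\<^sup>2 - c\<^sup>2))) * (\<integral>\<^sup>+s. ennreal (\<bar>c + s\<bar> * exp (- (c + s)\<^sup>2)) \<partial>lborel)"
      by (rule nn_integral_cmult) measurable
    also have "(\<integral>\<^sup>+s. ennreal (\<bar>c + s\<bar> * exp (- (c + s)\<^sup>2)) \<partial>lborel) = 1"
      using nn_integral_lborel_translate[of "\<lambda>s. ennreal (\<bar>s\<bar> * exp (- s\<^sup>2))" c] gauss_abs_integral by simp
    finally have "(\<integral>\<^sup>+s. ennreal (\<bar>(x + s *\<^sub>R a) \<bullet> a\<bar> * exp (- (norm (x + s *\<^sub>R a))\<^sup>2)) \<partial>lborel) = ennreal (exp (- ((norm x)\<^sup>2 - c\<^sup>2)))" by simp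
    moreover have "exp (- c\<^sup>2) / sqrt pi * exp (- ((norm x)\<^sup>2 - c\<^sup>2)) = 1 / sqrt pi * exp (- (norm x)\<^sup>2)"
      by (simp add: exp_add[symmetric])
    ultimately show "\<psi> (x \<bullet> a / (a \<bullet> a)) * (\<integral>\<^sup>+s. ennreal (\<bar>(x + s *\<^sub>R a) \<bullet> a\<bar> * exp (- (norm (x + s *\<^sub>R a))\<^sup>2)) \<partial>lborel)
      = ennreal (1 / sqrt pi) * ennreal (exp (- (norm x)\<^sup>2))"
      unfolding \<psi>_def aa c_def[symmetric] by (simp add: ennreal_mult[symmetric])
  qed
  also have "\<dots> = ennreal (1 / sqrt pi) * ennreal (sqrt pi ^ DIM('a))"
    by (simp add: nn_integral_cmult gauss_euclidean)
  also have "\<dots> = ennreal (1 / sqrt pi * sqrt pi ^ DIM('a))" by (simp add: ennreal_mult[symmetric])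
  also have "1 / sqrt pi * sqrt pi ^ DIM('a) = sqrt pi ^ (DIM('a) - 1)"
    using DIM_positive[where 'a='a] by (simp add: power_diff)
  finally show ?thesis .
qed

lemma power_tail_integral:
  assumes c: "0 < c"
  shows "(\<integral>\<^sup>+t. ennreal (1 / \<bar>t\<bar> ^ (n + 2)) * indicator {t. c \<le> \<bar>t\<bar>} t \<partial>lborel) = ennreal (2 / (real (n + 1) * c ^ (n + 1)))"
proof -
  have "(\<integral>\<^sup>+t. ennreal (1 / \<bar>t\<bar> ^ (n + 2)) * indicator {t. c \<le> \<bar>t\<bar>} t \<partial>lborel) =
     (\<integral>\<^sup>+t. (\<lambda>y. ennreal (1 / y ^ (n + 2)) * indicator {c..} y) \<bar>t\<bar> \<partial>lborel)"
    by (intro nn_integral_cong) (auto simp: indicator_def)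
  also have "\<dots> = 2 * (\<integral>\<^sup>+y. ennreal (1 / y ^ (n + 2)) * indicator {c..} y * indicator {0<..} y \<partial>lborel)"
    by (rule nn_integral_even) measurable
  also have "(\<integral>\<^sup>+y. ennreal (1 / y ^ (n + 2)) * indicator {c..} y * indicator {0<..} y \<partial>lborel) = (\<integral>\<^sup>+y. ennreal (1 / y ^ (n + 2)) * indicator {c..} y \<partial>lborel)"
    using c by (intro nn_integral_cong) (auto simp: indicator_def)
  also have "\<dots> = ennreal (0 - (- 1 / (real (n + 1) * c ^ (n + 1))))"
  proof (rule nn_integral_FTC_atLeast)
    fix x assume "c \<le> x"
    then have x: "0 < x" using c by simp
    have "((\<lambda>y. y powr (- real (n + 1))) has_real_derivative (- real (n + 1)) * x powr (- real (n + 1) - 1)) (at x)"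
      using x by (rule has_real_derivative_powr)
    then have "((\<lambda>y. - (1 / real (n + 1)) * y powr (- real (n + 1))) has_real_derivative - (1 / real (n + 1)) * ((- real (n + 1)) * x powr (- real (n + 1) - 1))) (at x)"
      by (rule DERIV_cmult)
    moreover have "- (1 / real (n + 1)) * ((- real (n + 1)) * x powr (- real (n + 1) - 1)) = 1 / x ^ (n + 2)"
    proof -
      have P: "x powr (- real (n + 1) - 1) = 1 / x ^ (n + 2)"
      proof -
        have "- real (n + 1) - 1 = - real (n + 2)" by simp
        then show ?thesis by (simp only: powr_minus_divide powr_realpow[OF x])
      qed
      have gen: "- (1 / k) * ((- k) * P) = P" if "k \<noteq> 0" for k P :: real using that by simp
      show ?thesis unfolding P by (rule gen) (simp del: of_nat_add)
    qed
    ultimately have "((\<lambda>y. - (1 / real (n + 1)) * y powr (- real (n + 1))) has_real_derivative 1 / x ^ (n + 2)) (at x)" by simp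
    then show "((\<lambda>y. - 1 / (real (n + 1) * y ^ (n + 1))) has_real_derivative 1 / x ^ (n + 2)) (at x)"
    proof (rule has_field_derivative_transform_within_open[where S="{0<..}"])
      fix y :: real assume "y \<in> {0<..}"
      then have y: "0 < y" by simp
      then have "y powr (- real (n + 1)) = 1 / y ^ (n + 1)" by (metis powr_minus_divide powr_realpow)
      then show "- (1 / real (n + 1)) * y powr (- real (n + 1)) = - 1 / (real (n + 1) * y ^ (n + 1))" by simp
    qed (use x in auto)
  next
    have "((\<lambda>y::real. - 1 / (real (n + 1)) * inverse (y ^ (n + 1))) \<longlongrightarrow> - 1 / real (n + 1) * 0) at_top"
      by (intro tendsto_mult tendsto_const tendsto_inverse_0_at_top filterlim_pow_at_top filterlim_ident) simp
    then show "((\<lambda>y::real. - 1 / (real (n + 1) * y ^ (n + 1))) \<longlongrightarrow> 0) at_top"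
      by (simp add: divide_inverse)
  qed (use c in auto)
  also have "2 * ennreal (0 - (- 1 / (real (n + 1) * c ^ (n + 1)))) = ennreal (2 * (1 / (real (n + 1) * c ^ (n + 1))))"
    using c by (subst ennreal_mult) auto
  finally show ?thesis by simp
qed

text \<open>The same tail-integral device: \<open>(r / t)^2 \<le> u\<close> means that
  \<open>\<bar>t\<bar>\<close> is at least \<open>r / sqrt u\<close>, so the integral in
  \<open>t\<close> is a power tail and the one in \<open>u\<close> a Gamma integral.\<close>

lemma radial_integral:
  assumes r: "0 < r"
  shows "(\<integral>\<^sup>+t. ennreal (1 / \<bar>t\<bar> ^ (n + 2) * exp (- (r / t)\<^sup>2)) \<partial>lborel) = ennreal (Gamma (real (n + 1) / 2) / r ^ (n + 1))"
proof -
  have "(\<integral>\<^sup>+t. ennreal (1 / \<bar>t\<bar> ^ (n + 2) * exp (- (r / t)\<^sup>2)) \<partial>lborel) =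
     (\<integral>\<^sup>+t. (\<integral>\<^sup>+u. ennreal (1 / \<bar>t\<bar> ^ (n + 2)) * (ennreal (exp (- u)) * indicator {(r / t)\<^sup>2..} u) \<partial>lborel) \<partial>lborel)"
  proof (rule nn_integral_cong)
    fix t :: real
    have "(\<integral>\<^sup>+u. ennreal (1 / \<bar>t\<bar> ^ (n + 2)) * (ennreal (exp (- u)) * indicator {(r / t)\<^sup>2..} u) \<partial>lborel) =
       ennreal (1 / \<bar>t\<bar> ^ (n + 2)) * ennreal (exp (- (r / t)\<^sup>2))"
      by (subst nn_integral_cmult) (measurable, simp only: exp_tail_integral)
    then show "ennreal (1 / \<bar>t\<bar> ^ (n + 2) * exp (- (r / t)\<^sup>2)) =
       (\<integral>\<^sup>+u. ennreal (1 / \<bar>t\<bar> ^ (n + 2)) * (ennreal (exp (- u)) * indicator {(r / t)\<^sup>2..} u) \<partial>lborel)"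
      by (subst ennreal_mult) auto
  qed
  also have "\<dots> = (\<integral>\<^sup>+u. (\<integral>\<^sup>+t. ennreal (1 / \<bar>t\<bar> ^ (n + 2)) * (ennreal (exp (- u)) * indicator {(r / t)\<^sup>2..} u) \<partial>lborel) \<partial>lborel)"
    by (rule lborel_pair.Fubini') (simp add: indicator_def[abs_def] split_beta' cong: if_cong)
  also have "\<dots> = (\<integral>\<^sup>+u. ennreal (2 / (real (n + 1) * r ^ (n + 1))) * (ennreal (u powr ((real (n + 1) / 2 + 1) - 1) * exp (- u)) * indicator {0<..} u) \<partial>lborel)"
  proof (rule nn_integral_cong_AE, use AE_lborel_singleton[of 0] in eventually_elim)
    case (elim u)
    show ?case
    proof (cases "0 < u")
      case True
      define c where "c = r / sqrt u"
      have c: "0 < c" using r True by (simp add: c_def)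
      have "(\<integral>\<^sup>+t. ennreal (1 / \<bar>t\<bar> ^ (n + 2)) * (ennreal (exp (- u)) * indicator {(r / t)\<^sup>2..} u) \<partial>lborel)
         = (\<integral>\<^sup>+t. ennreal (exp (- u)) * (ennreal (1 / \<bar>t\<bar> ^ (n + 2)) * indicator {t. c \<le> \<bar>t\<bar>} t) \<partial>lborel)"
      proof (rule nn_integral_cong)
        fix t :: real
        show "ennreal (1 / \<bar>t\<bar> ^ (n + 2)) * (ennreal (exp (- u)) * indicator {(r / t)\<^sup>2..} u) = ennreal (exp (- u)) * (ennreal (1 / \<bar>t\<bar> ^ (n + 2)) * indicator {t. c \<le> \<bar>t\<bar>} t)"
        \<comment> \<open>Division by zero yields 0, so both sides vanish at
          \<open>t = 0\<close>.\<close>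
        proof (cases "t = 0")
          case False
          have "(r / t)\<^sup>2 \<le> u \<longleftrightarrow> sqrt ((r / t)\<^sup>2) \<le> sqrt u" by (rule real_sqrt_le_iff[symmetric])
          also have "sqrt ((r / t)\<^sup>2) = r / \<bar>t\<bar>" using r by simp
          also have "r / \<bar>t\<bar> \<le> sqrt u \<longleftrightarrow> c \<le> \<bar>t\<bar>" using True False by (simp add: c_def field_simps)
          finally have "indicator {(r / t)\<^sup>2..} u = (indicator {t. c \<le> \<bar>t\<bar>} t :: ennreal)" by (auto simp: indicator_def)
          then show ?thesis by (simp add: mult_ac)
        qed simp
      qed
      also have "\<dots> = ennreal (exp (- u)) * ennreal (2 / (real (n + 1) * c ^ (n + 1)))"
        by (subst nn_integral_cmult) (measurable, simp only: power_tail_integral[OF c])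
      also have "\<dots> = ennreal (exp (- u) * (2 / (real (n + 1) * c ^ (n + 1))))" using c by (intro ennreal_mult[symmetric]) auto
      also have "exp (- u) * (2 / (real (n + 1) * c ^ (n + 1))) = (2 / (real (n + 1) * r ^ (n + 1))) * (u powr ((real (n + 1) / 2 + 1) - 1) * exp (- u))"
      proof -
        have "u powr (real (n + 1) / 2) = (u powr (1/2)) powr real (n + 1)" by (simp add: powr_powr)
        also have "\<dots> = sqrt u ^ (n + 1)" using True by (simp only: powr_half_sqrt powr_realpow real_sqrt_gt_0_iff less_imp_le)
        finally have "c ^ (n + 1) = r ^ (n + 1) / u powr (real (n + 1) / 2)" by (simp only: c_def power_divide)
        then show ?thesis by simp
      qed
      also have "ennreal \<dots> = ennreal (2 / (real (n + 1) * r ^ (n + 1))) * (ennreal (u powr ((real (n + 1) / 2 + 1) - 1) * exp (- u)) * indicator {0<..} u)"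
        using True r by (subst ennreal_mult) auto
      finally show ?thesis .
    next
      case False
      have "(\<integral>\<^sup>+t. ennreal (1 / \<bar>t\<bar> ^ (n + 2)) * (ennreal (exp (- u)) * indicator {(r / t)\<^sup>2..} u) \<partial>lborel) = (\<integral>\<^sup>+(t::real). 0 \<partial>lborel)"
        using False elim by (intro nn_integral_cong) (auto simp: indicator_def not_less dest: order_trans[OF zero_le_power2])
      then show ?thesis using False by simp
    qed
  qed
  also have "\<dots> = ennreal (2 / (real (n + 1) * r ^ (n + 1))) * ennreal (Gamma (real (n + 1) / 2 + 1))"
  proof -
    have g: "0 < real (n + 1) / 2 + 1" by (simp add: add_pos_pos)
    show ?thesis by (subst nn_integral_cmult) (measurable, simp only: gamma_integral[OF g])
  qed
  also have "Gamma (real (n + 1) / 2 + 1) = real (n + 1) / 2 * Gamma (real (n + 1) / 2)"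
    using nonpos_Ints_nonpos[of "real (n + 1) / 2"] by (intro Gamma_plus1) auto
  also have "ennreal (2 / (real (n + 1) * r ^ (n + 1))) * ennreal (real (n + 1) / 2 * Gamma (real (n + 1) / 2)) =
     ennreal ((2 / (real (n + 1) * r ^ (n + 1))) * (real (n + 1) / 2 * Gamma (real (n + 1) / 2)))"
    using r by (intro ennreal_mult[symmetric]) (auto intro!: mult_nonneg_nonneg less_imp_le[OF Gamma_real_pos])
  also have "(2 / (real (n + 1) * r ^ (n + 1))) * (real (n + 1) / 2 * Gamma (real (n + 1) / 2)) = Gamma (real (n + 1) / 2) / r ^ (n + 1)"
    by simp
  finally show ?thesis .
qed


section \<open>Rotations without polar coordinates\<close>

lemma lborel_integral_scale:
  fixes f :: "'a::euclidean_space \<Rightarrow> real"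
  assumes [measurable]: "f \<in> borel_measurable borel" and c: "c \<noteq> 0"
  shows "(LINT x|lborel. f x) = \<bar>c\<bar> ^ DIM('a) * (LINT x|lborel. f (c *\<^sub>R x))"
  by (subst lborel_affine[OF c, of 0])
     (simp add: integral_density integral_distr)

definition rot_kernel :: "real \<Rightarrow> 'a \<Rightarrow> 'a::euclidean_space \<Rightarrow> real" where
  "rot_kernel e a y = (if e < norm y then (y \<bullet> a) / norm y ^ (DIM('a) + 1) else 0)"

lemma rot_kernel_measurable [measurable]: "rot_kernel e a \<in> borel_measurable borel"
  unfolding rot_kernel_def[abs_def] by measurable

lemma rot_kernel_decay:
  fixes a :: "'a::euclidean_space"
  assumes e: "0 < e"
  shows "\<bar>rot_kernel e a y\<bar> \<le> (norm a * (1/e + 1) ^ DIM('a)) * box_decay y"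
proof (cases "e < norm y")
  case True
  then have y: "0 < norm y" using e by linarith
  have "\<bar>rot_kernel e a y\<bar> = \<bar>y \<bullet> a\<bar> / norm y ^ (DIM('a) + 1)" using True by (simp add: rot_kernel_def)
  also have "\<dots> \<le> (norm y * norm a) / norm y ^ (DIM('a) + 1)"
    by (intro divide_right_mono Cauchy_Schwarz_ineq2) auto
  also have "\<dots> = norm a * (1 / norm y) ^ DIM('a)" using y by (simp add: power_divide)
  also have "1 / norm y \<le> (1/e + 1) * (1 / (1 + norm y))"
  proof -
    have "1 + norm y \<le> (1/e + 1) * norm y" using True e by (simp add: field_simps)
    then have "1 / norm y \<le> (1/e + 1) / (1 + norm y)"
      using y by (simp add: pos_divide_le_eq pos_le_divide_eq add_pos_nonneg mult.commute)
    then show ?thesis by simp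
  qed
  then have "norm a * (1 / norm y) ^ DIM('a) \<le> norm a * ((1/e + 1) * (1 / (1 + norm y))) ^ DIM('a)"
    by (intro mult_left_mono power_mono) auto
  also have "\<dots> = norm a * (1/e + 1) ^ DIM('a) * (1 / (1 + norm y)) ^ DIM('a)" by (simp only: power_mult_distrib mult.assoc)
  also have "\<dots> \<le> norm a * (1/e + 1) ^ DIM('a) * box_decay y"
    using e by (intro mult_left_mono box_decay_ge) auto
  finally show ?thesis .
next
  case False
  then show ?thesis using e box_decay_pos[of y] by (simp add: rot_kernel_def)
qed

lemma rot_kernel_integrable:
  fixes f :: "'a::euclidean_space \<Rightarrow> real"
  assumes "f \<in> borel_measurable borel" "1 < p" "lp_int p f < \<infinity>" "0 < e"
  shows "integrable lborel (\<lambda>y. rot_kernel e a y * f (x - y))"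
  by (rule lp_kernel_integrable[OF assms(1) _ assms(2,3) rot_kernel_decay[OF assms(4)]]) simp

text \<open>
  The substitution \<open>y = t z\<close> for fixed \<open>t\<close> produces the Riesz kernel; a Gaussian weight on all
  directions \<open>z\<close> replaces the surface measure of the sphere.
\<close>

lemma rotation_formula:
  fixes f :: "'a::euclidean_space \<Rightarrow> real"
  assumes [measurable]: "f \<in> borel_measurable borel" and p: "1 < p" and fin: "lp_int p f < \<infinity>" and e: "0 < e"
  shows "(LINT z|lborel. (z \<bullet> a) * exp (- (norm z)\<^sup>2) * dirH (e / norm z) f x z) =
     Gamma (real (DIM('a) + 1) / 2) / pi * (LINT y|lborel. rot_kernel e a y * f (x - y))"
proof -
  define n where "n = DIM('a)"
  define G where "G = Gamma (real (n + 1) / 2)"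
  have G0: "0 < G" unfolding G_def by (rule Gamma_real_pos) simp
  \<comment> \<open>Integrating \<Psi> in \<open>t\<close> gives the directional transform truncated
    at \<open>e / norm z\<close>, since \<open>e < \<bar>t\<bar> * norm z\<close> says
    \<open>e < norm y\<close> for \<open>y = t z\<close>. For fixed \<open>t\<close>, \<Phi> is
    \<Psi> in the variable \<open>y\<close>, Jacobian included; its dependence on \<open>t\<close>
    is the radial integrand.\<close>
  define \<Psi> where "\<Psi> = (\<lambda>(t::real) (z::'a). if e < \<bar>t\<bar> * norm z then (z \<bullet> a) * exp (- (norm z)\<^sup>2) / (pi * t) * f (x - t *\<^sub>R z) else 0)"
  define \<Phi> where "\<Phi> = (\<lambda>(t::real) (y::'a). if e < norm y then 1 / \<bar>t\<bar> ^ (n + 2) * exp (- (norm y / t)\<^sup>2) * ((y \<bullet> a) / pi * f (x - y)) else 0)"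
  have [measurable]: "(\<lambda>(t, z). \<Psi> t z) \<in> borel_measurable (borel \<Otimes>\<^sub>M borel)" "(\<lambda>(t, z). \<Phi> t z) \<in> borel_measurable (borel \<Otimes>\<^sub>M borel)"
    unfolding \<Psi>_def \<Phi>_def by measurable
  have [measurable]: "\<Psi> t \<in> borel_measurable borel" "\<Phi> t \<in> borel_measurable borel" for t
    unfolding \<Psi>_def \<Phi>_def by measurable
  have [measurable]: "(\<lambda>t. \<Psi> t z) \<in> borel_measurable borel" "(\<lambda>t. \<Phi> t z) \<in> borel_measurable borel" for z
    unfolding \<Psi>_def \<Phi>_def by measurable
  have zero: "\<Psi> 0 z = 0" "\<Phi> 0 z = 0" for z unfolding \<Psi>_def \<Phi>_def using e by auto
  have subst: "\<bar>1 / t\<bar> ^ n * \<Psi> t ((1 / t) *\<^sub>R y) = \<Phi> t y" if "t \<noteq> 0" for t y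
  proof -
    have main: "\<bar>1 / t\<bar> ^ n * ((y \<bullet> a) / t * exp (- (norm y / \<bar>t\<bar>)\<^sup>2) / (pi * t)) = 1 / \<bar>t\<bar> ^ (n + 2) * exp (- (norm y / t)\<^sup>2) * ((y \<bullet> a) / pi)"
    proof -
      have e1: "(norm y / \<bar>t\<bar>)\<^sup>2 = (norm y / t)\<^sup>2" by (simp add: power_divide)
      have e2: "\<bar>t\<bar> ^ (n + 2) = \<bar>t\<bar> ^ n * (t * t)" unfolding power_add by (simp add: power2_eq_square)
      show ?thesis unfolding e1 e2 using that by (simp add: power_divide mult_ac)
    qed
    show ?thesis
    proof (cases "e < norm y")
      case True
      have a1: "\<Psi> t ((1 / t) *\<^sub>R y) = ((y \<bullet> a) / t * exp (- (norm y / \<bar>t\<bar>)\<^sup>2) / (pi * t)) * f (x - y)"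
        using True that by (simp add: \<Psi>_def)
      have a2: "\<Phi> t y = (1 / \<bar>t\<bar> ^ (n + 2) * exp (- (norm y / t)\<^sup>2) * ((y \<bullet> a) / pi)) * f (x - y)"
        using True by (simp add: \<Phi>_def)
      show ?thesis unfolding a1 a2 main[symmetric] by (simp only: mult.assoc)
    qed (use that in \<open>simp add: \<Psi>_def \<Phi>_def\<close>)
  qed
  have nn: "(\<integral>\<^sup>+z. ennreal (norm (\<Psi> t z)) \<partial>lborel) = (\<integral>\<^sup>+y. ennreal (norm (\<Phi> t y)) \<partial>lborel)" for t
  proof (cases "t = 0")
    case False
    have "(\<integral>\<^sup>+z. ennreal (norm (\<Psi> t z)) \<partial>lborel) = ennreal (\<bar>1 / t\<bar> ^ n) * (\<integral>\<^sup>+z. ennreal (norm (\<Psi> t (0 + (1 / t) *\<^sub>R z))) \<partial>lborel)"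
      unfolding n_def using False by (intro nn_integral_lborel_affine) auto
    also have "\<dots> = (\<integral>\<^sup>+z. ennreal (\<bar>1 / t\<bar> ^ n) * ennreal (norm (\<Psi> t (0 + (1 / t) *\<^sub>R z))) \<partial>lborel)"
      by (rule nn_integral_cmult[symmetric]) measurable
    also have "\<dots> = (\<integral>\<^sup>+y. ennreal (norm (\<Phi> t y)) \<partial>lborel)"
    proof (rule nn_integral_cong)
      fix y
      have "ennreal (\<bar>1 / t\<bar> ^ n) * ennreal (norm (\<Psi> t (0 + (1 / t) *\<^sub>R y))) = ennreal (\<bar>1 / t\<bar> ^ n * norm (\<Psi> t ((1 / t) *\<^sub>R y)))"
        by (subst ennreal_mult) auto
      also have "\<bar>1 / t\<bar> ^ n * norm (\<Psi> t ((1 / t) *\<^sub>R y)) = norm (\<bar>1 / t\<bar> ^ n * \<Psi> t ((1 / t) *\<^sub>R y))"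
        by (simp add: abs_mult power_abs)
      finally show "ennreal (\<bar>1 / t\<bar> ^ n) * ennreal (norm (\<Psi> t (0 + (1 / t) *\<^sub>R y))) = ennreal (norm (\<Phi> t y))"
        unfolding subst[OF False] .
    qed
    finally show ?thesis .
  qed (simp add: zero)
  have bo: "(LINT z|lborel. \<Psi> t z) = (LINT y|lborel. \<Phi> t y)" for t
  proof (cases "t = 0")
    case False
    then have "(LINT z|lborel. \<Psi> t z) = \<bar>1 / t\<bar> ^ n * (LINT z|lborel. \<Psi> t ((1 / t) *\<^sub>R z))"
      unfolding n_def by (intro lborel_integral_scale) auto
    also have "\<dots> = (LINT z|lborel. \<bar>1 / t\<bar> ^ n * \<Psi> t ((1 / t) *\<^sub>R z))" by simp
    finally show ?thesis unfolding subst[OF False] .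
  qed (simp add: zero)
  have rad: "(\<integral>\<^sup>+t. ennreal (norm (\<Phi> t y)) \<partial>lborel) = ennreal (G / pi) * ennreal (norm (rot_kernel e a y * f (x - y)))" for y
  proof (cases "e < norm y")
    case True
    then have y: "0 < norm y" using e by linarith
    have "(\<integral>\<^sup>+t. ennreal (norm (\<Phi> t y)) \<partial>lborel) = (\<integral>\<^sup>+t. ennreal (norm ((y \<bullet> a) / pi * f (x - y))) * ennreal (1 / \<bar>t\<bar> ^ (n + 2) * exp (- (norm y / t)\<^sup>2)) \<partial>lborel)"
      using True by (intro nn_integral_cong) (simp add: \<Phi>_def abs_mult ennreal_mult[symmetric] mult_ac)
    also have "\<dots> = ennreal (norm ((y \<bullet> a) / pi * f (x - y))) * ennreal (G / norm y ^ (n + 1))"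
      unfolding G_def by (subst nn_integral_cmult) (measurable, simp only: radial_integral[OF y])
    also have "\<dots> = ennreal (norm ((y \<bullet> a) / pi * f (x - y)) * (G / norm y ^ (n + 1)))"
      using G0 by (intro ennreal_mult[symmetric]) auto
    also have "norm ((y \<bullet> a) / pi * f (x - y)) * (G / norm y ^ (n + 1)) = G / pi * norm (rot_kernel e a y * f (x - y))"
      using True by (simp add: rot_kernel_def abs_mult n_def)
    also have "ennreal \<dots> = ennreal (G / pi) * ennreal (norm (rot_kernel e a y * f (x - y)))"
      using G0 by (intro ennreal_mult) auto
    finally show ?thesis .
  qed (simp add: \<Phi>_def rot_kernel_def)
  have rk: "integrable lborel (\<lambda>y. rot_kernel e a y * f (x - y))" by (rule rot_kernel_integrable[OF assms])
  \<comment> \<open>Absolute integrability is checked on \<Phi>, whose integral over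
    \<open>t\<close> is explicit, and passes to \<Psi> through \<open>nn\<close>. Both exchanges of
    integrals below depend on it.\<close>
  have fin2: "(\<integral>\<^sup>+t. (\<integral>\<^sup>+y. ennreal (norm (\<Phi> t y)) \<partial>lborel) \<partial>lborel) < \<infinity>"
  proof -
    have "(\<integral>\<^sup>+t. (\<integral>\<^sup>+y. ennreal (norm (\<Phi> t y)) \<partial>lborel) \<partial>lborel) = (\<integral>\<^sup>+y. (\<integral>\<^sup>+t. ennreal (norm (\<Phi> t y)) \<partial>lborel) \<partial>lborel)"
      by (rule lborel_pair.Fubini') measurable
    also have "\<dots> = ennreal (G / pi) * (\<integral>\<^sup>+y. ennreal (norm (rot_kernel e a y * f (x - y))) \<partial>lborel)"
      unfolding rad by (rule nn_integral_cmult) measurable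
    also have "\<dots> < \<infinity>" using rk by (simp add: integrable_iff_bounded ennreal_mult_less_top)
    finally show ?thesis .
  qed
  have i\<Phi>: "integrable (lborel \<Otimes>\<^sub>M lborel) (\<lambda>(t, y). \<Phi> t y)"
  proof (rule integrableI_bounded)
    have "(\<integral>\<^sup>+w. ennreal (norm (case w of (t, y) \<Rightarrow> \<Phi> t y)) \<partial>(lborel \<Otimes>\<^sub>M lborel)) = (\<integral>\<^sup>+t. (\<integral>\<^sup>+y. ennreal (norm (\<Phi> t y)) \<partial>lborel) \<partial>lborel)"
      by (subst lborel.nn_integral_fst[symmetric]) (auto simp: split_beta')
    then show "(\<integral>\<^sup>+w. ennreal (norm (case w of (t, y) \<Rightarrow> \<Phi> t y)) \<partial>(lborel \<Otimes>\<^sub>M lborel)) < \<infinity>" using fin2 by simp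
  qed measurable
  have i\<Psi>: "integrable (lborel \<Otimes>\<^sub>M lborel) (\<lambda>(t, y). \<Psi> t y)"
  proof (rule integrableI_bounded)
    have "(\<integral>\<^sup>+w. ennreal (norm (case w of (t, y) \<Rightarrow> \<Psi> t y)) \<partial>(lborel \<Otimes>\<^sub>M lborel)) = (\<integral>\<^sup>+t. (\<integral>\<^sup>+y. ennreal (norm (\<Psi> t y)) \<partial>lborel) \<partial>lborel)"
      by (subst lborel.nn_integral_fst[symmetric]) (auto simp: split_beta')
    then show "(\<integral>\<^sup>+w. ennreal (norm (case w of (t, y) \<Rightarrow> \<Psi> t y)) \<partial>(lborel \<Otimes>\<^sub>M lborel)) < \<infinity>" using fin2 nn by simp
  qed measurable
  have "(LINT z|lborel. (z \<bullet> a) * exp (- (norm z)\<^sup>2) * dirH (e / norm z) f x z) = (LINT z|lborel. (LINT t|lborel. \<Psi> t z))"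
  proof (rule Bochner_Integration.integral_cong)
    fix z :: 'a
    show "(z \<bullet> a) * exp (- (norm z)\<^sup>2) * dirH (e / norm z) f x z = (LINT t|lborel. \<Psi> t z)"
    proof (cases "z = 0")
      case True
      then show ?thesis using e by (simp add: \<Psi>_def)
    next
      case False
      then have z: "0 < norm z" by simp
      have "(z \<bullet> a) * exp (- (norm z)\<^sup>2) * dirH (e / norm z) f x z = (LINT t|lborel. ((z \<bullet> a) * exp (- (norm z)\<^sup>2)) * (hk (e / norm z) t * f (x + (0 - t) *\<^sub>R z)))"
        unfolding dirH_def trH_def by simp
      also have "\<dots> = (LINT t|lborel. \<Psi> t z)"
        using z by (intro Bochner_Integration.integral_cong) (auto simp: \<Psi>_def hk_def pos_divide_less_eq)
      finally show ?thesis .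
    qed
  qed simp
  also have "\<dots> = (LINT t|lborel. (LINT z|lborel. \<Psi> t z))" by (rule lborel_pair.Fubini_integral[OF i\<Psi>])
  also have "\<dots> = (LINT t|lborel. (LINT y|lborel. \<Phi> t y))" by (simp only: bo)
  also have "\<dots> = (LINT y|lborel. (LINT t|lborel. \<Phi> t y))" by (rule lborel_pair.Fubini_integral[OF i\<Phi>, symmetric])
  also have "\<dots> = (LINT y|lborel. G / pi * (rot_kernel e a y * f (x - y)))"
  proof (rule Bochner_Integration.integral_cong)
    fix y :: 'a
    show "(LINT t|lborel. \<Phi> t y) = G / pi * (rot_kernel e a y * f (x - y))"
    proof (cases "e < norm y")
      case True
      then have y: "0 < norm y" using e by linarith
      have "has_bochner_integral lborel (\<lambda>t. 1 / \<bar>t\<bar> ^ (n + 2) * exp (- (norm y / t)\<^sup>2)) (G / norm y ^ (n + 1))"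
        using radial_integral[OF y, of n] G0 unfolding G_def by (intro has_bochner_integral_nn_integral) auto
      then have I: "(LINT t|lborel. 1 / \<bar>t\<bar> ^ (n + 2) * exp (- (norm y / t)\<^sup>2)) = G / norm y ^ (n + 1)"
        by (rule has_bochner_integral_integral_eq)
      have "(LINT t|lborel. \<Phi> t y) = (LINT t|lborel. 1 / \<bar>t\<bar> ^ (n + 2) * exp (- (norm y / t)\<^sup>2) * ((y \<bullet> a) / pi * f (x - y)))"
        using True by (simp add: \<Phi>_def)
      also have "\<dots> = G / norm y ^ (n + 1) * ((y \<bullet> a) / pi * f (x - y))"
        unfolding I[symmetric] by (rule integral_mult_left_zero)
      also have "\<dots> = G / pi * (rot_kernel e a y * f (x - y))"
        using True by (simp add: rot_kernel_def n_def)
      finally show ?thesis .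
    qed (simp add: \<Phi>_def rot_kernel_def)
  qed simp
  also have "\<dots> = G / pi * (LINT y|lborel. rot_kernel e a y * f (x - y))" by simp
  finally show ?thesis by (simp add: G_def n_def)
qed

section \<open>The Riesz transforms as Gaussian averages\<close>

definition gw :: "'a::euclidean_space \<Rightarrow> real" where "gw z = exp (- (norm z)\<^sup>2)"

lemma gw_measurable [measurable]: "gw \<in> borel_measurable borel" unfolding gw_def[abs_def] by measurable

lemma gw_pos: "0 < gw z" by (simp add: gw_def)

lemma norm_gw_finite: "(\<integral>\<^sup>+z. ennreal (norm (z::'a::euclidean_space) * gw z) \<partial>lborel) < \<infinity>"
proof -
  have "(\<integral>\<^sup>+z. ennreal (norm (z::'a) * gw z) \<partial>lborel) \<le> (\<integral>\<^sup>+z. (\<Sum>b\<in>(Basis::'a set). ennreal (\<bar>z \<bullet> b\<bar> * exp (- (norm z)\<^sup>2))) \<partial>lborel)"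
  proof (rule nn_integral_mono)
    fix z :: 'a
    have "norm z * gw z \<le> (\<Sum>b\<in>Basis. \<bar>z \<bullet> b\<bar>) * gw z"
      using gw_pos[of z] by (intro mult_right_mono norm_le_l1) auto
    also have "\<dots> = (\<Sum>b\<in>Basis. \<bar>z \<bullet> b\<bar> * exp (- (norm z)\<^sup>2))" by (simp add: sum_distrib_right gw_def)
    finally have "ennreal (norm z * gw z) \<le> ennreal (\<Sum>b\<in>Basis. \<bar>z \<bullet> b\<bar> * exp (- (norm z)\<^sup>2))" by (rule ennreal_leI)
    then show "ennreal (norm z * gw z) \<le> (\<Sum>b\<in>Basis. ennreal (\<bar>z \<bullet> b\<bar> * exp (- (norm z)\<^sup>2)))" by (simp add: sum_ennreal)
  qed
  also have "\<dots> = (\<Sum>b\<in>(Basis::'a set). (\<integral>\<^sup>+z. ennreal (\<bar>z \<bullet> b\<bar> * exp (- (norm z)\<^sup>2)) \<partial>lborel))"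
    by (rule nn_integral_sum) measurable
  also have "\<dots> < \<infinity>" by (simp add: gauss_direction ennreal_mult_less_top of_nat_less_top)
  finally show ?thesis .
qed

definition riesz_trunc :: "'n::finite \<Rightarrow> (real^'n \<Rightarrow> real) \<Rightarrow> real^'n \<Rightarrow> real \<Rightarrow> real" where
  "riesz_trunc j f x e = - riesz_const CARD('n) *
     (LINT y : {y. e < norm y} | lborel. (y $ j / norm y ^ (CARD('n) + 1)) * f (x - y))"

text \<open>The reciprocal of the integral of \<open>\<bar>z \<bullet> a\<bar> * gw z\<close> for a
  unit vector \<open>a\<close>: with this factor the weight becomes a probability density.\<close>

definition kap :: "'n::finite itself \<Rightarrow> real" where "kap _ = 1 / sqrt pi ^ (CARD('n) - 1)"

lemma kap_pos: "0 < kap TYPE('n::finite)" by (simp add: kap_def)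

lemma dirH_scaled_measurable [measurable]:
  fixes f :: "'a::euclidean_space \<Rightarrow> real"
  assumes [measurable]: "f \<in> borel_measurable borel"
  shows "(\<lambda>z. dirH (e / norm z) f x z) \<in> borel_measurable borel"
  unfolding dirH_def trH_def hk_def by measurable

text \<open>The normalising constant of the Riesz kernel is \<open>kap\<close> times the constant of
  \<open>rotation_formula\<close>. The average therefore has total mass exactly one in each
  direction, which is why the limiting ratio is 1 and not some other constant.\<close>

lemma riesz_trunc_eq:
  fixes f :: "real^'n::finite \<Rightarrow> real"
  assumes "f \<in> borel_measurable borel" "1 < p" "lp_int p f < \<infinity>" "0 < e"
  shows "riesz_trunc j f x e = - kap TYPE('n) * (LINT z|lborel. z $ j * gw z * dirH (e / norm z) f x z)"
proof -
  define G where "G = Gamma (real (CARD('n) + 1) / 2)"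
  have G0: "0 < G" unfolding G_def by (rule Gamma_real_pos) simp
  have "(LINT z|lborel. z $ j * gw z * dirH (e / norm z) f x z) = G / pi * (LINT y|lborel. rot_kernel e (axis j 1) y * f (x - y))"
    using rotation_formula[OF assms, of "axis j 1" x] by (simp add: gw_def inner_axis G_def)
  moreover have "(LINT y : {y. e < norm y} | lborel. (y $ j / norm y ^ (CARD('n) + 1)) * f (x - y)) = (LINT y|lborel. rot_kernel e (axis j 1) y * f (x - y))"
    unfolding set_lebesgue_integral_def by (intro Bochner_Integration.integral_cong) (auto simp: rot_kernel_def inner_axis indicator_def)
  moreover have "riesz_const CARD('n) = kap TYPE('n) * (G / pi)"
  proof -
    have "pi powr ((real CARD('n) + 1) / 2) = (pi powr (1/2)) powr (real (CARD('n) + 1))" by (simp add: powr_powr add.commute)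
    also have "\<dots> = sqrt pi ^ (CARD('n) + 1)" by (simp only: powr_half_sqrt powr_realpow real_sqrt_gt_0_iff pi_gt_zero pi_ge_zero)
    also have "CARD('n) + 1 = (CARD('n) - 1) + 2" using zero_less_card_finite[where 'a='n] by linarith
    also have "sqrt pi ^ ((CARD('n) - 1) + 2) = sqrt pi ^ (CARD('n) - 1) * pi" unfolding power_add by simp
    finally have e1: "pi powr ((real CARD('n) + 1) / 2) = sqrt pi ^ (CARD('n) - 1) * pi" .
    show ?thesis unfolding riesz_const_def kap_def e1 G_def by (simp add: add.commute)
  qed
  ultimately show ?thesis unfolding riesz_trunc_def by simp
qed

text \<open>Dominated convergence over the directions. A spatial truncation \<open>e\<close> becomes
  the level \<open>e / norm z\<close> on the line with direction \<open>z\<close>, which tends to 0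
  for each nonzero \<open>z\<close>, while \<open>B\<close> controls all levels at once.\<close>

lemma riesz_limit:
  fixes f :: "real^'n::finite \<Rightarrow> real" and D B :: "real^'n \<Rightarrow> real"
  assumes m[measurable]: "f \<in> borel_measurable borel" "D \<in> borel_measurable borel" and p: "1 < p" and fin: "lp_int p f < \<infinity>"
    and conv: "AE z in lborel. ((\<lambda>e. dirH e f x z) \<longlongrightarrow> D z) (at_right 0)"
    and bnd: "AE z in lborel. \<forall>e>0. \<bar>dirH e f x z\<bar> \<le> B z"
    and int: "integrable lborel (\<lambda>z. norm z * gw z * B z)"
  shows "riesz j f x = - kap TYPE('n) * (LINT z|lborel. z $ j * gw z * D z)"
    and "integrable lborel (\<lambda>z. z $ j * gw z * D z)"
    and "integrable lborel (\<lambda>z. norm z * gw z * D z)"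
proof -
  have nz: "AE z in (lborel :: (real^'n) measure). z \<noteq> 0" by (rule AE_lborel_singleton)
  have DB: "AE z in lborel. \<bar>D z\<bar> \<le> B z"
    using conv bnd
  proof eventually_elim
    case (elim z)
    have lim: "((\<lambda>e. \<bar>dirH e f x z\<bar>) \<longlongrightarrow> \<bar>D z\<bar>) (at_right 0)" using elim(1) by (rule tendsto_rabs)
    show ?case by (rule tendsto_upperbound[OF lim]) (use elim(2) in \<open>auto intro!: eventually_at_rightI[of 0 1]\<close>)
  qed
  have jn: "\<bar>z $ j * gw z * w\<bar> \<le> norm z * gw z * B z" if "\<bar>w\<bar> \<le> B z" for z :: "real^'n" and w
  proof -
    have "\<bar>z $ j * gw z * w\<bar> = (\<bar>z $ j\<bar> * gw z) * \<bar>w\<bar>" using gw_pos[of z] by (simp add: abs_mult)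
    also have "\<dots> \<le> (norm z * gw z) * B z"
      using that gw_pos[of z] component_le_norm_cart[of z j] by (intro mult_mono) auto
    finally show ?thesis by simp
  qed
  show "integrable lborel (\<lambda>z. z $ j * gw z * D z)"
  proof (rule Bochner_Integration.integrable_bound[OF int])
    show "AE z in lborel. norm (z $ j * gw z * D z) \<le> norm (norm z * gw z * B z)"
      using DB by eventually_elim (use jn in \<open>fastforce intro: order_trans\<close>)
  qed measurable
  show "integrable lborel (\<lambda>z. norm z * gw z * D z)"
  proof (rule Bochner_Integration.integrable_bound[OF int])
    show "AE z in lborel. norm (norm z * gw z * D z) \<le> norm (norm z * gw z * B z)"
      using DB by eventually_elim (auto simp: abs_mult intro!: mult_left_mono)
  qed measurable
  have "((\<lambda>e. riesz_trunc j f x e) \<longlongrightarrow> - kap TYPE('n) * (LINT z|lborel. z $ j * gw z * D z)) (at_right 0)"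
    unfolding tendsto_at_iff_sequentially comp_def
  proof (intro allI impI)
    fix X :: "nat \<Rightarrow> real" assume X: "\<forall>i. X i \<in> {0<..} - {0}" "X \<longlonglongrightarrow> 0"
    then have Xp: "0 < X i" for i by auto
    have "(\<lambda>i. (LINT z|lborel. z $ j * gw z * dirH (X i / norm z) f x z)) \<longlonglongrightarrow> (LINT z|lborel. z $ j * gw z * D z)"
    proof (rule integral_dominated_convergence[OF _ _ int])
      show "AE z in lborel. (\<lambda>i. z $ j * gw z * dirH (X i / norm z) f x z) \<longlonglongrightarrow> z $ j * gw z * D z"
        using conv nz
      proof eventually_elim
        case (elim z)
        have "(\<lambda>i. X i / norm z) \<longlonglongrightarrow> 0 / norm z" using elim(2) by (intro tendsto_divide X tendsto_const) auto
        then have "filterlim (\<lambda>i. X i / norm z) (at_right 0) sequentially"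
          unfolding filterlim_at using Xp elim(2) by (auto intro!: always_eventually simp: less_imp_neq[OF Xp, symmetric])
        then have "(\<lambda>i. dirH (X i / norm z) f x z) \<longlonglongrightarrow> D z" by (rule filterlim_compose[OF elim(1)])
        then show ?case by (intro tendsto_mult tendsto_const)
      qed
      show "AE z in lborel. norm (z $ j * gw z * dirH (X i / norm z) f x z) \<le> norm z * gw z * B z" for i
        using bnd nz
      proof eventually_elim
        case (elim z)
        then have "\<bar>dirH (X i / norm z) f x z\<bar> \<le> B z" using Xp[of i] by simp
        then show ?case using jn by simp
      qed
    qed measurable
    then have "(\<lambda>i. - kap TYPE('n) * (LINT z|lborel. z $ j * gw z * dirH (X i / norm z) f x z)) \<longlonglongrightarrow> - kap TYPE('n) * (LINT z|lborel. z $ j * gw z * D z)"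
      by (intro tendsto_mult tendsto_const)
    then show "(\<lambda>i. riesz_trunc j f x (X i)) \<longlonglongrightarrow> - kap TYPE('n) * (LINT z|lborel. z $ j * gw z * D z)"
      by (simp only: riesz_trunc_eq[OF m(1) p fin Xp])
  qed
  then show "riesz j f x = - kap TYPE('n) * (LINT z|lborel. z $ j * gw z * D z)"
    unfolding riesz_def riesz_trunc_def[symmetric] by (intro tendsto_Lim) auto
qed

lemma riesz_ae:
  fixes f :: "real^'n::finite \<Rightarrow> real"
  assumes m[measurable]: "f \<in> borel_measurable borel" and p: "6 \<le> p" and fin: "lp_int p f < \<infinity>"
  shows "AE x in lborel. integrable lborel (\<lambda>z. norm z * gw z * dirL f x z) \<and>
    (\<forall>j. integrable lborel (\<lambda>z. z $ j * gw z * dirL f x z) \<and> riesz j f x = - kap TYPE('n) * (LINT z|lborel. z $ j * gw z * dirL f x z))"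
proof -
  have nz: "AE z in (lborel :: (real^'n) measure). z \<noteq> 0" by (rule AE_lborel_singleton)
  have "AE x in lborel. (\<integral>\<^sup>+z. ennreal (norm z * gw z) * dirM p f x z \<partial>lborel) < \<infinity>"
    by (rule dirM_weighted[OF m p fin _ norm_gw_finite]) measurable
  then show ?thesis using dir_good[OF m p fin]
  proof eventually_elim
    case (elim x)
    have "AE z in lborel. ennreal (norm z * gw z) * dirM p f x z \<noteq> \<infinity>"
      using elim(1) by (intro nn_integral_PInf_AE) auto
    then have fM: "AE z in lborel. dirM p f x z < \<infinity>"
      using nz
    proof eventually_elim
      case (elim z)
      have "0 < norm z * gw z" using elim(2) gw_pos[of z] by simp
      then show ?case using elim(1) by (auto simp: ennreal_mult_eq_top_iff top.not_eq_extremum)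
    qed
    \<comment> \<open>\<open>dirM\<close> bounds p-th powers; adding 1 turns this into a bound for
      the values, as \<open>w \<le> 1 + w powr p\<close> for nonnegative \<open>w\<close>.\<close>
    define B where "B z = 1 + enn2real (dirM p f x z)" for z
    have [measurable]: "B \<in> borel_measurable borel" unfolding B_def[abs_def] by measurable
    have bnd: "AE z in lborel. \<forall>e>0. \<bar>dirH e f x z\<bar> \<le> B z"
      using fM elim(2)
    proof eventually_elim
      case (elim z)
      show ?case
      proof (intro allI impI)
        fix e :: real assume "0 < e"
        then have "ennreal (\<bar>dirH e f x z\<bar> powr p) \<le> dirM p f x z" using elim(2) by blast
        also have "\<dots> = ennreal (enn2real (dirM p f x z))" using elim(1) by simp
        finally have 1: "\<bar>dirH e f x z\<bar> powr p \<le> enn2real (dirM p f x z)" by (simp add: ennreal_le_iff)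
        have "\<bar>dirH e f x z\<bar> \<le> 1 + \<bar>dirH e f x z\<bar> powr p"
        proof (cases "\<bar>dirH e f x z\<bar> \<le> 1")
          case False
          then have "\<bar>dirH e f x z\<bar> powr 1 \<le> \<bar>dirH e f x z\<bar> powr p" using p by (intro powr_mono) auto
          then show ?thesis by simp
        qed (simp add: add_increasing2)
        then show "\<bar>dirH e f x z\<bar> \<le> B z" using 1 by (simp add: B_def)
      qed
    qed
    have int: "integrable lborel (\<lambda>z. norm z * gw z * B z)"
    proof (rule integrableI_nonneg)
      show "AE z in lborel. 0 \<le> norm z * gw z * B z"
        by (intro AE_I2 mult_nonneg_nonneg) (auto simp: B_def less_imp_le[OF gw_pos])
      have "(\<integral>\<^sup>+z. ennreal (norm z * gw z * B z) \<partial>lborel) \<le> (\<integral>\<^sup>+z. ennreal (norm z * gw z) + ennreal (norm z * gw z) * dirM p f x z \<partial>lborel)"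
      proof (rule nn_integral_mono_AE, use fM in eventually_elim)
        case (elim z)
        have "norm z * gw z * B z = norm z * gw z + norm z * gw z * enn2real (dirM p f x z)" by (simp add: B_def distrib_left)
        then have "ennreal (norm z * gw z * B z) = ennreal (norm z * gw z) + ennreal (norm z * gw z) * ennreal (enn2real (dirM p f x z))"
          using gw_pos[of z] by (simp add: ennreal_mult[symmetric] less_imp_le)
        then show ?case using elim by simp
      qed
      also have "\<dots> = (\<integral>\<^sup>+z. ennreal (norm (z::real^'n) * gw z) \<partial>lborel) + (\<integral>\<^sup>+z. ennreal (norm z * gw z) * dirM p f x z \<partial>lborel)"
        by (rule nn_integral_add) measurable
      also have "\<dots> < \<infinity>" using norm_gw_finite[where 'a="real^'n"] elim(1) by simp
      finally show "(\<integral>\<^sup>+z. ennreal (norm z * gw z * B z) \<partial>lborel) < \<infinity>" .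
    qed measurable
    have conv: "AE z in lborel. ((\<lambda>e. dirH e f x z) \<longlongrightarrow> dirL f x z) (at_right 0)"
      using elim(2) by eventually_elim auto
    have p1: "1 < p" using p by simp
    note R = riesz_limit[OF m dirL_measurable(3)[OF m] p1 fin conv bnd int]
    show ?case using R by blast
  qed
qed

text \<open>The sign of \<open>z \<bullet> a\<close> is absorbed into the absolute value, Jensen
  applies to the probability density \<rho>, and after Tonelli each direction is bounded by
  \<open>dirL_bound\<close>. No constant is lost.\<close>

lemma riesz_direction_bound:
  fixes f :: "real^'n::finite \<Rightarrow> real" and a :: "real^'n"
  assumes m[measurable]: "f \<in> borel_measurable borel" and p: "6 \<le> p" and fin: "lp_int p f < \<infinity>" and a: "norm a = 1"
    and N: "\<And>h. h \<in> borel_measurable borel \<Longrightarrow> lp_int p h < \<infinity> \<Longrightarrow> lp_int p (hilR h) \<le> N * lp_int p h"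
  shows "lp_int p (\<lambda>x. kap TYPE('n) * (LINT z|lborel. (z \<bullet> a) * gw z * dirL f x z)) \<le> N * lp_int p f"
proof -
  define \<rho> where "\<rho> z = kap TYPE('n) * (\<bar>z \<bullet> a\<bar> * gw z)" for z :: "real^'n"
  have [measurable]: "\<rho> \<in> borel_measurable borel" unfolding \<rho>_def[abs_def] by measurable
  have \<rho>0: "0 \<le> \<rho> z" for z unfolding \<rho>_def using kap_pos[where 'n='n] gw_pos[of z] by (simp add: less_imp_le)
  have \<rho>1: "(\<integral>\<^sup>+z. ennreal (\<rho> z) \<partial>lborel) = 1"
  proof -
    have "(\<integral>\<^sup>+z. ennreal (\<rho> z) \<partial>lborel) = (\<integral>\<^sup>+z. ennreal (kap TYPE('n)) * ennreal (\<bar>z \<bullet> a\<bar> * exp (- (norm z)\<^sup>2)) \<partial>lborel)"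
      using kap_pos[where 'n='n] by (intro nn_integral_cong) (simp add: \<rho>_def gw_def ennreal_mult[symmetric])
    also have "\<dots> = ennreal (kap TYPE('n)) * ennreal (sqrt pi ^ (CARD('n) - 1))"
      using gauss_direction[OF a] by (simp add: nn_integral_cmult)
    also have "\<dots> = ennreal (kap TYPE('n) * sqrt pi ^ (CARD('n) - 1))" using kap_pos[where 'n='n] by (intro ennreal_mult[symmetric]) auto
    also have "\<dots> = 1" by (simp add: kap_def)
    finally show ?thesis .
  qed
  have \<rho>i: "integrable lborel \<rho>" using \<rho>0 \<rho>1 by (intro integrableI_nonneg) auto
  have \<rho>I: "(LINT z|lborel. \<rho> z) = 1" using \<rho>0 \<rho>1 \<rho>i by (simp add: integral_eq_nn_integral)
  have "lp_int p (\<lambda>x. kap TYPE('n) * (LINT z|lborel. (z \<bullet> a) * gw z * dirL f x z)) \<le> (\<integral>\<^sup>+x. (\<integral>\<^sup>+z. ennreal (\<rho> z * \<bar>dirL f x z\<bar> powr p) \<partial>lborel) \<partial>lborel)"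
    unfolding lp_int_def
  proof (rule nn_integral_mono_AE, use riesz_ae[OF m p fin] in eventually_elim)
    case (elim x)
    have i: "integrable lborel (\<lambda>z. \<rho> z * \<bar>dirL f x z\<bar>)"
    proof (rule Bochner_Integration.integrable_bound[where f="\<lambda>z. kap TYPE('n) * (norm z * gw z * dirL f x z)"])
      show "integrable lborel (\<lambda>z. kap TYPE('n) * (norm z * gw z * dirL f x z))" using elim by simp
      show "AE z in lborel. norm (\<rho> z * \<bar>dirL f x z\<bar>) \<le> norm (kap TYPE('n) * (norm z * gw z * dirL f x z))"
      proof (rule AE_I2)
        fix z :: "real^'n"
        have "\<bar>z \<bullet> a\<bar> \<le> norm z" using Cauchy_Schwarz_ineq2[of z a] a by simp
        then have "kap TYPE('n) * (\<bar>z \<bullet> a\<bar> * gw z) * \<bar>dirL f x z\<bar> \<le> kap TYPE('n) * (norm z * gw z) * \<bar>dirL f x z\<bar>"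
          using gw_pos[of z] kap_pos[where 'n='n] by (intro mult_right_mono mult_left_mono) auto
        then show "norm (\<rho> z * \<bar>dirL f x z\<bar>) \<le> norm (kap TYPE('n) * (norm z * gw z * dirL f x z))"
          using gw_pos[of z] kap_pos[where 'n='n] by (simp add: \<rho>_def abs_mult mult.assoc)
      qed
    qed measurable
    have "norm (kap TYPE('n) * (LINT z|lborel. (z \<bullet> a) * gw z * dirL f x z)) = \<bar>LINT z|lborel. kap TYPE('n) * ((z \<bullet> a) * gw z * dirL f x z)\<bar>" by simp
    also have "\<dots> \<le> (LINT z|lborel. \<bar>kap TYPE('n) * ((z \<bullet> a) * gw z * dirL f x z)\<bar>)" by (rule integral_abs_bound)
    also have "\<dots> = (LINT z|lborel. \<rho> z * \<bar>dirL f x z\<bar>)"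
      using kap_pos[where 'n='n] by (intro Bochner_Integration.integral_cong) (auto simp: \<rho>_def abs_mult abs_of_pos[OF gw_pos])
    finally have "norm (kap TYPE('n) * (LINT z|lborel. (z \<bullet> a) * gw z * dirL f x z)) powr p \<le> (LINT z|lborel. \<rho> z * \<bar>dirL f x z\<bar>) powr p"
      using p by (intro powr_mono2) auto
    then have "ennreal (norm (kap TYPE('n) * (LINT z|lborel. (z \<bullet> a) * gw z * dirL f x z)) powr p) \<le> ennreal ((LINT z|lborel. \<rho> z * \<bar>dirL f x z\<bar>) powr p)"
      by (rule ennreal_leI)
    also have "\<dots> \<le> (\<integral>\<^sup>+z. ennreal (\<rho> z * \<bar>dirL f x z\<bar> powr p) \<partial>lborel)"
      using \<rho>0 \<rho>i \<rho>I i p by (intro jensen_powr) auto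
    finally show ?case .
  qed
  also have "\<dots> = (\<integral>\<^sup>+z. (\<integral>\<^sup>+x. ennreal (\<rho> z * \<bar>dirL f x z\<bar> powr p) \<partial>lborel) \<partial>lborel)"
    by (rule lborel_pair.Fubini') measurable
  also have "\<dots> \<le> (\<integral>\<^sup>+z. ennreal (\<rho> z) * (N * lp_int p f) \<partial>lborel)"
  proof (rule nn_integral_mono_AE, use AE_lborel_singleton[of "0 :: real^'n"] in eventually_elim)
    case (elim z)
    have "(\<integral>\<^sup>+x. ennreal (\<rho> z * \<bar>dirL f x z\<bar> powr p) \<partial>lborel) = ennreal (\<rho> z) * lp_int p (\<lambda>x. dirL f x z)"
      unfolding lp_int_def using \<rho>0[of z] by (simp add: ennreal_mult nn_integral_cmult)
    also have "\<dots> \<le> ennreal (\<rho> z) * (N * lp_int p f)"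
      by (intro mult_left_mono dirL_bound[OF m elim p fin N]) auto
    finally show ?case .
  qed
  also have "\<dots> = N * lp_int p f" by (simp add: nn_integral_multc \<rho>1)
  finally show ?thesis .
qed

section \<open>Finite nets of directions\<close>

text \<open>The unit sphere is totally bounded. If \<open>norm (u - a) < d\<close> for unit vectors,
  then \<open>u \<bullet> a = 1 - u \<bullet> (u - a)\<close> is at least \<open>1 - d\<close>;
  homogeneity does the rest.\<close>

lemma finite_direction_net:
  assumes d: "0 < d" "d < 1"
  shows "\<exists>S. finite S \<and> (\<forall>a\<in>S. norm a = 1) \<and> (\<forall>v::'a::euclidean_space. \<exists>a\<in>S. (1 - d) * norm v \<le> \<bar>v \<bullet> a\<bar>)"
proof -
  have "\<exists>k. finite k \<and> k \<subseteq> sphere (0::'a) 1 \<and> sphere 0 1 \<subseteq> (\<Union>x\<in>k. ball x d)"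
    by (rule seq_compact_imp_totally_bounded[rule_format]) (use d in \<open>auto simp: compact_eq_seq_compact_metric[symmetric]\<close>)
  then obtain S where S: "finite S" "S \<subseteq> sphere (0::'a) 1" "sphere 0 1 \<subseteq> (\<Union>x\<in>S. ball x d)" by blast
  have unit: "\<exists>a\<in>S. 1 - d \<le> \<bar>u \<bullet> a\<bar>" if u: "norm u = 1" for u :: 'a
  proof -
    obtain a where a: "a \<in> S" "norm (u - a) < d" using S(3) u by (force simp: dist_norm norm_minus_commute)
    have "u \<bullet> u = 1" using u by (simp add: norm_eq_1)
    moreover have "u \<bullet> (u - a) \<le> norm u * norm (u - a)" by (rule norm_cauchy_schwarz)
    ultimately have "1 - d \<le> u \<bullet> a" using a u by (simp add: inner_diff_right)
    then show ?thesis using a(1) by (intro bexI[of _ a]) auto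
  qed
  have "\<exists>a\<in>S. (1 - d) * norm v \<le> \<bar>v \<bullet> a\<bar>" for v :: 'a
  proof (cases "v = 0")
    case True
    obtain b :: 'a where "b \<in> Basis" using nonempty_Basis by blast
    then obtain a where "a \<in> S" using unit[of b] by auto
    then show ?thesis using True by auto
  next
    case False
    obtain a where a: "a \<in> S" "1 - d \<le> \<bar>(v /\<^sub>R norm v) \<bullet> a\<bar>" using unit[of "v /\<^sub>R norm v"] False by auto
    have "(1 - d) * norm v \<le> \<bar>(v /\<^sub>R norm v) \<bullet> a\<bar> * norm v" using a by (intro mult_right_mono) auto
    also have "\<dots> = \<bar>v \<bullet> a\<bar>" using False by (simp add: abs_mult)
    finally show ?thesis using a(1) by blast
  qed
  then show ?thesis using S(1,2) by (intro exI[of _ S]) auto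
qed

text \<open>The field \<open>G\<close> consists of \<open>Lim\<close> values and comes without a
  measurability proof, so its components are replaced almost everywhere by measurable functions
  \<open>g a\<close> before sum and integral are exchanged.\<close>

lemma net_lp:
  fixes G :: "'a::euclidean_space \<Rightarrow> 'b::euclidean_space" and g :: "'b \<Rightarrow> 'a \<Rightarrow> real"
  assumes d: "d < 1" and S: "finite S" "\<And>v::'b. \<exists>a\<in>S. (1 - d) * norm v \<le> \<bar>v \<bullet> a\<bar>" and p: "0 < p"
    and g[measurable]: "\<And>a. g a \<in> borel_measurable borel" and G: "AE x in lborel. \<forall>a\<in>S. G x \<bullet> a = g a x"
    and C: "\<And>a. a \<in> S \<Longrightarrow> lp_int p (g a) \<le> C"
  shows "lp_int p G \<le> ennreal ((1 / (1 - d)) powr p) * (of_nat (card S) * C)"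
proof -
  have "lp_int p G \<le> (\<integral>\<^sup>+x. ennreal ((1 / (1 - d)) powr p) * (\<Sum>a\<in>S. ennreal (norm (g a x) powr p)) \<partial>lborel)"
    unfolding lp_int_def
  proof (rule nn_integral_mono_AE, use G in eventually_elim)
    case (elim x)
    obtain a where a: "a \<in> S" "(1 - d) * norm (G x) \<le> \<bar>G x \<bullet> a\<bar>" using S(2) by blast
    then have "norm (G x) \<le> (1 / (1 - d)) * norm (g a x)" using elim d by (simp add: field_simps)
    then have "norm (G x) powr p \<le> ((1 / (1 - d)) * norm (g a x)) powr p" using p by (intro powr_mono2) auto
    also have "\<dots> = (1 / (1 - d)) powr p * norm (g a x) powr p" by (rule powr_mult)
    finally have "ennreal (norm (G x) powr p) \<le> ennreal ((1 / (1 - d)) powr p * norm (g a x) powr p)" by (rule ennreal_leI)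
    also have "\<dots> = ennreal ((1 / (1 - d)) powr p) * ennreal (norm (g a x) powr p)" by (rule ennreal_mult) auto
    also have "\<dots> \<le> ennreal ((1 / (1 - d)) powr p) * (\<Sum>a\<in>S. ennreal (norm (g a x) powr p))"
      using S(1) a(1) by (intro mult_left_mono member_le_sum) auto
    finally show ?case .
  qed
  also have "\<dots> = ennreal ((1 / (1 - d)) powr p) * (\<integral>\<^sup>+x. (\<Sum>a\<in>S. ennreal (norm (g a x) powr p)) \<partial>lborel)"
    by (rule nn_integral_cmult) measurable
  also have "(\<integral>\<^sup>+x. (\<Sum>a\<in>S. ennreal (norm (g a x) powr p)) \<partial>lborel) = (\<Sum>a\<in>S. lp_int p (g a))"
    unfolding lp_int_def by (rule nn_integral_sum) measurable
  also have "ennreal ((1 / (1 - d)) powr p) * (\<Sum>a\<in>S. lp_int p (g a)) \<le> ennreal ((1 / (1 - d)) powr p) * (\<Sum>a\<in>S. C)"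
    using C by (intro mult_left_mono sum_mono) auto
  finally show ?thesis by simp
qed

lemma riesz_upper:
  fixes f :: "real^'n::finite \<Rightarrow> real" and S :: "(real^'n) set"
  assumes m[measurable]: "f \<in> borel_measurable borel" and p: "6 \<le> p" and fin: "lp_int p f < \<infinity>"
    and d: "d < 1" and S: "finite S" "\<And>a. a \<in> S \<Longrightarrow> norm a = 1" "\<And>v::real^'n. \<exists>a\<in>S. (1 - d) * norm v \<le> \<bar>v \<bullet> a\<bar>"
    and N: "\<And>h. h \<in> borel_measurable borel \<Longrightarrow> lp_int p h < \<infinity> \<Longrightarrow> lp_int p (hilR h) \<le> N * lp_int p h"
  shows "lp_int p (\<lambda>x. sqrt (\<Sum>k\<in>UNIV. (riesz k f x)\<^sup>2)) \<le> ennreal ((1 / (1 - d)) powr p) * (of_nat (card S) * (N * lp_int p f))"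
proof -
  define G where "G x = (\<chi> k. riesz k f x)" for x
  define g where "g a x = kap TYPE('n) * (LINT z|lborel. (z \<bullet> a) * gw z * dirL f x z)" for a x
  have norm_G: "norm (G x) = sqrt (\<Sum>k\<in>UNIV. (riesz k f x)\<^sup>2)" for x
    unfolding G_def norm_vec_def L2_set_def by simp
  have gm[measurable]: "g a \<in> borel_measurable borel" for a unfolding g_def[abs_def] by measurable
  have AE: "AE x in lborel. \<forall>a\<in>S. G x \<bullet> a = - g a x"
    using riesz_ae[OF m p fin]
  proof eventually_elim
    case (elim x)
    have "G x \<bullet> a = - g a x" for a
    proof -
      have "G x \<bullet> a = (\<Sum>k\<in>UNIV. riesz k f x * a $ k)" unfolding G_def inner_vec_def by simp
      also have "\<dots> = (\<Sum>k\<in>UNIV. - kap TYPE('n) * (LINT z|lborel. (z $ k * gw z * dirL f x z) * a $ k))"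
      proof (rule sum.cong)
        fix k
        have "riesz k f x * a $ k = - kap TYPE('n) * ((LINT z|lborel. z $ k * gw z * dirL f x z) * a $ k)" using elim by (simp add: mult.assoc)
        then show "riesz k f x * a $ k = - kap TYPE('n) * (LINT z|lborel. (z $ k * gw z * dirL f x z) * a $ k)"
          unfolding integral_mult_left_zero .
      qed simp
      also have "\<dots> = - kap TYPE('n) * (\<Sum>k\<in>UNIV. (LINT z|lborel. (z $ k * gw z * dirL f x z) * a $ k))"
        by (simp only: sum_distrib_left)
      also have "(\<Sum>k\<in>UNIV. (LINT z|lborel. (z $ k * gw z * dirL f x z) * a $ k)) = (LINT z|lborel. (\<Sum>k\<in>UNIV. (z $ k * gw z * dirL f x z) * a $ k))"
        using elim by (intro Bochner_Integration.integral_sum[symmetric]) auto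
      also have "\<dots> = (LINT z|lborel. (z \<bullet> a) * gw z * dirL f x z)"
        by (intro Bochner_Integration.integral_cong) (auto simp: inner_vec_def sum_distrib_left sum_distrib_right mult_ac)
      finally show ?thesis by (simp add: g_def)
    qed
    then show ?case by blast
  qed
  have "lp_int p G \<le> ennreal ((1 / (1 - d)) powr p) * (of_nat (card S) * (N * lp_int p f))"
  proof (rule net_lp[OF d S(1,3) _ _ AE])
    show "0 < p" using p by simp
    show "(\<lambda>x. - g a x) \<in> borel_measurable borel" for a by measurable
    fix a assume "a \<in> S"
    then have "lp_int p (g a) \<le> N * lp_int p f" unfolding g_def[abs_def] using S(2) by (intro riesz_direction_bound[OF m p fin _ N]) auto
    then show "lp_int p (\<lambda>x. - g a x) \<le> N * lp_int p f" by (simp add: lp_int_def)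
  qed
  moreover have "lp_int p (\<lambda>x. sqrt (\<Sum>k\<in>UNIV. (riesz k f x)\<^sup>2)) = lp_int p G"
    by (rule lp_int_cong_AE) (auto simp: norm_G[symmetric])
  ultimately show ?thesis by simp
qed

section \<open>The Hilbert transform of complex-valued functions\<close>

definition hil_trunc :: "(real \<Rightarrow> complex) \<Rightarrow> real \<Rightarrow> real \<Rightarrow> complex" where
  "hil_trunc f x e = complex_of_real (1 / pi) * (LINT y : {y. e < \<bar>y\<bar>} | lborel. f (x - y) / complex_of_real y)"

lemma lp_int_inner_le:
  fixes f :: "real \<Rightarrow> complex"
  assumes "norm a \<le> 1" "0 \<le> p"
  shows "lp_int p (\<lambda>y. f y \<bullet> a) \<le> lp_int p f"
proof (rule lp_int_mono)
  fix x
  have "\<bar>f x \<bullet> a\<bar> \<le> norm (f x) * norm a" by (rule Cauchy_Schwarz_ineq2)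
  also have "\<dots> \<le> norm (f x)" using assms by (simp add: mult_left_le)
  finally show "norm (f x \<bullet> a) \<le> norm (f x)" by simp
qed (use assms in auto)

lemma hil_trunc_inner:
  fixes f :: "real \<Rightarrow> complex"
  assumes [measurable]: "f \<in> borel_measurable borel" and p: "1 < p" and fin: "lp_int p f < \<infinity>" and e: "0 < e"
  shows "hil_trunc f x e \<bullet> a = trH e (\<lambda>y. f y \<bullet> a) x"
proof -
  have "integrable lborel (\<lambda>t. hk e t * norm (f (x - t)))"
    using fin by (intro kernel_integrable(3)[OF _ p _ e]) (auto simp: lp_int_def)
  then have i: "integrable lborel (\<lambda>t. hk e t *\<^sub>R f (x - t))"
    by (rule Bochner_Integration.integrable_bound) (auto simp: abs_mult)
  have "hil_trunc f x e = (LINT y|lborel. complex_of_real (1 / pi) * (indicator {y. e < \<bar>y\<bar>} y *\<^sub>R (f (x - y) / complex_of_real y)))"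
    unfolding hil_trunc_def set_lebesgue_integral_def by (rule integral_mult_right_zero[symmetric])
  also have "\<dots> = (LINT t|lborel. hk e t *\<^sub>R f (x - t))"
    by (intro Bochner_Integration.integral_cong) (auto simp: hk_def indicator_def scaleR_conv_of_real)
  finally have "hil_trunc f x e \<bullet> a = (LINT t|lborel. hk e t *\<^sub>R f (x - t)) \<bullet> a" by simp
  also have "\<dots> = (LINT t|lborel. (hk e t *\<^sub>R f (x - t)) \<bullet> a)"
    using i by (intro integral_inner_left[symmetric])
  also have "\<dots> = trH e (\<lambda>y. f y \<bullet> a) x" by (simp add: trH_def)
  finally show ?thesis .
qed

text \<open>One null set serves all \<open>a\<close>: convergence is needed only for the components
  along 1 and \<open>\<i>\<close>, and every other component follows from continuity of the inner
  product.\<close>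

lemma hilbert_inner_ae:
  fixes f :: "real \<Rightarrow> complex"
  assumes m[measurable]: "f \<in> borel_measurable borel" and p: "6 \<le> p" and fin: "lp_int p f < \<infinity>"
  shows "AE x in lborel. \<forall>a. hilbert f x \<bullet> a = hilR (\<lambda>y. f y \<bullet> a) x"
proof -
  have p1: "1 < p" using p by simp
  have f1: "lp_int p (\<lambda>y. f y \<bullet> 1) < \<infinity>" "lp_int p (\<lambda>y. f y \<bullet> \<i>) < \<infinity>"
    using lp_int_inner_le[of 1 p f] lp_int_inner_le[of \<i> p f] p fin by auto
  have "AE x in lborel. ((\<lambda>e. trH e (\<lambda>y. f y \<bullet> 1) x) \<longlongrightarrow> hilR (\<lambda>y. f y \<bullet> 1) x) (at_right 0)"
    by (rule hilR_converges[OF _ p f1(1)]) measurable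
  moreover have "AE x in lborel. ((\<lambda>e. trH e (\<lambda>y. f y \<bullet> \<i>) x) \<longlongrightarrow> hilR (\<lambda>y. f y \<bullet> \<i>) x) (at_right 0)"
    by (rule hilR_converges[OF _ p f1(2)]) measurable
  ultimately show ?thesis
  proof eventually_elim
    case (elim x)
    define l where "l = Complex (hilR (\<lambda>y. f y \<bullet> 1) x) (hilR (\<lambda>y. f y \<bullet> \<i>) x)"
    have eq: "hil_trunc f x e = Complex (trH e (\<lambda>y. f y \<bullet> 1) x) (trH e (\<lambda>y. f y \<bullet> \<i>) x)" if "0 < e" for e
      using hil_trunc_inner[OF m p1 fin that, of x 1] hil_trunc_inner[OF m p1 fin that, of x \<i>] by (auto simp: complex_eq_iff inner_complex_def)
    have ev: "eventually (\<lambda>e::real. 0 < e) (at_right 0)" by (rule eventually_at_right_less)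
    have lim: "((\<lambda>e. hil_trunc f x e) \<longlongrightarrow> l) (at_right 0)"
    proof (rule Lim_transform_eventually)
      show "((\<lambda>e. Complex (trH e (\<lambda>y. f y \<bullet> 1) x) (trH e (\<lambda>y. f y \<bullet> \<i>) x)) \<longlongrightarrow> l) (at_right 0)"
        unfolding l_def by (intro tendsto_Complex elim)
      show "eventually (\<lambda>e. Complex (trH e (\<lambda>y. f y \<bullet> 1) x) (trH e (\<lambda>y. f y \<bullet> \<i>) x) = hil_trunc f x e) (at_right 0)"
        using ev by eventually_elim (simp add: eq)
    qed
    have hl: "hilbert f x = l"
      unfolding hilbert_def hil_trunc_def[symmetric] by (rule tendsto_Lim[OF _ lim]) simp
    show ?case
    proof
      fix a
      have "((\<lambda>e. hil_trunc f x e \<bullet> a) \<longlongrightarrow> l \<bullet> a) (at_right 0)" by (intro tendsto_inner lim tendsto_const)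
      then have "((\<lambda>e. trH e (\<lambda>y. f y \<bullet> a) x) \<longlongrightarrow> l \<bullet> a) (at_right 0)"
        by (rule Lim_transform_eventually) (use ev in eventually_elim, simp add: hil_trunc_inner[OF m p1 fin])
      then have "hilR (\<lambda>y. f y \<bullet> a) x = l \<bullet> a" by (rule hilR_eqI)
      then show "hilbert f x \<bullet> a = hilR (\<lambda>y. f y \<bullet> a) x" using hl by simp
    qed
  qed
qed

text \<open>Unlike \<open>hilR\<close>, this version is measurable for every measurable argument.\<close>

definition hilM :: "(real \<Rightarrow> real) \<Rightarrow> real \<Rightarrow> real" where
  "hilM g x = lim (\<lambda>k. trH (1 / real (Suc k)) g x)"

lemma hilM_measurable [measurable]:
  assumes [measurable]: "g \<in> borel_measurable borel" shows "hilM g \<in> borel_measurable borel"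
  unfolding hilM_def[abs_def] by measurable

lemma hilM_ae:
  assumes "g \<in> borel_measurable borel" "6 \<le> p" "lp_int p g < \<infinity>"
  shows "AE x in lborel. hilM g x = hilR g x"
  using hilR_converges[OF assms]
proof eventually_elim
  case (elim x)
  have "filterlim (\<lambda>k. 1 / real (Suc k)) (at_right 0) sequentially"
    unfolding filterlim_at using LIMSEQ_Suc[OF lim_1_over_n] by (auto simp: always_eventually)
  then have "(\<lambda>k. trH (1 / real (Suc k)) g x) \<longlonglongrightarrow> hilR g x" by (rule filterlim_compose[OF elim])
  then show ?case unfolding hilM_def by (rule limI)
qed

text \<open>Passage from real to complex functions. Each component of the transform along a unit
  number is the real transform of the component of \<open>f\<close>, whose norm is no larger, so
  only the net factor is lost.\<close>

lemma hilbert_upper: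
  fixes f :: "real \<Rightarrow> complex" and S :: "complex set"
  assumes m[measurable]: "f \<in> borel_measurable borel" and p: "6 \<le> p" and fin: "lp_int p f < \<infinity>"
    and d: "d < 1" and S: "finite S" "\<And>a. a \<in> S \<Longrightarrow> norm a = 1" "\<And>v::complex. \<exists>a\<in>S. (1 - d) * norm v \<le> \<bar>v \<bullet> a\<bar>"
    and N: "\<And>h. h \<in> borel_measurable borel \<Longrightarrow> lp_int p h < \<infinity> \<Longrightarrow> lp_int p (hilR h) \<le> N * lp_int p h"
  shows "lp_int p (hilbert f) \<le> ennreal ((1 / (1 - d)) powr p) * (of_nat (card S) * (N * lp_int p f))"
proof (rule net_lp[OF d S(1,3)])
  have fa: "lp_int p (\<lambda>y. f y \<bullet> a) \<le> lp_int p f" if "a \<in> S" for a using S(2)[OF that] p by (intro lp_int_inner_le) auto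
  have "AE x in lborel. \<forall>a\<in>S. hilM (\<lambda>y. f y \<bullet> a) x = hilR (\<lambda>y. f y \<bullet> a) x"
  proof (rule AE_finite_allI[OF S(1)])
    fix a assume "a \<in> S"
    then show "AE x in lborel. hilM (\<lambda>y. f y \<bullet> a) x = hilR (\<lambda>y. f y \<bullet> a) x"
      using fa[of a] fin by (intro hilM_ae[OF _ p]) auto
  qed
  then show "AE x in lborel. \<forall>a\<in>S. hilbert f x \<bullet> a = hilM (\<lambda>y. f y \<bullet> a) x"
    using hilbert_inner_ae[OF m p fin] by eventually_elim auto
  show "0 < p" using p by simp
  show "hilM (\<lambda>y. f y \<bullet> a) \<in> borel_measurable borel" for a by measurable
  fix a assume a: "a \<in> S"
  have "AE x in lborel. hilM (\<lambda>y. f y \<bullet> a) x = hilR (\<lambda>y. f y \<bullet> a) x"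
    using fa[OF a] fin by (intro hilM_ae[OF _ p]) auto
  then have "lp_int p (hilM (\<lambda>y. f y \<bullet> a)) = lp_int p (hilR (\<lambda>y. f y \<bullet> a))"
    by (intro lp_int_cong_AE) auto
  also have "\<dots> \<le> N * lp_int p (\<lambda>y. f y \<bullet> a)" using fa[OF a] fin by (intro N) auto
  also have "\<dots> \<le> N * lp_int p f" using fa[OF a] by (intro mult_left_mono) auto
  finally show "lp_int p (hilM (\<lambda>y. f y \<bullet> a)) \<le> N * lp_int p f" .
qed

section \<open>Norms\<close>

lemma lp_norm_eq: "lp_norm lborel p G = (if lp_int p G = \<infinity> then \<infinity> else ennreal (enn2real (lp_int p G) powr (1 / p)))"
  unfolding lp_norm_def lp_int_def Let_def ..

lemma lp_norm_leI:
  assumes "lp_int p G \<le> ennreal (C powr p)" "0 \<le> C" "0 < p"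
  shows "lp_norm lborel p G \<le> ennreal C"
proof -
  have fin: "lp_int p G \<noteq> \<infinity>" using assms(1) by (metis ennreal_less_top infinity_ennreal_def leD)
  have "enn2real (lp_int p G) \<le> C powr p" using assms(1) by (intro enn2real_leI) auto
  then have "enn2real (lp_int p G) powr (1 / p) \<le> (C powr p) powr (1 / p)" using assms by (intro powr_mono2) auto
  also have "\<dots> = C" using assms by (simp add: powr_powr)
  finally show ?thesis unfolding lp_norm_eq using fin by (simp add: ennreal_leI)
qed

lemma lp_int_leI:
  assumes "lp_norm lborel p G \<le> ennreal C" "0 \<le> C" "0 < p"
  shows "lp_int p G \<le> ennreal (C powr p)"
proof -
  have fin: "lp_int p G \<noteq> \<infinity>"
  proof
    assume "lp_int p G = \<infinity>"
    then show False using assms(1) unfolding lp_norm_eq by (simp add: top_unique)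
  qed
  then have "enn2real (lp_int p G) powr (1 / p) \<le> C" using assms unfolding lp_norm_eq by (simp add: ennreal_le_iff)
  then have "(enn2real (lp_int p G) powr (1 / p)) powr p \<le> C powr p" using assms by (intro powr_mono2) auto
  then have "enn2real (lp_int p G) \<le> C powr p" using assms by (simp add: powr_powr)
  then have "ennreal (enn2real (lp_int p G)) \<le> ennreal (C powr p)" by (rule ennreal_leI)
  moreover have "ennreal (enn2real (lp_int p G)) = lp_int p G" using fin by (simp add: top.not_eq_extremum)
  ultimately show ?thesis by (simp only:)
qed

lemma lp_norm_le_1_iff: "0 < p \<Longrightarrow> lp_norm lborel p G \<le> 1 \<longleftrightarrow> lp_int p G \<le> 1"
  using lp_norm_leI[of p G 1] lp_int_leI[of p G 1] by auto

text \<open>Qualitative only: a net for the value 1/2 combined with the crude maximal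
  constant.\<close>

lemma hilbert_norm_finite:
  assumes p: "6 \<le> p" shows "hilbert_norm p < \<infinity>"
proof -
  obtain S :: "complex set" where S: "finite S" "\<And>a. a \<in> S \<Longrightarrow> norm a = 1" "\<And>v::complex. \<exists>a\<in>S. (1 - 1/2) * norm v \<le> \<bar>v \<bullet> a\<bar>"
    using finite_direction_net[of "1/2", where 'a=complex] by auto
  define K where "K = (1 / (1 - 1/2 :: real)) powr p * (real (card S) * hmax_const p)"
  have h0: "0 < hmax_const p" by (rule hmax_const_pos[OF p])
  have K0: "0 \<le> K" using h0 by (simp add: K_def)
  have "lp_norm lborel p (hilbert f) \<le> ennreal (K powr (1 / p))"
    if f: "f \<in> borel_measurable lborel" "lp_norm lborel p f \<le> 1" for f
  proof (rule lp_norm_leI)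
    have f1: "lp_int p f \<le> 1" using f p lp_norm_le_1_iff[of p f] by simp
    then have fin: "lp_int p f < \<infinity>" by (metis ennreal_one_less_top infinity_ennreal_def le_less_trans)
    have "lp_int p (hilbert f) \<le> ennreal ((1 / (1 - 1/2)) powr p) * (of_nat (card S) * (ennreal (hmax_const p) * lp_int p f))"
      using f p fin by (intro hilbert_upper S hilR_bound) auto
    also have "\<dots> \<le> ennreal ((1 / (1 - 1/2)) powr p) * (of_nat (card S) * (ennreal (hmax_const p) * 1))"
      using f1 by (intro mult_left_mono) auto
    also have "\<dots> = ennreal K" unfolding K_def using h0 by (simp add: ennreal_mult ennreal_of_nat_eq_real_of_nat)
    also have "K = (K powr (1 / p)) powr p" using K0 p by (simp add: powr_powr)
    finally show "lp_int p (hilbert f) \<le> ennreal ((K powr (1 / p)) powr p)" .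
  qed (use p in auto)
  then have "hilbert_norm p \<le> ennreal (K powr (1 / p))" unfolding hilbert_norm_def by (intro Sup_least) auto
  then show ?thesis by (auto intro: le_less_trans)
qed

text \<open>The operator norms are suprema over the unit ball and see a function only after division
  by some positive \<open>C\<close>. This lemma returns to the homogeneous inequality.\<close>

lemma homogeneous_bound:
  assumes p: "0 < p" and I: "I < \<infinity>" and M: "0 \<le> M"
    and h: "\<And>C. 0 < C \<Longrightarrow> I \<le> ennreal (C powr p) \<Longrightarrow> X \<le> ennreal (C powr p) * ennreal M"
  shows "X \<le> ennreal M * I"
proof -
  obtain i where i: "I = ennreal i" "0 \<le> i" using I by (cases I) auto
  show ?thesis
  proof (cases "i = 0")
    case False
    have "X \<le> ennreal ((i powr (1 / p)) powr p) * ennreal M" using False i p by (intro h) (auto simp: powr_powr)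
    then show ?thesis using i False p by (simp add: powr_powr mult.commute)
  next
    case True
    have "X \<le> 0"
    proof (rule LIMSEQ_le_const)
      have "(\<lambda>n. M * (1 / real (Suc n))) \<longlonglongrightarrow> M * 0" by (intro tendsto_mult tendsto_const LIMSEQ_Suc[OF lim_1_over_n])
      then have "(\<lambda>n. ennreal (M * (1 / real (Suc n)))) \<longlonglongrightarrow> ennreal (M * 0)" by (rule tendsto_ennrealI)
      then show "(\<lambda>n. ennreal (M * (1 / real (Suc n)))) \<longlonglongrightarrow> 0" by simp
      have "X \<le> ennreal (M * (1 / real (Suc n)))" for n
      proof -
        have "X \<le> ennreal (((1 / real (Suc n)) powr (1 / p)) powr p) * ennreal M" using i True by (intro h) auto
        also have "((1 / real (Suc n)) powr (1 / p)) powr p = 1 / real (Suc n)" using p by (simp add: powr_powr)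
        finally show ?thesis using M by (simp add: ennreal_mult[symmetric] mult.commute)
      qed
      then show "\<exists>N. \<forall>n\<ge>N. X \<le> ennreal (M * (1 / real (Suc n)))" by blast
    qed
    then show ?thesis by simp
  qed
qed

lemma trH_cmult: "trH e (\<lambda>y. c * h y) x = c * trH e h x"
proof -
  have "trH e (\<lambda>y. c * h y) x = (LINT t|lborel. c * (hk e t * h (x - t)))" unfolding trH_def by (simp add: mult_ac)
  then show ?thesis by (simp add: trH_def)
qed

text \<open>A real function is viewed as complex-valued; the real part of its Hilbert transform is
  \<open>hilR\<close> almost everywhere. The constant is exactly the norm
  \<open>hilbert_norm p\<close>, as the sharp upper estimate for the Riesz vector requires.\<close>

lemma hilR_norm_bound:
  assumes p: "6 \<le> p" and m[measurable]: "h \<in> borel_measurable borel" and fin: "lp_int p h < \<infinity>"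
  shows "lp_int p (hilR h) \<le> ennreal (enn2real (hilbert_norm p) powr p) * lp_int p h"
proof (rule homogeneous_bound)
  fix C :: real assume C: "0 < C" "lp_int p h \<le> ennreal (C powr p)"
  define g where "g y = (1 / C) * h y" for y
  have gm[measurable]: "g \<in> borel_measurable borel" unfolding g_def[abs_def] by measurable
  have g1: "lp_int p g \<le> 1"
  proof -
    have "lp_int p g = ennreal (\<bar>1 / C\<bar> powr p) * lp_int p h"
      using lp_int_scale[OF m, of p "1 / C"] by (simp add: g_def[abs_def])
    also have "\<dots> \<le> ennreal (\<bar>1 / C\<bar> powr p) * ennreal (C powr p)" using C by (intro mult_left_mono) auto
    also have "\<dots> = ennreal (\<bar>1 / C\<bar> powr p * C powr p)" by (intro ennreal_mult[symmetric]) auto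
    also have "\<bar>1 / C\<bar> powr p * C powr p = 1" using C by (simp add: powr_divide)
    finally show ?thesis by simp
  qed
  have gfin: "lp_int p g < \<infinity>" using g1 by (metis ennreal_one_less_top infinity_ennreal_def le_less_trans)
  define G where "G y = complex_of_real (g y)" for y
  have Gm[measurable]: "G \<in> borel_measurable borel" unfolding G_def[abs_def] by measurable
  have Gg: "lp_int p G = lp_int p g" by (simp add: lp_int_def G_def)
  have "lp_norm lborel p (hilbert G) \<le> hilbert_norm p"
    unfolding hilbert_norm_def using g1 p Gg lp_norm_le_1_iff[of p G] by (intro Sup_upper) auto
  also have "\<dots> = ennreal (enn2real (hilbert_norm p))" using hilbert_norm_finite[OF p] by simp
  finally have hG: "lp_int p (hilbert G) \<le> ennreal (enn2real (hilbert_norm p) powr p)" using p by (intro lp_int_leI) auto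
  have "lp_int p (hilR g) \<le> lp_int p (hilbert G)"
    unfolding lp_int_def
  proof (rule nn_integral_mono_AE)
    have Gf: "lp_int p G < \<infinity>" using Gg gfin by simp
    show "AE x in lborel. ennreal (norm (hilR g x) powr p) \<le> ennreal (norm (hilbert G x) powr p)"
      using hilbert_inner_ae[OF Gm p Gf]
    proof eventually_elim
      case (elim x)
      have "hilbert G x \<bullet> 1 = hilR (\<lambda>y. G y \<bullet> 1) x" using elim by blast
      then have "hilR g x = Re (hilbert G x)" by (simp add: G_def inner_complex_def)
      then show ?case using p abs_Re_le_cmod by (intro ennreal_leI powr_mono2) auto
    qed
  qed
  then have "lp_int p (hilR g) \<le> ennreal (enn2real (hilbert_norm p) powr p)" using hG by simp
  moreover have "lp_int p (hilR h) = lp_int p (\<lambda>x. C * hilR g x)"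
  proof (rule lp_int_cong_AE, use hilR_converges[OF gm p gfin] in eventually_elim)
    case (elim x)
    have "((\<lambda>e. C * trH e g x) \<longlongrightarrow> C * hilR g x) (at_right 0)" by (intro tendsto_mult tendsto_const elim)
    moreover have "C * trH e g x = trH e h x" for e unfolding g_def[abs_def] trH_cmult using C by simp
    ultimately have "hilR h x = C * hilR g x" by (intro hilR_eqI) simp
    then show ?case by simp
  qed
  moreover have "lp_int p (\<lambda>x. C * hilR g x) = ennreal (C powr p) * lp_int p (hilR g)"
  proof -
    \<comment> \<open>\<open>lp_int_scale\<close> asks for a measurable function, so the measurable
      version \<open>hilM\<close> is substituted and removed again.\<close>
    have ae: "AE x in lborel. hilM g x = hilR g x" by (rule hilM_ae[OF gm p gfin])
    have "lp_int p (\<lambda>x. C * hilR g x) = lp_int p (\<lambda>x. C *\<^sub>R hilM g x)" using ae by (intro lp_int_cong_AE) auto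
    also have "\<dots> = ennreal (\<bar>C\<bar> powr p) * lp_int p (hilM g)" by (rule lp_int_scale) measurable
    also have "lp_int p (hilM g) = lp_int p (hilR g)" using ae by (intro lp_int_cong_AE) auto
    finally show ?thesis using C by simp
  qed
  ultimately show "lp_int p (hilR h) \<le> ennreal (C powr p) * ennreal (enn2real (hilbert_norm p) powr p)"
    by (simp add: mult_left_mono)
qed (use p fin in auto)

section \<open>The tent function and positivity of the Hilbert norm\<close>

definition tent :: "real \<Rightarrow> real" where "tent t = max 0 (1 - \<bar>t\<bar>)"

lemma tent_lipschitz: "\<bar>tent x - tent y\<bar> \<le> \<bar>x - y\<bar>" unfolding tent_def by (auto simp: max_def abs_if)
lemma tent_bounds: "0 \<le> tent x" "tent x \<le> 1" unfolding tent_def by auto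
lemma tent_support: "1 < \<bar>x\<bar> \<Longrightarrow> tent x = 0" unfolding tent_def by auto
lemma tent_lipc: "lipc tent" unfolding lipc_def using tent_lipschitz tent_support
  by (intro exI[of _ 1]) auto

lemma tent_measurable [measurable]: "tent \<in> borel_measurable borel" by (rule lipc_measurable[OF tent_lipc])

lemma tent_lp_pos: "0 < p \<Longrightarrow> 0 < lp_int p tent"
proof -
  assume p: "0 < p"
  have "ennreal ((1/2) powr p) * emeasure lborel {-1/2..1/2::real} \<le> lp_int p tent"
    unfolding lp_int_def
  proof (subst nn_integral_cmult_indicator[symmetric])
    show "(\<integral>\<^sup>+x. ennreal ((1/2) powr p) * indicator {-1/2..1/2::real} x \<partial>lborel) \<le> (\<integral>\<^sup>+x. ennreal (norm (tent x) powr p) \<partial>lborel)"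
      using p by (intro nn_integral_mono) (auto simp: indicator_def tent_def intro!: ennreal_leI powr_mono2)
  qed simp
  moreover have "0 < ennreal ((1/2) powr p) * emeasure lborel {-1/2..1/2::real}" by (simp add: ennreal_zero_less_mult_iff)
  ultimately show ?thesis by (rule less_le_trans[rotated])
qed

text \<open>For \<open>x\<close> at least 2 the tent around \<open>x\<close> does not meet
  \<open>\<bar>t\<bar> < 1\<close>, so truncations below 1 change nothing and the integrand is
  nonnegative. Within 1/2 of \<open>x\<close> the tent is at least 1/2 and the kernel at least
  \<open>1 / (4 * pi)\<close>, on an interval of length 1.\<close>

lemma hilR_tent_pos:
  assumes x: "2 \<le> x" "x \<le> 3"
  shows "1 / (8 * pi) \<le> hilR tent x"
proof -
  have fin: "lp_int 2 tent < \<infinity>" by (rule lipc_lp_finite[OF tent_lipc]) simp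
  have c: "trH e tent x = trH 1 tent x" if "0 < e" "e < 1" for e
    unfolding trH_def
  proof (rule Bochner_Integration.integral_cong)
    fix t
    show "hk e t * tent (x - t) = hk 1 t * tent (x - t)"
    proof (cases "1 < \<bar>t\<bar>")
      case False
      then have "tent (x - t) = 0" using x by (auto simp: tent_def)
      then show ?thesis by simp
    qed (use that in \<open>auto simp: hk_def\<close>)
  qed simp
  have "((\<lambda>e. trH e tent x) \<longlongrightarrow> trH 1 tent x) (at_right 0)"
    by (rule tendsto_eventually, rule eventually_at_rightI[of 0 1]) (use c in auto)
  then have "hilR tent x = trH 1 tent x" by (rule hilR_eqI)
  moreover have "(LINT t|lborel. 1 / (8 * pi) * indicator {x - 1/2..x + 1/2} t) \<le> trH 1 tent x"
    unfolding trH_def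
  proof (rule integral_mono)
    show "integrable lborel (\<lambda>t. 1 / (8 * pi) * indicator {x - 1/2..x + 1/2} t :: real)"
      by (intro integrable_mult_right integrable_real_indicator) auto
    show "integrable lborel (\<lambda>t. hk 1 t * tent (x - t))" using fin by (intro kernel_integrable(3)[where p=2]) auto
    fix t :: real
    show "1 / (8 * pi) * indicator {x - 1/2..x + 1/2} t \<le> hk 1 t * tent (x - t)"
    proof (cases "t \<in> {x - 1/2..x + 1/2}")
      case True
      then have xt: "x - 1/2 \<le> t" "t \<le> x + 1/2" by auto
      have "\<bar>x - t\<bar> \<le> 1/2" using xt by linarith
      then have "1/2 \<le> tent (x - t)" by (auto simp: tent_def)
      moreover have "1 < t" "t \<le> 4" using x xt by auto
      ultimately have t: "1 < t" "t \<le> 4" "1/2 \<le> tent (x - t)" by auto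
      have "1 / (pi * 4) * (1/2) \<le> 1 / (pi * t) * tent (x - t)"
        using t by (intro mult_mono divide_left_mono) auto
      then show ?thesis using True t by (simp add: hk_def)
    next
      case False
      have "0 \<le> hk 1 t * tent (x - t)"
      proof (cases "t \<le> 1")
        case True
        then have "tent (x - t) = 0" using x by (auto simp: tent_def)
        then show ?thesis by simp
      next
        case False
        then show ?thesis using tent_bounds(1)[of "x - t"] by (simp add: hk_def)
      qed
      then show ?thesis using False by simp
    qed
  qed
  ultimately show ?thesis by simp
qed

lemma hilbert_norm_pos:
  assumes p: "6 \<le> p" shows "0 < enn2real (hilbert_norm p)"
proof (rule ccontr)
  assume "\<not> ?thesis"
  then have "enn2real (hilbert_norm p) = 0" by (metis enn2real_nonneg less_eq_real_def)
  then have "lp_int p (hilR tent) \<le> 0"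
    using hilR_norm_bound[OF p tent_measurable lipc_lp_finite[OF tent_lipc, of p]] p by simp
  moreover have "ennreal ((1 / (8 * pi)) powr p) * emeasure lborel {2..3::real} \<le> lp_int p (hilR tent)"
    unfolding lp_int_def
  proof (subst nn_integral_cmult_indicator[symmetric])
    show "(\<integral>\<^sup>+x. ennreal ((1 / (8 * pi)) powr p) * indicator {2..3::real} x \<partial>lborel) \<le> (\<integral>\<^sup>+x. ennreal (norm (hilR tent x) powr p) \<partial>lborel)"
    proof (rule nn_integral_mono)
      fix x :: real
      show "ennreal ((1 / (8 * pi)) powr p) * indicator {2..3::real} x \<le> ennreal (norm (hilR tent x) powr p)"
      proof (cases "x \<in> {2..3}")
        case True
        then have "1 / (8 * pi) \<le> norm (hilR tent x)" using hilR_tent_pos[of x] by auto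
        then show ?thesis using True p by (simp add: ennreal_leI powr_mono2)
      qed simp
    qed
  qed simp
  moreover have "0 < ennreal ((1 / (8 * pi)) powr p) * emeasure lborel {2..3::real}" by (simp add: ennreal_zero_less_mult_iff)
  ultimately show False by (metis leD le_zero_eq order_trans)
qed

section \<open>Riesz transforms of Lipschitz functions\<close>

text \<open>The Lipschitz constant along the line grows like \<open>norm z\<close>, the relevant
  parameter range shrinks like \<open>1 / norm z\<close>, and their product does not depend on the
  direction. Hence the bound is uniform in \<open>z\<close> and \<open>e\<close>.\<close>

lemma dirH_lipschitz:
  fixes f :: "'a::euclidean_space \<Rightarrow> real"
  assumes m[measurable]: "f \<in> borel_measurable borel" and C: "\<And>u v. \<bar>f u - f v\<bar> \<le> C * norm (u - v)" "0 < C"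
    and A: "\<And>u. A < norm u \<Longrightarrow> f u = 0" "0 < A" and B: "\<And>u. \<bar>f u\<bar> \<le> B" and z: "z \<noteq> 0"
  shows "((\<lambda>e. dirH e f x z) \<longlongrightarrow> (LINT t|lborel. hk 0 t * (f (x - t *\<^sub>R z) - f (x + t *\<^sub>R z))) / 2) (at_right 0)"
    and "0 < e \<Longrightarrow> \<bar>dirH e f x z\<bar> \<le> 2 * C * (A + norm x) / pi"
proof -
  define q where "q s = f (x + s *\<^sub>R z)" for s
  define R where "R = (A + norm x) / norm z"
  have qm: "q \<in> borel_measurable borel" unfolding q_def[abs_def] by measurable
  have R0: "0 < R" using A z by (simp add: R_def add_pos_nonneg)
  have q0: "q s = 0" if "R < \<bar>s\<bar>" for s
  proof -
    have "A + norm x < \<bar>s\<bar> * norm z" using that z by (simp add: R_def pos_divide_less_eq)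
    also have "\<dots> = norm (s *\<^sub>R z)" by simp
    also have "\<dots> \<le> norm (x + s *\<^sub>R z) + norm x" using norm_triangle_ineq4[of "x + s *\<^sub>R z" x] by simp
    finally show ?thesis unfolding q_def by (intro A) simp
  qed
  have fin: "lp_int 2 q < \<infinity>" using R0 B q0 by (intro bounded_support_lp_finite[of q B R]) (auto simp: q_def)
  have lip: "\<bar>q (0 - t) - q (0 + t)\<bar> \<le> (2 * C * norm z) * \<bar>t\<bar>" for t
  proof -
    have "(x + (0 - t) *\<^sub>R z) - (x + (0 + t) *\<^sub>R z) = (- 2 * t) *\<^sub>R z" by (simp add: algebra_simps scaleR_left_distrib[symmetric])
    then have "norm ((x + (0 - t) *\<^sub>R z) - (x + (0 + t) *\<^sub>R z)) = 2 * \<bar>t\<bar> * norm z" by (simp add: abs_mult)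
    then show ?thesis using C(1)[of "x + (0 - t) *\<^sub>R z" "x + (0 + t) *\<^sub>R z"] by (simp add: q_def mult_ac)
  qed
  have sup: "q (0 - t) - q (0 + t) = 0" if "R < \<bar>t\<bar>" for t using q0[of "0 - t"] q0[of "0 + t"] that by simp
  have L0: "0 \<le> 2 * C * norm z" using C by simp
  have two: "(1::real) < 2" by simp
  note lim = trH_symmetric_limit[OF qm two fin lip sup less_imp_le[OF R0] L0]
  show "((\<lambda>e. dirH e f x z) \<longlongrightarrow> (LINT t|lborel. hk 0 t * (f (x - t *\<^sub>R z) - f (x + t *\<^sub>R z))) / 2) (at_right 0)"
    using lim(1) unfolding dirH_def q_def[symmetric, abs_def] by (simp add: q_def)
  assume "0 < e"
  then have "\<bar>dirH e f x z\<bar> \<le> 2 * C * norm z * R / pi" using lim(2) unfolding dirH_def q_def[symmetric] by simp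
  also have "2 * C * norm z * R = 2 * C * (A + norm x)" using z by (simp add: R_def)
  finally show "\<bar>dirH e f x z\<bar> \<le> 2 * C * (A + norm x) / pi" .
qed

text \<open>Valid at every point, not just almost everywhere. Measurability and homogeneity of the
  Riesz transforms of Lipschitz functions follow from this formula.\<close>

lemma riesz_lipc:
  fixes f :: "real^'n::finite \<Rightarrow> real"
  assumes "lipc f"
  shows "riesz j f x = - kap TYPE('n) * (LINT z|lborel. z $ j * gw z * ((LINT t|lborel. hk 0 t * (f (x - t *\<^sub>R z) - f (x + t *\<^sub>R z))) / 2))"
proof -
  obtain C A B where c: "0 < C" "0 < A" "0 < B" "\<And>x y. \<bar>f x - f y\<bar> \<le> C * norm (x - y)"
      "\<And>x. norm x > A \<Longrightarrow> f x = 0" "\<And>x. \<bar>f x\<bar> \<le> B"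
    using lipc_bounds[OF assms] by blast
  have m[measurable]: "f \<in> borel_measurable borel" by (rule lipc_measurable[OF assms])
  have two: "(1::real) < 2" by simp
  have fin: "lp_int 2 f < \<infinity>" by (rule lipc_lp_finite[OF assms]) simp
  have nz: "AE z in (lborel :: (real^'n) measure). z \<noteq> 0" by (rule AE_lborel_singleton)
  note L = dirH_lipschitz[OF m c(4) c(1) c(5) c(2) c(6)]
  show ?thesis
  proof (rule riesz_limit(1)[OF m _ two fin, where B="\<lambda>z. 2 * C * (A + norm x) / pi"])
    show "(\<lambda>z. (LINT t|lborel. hk 0 t * (f (x - t *\<^sub>R z) - f (x + t *\<^sub>R z))) / 2) \<in> borel_measurable borel" by measurable
    show "AE z in lborel. ((\<lambda>e. dirH e f x z) \<longlongrightarrow> (LINT t|lborel. hk 0 t * (f (x - t *\<^sub>R z) - f (x + t *\<^sub>R z))) / 2) (at_right 0)"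
      using nz by eventually_elim (rule L(1))
    show "AE z in lborel. \<forall>e>0. \<bar>dirH e f x z\<bar> \<le> 2 * C * (A + norm x) / pi"
      using nz by eventually_elim (use L(2) in blast)
    have "integrable lborel (\<lambda>z::real^'n. norm z * gw z)"
      using norm_gw_finite[where 'a="real^'n"] by (intro integrableI_nonneg) (auto simp: less_imp_le[OF gw_pos])
    then show "integrable lborel (\<lambda>z::real^'n. norm z * gw z * (2 * C * (A + norm x) / pi))" by (rule integrable_mult_left)
  qed
qed

lemma riesz_lipc_measurable:
  fixes f :: "real^'n::finite \<Rightarrow> real"
  assumes "lipc f" shows "riesz j f \<in> borel_measurable borel"
proof -
  note [measurable] = lipc_measurable[OF assms]
  have [measurable]: "(\<lambda>w. LBINT t. hk 0 t * (f (fst w - t *\<^sub>R snd w) - f (fst w + t *\<^sub>R snd w))) \<in> borel_measurable (borel \<Otimes>\<^sub>M (lborel :: (real^'n) measure))"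
    by measurable
  have [measurable]: "(\<lambda>z::real^'n. z $ j) \<in> borel_measurable lborel"
    by (auto intro: borel_measurable_continuous_onI continuous_intros)
  have [measurable]: "(gw :: real^'n \<Rightarrow> real) \<in> borel_measurable lborel" by simp
  have "(\<lambda>x. - kap TYPE('n) * (LINT z|lborel. z $ j * gw z * ((LINT t|lborel. hk 0 t * (f (x - t *\<^sub>R z) - f (x + t *\<^sub>R z))) / 2))) \<in> borel_measurable borel"
    by (intro borel_measurable_times borel_measurable_const sigma_finite_measure.borel_measurable_lebesgue_integral[OF sigma_finite_lborel]) (simp add: case_prod_beta)
  then show ?thesis unfolding riesz_lipc[OF assms, abs_def] .
qed

lemma riesz_lipc_cmult:
  fixes f :: "real^'n::finite \<Rightarrow> real"
  assumes "lipc f"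
  shows "riesz j (\<lambda>x. c * f x) x = c * riesz j f x"
proof -
  have 1: "(LINT t|lborel. hk 0 t * (c * f (x - t *\<^sub>R z) - c * f (x + t *\<^sub>R z))) = c * (LINT t|lborel. hk 0 t * (f (x - t *\<^sub>R z) - f (x + t *\<^sub>R z)))" for z
  proof -
    have "(LINT t|lborel. hk 0 t * (c * f (x - t *\<^sub>R z) - c * f (x + t *\<^sub>R z))) = (LINT t|lborel. c * (hk 0 t * (f (x - t *\<^sub>R z) - f (x + t *\<^sub>R z))))"
      by (intro Bochner_Integration.integral_cong) (auto simp: algebra_simps)
    then show ?thesis by simp
  qed
  define D where "D z = (LINT t|lborel. hk 0 t * (f (x - t *\<^sub>R z) - f (x + t *\<^sub>R z))) / 2" for z
  have "(LINT z|lborel. z $ j * gw z * (c * (D z * 2) / 2)) = (LINT z|lborel. c * (z $ j * gw z * D z))"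
    by (intro Bochner_Integration.integral_cong) auto
  then have "(LINT z|lborel. z $ j * gw z * (c * (D z * 2) / 2)) = c * (LINT z|lborel. z $ j * gw z * D z)" by simp
  then show ?thesis unfolding riesz_lipc[OF assms] riesz_lipc[OF lipc_cmult[OF assms]] 1 by (simp add: D_def)
qed

text \<open>A single component is dominated by the Euclidean norm of the vector. Lipschitz functions
  suffice as test functions and make rescaling legitimate at every point.\<close>

lemma riesz_norm_bound:
  fixes f :: "real^'n::finite \<Rightarrow> real"
  assumes f: "lipc f" and p: "0 < p" and nr: "riesz_norm TYPE('n) p < \<infinity>"
  shows "lp_int p (riesz j f) \<le> ennreal (enn2real (riesz_norm TYPE('n) p) powr p) * lp_int p f"
proof (rule homogeneous_bound)
  show "lp_int p f < \<infinity>" by (rule lipc_lp_finite[OF f p])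
  fix C :: real assume C: "0 < C" "lp_int p f \<le> ennreal (C powr p)"
  note m[measurable] = lipc_measurable[OF f]
  define g where "g y = (1 / C) * f y" for y
  have gl: "lipc g" unfolding g_def[abs_def] by (rule lipc_cmult[OF f])
  note gm[measurable] = lipc_measurable[OF gl]
  have g1: "lp_int p g \<le> 1"
  proof -
    have "lp_int p g = ennreal (\<bar>1 / C\<bar> powr p) * lp_int p f"
      using lp_int_scale[OF m, of p "1 / C"] by (simp add: g_def[abs_def])
    also have "\<dots> \<le> ennreal (\<bar>1 / C\<bar> powr p) * ennreal (C powr p)" using C by (intro mult_left_mono) auto
    also have "\<dots> = ennreal (\<bar>1 / C\<bar> powr p * C powr p)" by (intro ennreal_mult[symmetric]) auto
    also have "\<bar>1 / C\<bar> powr p * C powr p = 1" using C by (simp add: powr_divide)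
    finally show ?thesis by simp
  qed
  have "lp_norm lborel p (\<lambda>x. sqrt (\<Sum>k\<in>UNIV. (riesz k g x)\<^sup>2)) \<le> riesz_norm TYPE('n) p"
    unfolding riesz_norm_def using g1 p lp_norm_le_1_iff[of p g] by (intro Sup_upper) auto
  also have "\<dots> = ennreal (enn2real (riesz_norm TYPE('n) p))" using nr by simp
  finally have R: "lp_int p (\<lambda>x. sqrt (\<Sum>k\<in>UNIV. (riesz k g x)\<^sup>2)) \<le> ennreal (enn2real (riesz_norm TYPE('n) p) powr p)"
    using p by (intro lp_int_leI) auto
  have "lp_int p (riesz j g) \<le> lp_int p (\<lambda>x. sqrt (\<Sum>k\<in>UNIV. (riesz k g x)\<^sup>2))"
  proof (rule lp_int_mono)
    fix x
    have "(riesz j g x)\<^sup>2 \<le> (\<Sum>k\<in>UNIV. (riesz k g x)\<^sup>2)" by (intro member_le_sum) auto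
    then have "sqrt ((riesz j g x)\<^sup>2) \<le> sqrt (\<Sum>k\<in>UNIV. (riesz k g x)\<^sup>2)" by (rule real_sqrt_le_mono)
    then show "norm (riesz j g x) \<le> norm (sqrt (\<Sum>k\<in>UNIV. (riesz k g x)\<^sup>2))" by simp
  qed (use p in simp)
  then have gR: "lp_int p (riesz j g) \<le> ennreal (enn2real (riesz_norm TYPE('n) p) powr p)" using R by simp
  have "riesz j f x = C *\<^sub>R riesz j g x" for x
    unfolding g_def[abs_def] riesz_lipc_cmult[OF f] using C by simp
  then have "lp_int p (riesz j f) = lp_int p (\<lambda>x. C *\<^sub>R riesz j g x)" by (simp add: lp_int_def)
  also have "\<dots> = ennreal (\<bar>C\<bar> powr p) * lp_int p (riesz j g)" by (rule lp_int_scale[OF riesz_lipc_measurable[OF gl]])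
  also have "\<dots> \<le> ennreal (\<bar>C\<bar> powr p) * ennreal (enn2real (riesz_norm TYPE('n) p) powr p)" by (intro mult_left_mono gR) auto
  finally show "lp_int p (riesz j f) \<le> ennreal (C powr p) * ennreal (enn2real (riesz_norm TYPE('n) p) powr p)" using C by simp
qed (use p in auto)

section \<open>Stretched product functions\<close>

text \<open>The constants of \<phi> are parameters because every bound below has to be uniform in
  the stretching factor \<open>L\<close>; uniformity provides the majorants for the limit.\<close>

locale stretch =
  fixes \<phi> :: "real \<Rightarrow> real" and j0 :: "'a::euclidean_space" and C A B :: real
  assumes j0: "j0 \<in> Basis" and \<phi>: "0 < C" "0 < A" "0 < B" "\<And>x y. \<bar>\<phi> x - \<phi> y\<bar> \<le> C * norm (x - y)"
      "\<And>x. norm x > A \<Longrightarrow> \<phi> x = 0" "\<And>x. \<bar>\<phi> x\<bar> \<le> B" and \<phi>l: "lipc \<phi>"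
begin

definition Phi :: "real \<Rightarrow> 'a \<Rightarrow> real" where
  "Phi L x = \<phi> (x \<bullet> j0) * (\<Prod>b\<in>Basis - {j0}. tent ((x \<bullet> b) / L))"

definition cT :: "real \<Rightarrow> 'a \<Rightarrow> real" where "cT L b = (if b = j0 then 1 else L)"

text \<open>Stretches all coordinates but \<open>j0\<close> by \<open>L\<close>, so that
  \<open>Phi L\<close> becomes \<open>Phi 1\<close> after substitution. The leading 0 is the
  translation part in the form that \<open>lborel_affine_euclidean\<close> expects.\<close>

definition T :: "real \<Rightarrow> 'a \<Rightarrow> 'a" where "T L y = 0 + (\<Sum>b\<in>Basis. (cT L b * (y \<bullet> b)) *\<^sub>R b)"

definition KL :: real where "KL = C + B * DIM('a)"

lemma \<phi>_measurable [measurable]: "\<phi> \<in> borel_measurable borel" by (rule lipc_measurable[OF \<phi>l])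

lemma T_inner: "b \<in> Basis \<Longrightarrow> T L y \<bullet> b = cT L b * (y \<bullet> b)"
  unfolding T_def by (simp add: inner_sum_left_Basis)

lemma KL_pos: "0 < KL" using \<phi> by (simp add: KL_def add_pos_nonneg)

lemma tent_prod_le: "\<bar>\<Prod>b\<in>M. tent (u b)\<bar> \<le> 1"
  unfolding abs_prod using tent_bounds by (intro prod_le_1) auto

text \<open>For \<open>1 \<le> L\<close> widening the tents only lowers their slopes. Since all
  factors are at most 1, differences of products are bounded by sums of differences, and
  \<open>KL\<close> works for all \<open>L\<close> simultaneously.\<close>

lemma Phi_lip:
  assumes L: "1 \<le> L"
  shows "\<bar>Phi L u - Phi L v\<bar> \<le> KL * norm (u - v)"
proof -
  define P where "P u = (\<Prod>b\<in>Basis - {j0}. tent ((u \<bullet> b) / L))" for u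
  have "\<bar>P u - P v\<bar> \<le> (\<Sum>b\<in>Basis - {j0}. \<bar>tent ((u \<bullet> b) / L) - tent ((v \<bullet> b) / L)\<bar>)"
    unfolding P_def using norm_prod_diff[of "Basis - {j0}" "\<lambda>b. tent ((u \<bullet> b) / L)" "\<lambda>b. tent ((v \<bullet> b) / L)"] tent_bounds by simp
  also have "\<dots> \<le> (\<Sum>b\<in>Basis - {j0}. norm (u - v))"
  proof (rule sum_mono)
    fix b assume b: "b \<in> Basis - {j0}"
    have "\<bar>tent ((u \<bullet> b) / L) - tent ((v \<bullet> b) / L)\<bar> \<le> \<bar>(u \<bullet> b) / L - (v \<bullet> b) / L\<bar>" by (rule tent_lipschitz)
    also have "\<dots> = \<bar>(u - v) \<bullet> b\<bar> / L" using L by (simp add: inner_diff_left diff_divide_distrib[symmetric])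
    also have "\<dots> \<le> \<bar>(u - v) \<bullet> b\<bar> / 1" using L by (intro divide_left_mono) auto
    also have "\<dots> \<le> norm (u - v)" using b Basis_le_norm[of b "u - v"] by simp
    finally show "\<bar>tent ((u \<bullet> b) / L) - tent ((v \<bullet> b) / L)\<bar> \<le> norm (u - v)" .
  qed
  also have "\<dots> = real (card (Basis - {j0} :: 'a set)) * norm (u - v)" by simp
  also have "\<dots> \<le> DIM('a) * norm (u - v)" by (intro mult_right_mono) (auto intro: card_mono)
  finally have P: "\<bar>P u - P v\<bar> \<le> DIM('a) * norm (u - v)" .
  have f: "\<bar>\<phi> (u \<bullet> j0) - \<phi> (v \<bullet> j0)\<bar> \<le> C * norm (u - v)"
  proof -
    have "\<bar>\<phi> (u \<bullet> j0) - \<phi> (v \<bullet> j0)\<bar> \<le> C * \<bar>(u - v) \<bullet> j0\<bar>" using \<phi>(4)[of "u \<bullet> j0" "v \<bullet> j0"] by (simp add: inner_diff_left)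
    also have "\<dots> \<le> C * norm (u - v)" using \<phi>(1) Basis_le_norm[OF j0, of "u - v"] by (intro mult_left_mono) auto
    finally show ?thesis .
  qed
  have "Phi L u - Phi L v = (\<phi> (u \<bullet> j0) - \<phi> (v \<bullet> j0)) * P u + \<phi> (v \<bullet> j0) * (P u - P v)"
    by (simp add: Phi_def P_def algebra_simps)
  also have "\<bar>\<dots>\<bar> \<le> (C * norm (u - v)) * 1 + B * (DIM('a) * norm (u - v))"
    using f P \<phi>(6)[of "v \<bullet> j0"] tent_prod_le[of "\<lambda>b. (u \<bullet> b) / L" "Basis - {j0}"] \<phi>(1,3)
    by (intro abs_add_le abs_mult_le) (auto simp: P_def)
  finally show ?thesis by (simp add: KL_def algebra_simps)
qed

lemma Phi_lipc:
  assumes L: "1 \<le> L" shows "lipc (Phi L)"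
  unfolding lipc_def
proof (intro exI conjI allI impI)
  show "\<bar>Phi L u - Phi L v\<bar> \<le> KL * norm (u - v)" for u v by (rule Phi_lip[OF L])
  fix u :: 'a assume u: "A + L * DIM('a) < norm u"
  show "Phi L u = 0"
  proof (rule ccontr)
    assume nz: "Phi L u \<noteq> 0"
    have 1: "\<bar>u \<bullet> j0\<bar> \<le> A" using \<phi>(5)[of "u \<bullet> j0"] nz by (force simp: Phi_def)
    have 2: "\<bar>u \<bullet> b\<bar> \<le> L" if "b \<in> Basis - {j0}" for b
    proof -
      have "tent ((u \<bullet> b) / L) \<noteq> 0" using nz that by (auto simp: Phi_def)
      then have "\<bar>(u \<bullet> b) / L\<bar> \<le> 1" using tent_support by force
      then show ?thesis using L by simp
    qed
    have "norm u \<le> (\<Sum>b\<in>Basis. \<bar>u \<bullet> b\<bar>)" by (rule norm_le_l1)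
    also have "\<dots> = \<bar>u \<bullet> j0\<bar> + (\<Sum>b\<in>Basis - {j0}. \<bar>u \<bullet> b\<bar>)" using j0 by (simp add: sum.remove)
    also have "\<dots> \<le> A + (\<Sum>b\<in>(Basis - {j0} :: 'a set). L)" using 1 2 by (intro add_mono sum_mono) auto
    also have "\<dots> = A + L * real (card (Basis - {j0} :: 'a set))" by simp
    also have "\<dots> \<le> A + L * DIM('a)" using L by (intro add_left_mono mult_left_mono) (auto intro: card_mono)
    finally show False using u by simp
  qed
qed

text \<open>In rescaled coordinates a shift by \<open>s\<close> times \<open>z\<close> moves the
  cut-off coordinates only by \<open>s * (z \<bullet> b) / L\<close>. For large \<open>L\<close> it
  acts on the coordinate \<open>j0\<close> alone.\<close>

lemma Phi_T: "L \<noteq> 0 \<Longrightarrow> Phi L (T L y + s *\<^sub>R z) = \<phi> (y \<bullet> j0 + s * (z \<bullet> j0)) * (\<Prod>b\<in>Basis - {j0}. tent (y \<bullet> b + s * (z \<bullet> b) / L))"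
  unfolding Phi_def using j0 by (auto simp: inner_add_left T_inner cT_def add_divide_distrib intro!: prod.cong)

lemma Phi_T0: "L \<noteq> 0 \<Longrightarrow> Phi L (T L y) = Phi 1 y"
  using Phi_T[of L y 0 0] by (simp add: Phi_def)

lemma nn_integral_T:
  assumes [measurable]: "G \<in> borel_measurable borel" and L: "0 < L"
  shows "(\<integral>\<^sup>+x. G x \<partial>lborel) = ennreal (\<Prod>b\<in>(Basis::'a set). \<bar>cT L b\<bar>) * (\<integral>\<^sup>+x. G (T L x) \<partial>lborel)"
proof -
  have [measurable]: "T L \<in> borel_measurable borel" unfolding T_def[abs_def] by measurable
  have "lborel = density (distr lborel borel (T L)) (\<lambda>_. ennreal (\<Prod>b\<in>(Basis::'a set). \<bar>cT L b\<bar>))"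
    unfolding T_def[abs_def] using L by (intro lborel_affine_euclidean) (auto simp: cT_def)
  then have "(\<integral>\<^sup>+x. G x \<partial>lborel) = (\<integral>\<^sup>+x. G x \<partial>density (distr lborel borel (T L)) (\<lambda>_. ennreal (\<Prod>b\<in>(Basis::'a set). \<bar>cT L b\<bar>)))" by simp
  also have "\<dots> = ennreal (\<Prod>b\<in>(Basis::'a set). \<bar>cT L b\<bar>) * (\<integral>\<^sup>+x. G (T L x) \<partial>lborel)"
    by (simp add: nn_integral_density nn_integral_distr nn_integral_cmult)
  finally show ?thesis .
qed

lemma lp_T:
  assumes "G \<in> borel_measurable borel" "0 < L"
  shows "lp_int p (G :: 'a \<Rightarrow> real) = ennreal (\<Prod>b\<in>(Basis::'a set). \<bar>cT L b\<bar>) * lp_int p (\<lambda>y. G (T L y))"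
  unfolding lp_int_def using assms by (intro nn_integral_T) auto

text \<open>Integrated over \<open>t\<close>, this is twice the Hilbert transform of \<open>Phi L\<close> at \<open>T L y\<close> in direction \<open>z\<close>.\<close>

definition Qd :: "real \<Rightarrow> 'a \<Rightarrow> 'a \<Rightarrow> real \<Rightarrow> real" where
  "Qd L y z t = hk 0 t * (Phi L (T L y - t *\<^sub>R z) - Phi L (T L y + t *\<^sub>R z))"

text \<open>Once \<open>t\<close> carries the coordinate \<open>j0\<close> out of the support of
  \<phi> both terms vanish, whatever the tents do. The support in \<open>t\<close> is thus bounded
  uniformly in \<open>L\<close>, and inside it the Lipschitz bound cancels
  \<open>1 / t\<close>.\<close>

lemma Qd_bound:
  assumes L: "1 \<le> L" and z: "z \<bullet> j0 \<noteq> 0"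
  shows "\<bar>Qd L y z t\<bar> \<le> (2 * KL * norm z / pi) * indicator {- ((A + \<bar>y \<bullet> j0\<bar>) / \<bar>z \<bullet> j0\<bar>)..(A + \<bar>y \<bullet> j0\<bar>) / \<bar>z \<bullet> j0\<bar>} t"
proof (cases "(A + \<bar>y \<bullet> j0\<bar>) / \<bar>z \<bullet> j0\<bar> < \<bar>t\<bar>")
  case True
  have Lnz: "L \<noteq> 0" using L by simp
  have "A + \<bar>y \<bullet> j0\<bar> < \<bar>t * (z \<bullet> j0)\<bar>" using True z by (simp add: pos_divide_less_eq abs_mult)
  then have "A < \<bar>y \<bullet> j0 + (- t) * (z \<bullet> j0)\<bar>" "A < \<bar>y \<bullet> j0 + t * (z \<bullet> j0)\<bar>" by auto
  then have "Phi L (T L y + (- t) *\<^sub>R z) = 0" "Phi L (T L y + t *\<^sub>R z) = 0"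
    unfolding Phi_T[of L, OF Lnz] using \<phi>(5) by simp_all
  then show ?thesis using True by (auto simp: Qd_def indicator_def)
next
  case False
  then have i: "indicator {- ((A + \<bar>y \<bullet> j0\<bar>) / \<bar>z \<bullet> j0\<bar>)..(A + \<bar>y \<bullet> j0\<bar>) / \<bar>z \<bullet> j0\<bar>} t = (1::real)"
    by (auto simp: indicator_def)
  have "(T L y - t *\<^sub>R z) - (T L y + t *\<^sub>R z) = (- 2 * t) *\<^sub>R z" by (simp add: algebra_simps scaleR_left_distrib[symmetric])
  then have n: "norm ((T L y - t *\<^sub>R z) - (T L y + t *\<^sub>R z)) = 2 * \<bar>t\<bar> * norm z" by (simp add: abs_mult)
  have "\<bar>Qd L y z t\<bar> = \<bar>hk 0 t\<bar> * \<bar>Phi L (T L y - t *\<^sub>R z) - Phi L (T L y + t *\<^sub>R z)\<bar>" by (simp add: Qd_def abs_mult)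
  also have "\<dots> \<le> \<bar>hk 0 t\<bar> * (KL * (2 * \<bar>t\<bar> * norm z))"
    using Phi_lip[OF L, of "T L y - t *\<^sub>R z" "T L y + t *\<^sub>R z"] unfolding n by (intro mult_left_mono) auto
  also have "\<dots> = 2 * KL * norm z * (\<bar>hk 0 t\<bar> * \<bar>t\<bar>)" by simp
  also have "\<dots> \<le> 2 * KL * norm z * (1 / pi)"
    using KL_pos by (intro mult_left_mono) (auto simp: hk_def abs_mult)
  finally show ?thesis unfolding i by simp
qed

text \<open>Under the limit the tents freeze at \<open>y\<close>, leaving the symmetrised Hilbert
  integral of \<phi> with \<open>t\<close> multiplied by \<open>z \<bullet> j0\<close>. The kernel
  is homogeneous of degree -1, so substitution leaves only the sign of
  \<open>z \<bullet> j0\<close>.\<close>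

lemma Qd_limit:
  assumes z: "z \<bullet> j0 \<noteq> 0"
  shows "(\<lambda>n. (LINT t|lborel. Qd (real (Suc n)) y z t) / 2) \<longlonglongrightarrow> sgn (z \<bullet> j0) * hilR \<phi> (y \<bullet> j0) * (\<Prod>b\<in>Basis - {j0}. tent (y \<bullet> b))"
proof -
  define P where "P = (\<Prod>b\<in>Basis - {j0}. tent (y \<bullet> b))"
  define c where "c = z \<bullet> j0"
  define Y where "Y = y \<bullet> j0"
  define w where "w t = (2 * KL * norm z / pi) * indicator {- ((A + \<bar>y \<bullet> j0\<bar>) / \<bar>z \<bullet> j0\<bar>)..(A + \<bar>y \<bullet> j0\<bar>) / \<bar>z \<bullet> j0\<bar>} t" for t :: real
  have wi: "integrable lborel w" unfolding w_def[abs_def]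
    using \<phi>(2) z by (intro integrable_mult_right integrable_real_indicator) auto
  have Pm[measurable]: "Phi L \<in> borel_measurable borel" if "1 \<le> L" for L by (rule lipc_measurable[OF Phi_lipc[OF that]])
  have "(\<lambda>n. (LINT t|lborel. Qd (real (Suc n)) y z t)) \<longlonglongrightarrow> (LINT t|lborel. hk 0 t * (\<phi> (Y - c * t) * P - \<phi> (Y + c * t) * P))"
  proof (rule integral_dominated_convergence[OF _ _ wi])
    show "Qd (real (Suc n)) y z \<in> borel_measurable lborel" for n
    proof -
      have [measurable]: "Phi (real (Suc n)) \<in> borel_measurable borel" by (rule Pm) simp
      show ?thesis unfolding Qd_def[abs_def] by measurable
    qed
    show "AE t in lborel. norm (Qd (real (Suc n)) y z t) \<le> w t" for n
      using Qd_bound[OF _ z, of "real (Suc n)" y] by (intro AE_I2) (auto simp: w_def)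
    show "AE t in lborel. (\<lambda>n. Qd (real (Suc n)) y z t) \<longlonglongrightarrow> hk 0 t * (\<phi> (Y - c * t) * P - \<phi> (Y + c * t) * P)"
    proof (rule AE_I2)
      fix t :: real
      have lim: "(\<lambda>n. Phi (real (Suc n)) (T (real (Suc n)) y + s *\<^sub>R z)) \<longlonglongrightarrow> \<phi> (Y + s * c) * P" for s
      proof -
        have tc: "isCont tent u" for u using lipc_continuous[OF tent_lipc] by (simp add: continuous_on_eq_continuous_at)
        have "(\<lambda>n. \<phi> (y \<bullet> j0 + s * (z \<bullet> j0)) * (\<Prod>b\<in>Basis - {j0}. tent (y \<bullet> b + s * (z \<bullet> b) / real (Suc n)))) \<longlonglongrightarrow> \<phi> (y \<bullet> j0 + s * (z \<bullet> j0)) * (\<Prod>b\<in>Basis - {j0}. tent (y \<bullet> b))"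
        proof (intro tendsto_mult tendsto_const tendsto_prod)
          fix b :: 'a
          have "(\<lambda>n. y \<bullet> b + (s * (z \<bullet> b)) * (1 / real (Suc n))) \<longlonglongrightarrow> y \<bullet> b + (s * (z \<bullet> b)) * 0"
            by (intro tendsto_add tendsto_mult tendsto_const LIMSEQ_Suc[OF lim_1_over_n])
          then have "(\<lambda>n. y \<bullet> b + s * (z \<bullet> b) / real (Suc n)) \<longlonglongrightarrow> y \<bullet> b" by simp
          then show "(\<lambda>n. tent (y \<bullet> b + s * (z \<bullet> b) / real (Suc n))) \<longlonglongrightarrow> tent (y \<bullet> b)" by (rule isCont_tendsto_compose[OF tc])
        qed
        moreover have "Phi (real (Suc n)) (T (real (Suc n)) y + s *\<^sub>R z) = \<phi> (y \<bullet> j0 + s * (z \<bullet> j0)) * (\<Prod>b\<in>Basis - {j0}. tent (y \<bullet> b + s * (z \<bullet> b) / real (Suc n)))" for n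
          by (rule Phi_T) simp
        ultimately show ?thesis by (simp only: Y_def c_def P_def)
      qed
      have "(\<lambda>n. hk 0 t * (Phi (real (Suc n)) (T (real (Suc n)) y + (- t) *\<^sub>R z) - Phi (real (Suc n)) (T (real (Suc n)) y + t *\<^sub>R z)))
          \<longlonglongrightarrow> hk 0 t * (\<phi> (Y + (- t) * c) * P - \<phi> (Y + t * c) * P)"
        by (intro tendsto_mult tendsto_diff tendsto_const lim)
      then show "(\<lambda>n. Qd (real (Suc n)) y z t) \<longlonglongrightarrow> hk 0 t * (\<phi> (Y - c * t) * P - \<phi> (Y + c * t) * P)"
        unfolding Qd_def by (simp add: mult.commute)
    qed
  qed measurable
  moreover have "(LINT t|lborel. hk 0 t * (\<phi> (Y - c * t) * P - \<phi> (Y + c * t) * P)) = 2 * (sgn c * hilR \<phi> Y * P)"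
  proof -
    have c0: "c \<noteq> 0" using z by (simp add: c_def)
    have "2 * hilR \<phi> Y = (LINT t|lborel. hk 0 t * (\<phi> (Y - t) - \<phi> (Y + t)))"
      unfolding lipc_trH_limit(2)[OF \<phi>l] by simp
    also have "\<dots> = \<bar>c\<bar> *\<^sub>R (LINT t|lborel. hk 0 (0 + c * t) * (\<phi> (Y - (0 + c * t)) - \<phi> (Y + (0 + c * t))))"
      by (rule lborel_integral_real_affine[OF c0])
    also have "(LINT t|lborel. hk 0 (0 + c * t) * (\<phi> (Y - (0 + c * t)) - \<phi> (Y + (0 + c * t)))) = (LINT t|lborel. (1 / c) * (hk 0 t * (\<phi> (Y - c * t) - \<phi> (Y + c * t))))"
      using c0 by (intro Bochner_Integration.integral_cong) (auto simp: hk_def)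
    also have "\<bar>c\<bar> *\<^sub>R (LINT t|lborel. (1 / c) * (hk 0 t * (\<phi> (Y - c * t) - \<phi> (Y + c * t)))) = sgn c * (LINT t|lborel. hk 0 t * (\<phi> (Y - c * t) - \<phi> (Y + c * t)))"
      using c0 by (simp add: sgn_if)
    finally have "2 * hilR \<phi> Y = sgn c * (LINT t|lborel. hk 0 t * (\<phi> (Y - c * t) - \<phi> (Y + c * t)))" .
    then have "sgn c * (2 * hilR \<phi> Y) = (LINT t|lborel. hk 0 t * (\<phi> (Y - c * t) - \<phi> (Y + c * t)))"
      using c0 by (simp add: sgn_if split: if_splits)
    then have "2 * (sgn c * hilR \<phi> Y * P) = (LINT t|lborel. hk 0 t * (\<phi> (Y - c * t) - \<phi> (Y + c * t))) * P" by (simp add: mult_ac)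
    also have "\<dots> = (LINT t|lborel. (hk 0 t * (\<phi> (Y - c * t) - \<phi> (Y + c * t))) * P)" by (rule integral_mult_left_zero[symmetric])
    also have "\<dots> = (LINT t|lborel. hk 0 t * (\<phi> (Y - c * t) * P - \<phi> (Y + c * t) * P))" by (simp add: algebra_simps)
    finally show ?thesis ..
  qed
  ultimately have "(\<lambda>n. (LINT t|lborel. Qd (real (Suc n)) y z t) / 2) \<longlonglongrightarrow> (2 * (sgn c * hilR \<phi> Y * P)) / 2"
    by (intro tendsto_divide tendsto_const) auto
  then show ?thesis by (simp add: c_def Y_def P_def)
qed

lemma Qd_integral_bound:
  assumes L: "1 \<le> L" and z: "z \<bullet> j0 \<noteq> 0"
  shows "\<bar>(LINT t|lborel. Qd L y z t) / 2\<bar> \<le> 2 * KL * norm z / pi * ((A + \<bar>y \<bullet> j0\<bar>) / \<bar>z \<bullet> j0\<bar>)"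
proof -
  define R where "R = (A + \<bar>y \<bullet> j0\<bar>) / \<bar>z \<bullet> j0\<bar>"
  have R: "0 \<le> R" using \<phi>(2) z by (simp add: R_def)
  have wi: "integrable lborel (\<lambda>t. (2 * KL * norm z / pi) * indicator {-R..R} t :: real)"
    using R by (intro integrable_mult_right integrable_real_indicator) auto
  have [measurable]: "Phi L \<in> borel_measurable borel" by (rule lipc_measurable[OF Phi_lipc[OF L]])
  have qm: "Qd L y z \<in> borel_measurable borel" unfolding Qd_def[abs_def] by measurable
  have b: "norm (Qd L y z t) \<le> (2 * KL * norm z / pi) * indicator {-R..R} t" for t
    using Qd_bound[OF L z, of y t] by (simp add: R_def)
  have "integrable lborel (Qd L y z)"
    by (rule Bochner_Integration.integrable_bound[OF wi]) (use qm order_trans[OF b abs_ge_self] in auto)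
  then have "norm (LINT t|lborel. Qd L y z t) \<le> (LINT t|lborel. (2 * KL * norm z / pi) * indicator {-R..R} t)"
    by (rule Bochner_Integration.integral_norm_bound_integral[OF _ wi b])
  also have "\<dots> = (2 * KL * norm z / pi) * (2 * R)" using R by simp
  finally have "\<bar>LINT t|lborel. Qd L y z t\<bar> / 2 \<le> 2 * KL * norm z / pi * R" by simp
  then show ?thesis by (simp add: R_def)
qed

lemma lp_product:
  assumes [measurable]: "u \<in> borel_measurable borel" and p: "0 < p"
  shows "lp_int p (\<lambda>y. u (y \<bullet> j0) * (\<Prod>b\<in>Basis - {j0}. tent (y \<bullet> b))) = lp_int p u * lp_int p tent ^ (DIM('a) - 1)"
proof -
  define G where "G b s = ennreal (norm (if b = j0 then u s else tent s) powr p)" for b s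
  have [measurable]: "G b \<in> borel_measurable borel" for b unfolding G_def[abs_def] by (cases "b = j0") auto
  have "lp_int p (\<lambda>y. u (y \<bullet> j0) * (\<Prod>b\<in>Basis - {j0}. tent (y \<bullet> b))) = (\<integral>\<^sup>+y. (\<Prod>b\<in>Basis. G b (y \<bullet> b)) \<partial>lborel)"
    unfolding lp_int_def
  proof (rule nn_integral_cong)
    fix y :: 'a
    have "norm (u (y \<bullet> j0) * (\<Prod>b\<in>Basis - {j0}. tent (y \<bullet> b))) powr p = norm (u (y \<bullet> j0)) powr p * (\<Prod>b\<in>Basis - {j0}. norm (tent (y \<bullet> b)) powr p)"
      by (simp add: abs_mult abs_prod powr_mult prod_powr_distrib[symmetric])
    then have "ennreal (norm (u (y \<bullet> j0) * (\<Prod>b\<in>Basis - {j0}. tent (y \<bullet> b))) powr p) = G j0 (y \<bullet> j0) * (\<Prod>b\<in>Basis - {j0}. ennreal (norm (tent (y \<bullet> b)) powr p))"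
      by (simp add: G_def ennreal_mult prod_nonneg prod_ennreal)
    also have "(\<Prod>b\<in>Basis - {j0}. ennreal (norm (tent (y \<bullet> b)) powr p)) = (\<Prod>b\<in>Basis - {j0}. G b (y \<bullet> b))"
      by (intro prod.cong) (auto simp: G_def)
    also have "G j0 (y \<bullet> j0) * (\<Prod>b\<in>Basis - {j0}. G b (y \<bullet> b)) = (\<Prod>b\<in>Basis. G b (y \<bullet> b))"
      using j0 by (simp add: prod.remove[symmetric, of Basis j0 "\<lambda>b. G b (y \<bullet> b)"])
    finally show "ennreal (norm (u (y \<bullet> j0) * (\<Prod>b\<in>Basis - {j0}. tent (y \<bullet> b))) powr p) = (\<Prod>b\<in>Basis. G b (y \<bullet> b))" .
  qed
  also have "\<dots> = (\<Prod>b\<in>(Basis::'a set). (\<integral>\<^sup>+s. G b s \<partial>lborel))" by (rule nn_integral_lborel_prod) auto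
  also have "\<dots> = (\<integral>\<^sup>+s. G j0 s \<partial>lborel) * (\<Prod>b\<in>(Basis - {j0} :: 'a set). (\<integral>\<^sup>+s. G b s \<partial>lborel))"
    using j0 by (simp add: prod.remove)
  also have "(\<Prod>b\<in>(Basis - {j0} :: 'a set). (\<integral>\<^sup>+s. G b s \<partial>lborel)) = (\<Prod>b\<in>(Basis - {j0} :: 'a set). lp_int p tent)"
    by (intro prod.cong) (auto simp: G_def lp_int_def)
  also have "\<dots> = lp_int p tent ^ (DIM('a) - 1)" using j0 by (simp add: card_Diff_singleton)
  finally show ?thesis by (simp add: G_def lp_int_def)
qed

end

section \<open>Comparison of the two norms\<close>

lemma integral_gauss_direction:
  fixes a :: "real^'n::finite"
  assumes "norm a = 1"
  shows "(LINT z|lborel. \<bar>z \<bullet> a\<bar> * gw z) = 1 / kap TYPE('n)"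
proof -
  have "(LINT z|lborel. \<bar>z \<bullet> a\<bar> * gw z) = enn2real (\<integral>\<^sup>+z. ennreal (\<bar>z \<bullet> a\<bar> * gw z) \<partial>lborel)"
    by (intro integral_eq_nn_integral) (auto simp: less_imp_le[OF gw_pos])
  also have "\<dots> = sqrt pi ^ (CARD('n) - 1)" unfolding gw_def gauss_direction[OF assms] by simp
  finally show ?thesis by (simp add: kap_def)
qed

context
  fixes j :: "'n::finite" and \<phi> :: "real \<Rightarrow> real" and C A B :: real
  assumes st: "stretch \<phi> (axis j 1 :: real^'n) C A B"
begin

interpretation stretch \<phi> "axis j 1 :: real^'n" C A B by (rule st)

lemma nth_inner_axis: "z $ j = z \<bullet> axis j (1::real)"
  by (simp add: inner_axis)

text \<open>The sign from \<open>Qd_limit\<close> combines with the weight \<open>z $ j\<close> to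
  its absolute value, whose Gaussian integral is the reciprocal of \<open>kap\<close>: the limit
  carries the constant -1 exactly. The same factor cancels
  \<open>1 / \<bar>z \<bullet> axis j 1\<bar>\<close> in \<open>Qd_integral_bound\<close>, which
  yields an integrable majorant.\<close>

lemma riesz_stretch_limit:
  "(\<lambda>n. riesz j (Phi (real (Suc n))) (T (real (Suc n)) y))
    \<longlonglongrightarrow> - (hilR \<phi> (y \<bullet> axis j 1) * (\<Prod>b\<in>Basis - {axis j 1}. tent (y \<bullet> b)))"
proof -
  define h where "h = hilR \<phi> (y \<bullet> axis j 1) * (\<Prod>b\<in>Basis - {axis j 1}. tent (y \<bullet> b))"
  define D where "D n z = (LINT t|lborel. Qd (real (Suc n)) y z t) / 2" for n z
  have j1: "norm (axis j 1 :: real^'n) = 1" by simp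
  have wi: "integrable lborel (\<lambda>z::real^'n. norm z * gw z * (2 * KL * (A + \<bar>y \<bullet> axis j 1\<bar>) / pi))"
  proof -
    have "integrable lborel (\<lambda>z::real^'n. norm z * gw z)"
      using norm_gw_finite[where 'a="real^'n"] by (intro integrableI_nonneg) (auto simp: less_imp_le[OF gw_pos])
    then show ?thesis by (rule integrable_mult_left)
  qed
  have jm: "(\<lambda>z::real^'n. z $ j) \<in> borel_measurable borel" unfolding nth_inner_axis by measurable
  have Dm: "D n \<in> borel_measurable borel" for n
  proof -
    have [measurable]: "Phi (real (Suc n)) \<in> borel_measurable borel" by (rule lipc_measurable[OF Phi_lipc]) simp
    show ?thesis unfolding D_def[abs_def] Qd_def by measurable
  qed
  have "(\<lambda>n. LINT z|lborel. z $ j * gw z * D n z) \<longlonglongrightarrow> (LINT z::real^'n|lborel. (\<bar>z \<bullet> axis j 1\<bar> * gw z) * h)"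
  proof (rule integral_dominated_convergence[OF _ _ wi])
    show "(\<lambda>z. z $ j * gw z * D n z) \<in> borel_measurable lborel" for n using jm Dm by simp
    show "(\<lambda>z::real^'n. (\<bar>z \<bullet> axis j 1\<bar> * gw z) * h) \<in> borel_measurable lborel" by measurable
    show "AE z in lborel. (\<lambda>n. z $ j * gw z * D n z) \<longlonglongrightarrow> (\<bar>z \<bullet> axis j 1\<bar> * gw z) * h"
    proof (rule AE_I2)
      fix z :: "real^'n"
      show "(\<lambda>n. z $ j * gw z * D n z) \<longlonglongrightarrow> (\<bar>z \<bullet> axis j 1\<bar> * gw z) * h"
      proof (cases "z \<bullet> axis j 1 = 0")
        case True
        then show ?thesis by (simp add: nth_inner_axis)
      next
        case False
        have "(\<lambda>n. z $ j * gw z * D n z) \<longlonglongrightarrow> z $ j * gw z * (sgn (z \<bullet> axis j 1) * hilR \<phi> (y \<bullet> axis j 1) * (\<Prod>b\<in>Basis - {axis j 1}. tent (y \<bullet> b)))"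
          unfolding D_def by (intro tendsto_mult tendsto_const Qd_limit False)
        also have "z $ j * gw z * (sgn (z \<bullet> axis j 1) * hilR \<phi> (y \<bullet> axis j 1) * (\<Prod>b\<in>Basis - {axis j 1}. tent (y \<bullet> b))) = (\<bar>z \<bullet> axis j 1\<bar> * gw z) * h"
          unfolding h_def nth_inner_axis abs_sgn by (simp only: mult_ac)
        finally show ?thesis .
      qed
    qed
    show "AE z in lborel. norm (z $ j * gw z * D n z) \<le> norm z * gw z * (2 * KL * (A + \<bar>y \<bullet> axis j 1\<bar>) / pi)" for n
    proof (rule AE_I2)
      fix z :: "real^'n"
      show "norm (z $ j * gw z * D n z) \<le> norm z * gw z * (2 * KL * (A + \<bar>y \<bullet> axis j 1\<bar>) / pi)"
      proof (cases "z \<bullet> axis j 1 = 0")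
        case True
        then show ?thesis using KL_pos \<phi>(2) gw_pos[of z] by (simp add: nth_inner_axis)
      next
        case False
        define c where "c = \<bar>z \<bullet> axis j 1\<bar>"
        have c: "0 < c" using False by (simp add: c_def)
        have "\<bar>D n z\<bar> \<le> 2 * KL * norm z / pi * ((A + \<bar>y \<bullet> axis j 1\<bar>) / c)"
          unfolding D_def c_def by (rule Qd_integral_bound[OF _ False]) simp
        then have "c * gw z * \<bar>D n z\<bar> \<le> c * gw z * (2 * KL * norm z / pi * ((A + \<bar>y \<bullet> axis j 1\<bar>) / c))"
          using c gw_pos[of z] by (intro mult_left_mono) auto
        also have "\<dots> = norm z * gw z * (2 * KL * (A + \<bar>y \<bullet> axis j 1\<bar>) / pi)" using c by (simp add: field_simps)
        finally show ?thesis using gw_pos[of z] by (simp add: nth_inner_axis abs_mult c_def)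
      qed
    qed
  qed
  then have "(\<lambda>n. - kap TYPE('n) * (LINT z|lborel. z $ j * gw z * D n z)) \<longlonglongrightarrow> - kap TYPE('n) * (LINT z::real^'n|lborel. (\<bar>z \<bullet> axis j 1\<bar> * gw z) * h)"
    by (intro tendsto_mult tendsto_const)
  also have "(LINT z::real^'n|lborel. (\<bar>z \<bullet> axis j 1\<bar> * gw z) * h) = 1 / kap TYPE('n) * h"
    unfolding integral_mult_left_zero integral_gauss_direction[OF j1] ..
  also have "- kap TYPE('n) * (1 / kap TYPE('n) * h) = - h" by (simp add: kap_def)
  also have "(\<lambda>n. - kap TYPE('n) * (LINT z|lborel. z $ j * gw z * D n z)) = (\<lambda>n. riesz j (Phi (real (Suc n))) (T (real (Suc n)) y))"
    by (rule ext, subst riesz_lipc[OF Phi_lipc]) (simp_all add: D_def Qd_def)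
  finally show ?thesis by (simp add: h_def)
qed

text \<open>The substitution multiplies the p-th powers on both sides of the Riesz inequality by the
  same Jacobian \<open>J\<close>, so the bound for the rescaled functions is uniform in
  \<open>L\<close> and survives Fatou. The tents then contribute the common factor \<open>I\<close>,
  positive and finite, which cancels.\<close>

lemma hilR_stretch_bound:
  assumes p: "0 < p" and nr: "riesz_norm TYPE('n) p < \<infinity>"
  shows "lp_int p (hilR \<phi>) \<le> ennreal (enn2real (riesz_norm TYPE('n) p) powr p) * lp_int p \<phi>"
proof -
  define N where "N = ennreal (enn2real (riesz_norm TYPE('n) p) powr p)"
  define I where "I = lp_int p tent ^ (DIM(real^'n) - 1)"
  have "lp_int p (\<lambda>y::real^'n. - (hilR \<phi> (y \<bullet> axis j 1) * (\<Prod>b\<in>Basis - {axis j 1}. tent (y \<bullet> b)))) \<le> N * lp_int p (Phi 1)"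
  proof (rule lp_int_fatou[OF _ p])
    show "AE y in lborel. (\<lambda>n. riesz j (Phi (real (Suc n))) (T (real (Suc n)) y))
        \<longlonglongrightarrow> - (hilR \<phi> (y \<bullet> axis j 1) * (\<Prod>b\<in>Basis - {axis j 1}. tent (y \<bullet> b)))"
      by (rule AE_I2[OF riesz_stretch_limit])
    fix n
    define L where "L = real (Suc n)"
    define J where "J = ennreal (\<Prod>b\<in>(Basis::(real^'n) set). \<bar>cT L b\<bar>)"
    have L: "1 \<le> L" "0 < L" "L \<noteq> 0" by (auto simp: L_def)
    have J: "0 < J" "J < \<infinity>" using L by (auto simp: J_def cT_def intro!: prod_pos)
    note l = Phi_lipc[OF L(1)]
    note [measurable] = riesz_lipc_measurable[OF l, of j] lipc_measurable[OF l]
    have [measurable]: "T L \<in> borel_measurable borel" unfolding T_def[abs_def] by measurable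
    show "(\<lambda>y. riesz j (Phi (real (Suc n))) (T (real (Suc n)) y)) \<in> borel_measurable borel"
      unfolding L_def[symmetric] by measurable
    have "J * lp_int p (\<lambda>y. riesz j (Phi L) (T L y)) = lp_int p (riesz j (Phi L))"
      unfolding J_def by (rule lp_T[symmetric, OF _ L(2)]) measurable
    also have "\<dots> \<le> N * lp_int p (Phi L)" unfolding N_def by (rule riesz_norm_bound[OF l p nr])
    also have "lp_int p (Phi L) = J * lp_int p (\<lambda>y. Phi L (T L y))"
      unfolding J_def by (rule lp_T[OF _ L(2)]) measurable
    also have "(\<lambda>y. Phi L (T L y)) = Phi 1" using Phi_T0[OF L(3)] by auto
    also have "N * (J * lp_int p (Phi 1)) = J * (N * lp_int p (Phi 1))" by (simp only: mult_ac)
    finally have "lp_int p (\<lambda>y. riesz j (Phi L) (T L y)) \<le> N * lp_int p (Phi 1)"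
      using J by (simp add: ennreal_mult_le_mult_iff)
    then show "lp_int p (\<lambda>y. riesz j (Phi (real (Suc n))) (T (real (Suc n)) y)) \<le> N * lp_int p (Phi 1)"
      unfolding L_def .
  qed
  moreover have "lp_int p (\<lambda>y::real^'n. - (hilR \<phi> (y \<bullet> axis j 1) * (\<Prod>b\<in>Basis - {axis j 1}. tent (y \<bullet> b)))) = lp_int p (hilR \<phi>) * I"
  proof -
    have [measurable]: "hilR \<phi> \<in> borel_measurable borel" unfolding lipc_trH_limit(2)[OF \<phi>l, abs_def] by measurable
    show ?thesis unfolding I_def using lp_product[OF _ p, of "hilR \<phi>"] by (simp add: lp_int_def)
  qed
  moreover have "lp_int p (Phi 1) = lp_int p \<phi> * I"
    unfolding I_def using lp_product[OF \<phi>_measurable p] by (simp add: lp_int_def Phi_def)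
  ultimately have "I * lp_int p (hilR \<phi>) \<le> I * (N * lp_int p \<phi>)" by (simp add: mult_ac)
  moreover have "0 < I" using tent_lp_pos[OF p] by (simp add: I_def zero_less_iff_neq_zero)
  moreover have "I < \<infinity>" using lipc_lp_finite[OF tent_lipc p] by (simp add: I_def power_less_top_ennreal)
  ultimately show ?thesis unfolding N_def by (simp add: ennreal_mult_le_mult_iff)
qed

end

lemma hilR_le_riesz_norm_lipc:
  assumes f: "lipc \<phi>" and p: "0 < p" and nr: "riesz_norm TYPE('n::finite) p < \<infinity>"
  shows "lp_int p (hilR \<phi>) \<le> ennreal (enn2real (riesz_norm TYPE('n) p) powr p) * lp_int p \<phi>"
proof -
  obtain C A B where c: "0 < C" "0 < A" "0 < B" "\<forall>x y. \<bar>\<phi> x - \<phi> y\<bar> \<le> C * norm (x - y)"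
      "\<forall>x. A < norm x \<longrightarrow> \<phi> x = 0" "\<forall>x. \<bar>\<phi> x\<bar> \<le> B"
    using lipc_bounds[OF f] by blast
  \<comment> \<open>Any coordinate direction serves, hence \<open>undefined\<close> as
    index.\<close>
  have "stretch \<phi> (axis undefined 1 :: real^'n) C A B"
    using c f by unfold_locales (auto simp: axis_in_Basis_iff Basis_real_def)
  then show ?thesis by (rule hilR_stretch_bound[OF _ p nr])
qed

text \<open>Extension from Lipschitz functions by density with an unchanged constant. For fixed
  \<theta> the approximants eventually satisfy the bound up to \<open>(1 + \<theta>) powr p\<close>
  and an additive \<theta>; Fatou gives it for \<open>g\<close>, and then \<theta> tends to
  0.\<close>

lemma hilR_le_riesz_norm:
  assumes m[measurable]: "g \<in> borel_measurable borel" and p: "6 \<le> p" and fin: "lp_int p g < \<infinity>"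
    and nr: "riesz_norm TYPE('n::finite) p < \<infinity>"
  shows "lp_int p (hilR g) \<le> ennreal (enn2real (riesz_norm TYPE('n) p) powr p) * lp_int p g"
proof -
  define N where "N = ennreal (enn2real (riesz_norm TYPE('n) p) powr p)"
  have Nf: "N < top" by (simp add: N_def)
  have p0: "0 < p" using p by simp
  have fin': "lp_int p g < top" using fin by simp
  obtain \<phi> where f: "\<And>n. lipc (\<phi> n)" and lim: "(\<lambda>n. lp_int p (\<lambda>x. g x - \<phi> n x)) \<longlonglongrightarrow> 0"
    and ae: "AE x in lborel. ((\<lambda>e. trH e g x) \<longlongrightarrow> hilR g x) (at_right 0) \<and> (\<lambda>n. hilR (\<phi> n) x) \<longlonglongrightarrow> hilR g x"
    using hilR_approx[OF m p fin] by blast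
  note [measurable] = lipc_measurable[OF f]
  have hm: "hilR (\<phi> n) \<in> borel_measurable borel" for n
    unfolding lipc_trH_limit(2)[OF f, abs_def] by measurable
  have step: "lp_int p (hilR g) \<le> N * (ennreal ((1 + \<theta>) powr p) * lp_int p g + ennreal \<theta>)" if t: "0 < \<theta>" for \<theta>
  proof -
    define K where "K = ennreal ((1 + 1 / \<theta>) powr p)"
    have "(\<lambda>n. K * lp_int p (\<lambda>x. g x - \<phi> n x)) \<longlonglongrightarrow> K * 0"
      by (rule ennreal_tendsto_cmult[OF _ lim]) (simp add: K_def)
    then have "\<forall>\<^sub>F n in sequentially. K * lp_int p (\<lambda>x. g x - \<phi> n x) < ennreal \<theta>"
      by (rule order_tendstoD) (use t in simp)
    then obtain n0 where n0: "\<And>n. n0 \<le> n \<Longrightarrow> K * lp_int p (\<lambda>x. g x - \<phi> n x) < ennreal \<theta>"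
      unfolding eventually_sequentially by blast
    show ?thesis
    proof (rule lp_int_fatou[OF hm p0])
      show "AE x in lborel. (\<lambda>k. hilR (\<phi> (k + n0)) x) \<longlonglongrightarrow> hilR g x"
        using ae by eventually_elim (use LIMSEQ_ignore_initial_segment in blast)
      fix k
      have "lp_int p (\<lambda>x. g x + (- 1) *\<^sub>R (g x - \<phi> (k + n0) x)) \<le> ennreal ((1 + \<theta>) powr p) * lp_int p g + K * lp_int p (\<lambda>x. (- 1) *\<^sub>R (g x - \<phi> (k + n0) x))"
        unfolding K_def using t p by (intro lp_int_add) auto
      also have "lp_int p (\<lambda>x. (- 1) *\<^sub>R (g x - \<phi> (k + n0) x)) = lp_int p (\<lambda>x. g x - \<phi> (k + n0) x)"
        by (subst lp_int_scale) auto
      also have "ennreal ((1 + \<theta>) powr p) * lp_int p g + K * lp_int p (\<lambda>x. g x - \<phi> (k + n0) x) \<le> ennreal ((1 + \<theta>) powr p) * lp_int p g + ennreal \<theta>"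
        using n0[of "k + n0"] by (intro add_left_mono less_imp_le) simp
      finally have "lp_int p (\<phi> (k + n0)) \<le> ennreal ((1 + \<theta>) powr p) * lp_int p g + ennreal \<theta>" by simp
      then have "N * lp_int p (\<phi> (k + n0)) \<le> N * (ennreal ((1 + \<theta>) powr p) * lp_int p g + ennreal \<theta>)"
        by (rule mult_left_mono) simp
      with hilR_le_riesz_norm_lipc[OF f p0 nr, of "k + n0"]
      show "lp_int p (hilR (\<phi> (k + n0))) \<le> N * (ennreal ((1 + \<theta>) powr p) * lp_int p g + ennreal \<theta>)"
        unfolding N_def by (rule order_trans)
    qed
  qed
  have lim: "((\<lambda>\<theta>. N * (ennreal ((1 + \<theta>) powr p) * lp_int p g + ennreal \<theta>)) \<longlongrightarrow> N * (ennreal ((1 + 0) powr p) * lp_int p g + ennreal 0)) (at_right 0)"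
  proof (rule ennreal_tendsto_cmult[OF Nf], rule tendsto_add)
    have "((\<lambda>\<theta>::real. (1 + \<theta>) powr p) \<longlongrightarrow> (1 + 0) powr p) (at_right 0)" by (intro tendsto_intros) auto
    then have "((\<lambda>\<theta>::real. lp_int p g * ennreal ((1 + \<theta>) powr p)) \<longlongrightarrow> lp_int p g * ennreal ((1 + 0) powr p)) (at_right 0)"
      by (intro ennreal_tendsto_cmult fin' tendsto_ennrealI)
    then show "((\<lambda>\<theta>::real. ennreal ((1 + \<theta>) powr p) * lp_int p g) \<longlongrightarrow> ennreal ((1 + 0) powr p) * lp_int p g) (at_right 0)"
      by (simp only: mult.commute)
    show "((\<lambda>\<theta>::real. ennreal \<theta>) \<longlongrightarrow> ennreal 0) (at_right 0)" by (intro tendsto_ennrealI tendsto_ident_at)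
  qed
  have "lp_int p (hilR g) \<le> N * (ennreal ((1 + 0) powr p) * lp_int p g + ennreal 0)"
    by (rule tendsto_lowerbound[OF lim]) (auto intro!: eventually_at_rightI[of 0 1] step)
  then show ?thesis by (simp add: N_def)
qed

section \<open>The two norm inequalities and the limit\<close>

lemma net_norm_bound:
  assumes p: "0 < p" and d: "d < 1" and n: "0 \<le> n" and I: "I \<le> 1"
    and X: "lp_int p G \<le> ennreal ((1 / (1 - d)) powr p) * (of_nat c * (ennreal (n powr p) * I))"
  shows "lp_norm lborel p G \<le> ennreal (1 / (1 - d) * real c powr (1 / p) * n)"
proof (rule lp_norm_leI[OF _ _ p])
  have "of_nat c * (ennreal (n powr p) * I) \<le> of_nat c * (ennreal (n powr p) * 1)" using I by (intro mult_left_mono) auto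
  then have "lp_int p G \<le> ennreal ((1 / (1 - d)) powr p) * (ennreal (real c) * ennreal (n powr p))"
    using order_trans[OF X mult_left_mono] by (simp add: ennreal_of_nat_eq_real_of_nat)
  also have "\<dots> = ennreal ((1 / (1 - d)) powr p * (real c * n powr p))" by (simp add: ennreal_mult)
  also have "(1 / (1 - d)) powr p * (real c * n powr p) = (1 / (1 - d) * real c powr (1 / p) * n) powr p"
  proof -
    define k where "k = 1 / (1 - d)"
    have "0 \<le> k" using d by (simp add: k_def)
    then show ?thesis unfolding k_def[symmetric] using p n by (simp add: powr_mult powr_powr)
  qed
  finally show "lp_int p G \<le> ennreal ((1 / (1 - d) * real c powr (1 / p) * n) powr p)" .
  show "0 \<le> 1 / (1 - d) * real c powr (1 / p) * n" using d n by simp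
qed

text \<open>The net is chosen from \<open>d\<close> and the dimension before \<open>p\<close>, so
  one \<open>c\<close>, its cardinality, serves all exponents. This order of quantifiers lets
  \<open>c powr (1 / p)\<close> disappear in the limit.\<close>

lemma riesz_norm_le:
  assumes d: "0 < d" "d < 1"
  shows "\<exists>c. \<forall>p\<ge>6. riesz_norm TYPE('n::finite) p \<le> ennreal (1 / (1 - d) * real c powr (1 / p) * enn2real (hilbert_norm p))"
proof -
  obtain S :: "(real^'n) set" where S: "finite S" "\<And>a. a \<in> S \<Longrightarrow> norm a = 1" "\<And>v. \<exists>a\<in>S. (1 - d) * norm v \<le> \<bar>v \<bullet> a\<bar>"
    using finite_direction_net[OF d, where 'a="real^'n"] by blast
  have "riesz_norm TYPE('n) p \<le> ennreal (1 / (1 - d) * real (card S) powr (1 / p) * enn2real (hilbert_norm p))" if p: "6 \<le> p" for p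
    unfolding riesz_norm_def
  proof (rule Sup_least, clarify)
    fix f :: "real^'n \<Rightarrow> real" assume f: "f \<in> borel_measurable lborel" "lp_norm lborel p f \<le> 1"
    have p0: "0 < p" using p by simp
    have m: "f \<in> borel_measurable borel" using f by simp
    have f1: "lp_int p f \<le> 1" using f(2) lp_norm_le_1_iff[OF p0] by blast
    then have fin: "lp_int p f < \<infinity>" by (rule le_less_trans) simp
    show "lp_norm lborel p (\<lambda>x. sqrt (\<Sum>k\<in>UNIV. (riesz k f x)\<^sup>2)) \<le> ennreal (1 / (1 - d) * real (card S) powr (1 / p) * enn2real (hilbert_norm p))"
      using riesz_upper[OF m p fin d(2) S hilR_norm_bound[OF p]] by (intro net_norm_bound[OF p0 d(2) _ f1]) auto
  qed
  then show ?thesis by blast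
qed

lemma hilbert_norm_le:
  assumes d: "0 < d" "d < 1"
  shows "\<exists>c. \<forall>p\<ge>6. riesz_norm TYPE('n::finite) p < \<infinity> \<longrightarrow>
    hilbert_norm p \<le> ennreal (1 / (1 - d) * real c powr (1 / p) * enn2real (riesz_norm TYPE('n) p))"
proof -
  obtain S :: "complex set" where S: "finite S" "\<And>a. a \<in> S \<Longrightarrow> norm a = 1" "\<And>v. \<exists>a\<in>S. (1 - d) * norm v \<le> \<bar>v \<bullet> a\<bar>"
    using finite_direction_net[OF d, where 'a=complex] by blast
  have "hilbert_norm p \<le> ennreal (1 / (1 - d) * real (card S) powr (1 / p) * enn2real (riesz_norm TYPE('n) p))"
    if p: "6 \<le> p" and nr: "riesz_norm TYPE('n) p < \<infinity>" for p
    unfolding hilbert_norm_def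
  proof (rule Sup_least, clarify)
    fix f :: "real \<Rightarrow> complex" assume f: "f \<in> borel_measurable lborel" "lp_norm lborel p f \<le> 1"
    have p0: "0 < p" using p by simp
    have m: "f \<in> borel_measurable borel" using f by simp
    have f1: "lp_int p f \<le> 1" using f(2) lp_norm_le_1_iff[OF p0] by blast
    then have fin: "lp_int p f < \<infinity>" by (rule le_less_trans) simp
    show "lp_norm lborel p (hilbert f) \<le> ennreal (1 / (1 - d) * real (card S) powr (1 / p) * enn2real (riesz_norm TYPE('n) p))"
      using hilbert_upper[OF m p fin d(2) S hilR_le_riesz_norm[OF _ p _ nr]] by (intro net_norm_bound[OF p0 d(2) _ f1]) auto
  qed
  then show ?thesis by blast
qed

lemma powr_inverse_tendsto_1:
  assumes "0 < c" shows "((\<lambda>p::real. k * c powr (1 / p)) \<longlongrightarrow> k) at_top"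
proof -
  have "((\<lambda>p::real. 1 / p) \<longlongrightarrow> 0) at_top" by real_asymp
  then have "((\<lambda>p::real. k * c powr (1 / p)) \<longlongrightarrow> k * c powr 0) at_top" using assms by (intro tendsto_intros) auto
  then show ?thesis using assms by simp
qed

theorem theorem5p9:
  assumes "CARD('n::finite) \<ge> 2"
  shows "((\<lambda>p. riesz_norm TYPE('n) p / hilbert_norm p) \<longlongrightarrow> (1::ennreal)) at_top"
proof -
  define R where "R p = enn2real (riesz_norm TYPE('n) p)" for p
  define H where "H p = enn2real (hilbert_norm p)" for p
  have Hpos: "0 < H p" if "6 \<le> p" for p using hilbert_norm_pos[OF that] by (simp add: H_def)
  have HH: "hilbert_norm p = ennreal (H p)" if "6 \<le> p" for p using hilbert_norm_finite[OF that] by (simp add: H_def)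
  have Rfin: "riesz_norm TYPE('n) p < \<infinity>" if "6 \<le> p" for p
  proof -
    obtain c where "\<forall>p\<ge>6. riesz_norm TYPE('n) p \<le> ennreal (1 / (1 - 1/2) * real c powr (1 / p) * enn2real (hilbert_norm p))"
      using riesz_norm_le[of "1/2"] by auto
    then have "riesz_norm TYPE('n) p \<le> ennreal (1 / (1 - 1/2) * real c powr (1 / p) * enn2real (hilbert_norm p))" using that by blast
    then show ?thesis by (rule le_less_trans) simp
  qed
  have RR: "riesz_norm TYPE('n) p = ennreal (R p)" if "6 \<le> p" for p using Rfin[OF that] by (simp add: R_def)
  have R0: "0 \<le> R p" for p by (simp add: R_def)
  have up: "\<exists>c::real. 0 < c \<and> (\<forall>p\<ge>6. R p \<le> 1 / (1 - d) * c powr (1 / p) * H p)" if d: "0 < d" "d < 1" for d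
  proof -
    obtain c where c: "\<And>p. 6 \<le> p \<Longrightarrow> riesz_norm TYPE('n) p \<le> ennreal (1 / (1 - d) * real c powr (1 / p) * enn2real (hilbert_norm p))"
      using riesz_norm_le[OF d] by blast
    \<comment> \<open>The base is raised to \<open>real c + 1\<close>, since a power with exponent
      tending to 0 converges to 1 only for a positive base.\<close>
    have "R p \<le> 1 / (1 - d) * (real c + 1) powr (1 / p) * H p" if p: "6 \<le> p" for p
    proof -
      have "R p \<le> 1 / (1 - d) * real c powr (1 / p) * H p"
        using c[OF p] d Hpos[OF p] unfolding RR[OF p] H_def[symmetric] by (subst (asm) ennreal_le_iff) auto
      also have "\<dots> \<le> 1 / (1 - d) * (real c + 1) powr (1 / p) * H p"
        using d Hpos[OF p] p by (intro mult_right_mono mult_left_mono powr_mono2) auto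
      finally show ?thesis .
    qed
    then show ?thesis by (intro exI[of _ "real c + 1"]) auto
  qed
  have lo: "\<exists>c::real. 0 < c \<and> (\<forall>p\<ge>6. H p \<le> 1 / (1 - d) * c powr (1 / p) * R p)" if d: "0 < d" "d < 1" for d
  proof -
    obtain c where c: "\<And>p. 6 \<le> p \<Longrightarrow> hilbert_norm p \<le> ennreal (1 / (1 - d) * real c powr (1 / p) * enn2real (riesz_norm TYPE('n) p))"
      using hilbert_norm_le[OF d, where 'n='n] Rfin by blast
    have "H p \<le> 1 / (1 - d) * (real c + 1) powr (1 / p) * R p" if p: "6 \<le> p" for p
    proof -
      have "H p \<le> 1 / (1 - d) * real c powr (1 / p) * R p"
        using c[OF p] d R0[of p] unfolding HH[OF p] R_def[symmetric] by (subst (asm) ennreal_le_iff) auto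
      also have "\<dots> \<le> 1 / (1 - d) * (real c + 1) powr (1 / p) * R p"
        using d R0[of p] p by (intro mult_right_mono mult_left_mono powr_mono2) auto
      finally show ?thesis .
    qed
    then show ?thesis by (intro exI[of _ "real c + 1"]) auto
  qed
  have "((\<lambda>p. R p / H p) \<longlongrightarrow> 1) at_top"
  proof (rule order_tendstoI)
    fix a :: real assume a: "1 < a"
    \<comment> \<open>Half the admissible size: \<open>1 / (1 - d)\<close> stays strictly below
      \<open>a\<close>, with room for the factor that tends to 1.\<close>
    define d where "d = (1 - 1 / a) / 2"
    have "1 / a < 1" "0 < 1 / a" using a by auto
    then have d: "0 < d" "d < 1" "1 / a < 1 - d" by (auto simp: d_def field_simps)
    then have da: "1 / (1 - d) < a" using a by (simp add: field_simps)
    obtain c :: real where c: "0 < c" "\<And>p. 6 \<le> p \<Longrightarrow> R p \<le> 1 / (1 - d) * c powr (1 / p) * H p" using up[OF d(1,2)] by blast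
    have "\<forall>\<^sub>F p in at_top. 1 / (1 - d) * c powr (1 / p) < a" by (rule order_tendstoD(2)[OF powr_inverse_tendsto_1[OF c(1)] da])
    with eventually_ge_at_top[of 6] show "\<forall>\<^sub>F p in at_top. R p / H p < a"
    proof eventually_elim
      case (elim p)
      have "R p / H p \<le> 1 / (1 - d) * c powr (1 / p)" using c(2)[OF elim(1)] Hpos[OF elim(1)] by (simp only: pos_divide_le_eq)
      then show ?case using elim(2) by (rule le_less_trans)
    qed
  next
    fix a :: real assume a: "a < 1"
    \<comment> \<open>\<open>a\<close> may be negative; replacing it by a nonnegative
      \<open>m\<close> keeps \<open>d\<close> below 1.\<close>
    obtain m where m: "0 \<le> m" "a \<le> m" "m < 1" using a by (intro that[of "max a 0"]) auto
    define d where "d = (1 - m) / 2"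
    have d: "0 < d" "d < 1" "a < 1 - d" using m by (auto simp: d_def field_simps)
    obtain c :: real where c: "0 < c" "\<And>p. 6 \<le> p \<Longrightarrow> H p \<le> 1 / (1 - d) * c powr (1 / p) * R p" using lo[OF d(1,2)] by blast
    have "\<forall>\<^sub>F p in at_top. a < (1 - d) * (1 / c) powr (1 / p)" by (rule order_tendstoD(1)[OF powr_inverse_tendsto_1 d(3)]) (use c in simp)
    with eventually_ge_at_top[of 6] show "\<forall>\<^sub>F p in at_top. a < R p / H p"
    proof eventually_elim
      case (elim p)
      define q where "q = c powr (1 / p)"
      have q: "0 < q" "(1 / c) powr (1 / p) = 1 / q" using c(1) by (auto simp: q_def powr_divide)
      have "H p \<le> 1 / (1 - d) * q * R p" unfolding q_def by (rule c(2)[OF elim(1)])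
      then have "(1 - d) * (1 / q) * H p \<le> R p" using d q by (simp add: field_simps)
      then have "(1 - d) * (1 / q) \<le> R p / H p" using Hpos[OF elim(1)] by (simp only: pos_le_divide_eq)
      with elim(2) show ?case unfolding q(2) by (rule less_le_trans)
    qed
  qed
  then have "((\<lambda>p. ennreal (R p / H p)) \<longlongrightarrow> ennreal 1) at_top" by (rule tendsto_ennrealI)
  \<comment> \<open>Both norms are finite and the Hilbert norm is positive, so division in
    \<open>ennreal\<close> agrees with the real quotient.\<close>
  moreover have "\<forall>\<^sub>F p in at_top. ennreal (R p / H p) = riesz_norm TYPE('n) p / hilbert_norm p"
    using eventually_ge_at_top[of 6]
  proof eventually_elim
    case (elim p)
    show ?case unfolding RR[OF elim] HH[OF elim] by (rule divide_ennreal[OF R0 Hpos[OF elim], symmetric])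
  qed
  ultimately show ?thesis by (simp add: tendsto_cong)
qed

end
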